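(* For a compact $K\subseteq\mathbb D$ and $m:\operatorname{Isol}(K)\to\mathbb N\cup\{\infty\}$, the theory $\Sigma_{K,m}$ is $\omega$-stable if and only if $K$ is countable.
   Context: $\mathbb D$ is the closed unit disc in $\mathbb C$. $\Sigma_{K,m}$ is the continuous-logic theory (language of unit balls of complex Hilbert spaces expanded by a unary function symbol $T$) whose models are $(H,T)$ with $H$ an infinite-dimensional complex Hilbert space, $T$ normal with $\|T\|\le1$, $\sigma(T)=K$, and $\dim\ker(T-\lambda)=m(\lambda)$ for each isolated $\lambda\in K$ ($\infty$ meaning infinite-dimensional). $\omega$-stable (continuous logic) means that for every countable set of parameters $B$ in a model, the space $S_1(B)$ of $1$-types over $B$ is separable with respect to the metric on types. *)

theory Defs
  imports "HOL-Analysis.Analysis" "HOL-Algebra.Module" "HOL-Library.Equipollence"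
begin

section \<open>Complex Hilbert spaces on a carrier set, and operators on them\<close>

text \<open>
  The class of models of a theory contains spaces of different dimensions, so a Hilbert space is an
  explicit structure whose carrier is a subset of an arbitrary type. The vector space structure is
  that of a module over the field of complex numbers; the fields \<open>mult\<close> and \<open>one\<close>
  of the record type are not used.
\<close>

definition complex_cring :: "complex ring" where
  "complex_cring = \<lparr>carrier = UNIV, mult = (*), one = 1, zero = 0, add = (+)\<rparr>"

record 'u hilb = "(complex, 'u) module" +
  hinner :: "'u \<Rightarrow> 'u \<Rightarrow> complex"

definition hnorm :: "'u hilb \<Rightarrow> 'u \<Rightarrow> real" where
  "hnorm H x = sqrt (Re (hinner H x x))"

locale complex_hilbert_space = module complex_cring H for H :: "'u hilb" (structure) +
  assumes hinner_add_left: "\<lbrakk>x \<in> carrier H; y \<in> carrier H; z \<in> carrier H\<rbrakk> \<Longrightarrow>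
      hinner H (x \<oplus>\<^bsub>H\<^esub> y) z = hinner H x z + hinner H y z"
    and hinner_smult_left: "\<lbrakk>x \<in> carrier H; y \<in> carrier H\<rbrakk> \<Longrightarrow>
      hinner H (c \<odot>\<^bsub>H\<^esub> x) y = c * hinner H x y"
    and hinner_commute: "\<lbrakk>x \<in> carrier H; y \<in> carrier H\<rbrakk> \<Longrightarrow>
      hinner H y x = cnj (hinner H x y)"
    and hinner_nonneg: "x \<in> carrier H \<Longrightarrow> 0 \<le> Re (hinner H x x)"
    and hinner_definite: "\<lbrakk>x \<in> carrier H; hinner H x x = 0\<rbrakk> \<Longrightarrow> x = \<zero>\<^bsub>H\<^esub>"
    and hcomplete: "\<lbrakk>\<And>n. X n \<in> carrier H;
        \<And>e. e > 0 \<Longrightarrow> \<exists>N. \<forall>i\<ge>N. \<forall>j\<ge>N. hnorm H (X i \<ominus>\<^bsub>H\<^esub> X j) < e\<rbrakk> \<Longrightarrow>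
      \<exists>l\<in>carrier H. (\<lambda>n. hnorm H (X n \<ominus>\<^bsub>H\<^esub> l)) \<longlonglongrightarrow> 0"

definition hilbert_basis :: "'u hilb \<Rightarrow> 'u set \<Rightarrow> 'u set \<Rightarrow> bool" where
  "hilbert_basis H V E \<longleftrightarrow> E \<subseteq> V \<and>
     (\<forall>x\<in>E. \<forall>y\<in>E. hinner H x y = (if x = y then 1 else 0)) \<and>
     (\<forall>v\<in>V. (\<forall>x\<in>E. hinner H v x = 0) \<longrightarrow> v = \<zero>\<^bsub>H\<^esub>)"

text \<open>The closed subspace \<open>V\<close> has dimension \<open>d\<close>; all infinite dimensions are
  identified.\<close>

definition hilbert_dim :: "'u hilb \<Rightarrow> 'u set \<Rightarrow> enat \<Rightarrow> bool" where
  "hilbert_dim H V d \<longleftrightarrow>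
     (\<exists>E. hilbert_basis H V E \<and> d = (if finite E then enat (card E) else \<infinity>))"

definition bounded_op :: "'u hilb \<Rightarrow> ('u \<Rightarrow> 'u) \<Rightarrow> bool" where
  "bounded_op H T \<longleftrightarrow>
     (\<forall>x\<in>carrier H. T x \<in> carrier H) \<and>
     (\<forall>x\<in>carrier H. \<forall>y\<in>carrier H. T (x \<oplus>\<^bsub>H\<^esub> y) = T x \<oplus>\<^bsub>H\<^esub> T y) \<and>
     (\<forall>c. \<forall>x\<in>carrier H. T (c \<odot>\<^bsub>H\<^esub> x) = c \<odot>\<^bsub>H\<^esub> T x) \<and>
     (\<exists>C. \<forall>x\<in>carrier H. hnorm H (T x) \<le> C * hnorm H x)"

definition is_adjoint :: "'u hilb \<Rightarrow> ('u \<Rightarrow> 'u) \<Rightarrow> ('u \<Rightarrow> 'u) \<Rightarrow> bool" where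
  "is_adjoint H T S \<longleftrightarrow> bounded_op H S \<and>
     (\<forall>x\<in>carrier H. \<forall>y\<in>carrier H. hinner H (T x) y = hinner H x (S y))"

definition normal_op :: "'u hilb \<Rightarrow> ('u \<Rightarrow> 'u) \<Rightarrow> bool" where
  "normal_op H T \<longleftrightarrow> bounded_op H T \<and>
     (\<exists>S. is_adjoint H T S \<and> (\<forall>x\<in>carrier H. T (S x) = S (T x)))"

definition op_spectrum :: "'u hilb \<Rightarrow> ('u \<Rightarrow> 'u) \<Rightarrow> complex set" where
  "op_spectrum H T = {c. \<not> (\<exists>S. bounded_op H S \<and> (\<forall>x\<in>carrier H.
      S (T x \<ominus>\<^bsub>H\<^esub> c \<odot>\<^bsub>H\<^esub> x) = x \<and> T (S x) \<ominus>\<^bsub>H\<^esub> c \<odot>\<^bsub>H\<^esub> S x = x))}"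

definition eigenspace :: "'u hilb \<Rightarrow> ('u \<Rightarrow> 'u) \<Rightarrow> complex \<Rightarrow> 'u set" where
  "eigenspace H T c = {x \<in> carrier H. T x \<ominus>\<^bsub>H\<^esub> c \<odot>\<^bsub>H\<^esub> x = \<zero>\<^bsub>H\<^esub>}"

definition unit_ball :: "'u hilb \<Rightarrow> 'u set" where
  "unit_ball H = {x \<in> carrier H. hnorm H x \<le> 1}"

section \<open>Continuous logic for unit balls of Hilbert spaces with an operator\<close>

text \<open>
  The language is the usual one for the unit ball of a complex Hilbert space, with function symbols
  for \<open>0\<close>, \<open>- x\<close>, \<open>\<i> x\<close> and \<open>(x + y) / 2\<close>, a predicate for the norm, and the
  distance \<open>d x y = \<parallel>x - y\<parallel> / 2\<close> (normalised to have values in the unit interval),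
  expanded by a unary function symbol for the operator. \<open>Par b\<close> is the constant naming
  the parameter \<open>b\<close>. A connective is an arbitrary continuous function from
  \<open>[0,1]\<^sup>n\<close> to \<open>[0,1]\<close>, given as a function on lists of length \<open>n\<close>.
\<close>

datatype (trm_pars: 'u) trm =
    Var nat
  | Par 'u
  | TZero
  | TMinus "'u trm"
  | TImag "'u trm"
  | TAvg "'u trm" "'u trm"
  | TOp "'u trm"

datatype (fml_pars: 'u) fml =
    FDist "'u trm" "'u trm"
  | FNorm "'u trm"
  | FConn "real list \<Rightarrow> real" "'u fml list"
  | FSup nat "'u fml"
  | FInf nat "'u fml"

primrec tval :: "'u hilb \<Rightarrow> ('u \<Rightarrow> 'u) \<Rightarrow> 'u trm \<Rightarrow> (nat \<Rightarrow> 'u) \<Rightarrow> 'u" where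
  "tval H T (Var n) v = v n"
| "tval H T (Par b) v = b"
| "tval H T TZero v = \<zero>\<^bsub>H\<^esub>"
| "tval H T (TMinus t) v = \<ominus>\<^bsub>H\<^esub> tval H T t v"
| "tval H T (TImag t) v = \<i> \<odot>\<^bsub>H\<^esub> tval H T t v"
| "tval H T (TAvg s t) v = (1 / 2) \<odot>\<^bsub>H\<^esub> (tval H T s v \<oplus>\<^bsub>H\<^esub> tval H T t v)"
| "tval H T (TOp t) v = T (tval H T t v)"

fun fval :: "'u hilb \<Rightarrow> ('u \<Rightarrow> 'u) \<Rightarrow> 'u fml \<Rightarrow> (nat \<Rightarrow> 'u) \<Rightarrow> real" where
  "fval H T (FDist s t) v = hnorm H (tval H T s v \<ominus>\<^bsub>H\<^esub> tval H T t v) / 2"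
| "fval H T (FNorm t) v = hnorm H (tval H T t v)"
| "fval H T (FConn u fs) v = u (map (\<lambda>f. fval H T f v) fs)"
| "fval H T (FSup n f) v = (SUP a\<in>unit_ball H. fval H T f (v(n := a)))"
| "fval H T (FInf n f) v = (INF a\<in>unit_ball H. fval H T f (v(n := a)))"

definition unit_cube :: "nat \<Rightarrow> real list set" where
  "unit_cube n = {xs. length xs = n \<and> set xs \<subseteq> {0..1}}"

definition connective :: "nat \<Rightarrow> (real list \<Rightarrow> real) \<Rightarrow> bool" where
  "connective n u \<longleftrightarrow> (\<forall>xs\<in>unit_cube n. u xs \<in> {0..1}) \<and>
     (\<forall>xs\<in>unit_cube n. \<forall>e>0. \<exists>d>0. \<forall>ys\<in>unit_cube n.
        (\<forall>i<n. \<bar>ys ! i - xs ! i\<bar> < d) \<longrightarrow> \<bar>u ys - u xs\<bar> < e)"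

fun wf_fml :: "'u fml \<Rightarrow> bool" where
  "wf_fml (FConn u fs) \<longleftrightarrow> connective (length fs) u \<and> (\<forall>f\<in>set fs. wf_fml f)"
| "wf_fml (FSup n f) \<longleftrightarrow> wf_fml f"
| "wf_fml (FInf n f) \<longleftrightarrow> wf_fml f"
| "wf_fml _ \<longleftrightarrow> True"

primrec trm_vars :: "'u trm \<Rightarrow> nat set" where
  "trm_vars (Var n) = {n}"
| "trm_vars (Par b) = {}"
| "trm_vars TZero = {}"
| "trm_vars (TMinus t) = trm_vars t"
| "trm_vars (TImag t) = trm_vars t"
| "trm_vars (TAvg s t) = trm_vars s \<union> trm_vars t"
| "trm_vars (TOp t) = trm_vars t"

fun free_vars :: "'u fml \<Rightarrow> nat set" where
  "free_vars (FDist s t) = trm_vars s \<union> trm_vars t"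
| "free_vars (FNorm t) = trm_vars t"
| "free_vars (FConn u fs) = (\<Union>f\<in>set fs. free_vars f)"
| "free_vars (FSup n f) = free_vars f - {n}"
| "free_vars (FInf n f) = free_vars f - {n}"

text \<open>Renaming all variables, bound ones included; for injective \<open>r\<close> there is no
  variable capture.\<close>

primrec trm_rename :: "(nat \<Rightarrow> nat) \<Rightarrow> 'u trm \<Rightarrow> 'u trm" where
  "trm_rename r (Var n) = Var (r n)"
| "trm_rename r (Par b) = Par b"
| "trm_rename r TZero = TZero"
| "trm_rename r (TMinus t) = TMinus (trm_rename r t)"
| "trm_rename r (TImag t) = TImag (trm_rename r t)"
| "trm_rename r (TAvg s t) = TAvg (trm_rename r s) (trm_rename r t)"
| "trm_rename r (TOp t) = TOp (trm_rename r t)"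

fun fml_rename :: "(nat \<Rightarrow> nat) \<Rightarrow> 'u fml \<Rightarrow> 'u fml" where
  "fml_rename r (FDist s t) = FDist (trm_rename r s) (trm_rename r t)"
| "fml_rename r (FNorm t) = FNorm (trm_rename r t)"
| "fml_rename r (FConn u fs) = FConn u (map (fml_rename r) fs)"
| "fml_rename r (FSup n f) = FSup (r n) (fml_rename r f)"
| "fml_rename r (FInf n f) = FInf (r n) (fml_rename r f)"

section \<open>Types, the metric on types, and stability\<close>

definition fmls_over :: "'u set \<Rightarrow> nat \<Rightarrow> 'u fml set" where
  "fmls_over B n = {f. wf_fml f \<and> fml_pars f \<subseteq> B \<and> free_vars f \<subseteq> {..<n}}"

text \<open>
  A complete \<open>n\<close>-type over \<open>B\<close> is given by the values it assigns to all formulas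
  in \<open>n\<close> variables with parameters in \<open>B\<close>. By compactness such an assignment is
  realised in an elementary extension of \<open>(H, T)\<close> if and only if it is approximately
  finitely satisfiable in \<open>(H, T)\<close> itself. The latter is taken as the definition, since
  one cannot quantify over elementary extensions with carriers in other types.
\<close>

definition types_over ::
    "'u hilb \<Rightarrow> ('u \<Rightarrow> 'u) \<Rightarrow> 'u set \<Rightarrow> nat \<Rightarrow> ('u fml \<Rightarrow> real) set" where
  "types_over H T B n = {p \<in> extensional (fmls_over B n).
     \<forall>F e. finite F \<longrightarrow> F \<subseteq> fmls_over B n \<longrightarrow> e > 0 \<longrightarrow>
       (\<exists>v. range v \<subseteq> unit_ball H \<and> (\<forall>f\<in>F. \<bar>fval H T f v - p f\<bar> < e))}"

text \<open>
  The distance of two \<open>1\<close>-types is the infimum of \<open>d a b\<close> over all realisations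
  \<open>a\<close> of \<open>p\<close> and \<open>b\<close> of \<open>q\<close> in a common elementary extension. The type
  \<open>r\<close> of the pair \<open>(a, b)\<close> ranges over all \<open>2\<close>-types that extend \<open>p\<close>
  in the first and \<open>q\<close> in the second variable.
\<close>

definition type_dist :: "'u hilb \<Rightarrow> ('u \<Rightarrow> 'u) \<Rightarrow> 'u set \<Rightarrow>
    ('u fml \<Rightarrow> real) \<Rightarrow> ('u fml \<Rightarrow> real) \<Rightarrow> real" where
  "type_dist H T B p q = Inf {r (FDist (Var 0) (Var 1)) | r. r \<in> types_over H T B 2 \<and>
     (\<forall>f\<in>fmls_over B 1. r f = p f \<and> r (fml_rename (id(0 := 1, 1 := 0)) f) = q f)}"

definition types_separable :: "'u hilb \<Rightarrow> ('u \<Rightarrow> 'u) \<Rightarrow> 'u set \<Rightarrow> bool" where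
  "types_separable H T B \<longleftrightarrow> (\<exists>D. countable D \<and> D \<subseteq> types_over H T B 1 \<and>
     (\<forall>p\<in>types_over H T B 1. \<forall>e>0. \<exists>q\<in>D. type_dist H T B p q < e))"

text \<open>A theory enters through the class of its models with carrier contained in the type
  \<open>'u\<close>.\<close>

definition omega_stable :: "('u hilb \<times> ('u \<Rightarrow> 'u)) set \<Rightarrow> bool" where
  "omega_stable Mods \<longleftrightarrow> (\<forall>(H, T)\<in>Mods. \<forall>B. countable B \<longrightarrow> B \<subseteq> unit_ball H \<longrightarrow>
     types_separable H T B)"

definition Sigma_models :: "complex set \<Rightarrow> (complex \<Rightarrow> enat) \<Rightarrow>
    ('u hilb \<times> ('u \<Rightarrow> 'u)) set" where
  "Sigma_models K m = {(H, T). complex_hilbert_space H \<and> hilbert_dim H (carrier H) \<infinity> \<and>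
     normal_op H T \<and> (\<forall>x\<in>carrier H. hnorm H (T x) \<le> hnorm H x) \<and>
     op_spectrum H T = K \<and>
     (\<forall>c. c isolated_in K \<longrightarrow> hilbert_dim H (eigenspace H T c) (m c))}"

end

theory Submission
  imports Defs
begin

text \<open>
  Suppose that \<open>K\<close> is countable. The approximate point spectrum of a normal operator on a nonzero
  space is nonempty and closed, so it has an isolated point when it is countable, and the part of the
  space on which \<open>T\<close> is near that point consists of eigenvectors. By Zorn's lemma \<open>T\<close> has an
  orthonormal eigenbasis. A unitary that nearly commutes with \<open>T\<close> and nearly fixes the parameters
  nearly preserves the values of formulas. Cutting \<open>K\<close> into small clopen pieces yields such
  unitaries, and they move a vector close to any other one with the same coordinates along the
  eigenvectors in the support of the parameters and the same spectral mass on each piece. Hence a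
  type is determined, up to a small distance, by these coordinates and by the limiting spectral mass on
  the clopen subsets of \<open>K\<close>. As \<open>K\<close> is countable this mass is concentrated, up to a small
  error, on finitely many points, so countably many approximate data suffice.

  Suppose that \<open>K\<close> is uncountable. A diagonal operator on a sequence space is a model, and each
  \<open>c\<close> in \<open>K\<close> has a type over the empty set of unit vectors that are approximate eigenvectors for
  \<open>c\<close>. Approximate eigenvectors of a normal operator for different values are nearly orthogonal, so these
  types are uniformly apart.
\<close>

section \<open>Hilbert spaces on a carrier set\<close>

text \<open>No spectral theorem is invoked: \<open>|S|\<close> is obtained by iteration, and the
  kernel of \<open>|S| - S\<close> serves as spectral subspace for a half-line. Carriers are
  explicit sets, so such subspaces are cut out and treated as Hilbert spaces again. A type need not
  be realised in the model at hand, and no extension is constructed, so the data of a type are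
  cluster points of data of approximating vectors. Finite additivity of spectral mass survives in
  the limit, but mass may drift along eigenvalues that converge to a point. Hence masses of clopen
  sets are compared instead of masses of single eigenvalues, and the unitaries commute with
  \<open>T\<close> only approximately: one commuting exactly would preserve the mass at every
  eigenvalue. Enough clopen sets exist because only countably many radii are attained as distances
  within \<open>K\<close>. For uncountable \<open>K\<close> the distances of types are not chained
  by a triangle inequality. A formula that vanishes close to approximate eigenvectors for
  \<open>c\<close> is evaluated at the members of a dense set instead.\<close>

locale hilbert =
  fixes V :: "'v set" and zr :: 'v and ad :: "'v \<Rightarrow> 'v \<Rightarrow> 'v" (infixl "\<boxplus>" 65)
    and sm :: "complex \<Rightarrow> 'v \<Rightarrow> 'v" (infixr "\<star>" 75) and ip :: "'v \<Rightarrow> 'v \<Rightarrow> complex"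
  assumes zr_closed [simp, intro]: "zr \<in> V"
    and ad_closed [simp, intro]: "x \<in> V \<Longrightarrow> y \<in> V \<Longrightarrow> x \<boxplus> y \<in> V"
    and sm_closed [simp, intro]: "x \<in> V \<Longrightarrow> c \<star> x \<in> V"
    and ip_zr_left [simp]: "y \<in> V \<Longrightarrow> ip zr y = 0"
    and ip_ad_left [simp]: "x \<in> V \<Longrightarrow> y \<in> V \<Longrightarrow> z \<in> V \<Longrightarrow> ip (x \<boxplus> y) z = ip x z + ip y z"
    and ip_sm_left [simp]: "x \<in> V \<Longrightarrow> y \<in> V \<Longrightarrow> ip (c \<star> x) y = c * ip x y"
    and ip_commute: "x \<in> V \<Longrightarrow> y \<in> V \<Longrightarrow> ip y x = cnj (ip x y)"
    and ip_nonneg: "x \<in> V \<Longrightarrow> 0 \<le> Re (ip x x)"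
    and ip_separates: "x \<in> V \<Longrightarrow> y \<in> V \<Longrightarrow>
      ip (x \<boxplus> (-1) \<star> y) (x \<boxplus> (-1) \<star> y) = 0 \<Longrightarrow> x = y"
    and complete: "(\<And>n. X n \<in> V) \<Longrightarrow>
      (\<And>e. e > 0 \<Longrightarrow> \<exists>N. \<forall>i\<ge>N. \<forall>j\<ge>N.
         sqrt (Re (ip (X i \<boxplus> (-1) \<star> X j) (X i \<boxplus> (-1) \<star> X j))) < e) \<Longrightarrow>
      \<exists>l\<in>V. (\<lambda>n. sqrt (Re (ip (X n \<boxplus> (-1) \<star> l) (X n \<boxplus> (-1) \<star> l)))) \<longlonglongrightarrow> 0"
begin

abbreviation mi :: "'v \<Rightarrow> 'v \<Rightarrow> 'v" (infixl "\<boxminus>" 65) where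
  "x \<boxminus> y \<equiv> x \<boxplus> (-1) \<star> y"

definition nm :: "'v \<Rightarrow> real" where
  "nm x = sqrt (Re (ip x x))"

definition vconv :: "(nat \<Rightarrow> 'v) \<Rightarrow> 'v \<Rightarrow> bool" where
  "vconv X l \<longleftrightarrow> (\<lambda>n. nm (X n \<boxminus> l)) \<longlonglongrightarrow> 0"

definition lin :: "('v \<Rightarrow> 'v) \<Rightarrow> bool" where
  "lin A \<longleftrightarrow> (\<forall>x\<in>V. A x \<in> V) \<and> (\<forall>x\<in>V. \<forall>y\<in>V. A (x \<boxplus> y) = A x \<boxplus> A y) \<and>
     (\<forall>c. \<forall>x\<in>V. A (c \<star> x) = c \<star> A x)"

definition bdd :: "('v \<Rightarrow> 'v) \<Rightarrow> bool" where
  "bdd A \<longleftrightarrow> (\<exists>C\<ge>0. \<forall>x\<in>V. nm (A x) \<le> C * nm x)"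

definition selfadj :: "('v \<Rightarrow> 'v) \<Rightarrow> bool" where
  "selfadj A \<longleftrightarrow> (\<forall>x\<in>V. \<forall>y\<in>V. ip (A x) y = ip x (A y))"

definition comm :: "('v \<Rightarrow> 'v) \<Rightarrow> ('v \<Rightarrow> 'v) \<Rightarrow> bool" where
  "comm A B \<longleftrightarrow> (\<forall>x\<in>V. A (B x) = B (A x))"

definition csub :: "'v set \<Rightarrow> bool" where
  "csub U \<longleftrightarrow> U \<subseteq> V \<and> zr \<in> U \<and> (\<forall>x\<in>U. \<forall>y\<in>U. x \<boxplus> y \<in> U) \<and> (\<forall>c. \<forall>x\<in>U. c \<star> x \<in> U) \<and>
     (\<forall>X l. (\<forall>n. X n \<in> U) \<longrightarrow> l \<in> V \<longrightarrow> vconv X l \<longrightarrow> l \<in> U)"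

section \<open>Elementary geometry of inner products\<close>

lemma linD [simp, intro]: "lin A \<Longrightarrow> x \<in> V \<Longrightarrow> A x \<in> V"
  and lin_ad: "lin A \<Longrightarrow> x \<in> V \<Longrightarrow> y \<in> V \<Longrightarrow> A (x \<boxplus> y) = A x \<boxplus> A y"
  and lin_sm: "lin A \<Longrightarrow> x \<in> V \<Longrightarrow> A (c \<star> x) = c \<star> A x"
  by (auto simp: lin_def)

lemma ip_ad_right [simp]: "x \<in> V \<Longrightarrow> y \<in> V \<Longrightarrow> z \<in> V \<Longrightarrow> ip x (y \<boxplus> z) = ip x y + ip x z"
  by (metis ad_closed complex_cnj_add ip_ad_left ip_commute)

lemma ip_sm_right [simp]: "x \<in> V \<Longrightarrow> y \<in> V \<Longrightarrow> ip x (c \<star> y) = cnj c * ip x y"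
  by (metis complex_cnj_mult ip_commute ip_sm_left sm_closed)

lemma ip_zr_right [simp]: "x \<in> V \<Longrightarrow> ip x zr = 0"
  by (metis complex_cnj_zero ip_commute ip_zr_left zr_closed)

text \<open>The locale assumes no vector space laws. Axiom \<open>ip_separates\<close> yields them
  on demand: equality of vectors is tested against all inner products, where it becomes an identity
  between complex numbers.\<close>

lemma vec_eqI:
  assumes "x \<in> V" "y \<in> V" "\<And>z. z \<in> V \<Longrightarrow> ip x z = ip y z"
  shows "x = y"
  by (rule ip_separates[OF assms(1,2)]) (use assms in simp)

lemma lin_zr: "lin A \<Longrightarrow> A zr = zr"
proof -
  assume A: "lin A"
  have "zr = 0 \<star> zr" by (rule vec_eqI) auto
  then have "A zr = 0 \<star> A zr" using lin_sm[OF A, of zr 0] by simp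
  then show ?thesis using A by (intro vec_eqI) (auto, metis ip_sm_left linD mult_zero_left zr_closed)
qed

lemma lin_mi: "lin A \<Longrightarrow> x \<in> V \<Longrightarrow> y \<in> V \<Longrightarrow> A (x \<boxminus> y) = A x \<boxminus> A y"
  by (simp add: lin_ad lin_sm)

lemma ip_self: "x \<in> V \<Longrightarrow> ip x x = of_real ((nm x)\<^sup>2)"
proof -
  assume x: "x \<in> V"
  have "Im (ip x x) = 0" using ip_commute[OF x x] by (simp add: complex_eq_iff)
  then show ?thesis using ip_nonneg[OF x] by (simp add: nm_def complex_eq_iff)
qed

lemma nm_sq: "x \<in> V \<Longrightarrow> (nm x)\<^sup>2 = Re (ip x x)"
  by (simp add: ip_self)

lemma nm_nonneg [simp]: "0 \<le> nm x" if "x \<in> V"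
  using that ip_nonneg by (simp add: nm_def)

lemma nm_zr [simp]: "nm zr = 0"
  by (simp add: nm_def)

lemma nm_eq_0: "x \<in> V \<Longrightarrow> nm x = 0 \<longleftrightarrow> x = zr"
  using ip_separates[of x zr] ip_self[of x] by auto

lemma nm_sm: "x \<in> V \<Longrightarrow> nm (c \<star> x) = cmod c * nm x"
proof -
  assume x: "x \<in> V"
  have "(nm (c \<star> x))\<^sup>2 = (cmod c * nm x)\<^sup>2"
  proof -
    have "(nm (c \<star> x))\<^sup>2 = Re ((c * cnj c) * ip x x)" using x by (simp add: nm_sq mult.assoc mult.left_commute)
    also have "\<dots> = (cmod c * nm x)\<^sup>2"
      unfolding ip_self[OF x] complex_norm_square[symmetric] by (simp add: power_mult_distrib flip: of_real_power)
    finally show ?thesis .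
  qed
  then show ?thesis using x by (simp add: power2_eq_iff_nonneg)
qed

lemma nm_sq_mi: "x \<in> V \<Longrightarrow> y \<in> V \<Longrightarrow> (nm (x \<boxminus> y))\<^sup>2 = (nm x)\<^sup>2 - 2 * Re (ip x y) + (nm y)\<^sup>2"
  and nm_sq_ad: "x \<in> V \<Longrightarrow> y \<in> V \<Longrightarrow> (nm (x \<boxplus> y))\<^sup>2 = (nm x)\<^sup>2 + 2 * Re (ip x y) + (nm y)\<^sup>2"
proof -
  assume "x \<in> V" "y \<in> V"
  then have "Re (ip y x) = Re (ip x y)" using ip_commute[of x y] by simp
  then show "(nm (x \<boxminus> y))\<^sup>2 = (nm x)\<^sup>2 - 2 * Re (ip x y) + (nm y)\<^sup>2"
    and "(nm (x \<boxplus> y))\<^sup>2 = (nm x)\<^sup>2 + 2 * Re (ip x y) + (nm y)\<^sup>2"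
    using \<open>x \<in> V\<close> \<open>y \<in> V\<close> by (simp_all add: nm_sq)
qed

lemma Re_ip_le: assumes "x \<in> V" "y \<in> V" shows "Re (ip x y) \<le> nm x * nm y"
proof (cases "nm x = 0 \<or> nm y = 0")
  case True
  then show ?thesis using assms by (auto simp: nm_eq_0)
next
  case False
  then have pos: "nm x > 0" "nm y > 0" using assms by (auto simp: less_le)
  \<comment> \<open>The two vectors are rescaled to the common length \<open>nm x * nm y\<close>
    before their difference is squared, which avoids dividing by norms.\<close>
  have "0 \<le> (nm (of_real (nm y) \<star> x \<boxminus> of_real (nm x) \<star> y))\<^sup>2" by simp
  also have "\<dots> = 2 * (nm x * nm y) * (nm x * nm y - Re (ip x y))"
    using assms by (subst nm_sq_mi) (auto simp: nm_sm algebra_simps power2_eq_square)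
  finally show ?thesis using mult_pos_pos[OF pos] by (simp add: zero_le_mult_iff)
qed

lemma cauchy_schwarz: assumes "x \<in> V" "y \<in> V" shows "cmod (ip x y) \<le> nm x * nm y"
proof (cases "ip x y = 0")
  case True
  then show ?thesis using assms by simp
next
  case False
  \<comment> \<open>The phase \<open>c\<close> rotates \<open>ip x y\<close> onto the positive real
    axis, where the bound for real parts applies.\<close>
  define c where "c = cnj (ip x y) / cmod (ip x y)"
  have c: "cmod c = 1" using False by (simp add: c_def norm_divide)
  have "c * ip x y = cmod (ip x y)"
    using False by (simp add: c_def complex_norm_square[symmetric] power2_eq_square mult.commute)
  then have "cmod (ip x y) = Re (ip (c \<star> x) y)" using assms by simp
  also have "\<dots> \<le> nm (c \<star> x) * nm y" by (rule Re_ip_le) (use assms in auto)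
  finally show ?thesis using assms c by (simp add: nm_sm)
qed

lemma nm_triangle: assumes "x \<in> V" "y \<in> V" shows "nm (x \<boxplus> y) \<le> nm x + nm y"
proof (rule power2_le_imp_le)
  show "(nm (x \<boxplus> y))\<^sup>2 \<le> (nm x + nm y)\<^sup>2"
    using assms Re_ip_le[OF assms] by (simp add: nm_sq_ad power2_sum)
qed (use assms in simp)

lemma nm_triangle_mi: assumes "x \<in> V" "y \<in> V" shows "nm (x \<boxminus> y) \<le> nm x + nm y"
  using nm_triangle[of x "(-1) \<star> y"] assms by (simp add: nm_sm)

lemma nm_mi_commute: assumes "x \<in> V" "y \<in> V" shows "nm (x \<boxminus> y) = nm (y \<boxminus> x)"
proof -
  have "y \<boxminus> x = (-1) \<star> (x \<boxminus> y)" by (rule vec_eqI) (use assms in auto)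
  then show ?thesis using assms by (simp add: nm_sm)
qed

lemma nm_dist_triangle: assumes "x \<in> V" "y \<in> V" "z \<in> V"
  shows "nm (x \<boxminus> z) \<le> nm (x \<boxminus> y) + nm (y \<boxminus> z)"
proof -
  have "x \<boxminus> z = (x \<boxminus> y) \<boxplus> (y \<boxminus> z)" by (rule vec_eqI) (use assms in auto)
  then show ?thesis using nm_triangle[of "x \<boxminus> y" "y \<boxminus> z"] assms by simp
qed

lemma nm_diff_le: assumes "x \<in> V" "y \<in> V" shows "\<bar>nm x - nm y\<bar> \<le> nm (x \<boxminus> y)"
proof -
  have "x = y \<boxplus> (x \<boxminus> y)" "y = x \<boxplus> (y \<boxminus> x)" by (rule vec_eqI; use assms in simp)+
  then have "nm x \<le> nm y + nm (x \<boxminus> y)" "nm y \<le> nm x + nm (y \<boxminus> x)"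
    using nm_triangle[of y "x \<boxminus> y"] nm_triangle[of x "y \<boxminus> x"] assms by simp_all
  then show ?thesis using nm_mi_commute[OF assms] by linarith
qed

lemma mi_eq_zr: "x \<in> V \<Longrightarrow> y \<in> V \<Longrightarrow> nm (x \<boxminus> y) = 0 \<longleftrightarrow> x = y"
  using ip_separates[of x y] ip_self[of "x \<boxminus> y"] by (auto simp: nm_def)

section \<open>Norm convergence and closed subspaces\<close>

lemma vconv_ip:
  assumes "\<And>n. X n \<in> V" "\<And>n. Y n \<in> V" "x \<in> V" "y \<in> V" "vconv X x" "vconv Y y"
  shows "(\<lambda>n. ip (X n) (Y n)) \<longlonglongrightarrow> ip x y"
proof -
  have "(\<lambda>n. nm (X n \<boxminus> x) * nm (Y n \<boxminus> y) + nm (X n \<boxminus> x) * nm y + nm x * nm (Y n \<boxminus> y)) \<longlonglongrightarrow> 0"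
    using tendsto_add[OF tendsto_add[OF tendsto_mult tendsto_mult_right] tendsto_mult_left,
        OF assms(5,6,5,6)[unfolded vconv_def], of "nm y" "nm x"] by simp
  moreover have "norm (ip (X n) (Y n) - ip x y) \<le>
      nm (X n \<boxminus> x) * nm (Y n \<boxminus> y) + nm (X n \<boxminus> x) * nm y + nm x * nm (Y n \<boxminus> y)" for n
  proof -
    have eq: "ip (X n) (Y n) - ip x y =
        ip (X n \<boxminus> x) (Y n \<boxminus> y) + ip (X n \<boxminus> x) y + ip x (Y n \<boxminus> y)"
      using assms(1-4) by (simp add: algebra_simps)
    moreover have "cmod (ip (X n \<boxminus> x) (Y n \<boxminus> y)) \<le> nm (X n \<boxminus> x) * nm (Y n \<boxminus> y)"
      "cmod (ip (X n \<boxminus> x) y) \<le> nm (X n \<boxminus> x) * nm y"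
      "cmod (ip x (Y n \<boxminus> y)) \<le> nm x * nm (Y n \<boxminus> y)"
      by (rule cauchy_schwarz; use assms(1-4) in simp)+
    moreover have "cmod (ip (X n \<boxminus> x) (Y n \<boxminus> y) + ip (X n \<boxminus> x) y + ip x (Y n \<boxminus> y)) \<le>
        cmod (ip (X n \<boxminus> x) (Y n \<boxminus> y)) + cmod (ip (X n \<boxminus> x) y) + cmod (ip x (Y n \<boxminus> y))"
      by (intro order_trans[OF norm_triangle_ineq] add_right_mono norm_triangle_ineq)
    ultimately show ?thesis unfolding eq by linarith
  qed
  ultimately have "(\<lambda>n. ip (X n) (Y n) - ip x y) \<longlonglongrightarrow> 0"
    by (metis (mono_tags, lifting) Lim_null_comparison always_eventually)
  then show ?thesis by (simp add: LIM_zero_iff)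
qed

lemma vconv_const [simp]: "x \<in> V \<Longrightarrow> vconv (\<lambda>_. x) x"
  using mi_eq_zr[of x x] by (simp add: vconv_def)

lemma vconv_unique:
  assumes "\<And>n. X n \<in> V" "x \<in> V" "y \<in> V" "vconv X x" "vconv X y"
  shows "x = y"
proof (rule vec_eqI)
  fix z assume z: "z \<in> V"
  show "ip x z = ip y z"
    by (rule LIMSEQ_unique[OF vconv_ip[of X "\<lambda>_. z"] vconv_ip[of X "\<lambda>_. z"]]) (use assms z in auto)
qed fact+

lemma vconv_bdd:
  assumes "lin A" "bdd A" "\<And>n. X n \<in> V" "x \<in> V" "vconv X x"
  shows "vconv (\<lambda>n. A (X n)) (A x)"
proof -
  obtain C where C: "\<And>x. x \<in> V \<Longrightarrow> nm (A x) \<le> C * nm x" using assms(2) by (auto simp: bdd_def)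
  have "(\<lambda>n. C * nm (X n \<boxminus> x)) \<longlonglongrightarrow> 0"
    using tendsto_mult_left[OF assms(5)[unfolded vconv_def], of C] by simp
  then have "(\<lambda>n. nm (A (X n) \<boxminus> A x)) \<longlonglongrightarrow> 0"
    by (rule Lim_null_comparison[rotated])
      (use assms C in \<open>auto intro!: always_eventually simp flip: lin_mi\<close>)
  then show ?thesis by (simp add: vconv_def)
qed

lemma vconv_nm:
  assumes "\<And>n. X n \<in> V" "x \<in> V" "vconv X x"
  shows "(\<lambda>n. nm (X n)) \<longlonglongrightarrow> nm x"
  unfolding nm_def by (intro tendsto_intros vconv_ip) (use assms in auto)

lemma vconvI_Cauchy:
  assumes "\<And>n. X n \<in> V" "\<And>e. e > 0 \<Longrightarrow> \<exists>N. \<forall>i\<ge>N. \<forall>j\<ge>N. nm (X i \<boxminus> X j) < e"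
  obtains l where "l \<in> V" "vconv X l"
  using complete[of X] assms unfolding vconv_def nm_def by blast

text \<open>The operations are kept and only the carrier shrinks, so closed subspaces of closed
  subspaces again fit the locale without any transport; later constructions restrict
  \<open>T\<close> repeatedly.\<close>

lemma hilbert_csub:
  assumes "csub U" shows "hilbert U zr ad sm ip"
proof
  have sub: "x \<in> U \<Longrightarrow> x \<in> V" for x using assms by (auto simp: csub_def)
  fix x y z c assume "x \<in> U" "y \<in> U" "z \<in> U"
  then have xyz: "x \<in> V" "y \<in> V" "z \<in> V" and "x \<in> U" "y \<in> U" using sub by auto
  then show "x \<boxplus> y \<in> U" "c \<star> x \<in> U" "ip zr y = 0" "ip (x \<boxplus> y) z = ip x z + ip y z"
    "ip (c \<star> x) y = c * ip x y" "ip y x = cnj (ip x y)" "0 \<le> Re (ip x x)"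
    "ip (x \<boxplus> (-1) \<star> y) (x \<boxplus> (-1) \<star> y) = 0 \<Longrightarrow> x = y"
    using assms xyz ip_commute[OF xyz(1,2)] ip_nonneg[OF xyz(1)] ip_separates[OF xyz(1,2)]
    unfolding csub_def by (blast, blast, simp_all only: ip_zr_left ip_ad_left ip_sm_left)
next
  show "zr \<in> U" using assms by (auto simp: csub_def)
  fix X :: "nat \<Rightarrow> 'v"
  assume X: "\<And>n. X n \<in> U" and C: "\<And>e. e > 0 \<Longrightarrow> \<exists>N. \<forall>i\<ge>N. \<forall>j\<ge>N.
         sqrt (Re (ip (X i \<boxminus> X j) (X i \<boxminus> X j))) < e"
  have "\<And>n. X n \<in> V" using X assms by (auto simp: csub_def)
  from complete[OF this C] obtain l where "l \<in> V"
    "(\<lambda>n. sqrt (Re (ip (X n \<boxminus> l) (X n \<boxminus> l)))) \<longlonglongrightarrow> 0" by blast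
  moreover from this have "l \<in> U" using assms X unfolding csub_def vconv_def nm_def by blast
  ultimately show "\<exists>l\<in>U. (\<lambda>n. sqrt (Re (ip (X n \<boxminus> l) (X n \<boxminus> l)))) \<longlonglongrightarrow> 0" by blast
qed

section \<open>Absolute value and positive spectral part of a self-adjoint operator\<close>

lemma pos_norm:
  assumes A: "lin A" "selfadj A" and e: "e > 0"
    and pos: "\<And>x. x \<in> V \<Longrightarrow> 0 \<le> Re (ip (A x) x)" and le: "\<And>x. x \<in> V \<Longrightarrow> Re (ip (A x) x) \<le> e * (nm x)\<^sup>2"
    and x: "x \<in> V"
  shows "nm (A x) \<le> e * nm x"
proof -
  \<comment> \<open>Positivity is tested at \<open>x - (1 / e) A x\<close>. The factor
    \<open>1 / e\<close> balances the quadratic term, bounded by \<open>e |A x|^2 / e^2\<close>,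
    against the mixed term \<open>2 |A x|^2 / e\<close>.\<close>
  define t :: complex where "t = of_real (1 / e)"
  have Ax: "A x \<in> V" "A (A x) \<in> V" using A x by auto
  have "0 \<le> Re (ip (A (x \<boxminus> t \<star> A x)) (x \<boxminus> t \<star> A x))" by (rule pos) (use A x in auto)
  also have "\<dots> = Re (ip (A x) x) - 2 / e * (nm (A x))\<^sup>2 + 1 / e\<^sup>2 * Re (ip (A (A x)) (A x))"
  proof -
    have "ip (A (A x)) x = ip (A x) (A x)" using A x Ax by (auto simp: selfadj_def)
    then show ?thesis using A x Ax
      by (simp add: lin_ad lin_sm t_def nm_sq algebra_simps power2_eq_square[of e])
  qed
  also have "\<dots> \<le> e * (nm x)\<^sup>2 - 2 / e * (nm (A x))\<^sup>2 + 1 / e\<^sup>2 * (e * (nm (A x))\<^sup>2)"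
    using le[OF x] le[OF Ax(1)] e by (intro add_mono diff_mono mult_left_mono) auto
  also have "\<dots> = ((e * nm x)\<^sup>2 - (nm (A x))\<^sup>2) / e"
    using e by (simp add: field_simps power2_eq_square)
  finally have "(nm (A x))\<^sup>2 \<le> (e * nm x)\<^sup>2" using e by (simp add: zero_le_divide_iff)
  then show ?thesis using e x by (auto intro: power2_le_imp_le)
qed

context
  fixes S :: "'v \<Rightarrow> 'v"
  assumes S: "lin S" "selfadj S" and S1: "\<And>x. x \<in> V \<Longrightarrow> nm (S x) \<le> nm x"
begin

private definition E :: "'v \<Rightarrow> 'v" where "E x = x \<boxminus> S (S x)"

private primrec W :: "nat \<Rightarrow> 'v \<Rightarrow> 'v" where
  "W 0 x = zr"
| "W (Suc n) x = (1/2) \<star> (E x \<boxplus> W n (W n x))"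

text \<open>The scalar majorant of the operator iteration: \<open>E\<close> is replaced by its norm
  bound 1. Being increasing and bounded by 1, the numbers \<open>w n\<close> converge, and they
  control both the norms of the \<open>W n\<close> and their differences.\<close>

private primrec w :: "nat \<Rightarrow> real" where
  "w 0 = 0"
| "w (Suc n) = (1 + (w n)\<^sup>2) / 2"

private lemma w_bounds: "0 \<le> w n \<and> w n \<le> 1"
  by (induction n) (auto simp: power_le_one)

private lemma w_mono: "incseq w"
proof (rule incseq_SucI)
  show "w n \<le> w (Suc n)" for n
    using sum_squares_bound[of 1 "w n"] by (simp add: field_simps)
qed

private lemma lin_E: "lin E"
  unfolding lin_def E_def
proof (intro conjI ballI allI)
  fix x y c assume "x \<in> V" "y \<in> V"
  then show "(x \<boxplus> y) \<boxminus> S (S (x \<boxplus> y)) = (x \<boxminus> S (S x)) \<boxplus> (y \<boxminus> S (S y))"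
    using S by (intro vec_eqI) (auto simp: lin_ad algebra_simps)
next
  fix x c assume "x \<in> V"
  then show "c \<star> x \<boxminus> S (S (c \<star> x)) = c \<star> (x \<boxminus> S (S x))"
    using S by (intro vec_eqI) (auto simp: lin_sm algebra_simps)
qed (use S in auto)

private lemma lin_W: "lin (W n)"
proof (induction n)
  case 0
  show ?case unfolding lin_def by (auto intro!: vec_eqI)
next
  case (Suc n)
  show ?case
    unfolding lin_def
  proof (intro conjI ballI allI)
    fix x y c assume "x \<in> V" "y \<in> V"
    then show "W (Suc n) (x \<boxplus> y) = W (Suc n) x \<boxplus> W (Suc n) y"
      using Suc lin_E by (intro vec_eqI) (auto simp: lin_ad algebra_simps)
  next
    fix x c assume "x \<in> V"
    then show "W (Suc n) (c \<star> x) = c \<star> W (Suc n) x"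
      using Suc lin_E by (intro vec_eqI) (auto simp: lin_sm algebra_simps)
  qed (use Suc lin_E in auto)
qed

private lemma selfadj_E: "selfadj E"
  using S unfolding selfadj_def E_def by auto

private lemma selfadj_W: "selfadj (W n)"
proof (induction n)
  case (Suc n)
  then show ?case using lin_W[of n] lin_E selfadj_E unfolding selfadj_def by auto
qed (auto simp: selfadj_def)

private lemma comm_E:
  assumes A: "lin A" "comm A S" shows "comm A E"
  unfolding comm_def E_def
proof
  fix x assume x: "x \<in> V"
  have "A (S (S x)) = S (S (A x))" using A(2) x S by (simp add: comm_def)
  then show "A (x \<boxminus> S (S x)) = A x \<boxminus> S (S (A x))" using A x S by (simp add: lin_mi)
qed

text \<open>Every \<open>W n\<close> is a polynomial in \<open>S\<close>, so it commutes with
  whatever commutes with \<open>S\<close>.\<close>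

private lemma comm_W:
  assumes A: "lin A" "comm A S" shows "comm A (W n)"
proof (induction n)
  case 0
  show ?case using A by (simp add: comm_def lin_zr)
next
  case (Suc n)
  show ?case unfolding comm_def
  proof
    fix x assume x: "x \<in> V"
    have "A (W n (W n x)) = W n (W n (A x))" using Suc x lin_W[of n] by (simp add: comm_def)
    moreover have "A (E x) = E (A x)" using comm_E[OF A] x by (simp add: comm_def)
    ultimately show "A (W (Suc n) x) = W (Suc n) (A x)"
      using A x lin_E lin_W[of n] by (simp add: lin_ad lin_sm)
  qed
qed

private lemma comm_WW: "comm (W m) (W n)"
proof (rule comm_W[OF lin_W])
  have "comm S (W m)" by (rule comm_W) (use S in \<open>auto simp: comm_def\<close>)
  then show "comm (W m) S" by (simp add: comm_def)
qed

text \<open>\<open>E\<close> is positive with quadratic form \<open>|x|^2 - |S x|^2\<close>, which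
  lies between 0 and \<open>|x|^2\<close>, so \<open>pos_norm\<close> applies with constant 1. The
  triangle inequality would only give the constant 2.\<close>

private lemma nm_E: assumes "x \<in> V" shows "nm (E x) \<le> nm x"
proof -
  have ip: "Re (ip (E x) x) = (nm x)\<^sup>2 - (nm (S x))\<^sup>2" if "x \<in> V" for x
  proof -
    have "ip (S (S x)) x = ip (S x) (S x)" using S that unfolding selfadj_def by auto
    then show ?thesis using that S by (simp add: E_def nm_sq)
  qed
  have "nm (E x) \<le> 1 * nm x"
  proof (rule pos_norm[OF lin_E selfadj_E _ _ _ assms])
    fix x assume "x \<in> V"
    then show "0 \<le> Re (ip (E x) x)" "Re (ip (E x) x) \<le> 1 * (nm x)\<^sup>2"
      using S1[of x] S by (simp_all add: ip power_mono)
  qed simp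
  then show ?thesis by simp
qed

private lemma nm_W: "x \<in> V \<Longrightarrow> nm (W n x) \<le> w n * nm x"
proof (induction n arbitrary: x)
  case (Suc n)
  have Wx: "W n x \<in> V" "W n (W n x) \<in> V" using lin_W[of n] Suc.prems by auto
  have "nm (W (Suc n) x) = nm (E x \<boxplus> W n (W n x)) / 2"
    using Suc.prems lin_E Wx by (simp add: nm_sm)
  also have "\<dots> \<le> (nm (E x) + nm (W n (W n x))) / 2"
    using nm_triangle[of "E x" "W n (W n x)"] Suc.prems lin_E Wx by simp
  also have "\<dots> \<le> (nm x + w n * (w n * nm x)) / 2"
    using Suc.IH[OF Wx(1)] nm_E[OF Suc.prems] w_bounds[of n]
      mult_left_mono[OF Suc.IH[OF Suc.prems], of "w n"] by (intro divide_right_mono add_mono) auto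
  finally show ?case by (simp add: algebra_simps power2_eq_square)
qed simp

text \<open>As the \<open>W n\<close> commute, a difference of squares factors into difference and
  sum. Inductively the factors are bounded by \<open>w k - w n\<close> and \<open>w k + w n\<close>,
  and half their product is the next difference of the majorant.\<close>

private lemma nm_W_diff: "n \<le> m \<Longrightarrow> x \<in> V \<Longrightarrow> nm (W m x \<boxminus> W n x) \<le> (w m - w n) * nm x"
proof (induction n arbitrary: m x)
  case 0
  have "W m x \<boxminus> W 0 x = W m x" using lin_W[of m] 0 by (intro vec_eqI) auto
  then show ?case using nm_W[of x m] 0 by simp
next
  case (Suc n)
  then obtain k where m: "m = Suc k" and k: "n \<le> k" by (cases m) auto
  note [simp] = linD[OF lin_W] linD[OF lin_E]
  have x: "x \<in> V" by fact
  define y where "y = W k x \<boxplus> W n x"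
  have y: "y \<in> V" using x by (simp add: y_def)
  have cm: "W n (W k x) = W k (W n x)" using comm_WW[of n k] x by (simp add: comm_def)
  have "W m x \<boxminus> W (Suc n) x = (1/2) \<star> (W k y \<boxminus> W n y)"
    using x by (intro vec_eqI) (auto simp: m y_def lin_ad[OF lin_W] cm algebra_simps)
  then have "nm (W m x \<boxminus> W (Suc n) x) = nm (W k y \<boxminus> W n y) / 2"
    using y by (simp add: nm_sm)
  also have "\<dots> \<le> (w k - w n) * nm y / 2" using Suc.IH[OF k y] by simp
  also have "\<dots> \<le> (w k - w n) * ((w k + w n) * nm x) / 2"
  proof -
    have "nm y \<le> nm (W k x) + nm (W n x)" unfolding y_def using x by (intro nm_triangle) auto
    also have "\<dots> \<le> (w k + w n) * nm x" using nm_W[OF x, of k] nm_W[OF x, of n] by (simp add: algebra_simps)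
    finally show ?thesis using incseqD[OF w_mono k] by (intro divide_right_mono mult_left_mono) auto
  qed
  also have "\<dots> = (w m - w (Suc n)) * nm x" by (simp add: m field_simps power2_eq_square)
  finally show ?case .
qed

private lemma W_limit:
  assumes x: "x \<in> V" shows "\<exists>l\<in>V. vconv (\<lambda>n. W n x) l"
proof -
  note [simp] = linD[OF lin_W]
  have "Bseq w" using w_bounds by (intro BseqI'[of _ 1]) auto
  then have "convergent w" using w_mono by (intro Bseq_mono_convergent) (auto simp: incseq_def)
  then have C: "Cauchy w" by (simp add: Cauchy_convergent_iff)
  show ?thesis
  proof (rule vconvI_Cauchy[of "\<lambda>n. W n x"])
    show "W n x \<in> V" for n using x by simp
    fix e :: real assume e: "e > 0"
    \<comment> \<open>The summand 1 keeps the tolerance meaningful for the zero vector.\<close>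
    have "e / (nm x + 1) > 0" using e x nm_nonneg[OF x] by (intro divide_pos_pos) linarith+
    then obtain N where N: "\<And>i j. i \<ge> N \<Longrightarrow> j \<ge> N \<Longrightarrow> \<bar>w i - w j\<bar> < e / (nm x + 1)"
      using C unfolding Cauchy_def dist_real_def by blast
    have main: "nm (W i x \<boxminus> W j x) < e" if "i \<ge> N" "j \<ge> N" "j \<le> i" for i j
    proof -
      have "nm (W i x \<boxminus> W j x) \<le> (w i - w j) * nm x" by (rule nm_W_diff) (use that x in auto)
      also have "\<dots> \<le> (w i - w j) * (nm x + 1)"
        using incseqD[OF w_mono that(3)] by (intro mult_left_mono) auto
      also have "\<dots> < e" using N[OF that(1,2)] nm_nonneg[OF x] incseqD[OF w_mono that(3)]
        by (simp add: pos_less_divide_eq)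
      finally show ?thesis .
    qed
    have "nm (W i x \<boxminus> W j x) < e" if "i \<ge> N" "j \<ge> N" for i j
      using main[of i j] main[of j i] that nm_mi_commute[of "W i x" "W j x"] x
      by (cases "j \<le> i") auto
    then show "\<exists>N. \<forall>i\<ge>N. \<forall>j\<ge>N. nm (W i x \<boxminus> W j x) < e" by blast
  qed blast
qed

text \<open>With \<open>E = 1 - S\<^sup>2\<close>, the iteration converges to \<open>W = 1 - \<bar>S\<bar>\<close>, the fixed point of
  \<open>W = (E + W\<^sup>2) / 2\<close>.\<close>

private lemma absolute_value:
  obtains R where "lin R" "\<And>x. x \<in> V \<Longrightarrow> 0 \<le> Re (ip (R x) x)" "\<And>x. x \<in> V \<Longrightarrow> R (R x) = S (S x)"
    "\<And>A. lin A \<Longrightarrow> bdd A \<Longrightarrow> comm A S \<Longrightarrow> comm A R" "bdd R"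
proof -
  note [simp] = linD[OF lin_W] linD[OF lin_E]
  obtain U where U: "\<And>x. x \<in> V \<Longrightarrow> U x \<in> V" "\<And>x. x \<in> V \<Longrightarrow> vconv (\<lambda>n. W n x) (U x)"
    using W_limit by metis
  have lim: "(\<lambda>n. ip (W n x) z) \<longlonglongrightarrow> ip (U x) z" if "x \<in> V" "z \<in> V" for x z
    by (rule vconv_ip) (use that U in auto)
  have linU: "lin U" unfolding lin_def
  proof (intro conjI ballI allI)
    fix x y assume xy: "x \<in> V" "y \<in> V"
    show "U (x \<boxplus> y) = U x \<boxplus> U y"
    proof (rule vec_eqI)
      fix z assume z: "z \<in> V"
      have "(\<lambda>n. ip (W n (x \<boxplus> y)) z) \<longlonglongrightarrow> ip (U x) z + ip (U y) z"
        using tendsto_add[OF lim[OF xy(1) z] lim[OF xy(2) z]] xy z by (simp add: lin_ad[OF lin_W])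
      then show "ip (U (x \<boxplus> y)) z = ip (U x \<boxplus> U y) z"
        using LIMSEQ_unique lim[of "x \<boxplus> y" z] xy z U by auto
    qed (use xy U in auto)
  next
    fix x c assume x: "x \<in> V"
    show "U (c \<star> x) = c \<star> U x"
    proof (rule vec_eqI)
      fix z assume z: "z \<in> V"
      have "(\<lambda>n. ip (W n (c \<star> x)) z) \<longlonglongrightarrow> c * ip (U x) z"
        using tendsto_mult_left[OF lim[OF x z], of c] x z by (simp add: lin_sm[OF lin_W])
      then show "ip (U (c \<star> x)) z = ip (c \<star> U x) z"
        using LIMSEQ_unique lim[of "c \<star> x" z] x z U by auto
    qed (use x U in auto)
  qed (use U in auto)
  have nmU: "nm (U x) \<le> nm x" if "x \<in> V" for x
  proof (rule LIMSEQ_le_const2[OF vconv_nm])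
    show "vconv (\<lambda>n. W n x) (U x)" using U that by auto
    have "nm (W n x) \<le> nm x" for n
      using nm_W[OF that, of n] w_bounds[of n] nm_nonneg[OF that] by (meson mult_left_le_one_le order_trans)
    then show "\<exists>N. \<forall>n\<ge>N. nm (W n x) \<le> nm x" by blast
  qed (use that U in auto)
  have UU: "2 \<star> U x = E x \<boxplus> U (U x)" if x: "x \<in> V" for x
  proof (rule vec_eqI)
    fix z assume z: "z \<in> V"
    \<comment> \<open>Moving one factor to the other side by self-adjointness turns the square of
      \<open>W n\<close> into an inner product of two convergent sequences, whose limit is
      known.\<close>
    have "(\<lambda>n. ip (W n x) (W n z)) \<longlonglongrightarrow> ip (U x) (U z)" by (rule vconv_ip) (use x z U in auto)
    moreover have "ip (U x) (U z) = ip (U (U x)) z"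
    proof (rule LIMSEQ_unique)
      have "ip (U x) (W n z) = ip (W n (U x)) z" for n
        using selfadj_W[of n] x z U unfolding selfadj_def by auto
      then show "(\<lambda>n. ip (W n (U x)) z) \<longlonglongrightarrow> ip (U x) (U z)"
        using vconv_ip[of "\<lambda>_. U x" "\<lambda>n. W n z" "U x" "U z"] x z U by simp
      show "(\<lambda>n. ip (W n (U x)) z) \<longlonglongrightarrow> ip (U (U x)) z" by (rule lim) (use x z U in auto)
    qed
    ultimately have "(\<lambda>n. ip (E x) z + ip (W n x) (W n z)) \<longlonglongrightarrow> ip (E x) z + ip (U (U x)) z"
      by (intro tendsto_intros) simp
    moreover have "ip (E x) z + ip (W n x) (W n z) = 2 * ip (W (Suc n) x) z" for n
      using selfadj_W[of n] x z unfolding selfadj_def by auto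
    ultimately have "(\<lambda>n. 2 * ip (W (Suc n) x) z) \<longlonglongrightarrow> ip (E x) z + ip (U (U x)) z" by simp
    moreover have "(\<lambda>n. 2 * ip (W (Suc n) x) z) \<longlonglongrightarrow> 2 * ip (U x) z"
      by (intro tendsto_mult_left LIMSEQ_Suc lim x z)
    ultimately show "ip (2 \<star> U x) z = ip (E x \<boxplus> U (U x)) z"
      using LIMSEQ_unique x z U by auto
  qed (use x U in auto)
  define R where "R x = x \<boxminus> U x" for x
  show ?thesis
  proof
    show "lin R" unfolding lin_def R_def
    proof (intro conjI ballI allI)
      fix x y assume "x \<in> V" "y \<in> V"
      then show "(x \<boxplus> y) \<boxminus> U (x \<boxplus> y) = (x \<boxminus> U x) \<boxplus> (y \<boxminus> U y)"
        using linU by (intro vec_eqI) (auto simp: lin_ad algebra_simps)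
    next
      fix x c assume "x \<in> V"
      then show "c \<star> x \<boxminus> U (c \<star> x) = c \<star> (x \<boxminus> U x)"
        using linU by (intro vec_eqI) (auto simp: lin_sm algebra_simps)
    qed (use U in auto)
    show "bdd R" unfolding bdd_def R_def
    proof (intro exI[of _ 2] conjI ballI)
      fix x assume x: "x \<in> V"
      show "nm (x \<boxminus> U x) \<le> 2 * nm x"
        using nm_triangle_mi[of x "U x"] nmU[of x] U x by simp
    qed simp
    fix x assume x: "x \<in> V"
    show "0 \<le> Re (ip (R x) x)"
    proof -
      have "Re (ip (U x) x) \<le> nm x * nm x"
        using Re_ip_le[of "U x" x] nmU[OF x] U x mult_right_mono[OF nmU[OF x], of "nm x"] by force
      then show ?thesis using x U by (simp add: R_def nm_sq[symmetric] power2_eq_square)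
    qed
    show "R (R x) = S (S x)"
    proof (rule vec_eqI)
      fix z assume z: "z \<in> V"
      \<comment> \<open>With \<open>R = 1 - U\<close> one has \<open>R^2 = 1 - 2 U + U^2\<close>,
        and the fixed point equation reduces this to \<open>1 - E = S^2\<close>.\<close>
      have "2 * ip (U x) z = ip x z - ip (S (S x)) z + ip (U (U x)) z"
        using arg_cong[OF UU[OF x], of "\<lambda>y. ip y z"] x z U S by (simp add: E_def)
      then show "ip (R (R x)) z = ip (S (S x)) z"
        using x z U S linU by (simp add: R_def lin_ad lin_sm algebra_simps)
    qed (use x U S in \<open>auto simp: R_def\<close>)
  next
    fix A assume A: "lin A" "bdd A" "comm A S"
    have AU: "A (U x) = U (A x)" if x: "x \<in> V" for x
    proof (rule vconv_unique)
      show "vconv (\<lambda>n. A (W n x)) (A (U x))" by (rule vconv_bdd) (use A x U in auto)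
      show "vconv (\<lambda>n. A (W n x)) (U (A x))"
        using U(2)[of "A x"] A x comm_W[OF A(1,3)] by (simp add: comm_def)
    qed (use A x U in auto)
    then show "comm A R" using A U by (auto simp: comm_def R_def lin_mi)
  qed
qed

text \<open>The subspace is the kernel of \<open>R - S\<close> with \<open>R = |S|\<close>, the
  spectral subspace of \<open>S\<close> for the nonnegative half-line. If it is trivial, then
  \<open>R + S\<close> vanishes, because \<open>R^2 - S^2 = 0\<close> places the range of
  \<open>R + S\<close> in that kernel; so \<open>S = -R\<close> has a nonpositive form.\<close>

lemma positive_part_contraction:
  obtains U where "csub U" "\<And>x. x \<in> U \<Longrightarrow> 0 \<le> Re (ip (S x) x)"
    "\<And>A. lin A \<Longrightarrow> bdd A \<Longrightarrow> comm A S \<Longrightarrow> A ` U \<subseteq> U"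
    "U = {zr} \<Longrightarrow> \<forall>x\<in>V. Re (ip (S x) x) \<le> 0"
proof -
  obtain R where R: "lin R" "\<And>x. x \<in> V \<Longrightarrow> 0 \<le> Re (ip (R x) x)" "\<And>x. x \<in> V \<Longrightarrow> R (R x) = S (S x)"
    and RA: "\<And>A. lin A \<Longrightarrow> bdd A \<Longrightarrow> comm A S \<Longrightarrow> comm A R" and bR: "bdd R"
    by (rule absolute_value) (rule that)
  have bS: "bdd S" unfolding bdd_def using S1 by (intro exI[of _ 1]) auto
  have SR: "S (R x) = R (S x)" if "x \<in> V" for x
    using RA[OF S(1) bS] that by (simp add: comm_def)
  define U where "U = {x \<in> V. R x = S x}"
  show ?thesis
  proof
    show "csub U" unfolding csub_def
    proof (intro conjI ballI allI impI)
      fix X l assume X: "\<forall>n. X n \<in> U" and l: "l \<in> V" "vconv X l"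
      have "R l = S l"
      proof (rule vconv_unique)
        show "vconv (\<lambda>n. R (X n)) (R l)" by (rule vconv_bdd) (use X l R bR in \<open>auto simp: U_def\<close>)
        have "vconv (\<lambda>n. S (X n)) (S l)" by (rule vconv_bdd) (use X l S bS in \<open>auto simp: U_def\<close>)
        then show "vconv (\<lambda>n. R (X n)) (S l)" using X by (simp add: U_def)
      qed (use X l R S in \<open>auto simp: U_def\<close>)
      then show "l \<in> U" using l by (simp add: U_def)
    qed (use R S in \<open>auto simp: U_def lin_zr lin_ad lin_sm\<close>)
    show "0 \<le> Re (ip (S x) x)" if "x \<in> U" for x using that R(2)[of x] by (auto simp: U_def)
    show "A ` U \<subseteq> U" if "lin A" "bdd A" "comm A S" for A
      using that RA[OF that] unfolding U_def comm_def by auto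
    assume U0: "U = {zr}"
    show "\<forall>x\<in>V. Re (ip (S x) x) \<le> 0"
    proof
      fix x assume x: "x \<in> V"
      define y where "y = R x \<boxplus> S x"
      have y: "y \<in> V" using x R S by (simp add: y_def)
      have "R y = S y"
        using x R S SR by (intro vec_eqI) (auto simp: y_def lin_ad)
      then have "y = zr" using U0 y by (auto simp: U_def)
      then have "ip (R x) x + ip (S x) x = 0" using x R S ip_ad_left[of "R x" "S x" x] by (simp add: y_def)
      then have "Re (ip (R x) x) + Re (ip (S x) x) = 0" by (metis plus_complex.simps(1) zero_complex.simps(1))
      then show "Re (ip (S x) x) \<le> 0" using R(2)[OF x] by linarith
    qed
  qed
qed

end

lemma positive_part:
  assumes S: "lin S" "selfadj S" "bdd S"
  obtains U where "csub U" "\<And>x. x \<in> U \<Longrightarrow> 0 \<le> Re (ip (S x) x)"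
    "\<And>A. lin A \<Longrightarrow> bdd A \<Longrightarrow> comm A S \<Longrightarrow> A ` U \<subseteq> U"
    "U = {zr} \<Longrightarrow> \<forall>x\<in>V. Re (ip (S x) x) \<le> 0"
proof -
  obtain C where C: "C \<ge> 0" "\<And>x. x \<in> V \<Longrightarrow> nm (S x) \<le> C * nm x" using S(3) by (auto simp: bdd_def)
  \<comment> \<open>Scaling to a contraction changes neither the sign of the form nor the set of
    commuting operators; the summand 1 covers \<open>C = 0\<close>.\<close>
  define t where "t = 1 / (C + 1)"
  have t: "t > 0" "t * C \<le> 1" using C by (auto simp: t_def)
  define S' where "S' x = of_real t \<star> S x" for x
  have L1: "lin S'" unfolding lin_def S'_def
  proof (intro conjI ballI allI)
    fix x y assume "x \<in> V" "y \<in> V"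
    then show "of_real t \<star> S (x \<boxplus> y) = of_real t \<star> S x \<boxplus> of_real t \<star> S y"
      using S by (intro vec_eqI) (auto simp: lin_ad algebra_simps)
  next
    fix x c assume "x \<in> V"
    then show "of_real t \<star> S (c \<star> x) = c \<star> of_real t \<star> S x"
      using S by (intro vec_eqI) (auto simp: lin_sm algebra_simps)
  qed (use S in auto)
  have L2: "selfadj S'" using S by (auto simp: selfadj_def S'_def)
  have L3: "nm (S' x) \<le> nm x" if x: "x \<in> V" for x
  proof -
    have "nm (S' x) = t * nm (S x)" using x S t by (simp add: S'_def nm_sm)
    also have "\<dots> \<le> t * (C * nm x)" using C(2)[OF x] t by (intro mult_left_mono) auto
    also have "\<dots> \<le> nm x" using mult_right_mono[OF t(2) nm_nonneg[OF x]] by (simp add: mult.assoc)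
    finally show ?thesis .
  qed
  obtain U where U: "csub U" "\<And>x. x \<in> U \<Longrightarrow> 0 \<le> Re (ip (S' x) x)"
    "\<And>A. lin A \<Longrightarrow> bdd A \<Longrightarrow> comm A S' \<Longrightarrow> A ` U \<subseteq> U"
    "U = {zr} \<Longrightarrow> \<forall>x\<in>V. Re (ip (S' x) x) \<le> 0"
    by (rule positive_part_contraction[OF L1 L2 L3]) (assumption, rule that)
  have ip: "Re (ip (S' x) x) = t * Re (ip (S x) x)" if "x \<in> V" for x
    using that S by (simp add: S'_def)
  show ?thesis
  proof
    show "csub U" by fact
    then have UV: "U \<subseteq> V" by (simp add: csub_def)
    show "0 \<le> Re (ip (S x) x)" if "x \<in> U" for x
      using U(2)[OF that] ip[of x] UV that t by (auto simp: zero_le_mult_iff)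
    show "A ` U \<subseteq> U" if A: "lin A" "bdd A" "comm A S" for A
    proof (rule U(3)[OF A(1,2)])
      show "comm A S'" using A(3) lin_sm[OF A(1)] S(1) by (simp add: comm_def S'_def)
    qed
    show "\<forall>x\<in>V. Re (ip (S x) x) \<le> 0" if "U = {zr}"
      using U(4)[OF that] t by (simp add: ip mult_le_0_iff)
  qed
qed

lemma csub_subset: "csub U \<Longrightarrow> U \<subseteq> V" and csub_zr: "csub U \<Longrightarrow> zr \<in> U"
  by (simp_all add: csub_def)

lemma nm_pos: "x \<in> V \<Longrightarrow> x \<noteq> zr \<Longrightarrow> 0 < nm x"
  using nm_eq_0[of x] nm_nonneg[of x] by linarith

lemma lin_comb:
  assumes "lin A" "lin B" shows "lin (\<lambda>x. a \<star> A x \<boxplus> b \<star> B x)"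
  unfolding lin_def
proof (intro conjI ballI allI)
  fix x y assume "x \<in> V" "y \<in> V"
  then show "a \<star> A (x \<boxplus> y) \<boxplus> b \<star> B (x \<boxplus> y) = (a \<star> A x \<boxplus> b \<star> B x) \<boxplus> (a \<star> A y \<boxplus> b \<star> B y)"
    using assms by (intro vec_eqI) (auto simp: lin_ad algebra_simps)
next
  fix x c assume "x \<in> V"
  then show "a \<star> A (c \<star> x) \<boxplus> b \<star> B (c \<star> x) = c \<star> (a \<star> A x \<boxplus> b \<star> B x)"
    using assms by (intro vec_eqI) (auto simp: lin_sm algebra_simps)
qed (use assms in auto)

lemma bdd_comb:
  assumes "lin A" "lin B" "bdd A" "bdd B" shows "bdd (\<lambda>x. a \<star> A x \<boxplus> b \<star> B x)"
proof -
  obtain C D where C: "C \<ge> 0" "\<And>x. x \<in> V \<Longrightarrow> nm (A x) \<le> C * nm x"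
    and D: "D \<ge> 0" "\<And>x. x \<in> V \<Longrightarrow> nm (B x) \<le> D * nm x" using assms(3,4) by (auto simp: bdd_def)
  show ?thesis unfolding bdd_def
  proof (intro exI[of _ "cmod a * C + cmod b * D"] conjI ballI)
    fix x assume x: "x \<in> V"
    have "nm (a \<star> A x \<boxplus> b \<star> B x) \<le> nm (a \<star> A x) + nm (b \<star> B x)"
      by (rule nm_triangle) (use x assms in auto)
    also have "\<dots> = cmod a * nm (A x) + cmod b * nm (B x)" using x assms by (simp add: nm_sm)
    also have "\<dots> \<le> cmod a * (C * nm x) + cmod b * (D * nm x)"
      using C(2)[OF x] D(2)[OF x] by (intro add_mono mult_left_mono) auto
    finally show "nm (a \<star> A x \<boxplus> b \<star> B x) \<le> (cmod a * C + cmod b * D) * nm x"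
      by (simp add: algebra_simps)
  qed (use C D in simp)
qed

lemma comm_comb:
  assumes "lin A" "lin B" "lin D" "comm D A" "comm D B" shows "comm D (\<lambda>x. a \<star> A x \<boxplus> b \<star> B x)"
  using assms by (auto simp: comm_def lin_ad lin_sm)

lemma lin_id: "lin (\<lambda>x. x)" and bdd_id: "bdd (\<lambda>x. x)" and comm_id: "comm A (\<lambda>x. x)"
  by (auto simp: lin_def bdd_def comm_def intro!: exI[of _ 1])

lemma lin_comp: "lin A \<Longrightarrow> lin B \<Longrightarrow> lin (\<lambda>x. A (B x))"
  by (auto simp: lin_def)

lemma bdd_comp: assumes "lin B" "bdd A" "bdd B" shows "bdd (\<lambda>x. A (B x))"
proof -
  obtain C D where C: "C \<ge> 0" "\<And>x. x \<in> V \<Longrightarrow> nm (A x) \<le> C * nm x"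
    and D: "D \<ge> 0" "\<And>x. x \<in> V \<Longrightarrow> nm (B x) \<le> D * nm x" using assms(2,3) by (auto simp: bdd_def)
  show ?thesis unfolding bdd_def
  proof (intro exI[of _ "C * D"] conjI ballI)
    fix x assume x: "x \<in> V"
    have "nm (A (B x)) \<le> C * nm (B x)" using C x assms by auto
    also have "\<dots> \<le> C * (D * nm x)" using C D x by (intro mult_left_mono) auto
    finally show "nm (A (B x)) \<le> C * D * nm x" by simp
  qed (use C D in auto)
qed

lemma comm_comp: "lin A \<Longrightarrow> lin B \<Longrightarrow> lin D \<Longrightarrow> comm D A \<Longrightarrow> comm D B \<Longrightarrow> comm D (\<lambda>x. A (B x))"
  by (auto simp: comm_def)

lemma csub_restrict:
  assumes U: "csub U"
  shows "lin A \<Longrightarrow> A ` U \<subseteq> U \<Longrightarrow> hilbert.lin U ad sm A"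
    and "bdd A \<Longrightarrow> hilbert.bdd U ip A" and "selfadj A \<Longrightarrow> hilbert.selfadj U ip A"
    and "comm A B \<Longrightarrow> hilbert.comm U A B"
proof -
  interpret U: hilbert U zr ad sm ip by (rule hilbert_csub) fact
  have UV: "U \<subseteq> V" using U by (simp add: csub_subset)
  show "lin A \<Longrightarrow> A ` U \<subseteq> U \<Longrightarrow> U.lin A" using UV unfolding lin_def U.lin_def by blast
  show "bdd A \<Longrightarrow> U.bdd A" using UV unfolding bdd_def U.bdd_def by blast
  show "selfadj A \<Longrightarrow> U.selfadj A" using UV unfolding selfadj_def U.selfadj_def by blast
  show "comm A B \<Longrightarrow> U.comm A B" using UV unfolding comm_def U.comm_def by blast
qed

text \<open>With \<open>h\<close> the supremum of the form of \<open>X\<close> on unit vectors, the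
  positive part of \<open>X - (h - e)\<close> is nonzero, as otherwise \<open>h - e\<close> would
  bound the form. On it the form of \<open>X - (h - e)\<close> lies between 0 and \<open>e\<close>,
  so its norm is at most \<open>e\<close>. Invariance under all bounded operators commuting with
  \<open>X\<close> allows a second commuting operator to be restricted afterwards.\<close>

lemma near_top_of_spectrum:
  assumes X: "lin X" "selfadj X" "bdd X" and V: "V \<noteq> {zr}" and e: "e > 0"
  obtains a U where "csub U" "U \<noteq> {zr}" "\<And>A. lin A \<Longrightarrow> bdd A \<Longrightarrow> comm A X \<Longrightarrow> A ` U \<subseteq> U"
    "\<And>x. x \<in> U \<Longrightarrow> nm (X x \<boxminus> of_real a \<star> x) \<le> e * nm x"
proof -
  obtain C where C: "\<And>x. x \<in> V \<Longrightarrow> nm (X x) \<le> C * nm x" using X(3) by (auto simp: bdd_def)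
  define N where "N = {Re (ip (X x) x) | x. x \<in> V \<and> nm x = 1}"
  define h where "h = Sup N"
  obtain x0 where x0: "x0 \<in> V" "x0 \<noteq> zr" using V by auto
  have unit: "of_real (1 / nm x) \<star> x \<in> V \<and> nm (of_real (1 / nm x) \<star> x) = 1" if "x \<in> V" "x \<noteq> zr" for x
    using that nm_eq_0[of x] nm_nonneg[of x] by (auto simp: nm_sm norm_divide)
  have ne: "N \<noteq> {}" using unit[OF x0] unfolding N_def by blast
  have bd: "bdd_above N"
  proof (rule bdd_aboveI[of _ C])
    fix r assume "r \<in> N"
    then obtain x where x: "x \<in> V" "nm x = 1" "r = Re (ip (X x) x)" by (auto simp: N_def)
    then show "r \<le> C" using Re_ip_le[of "X x" x] C[of x] X by auto
  qed
  have le_h: "Re (ip (X x) x) \<le> h * (nm x)\<^sup>2" if x: "x \<in> V" for x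
  proof (cases "x = zr")
    case False
    define y where "y = of_real (1 / nm x) \<star> x"
    have "Re (ip (X y) y) \<le> h"
      unfolding h_def using unit[OF x False] bd by (intro cSup_upper) (auto simp: N_def y_def)
    moreover have "ip (X y) y = of_real (1 / (nm x)\<^sup>2) * ip (X x) x"
      using x X by (simp add: y_def lin_sm power2_eq_square)
    then have "Re (ip (X y) y) = Re (ip (X x) x) / (nm x)\<^sup>2" by (simp del: of_real_divide of_real_power)
    ultimately show ?thesis using False x nm_eq_0[of x] by (simp add: divide_le_eq)
  qed (use X in \<open>simp add: lin_zr\<close>)
  define S where "S x = 1 \<star> X x \<boxplus> (- of_real (h - e)) \<star> x" for x
  have S: "lin S" unfolding S_def by (rule lin_comb) (use X lin_id in auto)
  have sS: "selfadj S" using X unfolding selfadj_def S_def by auto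
  have bS: "bdd S" unfolding S_def by (rule bdd_comb) (use X lin_id bdd_id in auto)
  have ipS: "Re (ip (S x) x) = Re (ip (X x) x) - (h - e) * (nm x)\<^sup>2" if "x \<in> V" for x
    using that X by (simp add: S_def nm_sq algebra_simps)
  obtain U where U: "csub U" "\<And>x. x \<in> U \<Longrightarrow> 0 \<le> Re (ip (S x) x)"
    "\<And>A. lin A \<Longrightarrow> bdd A \<Longrightarrow> comm A S \<Longrightarrow> A ` U \<subseteq> U"
    "U = {zr} \<Longrightarrow> \<forall>x\<in>V. Re (ip (S x) x) \<le> 0"
    by (rule positive_part[OF S sS bS]) (rule that)
  have UV: "U \<subseteq> V" using U by (simp add: csub_subset)
  interpret U: hilbert U zr ad sm ip by (rule hilbert_csub) fact
  show ?thesis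
  proof
    show "csub U" by fact
    show "U \<noteq> {zr}"
    proof
      assume "U = {zr}"
      then have *: "\<forall>x\<in>V. Re (ip (S x) x) \<le> 0" by (rule U(4))
      have "h \<le> h - e" unfolding h_def
      proof (rule cSup_least[OF ne])
        fix r assume "r \<in> N"
        then obtain x where x: "x \<in> V" "nm x = 1" "r = Re (ip (X x) x)" by (auto simp: N_def)
        then show "r \<le> Sup N - e" using *[rule_format, OF x(1)] ipS[OF x(1)] by (simp add: h_def)
      qed
      then show False using e by simp
    qed
    show "A ` U \<subseteq> U" if A: "lin A" "bdd A" "comm A X" for A
      by (rule U(3)) (use A X lin_id comm_id in \<open>auto simp: S_def[abs_def] intro!: comm_comb\<close>)
    fix x assume x: "x \<in> U"
    have "nm (S x) \<le> e * nm x"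
    proof (rule U.pos_norm[OF _ _ e _ _ x])
      have "S ` U \<subseteq> U" by (rule U(3)) (use S bS in \<open>auto simp: comm_def\<close>)
      then show "U.lin S" by (rule csub_restrict(1)[OF U(1) S])
      show "U.selfadj S" by (rule csub_restrict(3)[OF U(1) sS])
      fix x assume "x \<in> U"
      then show "0 \<le> Re (ip (S x) x)" "Re (ip (S x) x) \<le> e * (nm x)\<^sup>2"
        using U(2) ipS[of x] le_h[of x] UV by (auto simp: algebra_simps)
    qed
    moreover have "S x = X x \<boxplus> (-1) \<star> of_real (h - e) \<star> x"
      using subsetD[OF UV x] X by (intro vec_eqI) (auto simp: S_def algebra_simps)
    ultimately show "nm (X x \<boxplus> (-1) \<star> of_real (h - e) \<star> x) \<le> e * nm x" by simp
  qed
qed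

end

section \<open>Normal operators and eigenvectors\<close>

locale normal_hilbert = hilbert +
  fixes T Ts :: "'a \<Rightarrow> 'a"
  assumes lin_T [simp]: "lin T" and lin_Ts [simp]: "lin Ts" and bdd_T: "bdd T"
    and adj: "x \<in> V \<Longrightarrow> y \<in> V \<Longrightarrow> ip (T x) y = ip x (Ts y)"
    and comm_T_Ts: "comm T Ts"
begin

lemma adj': "x \<in> V \<Longrightarrow> y \<in> V \<Longrightarrow> ip (Ts x) y = ip x (T y)"
  by (metis adj ip_commute lin_T lin_Ts linD)

text \<open>\<open>T - c\<close> is normal with adjoint \<open>Ts - cnj c\<close>, and a normal
  operator and its adjoint have the same norm at each vector. Besides the boundedness of
  \<open>Ts\<close>, this yields exact and approximate eigenvalue equations for the adjoint.\<close>

lemma nm_T_minus: "x \<in> V \<Longrightarrow> nm (Ts x \<boxminus> cnj c \<star> x) = nm (T x \<boxminus> c \<star> x)"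
proof -
  assume x: "x \<in> V"
  have "ip (T (Ts x)) x = ip (Ts (T x)) x" using comm_T_Ts x by (simp add: comm_def)
  then have "ip (Ts x) (Ts x) = ip (T x) (T x)" using x by (simp add: adj adj')
  then have "ip (Ts x \<boxminus> cnj c \<star> x) (Ts x \<boxminus> cnj c \<star> x) = ip (T x \<boxminus> c \<star> x) (T x \<boxminus> c \<star> x)"
    using x by (simp add: adj adj' algebra_simps)
  then show ?thesis by (simp add: nm_def)
qed

lemma nm_Ts: "x \<in> V \<Longrightarrow> nm (Ts x) = nm (T x)"
proof -
  assume x: "x \<in> V"
  have "Ts x \<boxminus> cnj 0 \<star> x = Ts x" "T x \<boxminus> 0 \<star> x = T x" by (rule vec_eqI; use x in simp)+
  then show ?thesis using nm_T_minus[OF x, of 0] by simp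
qed

lemma bdd_Ts: "bdd Ts"
  using bdd_T by (simp add: bdd_def nm_Ts)

lemma normal_csub:
  assumes "csub U" "T ` U \<subseteq> U" "Ts ` U \<subseteq> U"
  shows "normal_hilbert U zr ad sm ip T Ts"
proof -
  interpret U: hilbert U zr ad sm ip by (rule hilbert_csub) fact
  have UV: "U \<subseteq> V" using assms by (simp add: csub_def)
  show ?thesis
  proof
    show "U.lin T" "U.lin Ts" using csub_restrict(1)[OF assms(1)] assms(2,3) by simp_all
    show "U.bdd T" by (rule csub_restrict(2)[OF assms(1) bdd_T])
    show "U.comm T Ts" by (rule csub_restrict(4)[OF assms(1) comm_T_Ts])
    show "ip (T x) y = ip x (Ts y)" if "x \<in> U" "y \<in> U" for x y
      using that UV by (intro adj) auto
  qed
qed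

text \<open>The approximate point spectrum is preferred to the spectrum because it can only shrink
  when the space is cut down: a witness in a subspace is a witness in the whole space.\<close>

definition apspec :: "complex set" where
  "apspec = {c. \<forall>e>0. \<exists>x\<in>V. x \<noteq> zr \<and> nm (T x \<boxminus> c \<star> x) \<le> e * nm x}"

lemma not_apspecD:
  assumes "c \<notin> apspec"
  obtains e where "e > 0" "\<And>x. x \<in> V \<Longrightarrow> e * nm x \<le> nm (T x \<boxminus> c \<star> x)"
proof -
  obtain e where e: "e > 0" "\<And>x. x \<in> V \<Longrightarrow> x \<noteq> zr \<Longrightarrow> \<not> nm (T x \<boxminus> c \<star> x) \<le> e * nm x"
    using assms unfolding apspec_def by blast
  then have "e * nm x \<le> nm (T x \<boxminus> c \<star> x)" if "x \<in> V" for x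
    using e(2)[OF that] that by (cases "x = zr") (auto simp: not_le intro: less_imp_le)
  then show ?thesis using e(1) that by blast
qed

lemma nm_shift:
  assumes "x \<in> V" shows "nm (T x \<boxminus> c \<star> x) \<le> nm (T x \<boxminus> d \<star> x) + cmod (d - c) * nm x"
proof -
  have "T x \<boxminus> c \<star> x = (T x \<boxminus> d \<star> x) \<boxplus> (d - c) \<star> x"
    using assms by (intro vec_eqI) (auto simp: algebra_simps)
  then show ?thesis
    using nm_triangle[of "T x \<boxminus> d \<star> x" "(d - c) \<star> x"] assms by (simp add: nm_sm)
qed

lemma closed_apspec: "closed apspec"
  unfolding closed_def open_dist
proof safe
  fix c assume "c \<notin> apspec"
  then obtain e where e: "e > 0" "\<And>x. x \<in> V \<Longrightarrow> e * nm x \<le> nm (T x \<boxminus> c \<star> x)"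
    by (rule not_apspecD) (rule that)
  show "\<exists>r>0. \<forall>d. dist d c < r \<longrightarrow> d \<in> - apspec"
  \<comment> \<open>Moving \<open>c\<close> by less than \<open>e / 3\<close> leaves at least
    \<open>2 e / 3\<close> of the gap \<open>e\<close>, still above the \<open>e / 3\<close> tested
    at \<open>d\<close>.\<close>
  proof (intro exI[of _ "e/3"] conjI allI impI)
    fix d assume d: "dist d c < e / 3"
    have "\<not> nm (T x \<boxminus> d \<star> x) \<le> (e/3) * nm x" if x: "x \<in> V" "x \<noteq> zr" for x
    proof
      assume "nm (T x \<boxminus> d \<star> x) \<le> (e/3) * nm x"
      then have "e * nm x \<le> (e/3) * nm x + cmod (d - c) * nm x"
        using nm_shift[OF x(1), of c d] e(2)[OF x(1)] by linarith
      also have "\<dots> \<le> (e/3) * nm x + (e/3) * nm x"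
        using d x by (intro add_left_mono mult_right_mono) (auto simp: dist_norm)
      finally have "e / 3 * nm x \<le> 0" by linarith
      then show False using e(1) nm_pos[OF x] by (simp add: mult_le_0_iff)
    qed
    then show "d \<in> - apspec" using e(1) unfolding apspec_def by (auto intro!: exI[of _ "e/3"])
  qed (use e in simp)
qed

lemma apspec_bound:
  obtains M where "\<And>c x e. x \<in> V \<Longrightarrow> x \<noteq> zr \<Longrightarrow> nm (T x \<boxminus> c \<star> x) \<le> e * nm x \<Longrightarrow> cmod c \<le> M + e"
proof -
  obtain C where C: "\<And>x. x \<in> V \<Longrightarrow> nm (T x) \<le> C * nm x" using bdd_T by (auto simp: bdd_def)
  have "cmod c \<le> C + e" if x: "x \<in> V" "x \<noteq> zr" and le: "nm (T x \<boxminus> c \<star> x) \<le> e * nm x" for c x e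
  proof -
    have pos: "nm x > 0" using x by (simp add: nm_pos)
    have "cmod c * nm x = nm (c \<star> x)" using x by (simp add: nm_sm)
    also have "\<dots> \<le> nm (T x) + nm (T x \<boxminus> c \<star> x)"
      using nm_diff_le[of "T x" "c \<star> x"] nm_diff_le[of "c \<star> x" "T x"] nm_mi_commute[of "c \<star> x" "T x"] x by simp
    also have "\<dots> \<le> (C + e) * nm x" using C[OF x(1)] le by (simp add: algebra_simps)
    finally show ?thesis using pos by simp
  qed
  then show ?thesis using that by blast
qed

text \<open>\<open>T = X + i Y\<close> with commuting self-adjoint parts. A subspace of approximate
  eigenvectors of \<open>X\<close> is invariant under \<open>Y\<close>, and inside it approximate
  eigenvectors of \<open>Y\<close> are found; they are approximate eigenvectors of \<open>T\<close>
  for \<open>a + i b\<close>, with one error \<open>e\<close> from each part. The values stay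
  bounded as the errors tend to 0, and the limit of a convergent subsequence lies in
  \<open>apspec\<close>.\<close>

lemma apspec_nonempty:
  assumes V: "V \<noteq> {zr}" shows "apspec \<noteq> {}"
proof -
  define X where "X x = (1/2) \<star> T x \<boxplus> (1/2) \<star> Ts x" for x
  define Y where "Y x = (-\<i>/2) \<star> T x \<boxplus> (\<i>/2) \<star> Ts x" for x
  have lin: "lin X" "lin Y" unfolding X_def Y_def by (rule lin_comb; simp)+
  have bd: "bdd X" "bdd Y" unfolding X_def Y_def by (rule bdd_comb; use bdd_T bdd_Ts in simp)+
  have sa: "selfadj X" "selfadj Y" unfolding selfadj_def X_def Y_def by (auto simp: adj adj')
  have "comm T X" "comm Ts X" unfolding X_def
    by (rule comm_comb; use comm_T_Ts in \<open>simp add: comm_def\<close>)+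
  then have "comm X T" "comm X Ts" by (auto simp: comm_def)
  then have "comm X Y" unfolding Y_def by (intro comm_comb lin) auto
  then have cm: "comm Y X" by (auto simp: comm_def)
  have ex: "\<exists>c x. x \<in> V \<and> x \<noteq> zr \<and> nm (T x \<boxminus> c \<star> x) \<le> 2 * e * nm x" if e: "e > 0" for e :: real
  proof -
    obtain a U where U: "csub U" "U \<noteq> {zr}" "\<And>A. lin A \<Longrightarrow> bdd A \<Longrightarrow> comm A X \<Longrightarrow> A ` U \<subseteq> U"
      "\<And>x. x \<in> U \<Longrightarrow> nm (X x \<boxminus> of_real a \<star> x) \<le> e * nm x"
      by (rule near_top_of_spectrum[OF lin(1) sa(1) bd(1) V e]) (rule that)
    interpret U: hilbert U zr ad sm ip by (rule hilbert_csub) fact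
    have "U.lin Y" by (rule csub_restrict(1)[OF U(1) lin(2) U(3)]) (use lin bd cm in auto)
    then obtain b W where W: "U.csub W" "W \<noteq> {zr}"
      "\<And>x. x \<in> W \<Longrightarrow> nm (Y x \<boxplus> (-1) \<star> of_real b \<star> x) \<le> e * nm x"
      by (rule U.near_top_of_spectrum[OF _ csub_restrict(3)[OF U(1) sa(2)]
            csub_restrict(2)[OF U(1) bd(2)] U(2) e]) (rule that)
    obtain x where x: "x \<in> W" "x \<noteq> zr" using W(2) U.csub_zr[OF W(1)] by blast
    have xU: "x \<in> U" "x \<in> V" using x(1) U.csub_subset[OF W(1)] csub_subset[OF U(1)] by blast+
    have "T x \<boxplus> (-1) \<star> Complex a b \<star> x = (X x \<boxplus> (-1) \<star> of_real a \<star> x) \<boxplus> \<i> \<star> (Y x \<boxplus> (-1) \<star> of_real b \<star> x)"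
    proof (rule vec_eqI)
      fix z assume z: "z \<in> V"
      show "ip (T x \<boxplus> (-1) \<star> Complex a b \<star> x) z = ip ((X x \<boxplus> (-1) \<star> of_real a \<star> x) \<boxplus> \<i> \<star> (Y x \<boxplus> (-1) \<star> of_real b \<star> x)) z"
        using xU z by (simp add: X_def Y_def Complex_eq algebra_simps)
    qed (use xU lin in auto)
    then have "nm (T x \<boxplus> (-1) \<star> Complex a b \<star> x) \<le> nm (X x \<boxplus> (-1) \<star> of_real a \<star> x) + nm (\<i> \<star> (Y x \<boxplus> (-1) \<star> of_real b \<star> x))"
      using nm_triangle[of "X x \<boxplus> (-1) \<star> of_real a \<star> x" "\<i> \<star> (Y x \<boxplus> (-1) \<star> of_real b \<star> x)"] xU lin by simp
    also have "\<dots> \<le> 2 * e * nm x"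
      using U(4)[OF xU(1)] W(3)[OF x(1)] xU lin by (simp add: nm_sm)
    finally show ?thesis using xU x by blast
  qed
  have "\<exists>c. \<exists>x\<in>V. x \<noteq> zr \<and> nm (T x \<boxplus> (-1) \<star> c \<star> x) \<le> 1 / (real n + 1) * nm x" for n
  proof -
    have eq: "2 * (1 / (2 * (real n + 1))) = 1 / (real n + 1)" by (simp add: field_simps)
    show ?thesis using ex[of "1 / (2 * (real n + 1))", unfolded eq] by auto
  qed
  then obtain c where c: "\<And>n. \<exists>x\<in>V. x \<noteq> zr \<and> nm (T x \<boxplus> (-1) \<star> c n \<star> x) \<le> 1 / (real n + 1) * nm x"
    by metis
  obtain M where M: "\<And>c x e. x \<in> V \<Longrightarrow> x \<noteq> zr \<Longrightarrow> nm (T x \<boxplus> (-1) \<star> c \<star> x) \<le> e * nm x \<Longrightarrow> cmod c \<le> M + e"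
    by (rule apspec_bound) (rule that)
  have "cmod (c n) \<le> M + 1" for n
  proof -
    have "cmod (c n) \<le> M + 1 / (real n + 1)" using c[of n] M by blast
    also have "\<dots> \<le> M + 1" by simp
    finally show ?thesis .
  qed
  then have "bounded (range c)" by (auto simp: bounded_iff)
  then obtain l r where r: "strict_mono r" "(c \<circ> r) \<longlonglongrightarrow> l" using bounded_imp_convergent_subsequence by blast
  have "l \<in> apspec" unfolding apspec_def
  proof (intro CollectI allI impI)
    fix e :: real assume e: "e > 0"
    obtain N where N: "\<And>n. n \<ge> N \<Longrightarrow> dist ((c \<circ> r) n) l < e / 2"
      using r(2) e unfolding lim_sequentially by (meson half_gt_zero)
    obtain n0 :: nat where n0: "1 / (real n0 + 1) < e / 2" using e by (metis half_gt_zero nat_approx_posE of_nat_Suc add.commute)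
    define n where "n = max N n0"
    have "n0 \<le> r n" using seq_suble[OF r(1), of n] by (simp add: n_def)
    then have small: "1 / (real (r n) + 1) \<le> e / 2"
      using n0 by (intro order_trans[OF _ less_imp_le[OF n0]] divide_left_mono) auto
    obtain x where x: "x \<in> V" "x \<noteq> zr" "nm (T x \<boxplus> (-1) \<star> c (r n) \<star> x) \<le> 1 / (real (r n) + 1) * nm x"
      using c by blast
    have "nm (T x \<boxplus> (-1) \<star> l \<star> x) \<le> nm (T x \<boxplus> (-1) \<star> c (r n) \<star> x) + cmod (c (r n) - l) * nm x"
      by (rule nm_shift) fact
    also have "\<dots> \<le> e / 2 * nm x + e / 2 * nm x"
    proof (rule add_mono)
      show "nm (T x \<boxplus> (-1) \<star> c (r n) \<star> x) \<le> e / 2 * nm x"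
        using x(3) mult_right_mono[OF small nm_nonneg[OF x(1)]] by linarith
      show "cmod (c (r n) - l) * nm x \<le> e / 2 * nm x"
        using N[of n] x by (intro mult_right_mono) (auto simp: n_def dist_norm)
    qed
    finally show "\<exists>x\<in>V. x \<noteq> zr \<and> nm (T x \<boxplus> (-1) \<star> l \<star> x) \<le> e * nm x" using x by auto
  qed
  then show ?thesis by blast
qed

text \<open>\<open>Q s\<close> is \<open>s\<close> times the difference of \<open>Ds D\<close> and
  \<open>r^2\<close>, where \<open>D = T - c\<close>. Its form compares \<open>|T x - c x|\<close>
  with \<open>r |x|\<close>, so the positive part for \<open>s = -1\<close> is the spectral subspace
  of the closed disc and for \<open>s = 1\<close> that of its outside, boundary included.\<close>

lemma spectral_disc_split:
  assumes r: "r > 0"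
  shows "\<exists>U. csub U \<and> T ` U \<subseteq> U \<and> Ts ` U \<subseteq> U \<and> (\<forall>x\<in>U. nm (T x \<boxminus> c \<star> x) \<le> r * nm x) \<and>
      (U = {zr} \<longrightarrow> (\<forall>x\<in>V. r * nm x \<le> nm (T x \<boxminus> c \<star> x)))" (is ?inner)
    and "\<exists>U. csub U \<and> T ` U \<subseteq> U \<and> Ts ` U \<subseteq> U \<and> (\<forall>x\<in>U. r * nm x \<le> nm (T x \<boxminus> c \<star> x)) \<and>
      (U = {zr} \<longrightarrow> (\<forall>x\<in>V. nm (T x \<boxminus> c \<star> x) \<le> r * nm x))" (is ?outer)
proof -
  define D where "D x = 1 \<star> T x \<boxplus> (-c) \<star> x" for x
  define Ds where "Ds x = 1 \<star> Ts x \<boxplus> (-cnj c) \<star> x" for x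
  have lin: "lin D" "lin Ds" unfolding D_def Ds_def by (rule lin_comb; simp add: lin_id)+
  have bd: "bdd D" "bdd Ds" unfolding D_def Ds_def
    by (rule bdd_comb; simp add: lin_id bdd_id bdd_T bdd_Ts)+
  define Q where "Q s x = of_real s \<star> Ds (D x) \<boxplus> of_real (- s * r\<^sup>2) \<star> x" for s x
  have Q: "lin (Q s)" "bdd (Q s)" for s unfolding Q_def
    by (rule lin_comb bdd_comb; use lin bd in \<open>simp add: lin_id bdd_id lin_comp bdd_comp\<close>)+
  have adjD: "ip (Ds x) y = ip x (D y)" "ip (D x) y = ip x (Ds y)" if "x \<in> V" "y \<in> V" for x y
    using that by (auto simp: D_def Ds_def adj adj')
  have saQ: "selfadj (Q s)" for s
    using lin adjD unfolding selfadj_def Q_def by auto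
  have D_eq: "D x = T x \<boxminus> c \<star> x" if "x \<in> V" for x
    using that by (intro vec_eqI) (auto simp: D_def)
  have ipQ: "Re (ip (Q s x) x) = s * ((nm (T x \<boxminus> c \<star> x))\<^sup>2 - (r * nm x)\<^sup>2)" if x: "x \<in> V" for s x
  proof -
    have "ip (Q s x) x = of_real s * ip (D x) (D x) - of_real (s * r\<^sup>2) * ip x x"
      using x lin adjD by (simp add: Q_def)
    also have "\<dots> = of_real (s * ((nm (D x))\<^sup>2 - (r * nm x)\<^sup>2))"
      using x lin by (simp add: ip_self algebra_simps power2_eq_square)
    finally show ?thesis using D_eq[OF x] by (metis Re_complex_of_real)
  qed
  have cmT: "comm T (Q s)" "comm Ts (Q s)" for s
  proof -
    have "comm A (Q s)" if A: "lin A" "comm A T" "comm A Ts" for A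
    proof -
      have "comm A D" "comm A Ds" unfolding D_def Ds_def
        by (rule comm_comb; use A in \<open>simp add: lin_id comm_id\<close>)+
      then have "comm A (\<lambda>x. Ds (D x))" using comm_comp[of Ds D A] lin A by simp
      then show ?thesis unfolding Q_def
        using comm_comb[of "\<lambda>x. Ds (D x)" "\<lambda>x. x" A] lin A by (simp add: lin_id comm_id lin_comp)
    qed
    moreover have "comm T T" "comm Ts Ts" by (simp_all add: comm_def)
    moreover have "comm Ts T" using comm_T_Ts unfolding comm_def by metis
    ultimately show "comm T (Q s)" "comm Ts (Q s)" using comm_T_Ts by simp_all
  qed
  have sq: "nm (T x \<boxminus> c \<star> x) \<le> r * nm x \<longleftrightarrow> (nm (T x \<boxminus> c \<star> x))\<^sup>2 \<le> (r * nm x)\<^sup>2"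
    "r * nm x \<le> nm (T x \<boxminus> c \<star> x) \<longleftrightarrow> (r * nm x)\<^sup>2 \<le> (nm (T x \<boxminus> c \<star> x))\<^sup>2" if "x \<in> V" for x
    by (subst power_mono_iff; use that r in simp)+
  obtain U where U: "csub U" "\<And>x. x \<in> U \<Longrightarrow> 0 \<le> Re (ip (Q (-1) x) x)"
    "\<And>A. lin A \<Longrightarrow> bdd A \<Longrightarrow> comm A (Q (-1)) \<Longrightarrow> A ` U \<subseteq> U"
    "U = {zr} \<Longrightarrow> \<forall>x\<in>V. Re (ip (Q (-1) x) x) \<le> 0"
    by (rule positive_part[OF Q(1) saQ Q(2)]) (rule that)
  obtain W where W: "csub W" "\<And>x. x \<in> W \<Longrightarrow> 0 \<le> Re (ip (Q 1 x) x)"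
    "\<And>A. lin A \<Longrightarrow> bdd A \<Longrightarrow> comm A (Q 1) \<Longrightarrow> A ` W \<subseteq> W"
    "W = {zr} \<Longrightarrow> \<forall>x\<in>V. Re (ip (Q 1 x) x) \<le> 0"
    by (rule positive_part[OF Q(1) saQ Q(2)]) (rule that)
  have UV: "U \<subseteq> V" "W \<subseteq> V" using U(1) W(1) by (simp_all add: csub_subset)
  have cmp: "nm (T x \<boxminus> c \<star> x) \<le> r * nm x \<longleftrightarrow> 0 \<le> Re (ip (Q (-1) x) x)"
    "nm (T x \<boxminus> c \<star> x) \<le> r * nm x \<longleftrightarrow> Re (ip (Q 1 x) x) \<le> 0"
    "r * nm x \<le> nm (T x \<boxminus> c \<star> x) \<longleftrightarrow> 0 \<le> Re (ip (Q 1 x) x)"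
    "r * nm x \<le> nm (T x \<boxminus> c \<star> x) \<longleftrightarrow> Re (ip (Q (-1) x) x) \<le> 0" if "x \<in> V" for x
    unfolding sq[OF that] ipQ[OF that] by auto
  show ?inner
    by (rule exI[of _ U], intro conjI U(1,3))
      (use U(2,4) UV cmp cmT bdd_T bdd_Ts in \<open>simp_all add: subset_iff\<close>)
  show ?outer
    by (rule exI[of _ W], intro conjI W(1,3))
      (use W(2,4) UV cmp cmT bdd_T bdd_Ts in \<open>simp_all add: subset_iff\<close>)
qed

end

text \<open>A nonempty perfect subset of a completely metrizable space has at least the cardinality
  of the reals, so a countable closed set differs from its derived set; a point outside the latter
  is isolated. Halving the radius passes from an open to a closed ball.\<close>

lemma countable_compact_isolated:
  fixes K :: "complex set"
  assumes "closed K" "countable K" "K \<noteq> {}"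
  obtains c r where "c \<in> K" "r > 0" "K \<inter> cball c r = {c}"
proof -
  have "\<not> (UNIV :: real set) \<lesssim> K"
    using assms(2) countable_lepoll uncountable_UNIV_real by blast
  then have "euclidean derived_set_of K \<noteq> K"
    using lepoll_perfect_set[of "euclidean :: complex topology" K] assms(3)
      completely_metrizable_space_euclidean by blast
  moreover have "euclidean derived_set_of K \<subseteq> K"
    using assms(1) by (metis closed_closedin closedin_contains_derived_set)
  ultimately obtain c where "c \<in> K" "c \<notin> euclidean derived_set_of K" by blast
  then have c: "c \<in> K" "\<not> c islimpt K"
    unfolding in_derived_set_of islimpt_def by (auto; metis)+
  then obtain e where e: "e > 0" "\<And>y. y \<in> K \<Longrightarrow> dist y c < e \<Longrightarrow> y = c"
    by (auto simp: islimpt_approachable)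
  then have "K \<inter> cball c (e/2) = {c}" using c by (auto simp: dist_commute)
  then show ?thesis using that[of c "e/2"] c e by simp
qed

text \<open>\<open>U\<close> is the spectral subspace of a closed disc that contains no point of
  \<open>apspec\<close> other than its centre \<open>c\<close>; it is nonzero because
  \<open>c\<close> is an approximate eigenvalue. For every \<open>s > 0\<close> the part of
  \<open>U\<close> where \<open>T - c\<close> is at least \<open>s\<close> has its approximate
  spectrum in the annulus from \<open>s\<close> to \<open>r\<close> around \<open>c\<close>, so that
  spectrum is empty and the part is trivial. Hence \<open>T - c\<close> is smaller than every
  \<open>s\<close> on \<open>U\<close>, that is, 0.\<close>

theorem (in normal_hilbert) eigenvector_exists:
  assumes V: "V \<noteq> {zr}" and K: "countable apspec"
  obtains x c where "x \<in> V" "x \<noteq> zr" "T x = c \<star> x"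
proof -
  obtain c r where c: "c \<in> apspec" and r: "r > 0" and iso: "apspec \<inter> cball c r = {c}"
    using countable_compact_isolated[OF closed_apspec K apspec_nonempty[OF V]] by metis
  obtain U where U: "csub U" "T ` U \<subseteq> U" "Ts ` U \<subseteq> U"
    and small: "\<And>x. x \<in> U \<Longrightarrow> nm (T x \<boxminus> c \<star> x) \<le> r * nm x"
    and U0: "U = {zr} \<Longrightarrow> \<forall>x\<in>V. r * nm x \<le> nm (T x \<boxminus> c \<star> x)"
    using spectral_disc_split(1)[OF r, of c] by blast
  have UV: "U \<subseteq> V" "zr \<in> U" using U(1) by (simp_all add: csub_subset csub_zr)
  interpret U: normal_hilbert U zr ad sm ip T Ts by (rule normal_csub) fact+
  have "U \<noteq> {zr}"
  proof
    assume "U = {zr}"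
    then have far: "\<forall>x\<in>V. r * nm x \<le> nm (T x \<boxplus> (-1) \<star> c \<star> x)" by (rule U0)
    have "r / 2 > 0" using r by simp
    then obtain x where x: "x \<in> V" "x \<noteq> zr" "nm (T x \<boxplus> (-1) \<star> c \<star> x) \<le> r / 2 * nm x"
      using c unfolding apspec_def by blast
    then have "r * nm x \<le> r / 2 * nm x" using far by fastforce
    then show False using r nm_pos[OF x(1,2)] by (simp add: mult_le_0_iff)
  qed
  then obtain x where x: "x \<in> U" "x \<noteq> zr" using UV by blast
  have xV: "x \<in> V" using x UV by auto
  have "nm (T x \<boxplus> (-1) \<star> c \<star> x) \<le> s * nm x" if s: "s > 0" for s
  proof -
    obtain W where W: "U.csub W" "T ` W \<subseteq> W" "Ts ` W \<subseteq> W"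
      and far: "\<And>x. x \<in> W \<Longrightarrow> s * nm x \<le> nm (T x \<boxplus> (-1) \<star> c \<star> x)"
      and W0: "W = {zr} \<Longrightarrow> \<forall>x\<in>U. nm (T x \<boxplus> (-1) \<star> c \<star> x) \<le> s * nm x"
      using U.spectral_disc_split(2)[OF s, of c] by blast
    interpret W: normal_hilbert W zr ad sm ip T Ts by (rule U.normal_csub) fact+
    have WU: "W \<subseteq> U" "zr \<in> W" using W(1) by (simp_all add: U.csub_subset U.csub_zr)
    have "W = {zr}"
    proof (rule ccontr)
      assume "W \<noteq> {zr}"
      then obtain l where l: "l \<in> W.apspec" using W.apspec_nonempty by blast
      have "l \<in> apspec" using l WU UV unfolding apspec_def W.apspec_def by blast
      have bounds: "s \<le> cmod (l - c) + e \<and> cmod (l - c) \<le> r + e" if "e > 0" for e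
      proof -
        obtain y where y: "y \<in> W" "y \<noteq> zr" "nm (T y \<boxplus> (-1) \<star> l \<star> y) \<le> e * nm y"
          using l \<open>e > 0\<close> unfolding W.apspec_def by blast
        have yV: "y \<in> V" and yU: "y \<in> U" using y WU UV by auto
        have pos: "nm y > 0" using yV y by (simp add: nm_pos)
        have "s * nm y \<le> (cmod (l - c) + e) * nm y"
          using far[OF y(1)] nm_shift[OF yV, of c l] y(3) by (simp add: algebra_simps)
        moreover have "cmod (l - c) * nm y \<le> (r + e) * nm y"
        proof -
          have "cmod (l - c) * nm y = nm ((T y \<boxplus> (-1) \<star> c \<star> y) \<boxplus> (-1) \<star> (T y \<boxplus> (-1) \<star> l \<star> y))"
          proof -
            have "(T y \<boxplus> (-1) \<star> c \<star> y) \<boxplus> (-1) \<star> (T y \<boxplus> (-1) \<star> l \<star> y) = (l - c) \<star> y"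
              using yV by (intro vec_eqI) (auto simp: algebra_simps)
            then show ?thesis using yV by (simp add: nm_sm)
          qed
          also have "\<dots> \<le> nm (T y \<boxplus> (-1) \<star> c \<star> y) + nm (T y \<boxplus> (-1) \<star> l \<star> y)"
            by (rule nm_triangle_mi) (use yV in auto)
          also have "\<dots> \<le> (r + e) * nm y" using small[OF yU] y(3) by (simp add: algebra_simps)
          finally show ?thesis .
        qed
        ultimately show ?thesis using pos by simp
      qed
      have "s \<le> cmod (l - c)" "cmod (l - c) \<le> r"
        using bounds by (auto intro: field_le_epsilon)
      then have "l \<in> apspec \<inter> cball c r" "l \<noteq> c"
        using \<open>l \<in> apspec\<close> s by (auto simp: dist_norm norm_minus_commute)
      then show False using iso by auto
    qed
    then show ?thesis using W0 x by blast
  qed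
  then have "nm (T x \<boxplus> (-1) \<star> c \<star> x) \<le> 0 + e" if "e > 0" for e
  proof -
    have pos: "nm x > 0" using xV x by (simp add: nm_pos)
    then have "e / nm x > 0" using that by simp
    from \<open>\<And>s. s > 0 \<Longrightarrow> nm (T x \<boxplus> (-1) \<star> c \<star> x) \<le> s * nm x\<close>[OF this] show ?thesis using pos by simp
  qed
  then have "nm (T x \<boxplus> (-1) \<star> c \<star> x) \<le> 0" by (rule field_le_epsilon)
  then have "T x = c \<star> x" using mi_eq_zr[of "T x" "c \<star> x"] nm_nonneg[of "T x \<boxplus> (-1) \<star> c \<star> x"] xV
    by (metis antisym lin_T linD sm_closed ad_closed)
  then show ?thesis using that xV x by blast
qed

text \<open>By equality of norms, \<open>T - c\<close> and its adjoint vanish together. This keeps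
  the orthogonal complement of eigenvectors invariant under \<open>T\<close>; for \<open>Ts\<close>
  the eigenvalue equation itself suffices.\<close>

lemma (in normal_hilbert) eigenvector_adjoint:
  assumes "x \<in> V" "T x = c \<star> x" shows "Ts x = cnj c \<star> x"
proof -
  have "nm (T x \<boxminus> c \<star> x) = 0" using mi_eq_zr[of "T x" "c \<star> x"] assms by simp
  then have "nm (Ts x \<boxminus> cnj c \<star> x) = 0" using nm_T_minus[OF assms(1), of c] by simp
  then show ?thesis using mi_eq_zr[of "Ts x" "cnj c \<star> x"] assms by simp
qed

definition (in hilbert) orthonormal :: "'v set \<Rightarrow> bool" where
  "orthonormal E \<longleftrightarrow> E \<subseteq> V \<and> (\<forall>x\<in>E. \<forall>y\<in>E. ip x y = (if x = y then 1 else 0))"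

lemma (in hilbert) csub_orthogonal:
  assumes "E \<subseteq> V" shows "csub {v \<in> V. \<forall>e\<in>E. ip v e = 0}"
  unfolding csub_def
proof (intro conjI ballI allI impI)
  fix X l assume X: "\<forall>n. X n \<in> {v \<in> V. \<forall>e\<in>E. ip v e = 0}" and l: "l \<in> V" "vconv X l"
  have "ip l e = 0" if e: "e \<in> E" for e
  proof (rule LIMSEQ_unique)
    show "(\<lambda>n. ip (X n) e) \<longlonglongrightarrow> ip l e"
      by (rule vconv_ip) (use X l e assms in auto)
    show "(\<lambda>n. ip (X n) e) \<longlonglongrightarrow> 0" using X e by simp
  qed
  then show "l \<in> {v \<in> V. \<forall>e\<in>E. ip v e = 0}" using l by blast
qed (use assms in \<open>auto simp: subset_iff\<close>)

text \<open>Maximality makes the orthogonal complement trivial: it is invariant under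
  \<open>T\<close> and \<open>Ts\<close>, its approximate spectrum is still countable, and a nonzero
  complement would contain an eigenvector whose normalisation could be adjoined.\<close>

theorem (in normal_hilbert) eigenbasis_exists:
  assumes K: "countable apspec"
  obtains E where "orthonormal E" "\<And>e. e \<in> E \<Longrightarrow> \<exists>c. T e = c \<star> e"
    "\<forall>v\<in>V. (\<forall>e\<in>E. ip v e = 0) \<longrightarrow> v = zr"
proof -
  define A where "A = {E. orthonormal E \<and> (\<forall>e\<in>E. \<exists>c. T e = c \<star> e)}"
  have "\<exists>E\<in>A. \<forall>X\<in>A. E \<subseteq> X \<longrightarrow> X = E"
  proof (rule subset_Zorn')
    fix C assume C: "subset.chain A C"
    then have CA: "C \<subseteq> A" by (simp add: subset.chain_def)
    have "ip x y = (if x = y then 1 else 0)" if xy: "x \<in> \<Union>C" "y \<in> \<Union>C" for x y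
    proof -
      obtain X Y where XY: "X \<in> C" "x \<in> X" "Y \<in> C" "y \<in> Y" using xy by blast
      then consider "X \<subseteq> Y" | "Y \<subseteq> X" using C unfolding subset.chain_def by blast
      then obtain Z where "Z \<in> C" "x \<in> Z" "y \<in> Z" using XY by cases blast+
      then show ?thesis using CA unfolding A_def orthonormal_def by blast
    qed
    then show "\<Union>C \<in> A" using CA unfolding A_def orthonormal_def by blast
  qed
  then obtain E where E: "E \<in> A" and max: "\<And>X. X \<in> A \<Longrightarrow> E \<subseteq> X \<Longrightarrow> X = E" by blast
  have EV: "E \<subseteq> V" and on: "\<And>x y. x \<in> E \<Longrightarrow> y \<in> E \<Longrightarrow> ip x y = (if x = y then 1 else 0)"
    and eig: "\<And>e. e \<in> E \<Longrightarrow> \<exists>c. T e = c \<star> e"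
    using E unfolding A_def orthonormal_def by blast+
  define U where "U = {v \<in> V. \<forall>e\<in>E. ip v e = 0}"
  have U: "csub U" unfolding U_def by (rule csub_orthogonal) fact
  have UV: "U \<subseteq> V" by (auto simp: U_def)
  have "T ` U \<subseteq> U" "Ts ` U \<subseteq> U"
  proof -
    show "T ` U \<subseteq> U"
    proof safe
      fix v assume v: "v \<in> U"
      have "ip (T v) e = 0" if e: "e \<in> E" for e
      proof -
        obtain c where "T e = c \<star> e" using eig e by blast
        then have "Ts e = cnj c \<star> e" using e EV by (intro eigenvector_adjoint) auto
        then show ?thesis using v e EV by (auto simp: U_def adj subset_iff)
      qed
      then show "T v \<in> U" using v by (auto simp: U_def)
    qed
    show "Ts ` U \<subseteq> U"
    proof safe
      fix v assume v: "v \<in> U"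
      have "ip (Ts v) e = 0" if e: "e \<in> E" for e
      proof -
        obtain c where "T e = c \<star> e" using eig e by blast
        then show ?thesis using v e EV by (auto simp: U_def adj' subset_iff)
      qed
      then show "Ts v \<in> U" using v by (auto simp: U_def)
    qed
  qed
  then interpret U: normal_hilbert U zr ad sm ip T Ts by (intro normal_csub U)
  have "U = {zr}"
  proof (rule ccontr)
    assume "U \<noteq> {zr}"
    moreover have "U.apspec \<subseteq> apspec" using UV unfolding apspec_def U.apspec_def by blast
    then have "countable U.apspec" using K by (rule countable_subset)
    ultimately obtain x c where x: "x \<in> U" "x \<noteq> zr" "T x = c \<star> x"
      by (rule U.eigenvector_exists)
    have xV: "x \<in> V" and x0: "\<And>e. e \<in> E \<Longrightarrow> ip x e = 0" using x by (auto simp: U_def)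
    define y where "y = of_real (1 / nm x) \<star> x"
    have yV: "y \<in> V" using xV by (simp add: y_def)
    have y0: "ip y e = 0" "ip e y = 0" if "e \<in> E" for e
    proof -
      have "e \<in> V" using that EV by blast
      then show "ip y e = 0" using x0[OF that] xV by (simp add: y_def)
      then show "ip e y = 0" using ip_commute[OF yV \<open>e \<in> V\<close>] by simp
    qed
    have "nm y = 1" using nm_pos[OF xV x(2)] xV by (simp add: y_def nm_sm norm_divide)
    then have yy: "ip y y = 1" using ip_self[OF yV] by simp
    have Ty: "T y = c \<star> y" using xV x(3) by (intro vec_eqI) (auto simp: y_def lin_sm)
    have "insert y E \<in> A"
      unfolding A_def orthonormal_def
    proof (intro CollectI conjI ballI)
      fix a b assume "a \<in> insert y E" "b \<in> insert y E"
      then show "ip a b = (if a = b then 1 else 0)" using on yy y0 by (metis insertE)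
    qed (use yV EV eig Ty in auto)
    then have "y \<in> E" using max[of "insert y E"] by blast
    then show False using y0(1) yy by force
  qed
  show ?thesis
  proof
    show "orthonormal E" using EV on by (simp add: orthonormal_def)
    show "\<forall>v\<in>V. (\<forall>e\<in>E. ip v e = 0) \<longrightarrow> v = zr"
      using \<open>U = {zr}\<close> unfolding U_def by blast
  qed (rule eig)
qed

section \<open>Orthonormal bases and diagonal operators\<close>

text \<open>\<open>E\<close> may be uncountable, as models need not be separable; sums over
  \<open>E\<close> are therefore unordered. Totality is expressed by a trivial orthogonal
  complement, and vectors with prescribed coordinates are obtained from completeness.\<close>

locale hilbert_onb = hilbert +
  fixes E :: "'a set"
  assumes E_closed [simp, intro]: "e \<in> E \<Longrightarrow> e \<in> V"
    and E_ip: "e \<in> E \<Longrightarrow> e' \<in> E \<Longrightarrow> ip e e' = (if e = e' then 1 else 0)"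
    and E_total: "v \<in> V \<Longrightarrow> (\<And>e. e \<in> E \<Longrightarrow> ip v e = 0) \<Longrightarrow> v = zr"
begin

lemma coord_eqI: "x \<in> V \<Longrightarrow> y \<in> V \<Longrightarrow> (\<And>e. e \<in> E \<Longrightarrow> ip x e = ip y e) \<Longrightarrow> x = y"
  using E_total[of "x \<boxminus> y"] mi_eq_zr[of x y] by simp

text \<open>Finite sums of vectors are described by their inner products with all \<open>z\<close>,
  in the spirit of \<open>vec_eqI\<close>; the structure offers addition of two vectors
  only.\<close>

lemma finite_combination:
  assumes "finite F" "F \<subseteq> E"
  shows "\<exists>y\<in>V. (\<forall>z\<in>V. ip y z = (\<Sum>e\<in>F. a e * ip e z))"
  using assms
proof (induction F rule: finite_induct)
  case empty
  show ?case by (rule bexI[of _ zr]) auto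
next
  case (insert e F)
  then obtain y where y: "y \<in> V" "\<forall>z\<in>V. ip y z = (\<Sum>e\<in>F. a e * ip e z)" by auto
  show ?case
    by (rule bexI[of _ "a e \<star> e \<boxplus> y"]) (use insert y in auto)
qed

lemma finite_combination_coord:
  assumes F: "finite F" "F \<subseteq> E" and y: "y \<in> V" "\<forall>z\<in>V. ip y z = (\<Sum>e\<in>F. a e * ip e z)"
  shows "e \<in> E \<Longrightarrow> ip y e = (if e \<in> F then a e else 0)"
    and "(nm y)\<^sup>2 = (\<Sum>e\<in>F. (cmod (a e))\<^sup>2)"
proof -
  show coord: "ip y e = (if e \<in> F then a e else 0)" if "e \<in> E" for e
  proof -
    have "ip y e = (\<Sum>e'\<in>F. if e' = e then a e' else 0)"
      using y(2)[rule_format, of e] that F(2) by (auto simp: E_ip subset_iff intro!: sum.cong)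
    then show ?thesis using F(1) by simp
  qed
  have "ip y y = (\<Sum>e\<in>F. a e * cnj (a e))"
  proof -
    have "ip e y = cnj (a e)" if "e \<in> F" for e
    proof -
      have "e \<in> E" using that F by blast
      then show ?thesis unfolding ip_commute[OF y(1) E_closed[OF \<open>e \<in> E\<close>]] coord[OF \<open>e \<in> E\<close>] using that by simp
    qed
    then show ?thesis unfolding y(2)[rule_format, OF y(1)] by simp
  qed
  then have "ip y y = of_real (\<Sum>e\<in>F. (cmod (a e))\<^sup>2)"
    by (simp add: complex_norm_square del: of_real_power)
  then show "(nm y)\<^sup>2 = (\<Sum>e\<in>F. (cmod (a e))\<^sup>2)"
    using nm_sq[OF y(1)] by (metis Re_complex_of_real)
qed

lemma bessel:
  assumes F: "finite F" "F \<subseteq> E" and x: "x \<in> V"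
  shows "(\<Sum>e\<in>F. (cmod (ip x e))\<^sup>2) \<le> (nm x)\<^sup>2"
proof -
  obtain y where y: "y \<in> V" "\<forall>z\<in>V. ip y z = (\<Sum>e\<in>F. ip x e * ip e z)"
    using finite_combination[OF F, of "ip x"] by blast
  have "ip y x = (\<Sum>e\<in>F. ip x e * cnj (ip x e))"
    using y(2) x F ip_commute[OF x] by (auto intro!: sum.cong)
  then have "ip y x = of_real ((nm y)\<^sup>2)"
    unfolding finite_combination_coord(2)[OF F y] by (simp add: complex_norm_square del: of_real_power)
  then have "Re (ip y x) = (nm y)\<^sup>2" by (metis Re_complex_of_real)
  moreover have "0 \<le> (nm (y \<boxminus> x))\<^sup>2" by simp
  ultimately have "(nm y)\<^sup>2 \<le> (nm x)\<^sup>2" using nm_sq_mi[OF y(1) x] by linarith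
  then show ?thesis unfolding finite_combination_coord(2)[OF F y] .
qed

text \<open>Nested finite sets \<open>F n\<close> capture all but \<open>1 / (n + 1)\<close> of the
  total, so the corresponding finite combinations form a Cauchy sequence. A coordinate outside every
  \<open>F n\<close> must be 0, since adding it to the finite sums would exceed the total.\<close>

lemma riesz_fischer:
  assumes a: "(\<lambda>e. (cmod (a e))\<^sup>2) summable_on E"
  shows "\<exists>y\<in>V. (\<forall>e\<in>E. ip y e = a e) \<and> (nm y)\<^sup>2 = (\<Sum>\<^sub>\<infinity>e\<in>E. (cmod (a e))\<^sup>2)"
proof -
  define q where "q e = (cmod (a e))\<^sup>2" for e
  define S where "S = (\<Sum>\<^sub>\<infinity>e\<in>E. q e)"
  have q0: "0 \<le> q e" for e by (simp add: q_def)
  have hs: "(q has_sum S) E" unfolding S_def q_def using a by (rule has_sum_infsum)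
  have leS: "sum q F \<le> S" if "finite F" "F \<subseteq> E" for F
    unfolding S_def by (rule finite_sum_le_infsum) (use a that q0 in \<open>auto simp: q_def[abs_def]\<close>)
  have "\<exists>F. finite F \<and> F \<subseteq> E \<and> S - 1 / real (Suc n) < sum q F" for n
  proof -
    have "eventually (\<lambda>F. S - 1 / real (Suc n) < sum q F) (finite_subsets_at_top E)"
      by (rule order_tendstoD(1)) (use hs in \<open>auto simp: has_sum_def\<close>)
    then show ?thesis by (auto simp: eventually_finite_subsets_at_top)
  qed
  then obtain G where G: "\<And>n. finite (G n)" "\<And>n. G n \<subseteq> E" "\<And>n. S - 1 / real (Suc n) < sum q (G n)"
    by metis
  define F where "F n = (\<Union>k\<le>n. G k)" for n
  have F: "finite (F n)" "F n \<subseteq> E" for n using G by (auto simp: F_def)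
  have mono: "F n \<subseteq> F m" if "n \<le> m" for n m using that by (force simp: F_def)
  have SF: "S - 1 / real (Suc n) < sum q (F n)" for n
  proof -
    have "sum q (G n) \<le> sum q (F n)" by (rule sum_mono2) (use F q0 in \<open>auto simp: F_def\<close>)
    then show ?thesis using G(3)[of n] by linarith
  qed
  have "\<exists>y. y \<in> V \<and> (\<forall>z\<in>V. ip y z = (\<Sum>e\<in>F n. a e * ip e z))" for n
    using finite_combination[OF F, of a n] by blast
  then obtain Y where Y: "\<And>n. Y n \<in> V" "\<And>n. \<forall>z\<in>V. ip (Y n) z = (\<Sum>e\<in>F n. a e * ip e z)"
    by metis
  note co = finite_combination_coord[OF F Y]
  have diff: "(nm (Y m \<boxminus> Y n))\<^sup>2 \<le> 1 / real (Suc n)" if "n \<le> m" for n m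
  proof -
    have D: "finite (F m - F n)" "F m - F n \<subseteq> E" using F by auto
    have "ip (Y m \<boxminus> Y n) z = (\<Sum>e\<in>F m - F n. a e * ip e z)" if "z \<in> V" for z
      using Y that sum_diff[OF F(1) mono[OF \<open>n \<le> m\<close>], of "\<lambda>e. a e * ip e z"] by simp
    then have "(nm (Y m \<boxminus> Y n))\<^sup>2 = sum q (F m - F n)"
      using finite_combination_coord(2)[OF D, of "Y m \<boxminus> Y n" a] Y by (simp add: q_def)
    also have "\<dots> = sum q (F m) - sum q (F n)" by (rule sum_diff[OF F(1) mono[OF that]])
    also have "\<dots> \<le> 1 / real (Suc n)" using leS[OF F, of m] SF[of n] by linarith
    finally show ?thesis .
  qed
  obtain y where y: "y \<in> V" "vconv Y y"
  proof (rule vconvI_Cauchy[of Y])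
    fix e :: real assume e: "e > 0"
    then obtain N where N: "inverse (real (Suc N)) < e\<^sup>2"
      using reals_Archimedean[of "e\<^sup>2"] by auto
    have main: "nm (Y i \<boxminus> Y j) < e" if "i \<ge> N" "j \<ge> N" "j \<le> i" for i j
    proof (rule power2_less_imp_less)
      have "(nm (Y i \<boxminus> Y j))\<^sup>2 \<le> 1 / real (Suc j)" by (rule diff) fact
      also have "\<dots> \<le> 1 / real (Suc N)" using that by (intro divide_left_mono) auto
      finally show "(nm (Y i \<boxminus> Y j))\<^sup>2 < e\<^sup>2" using N by (simp add: inverse_eq_divide)
    qed (use e in simp)
    have "nm (Y i \<boxminus> Y j) < e" if "i \<ge> N" "j \<ge> N" for i j
      using main[of i j] main[of j i] that nm_mi_commute[of "Y i" "Y j"] Y by (cases "j \<le> i") auto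
    then show "\<exists>N. \<forall>i\<ge>N. \<forall>j\<ge>N. nm (Y i \<boxminus> Y j) < e" by blast
  qed (use Y in auto)
  have coord: "ip y e = a e" if e: "e \<in> E" for e
  proof (rule LIMSEQ_unique)
    show "(\<lambda>n. ip (Y n) e) \<longlonglongrightarrow> ip y e" by (rule vconv_ip) (use Y y e in auto)
    show "(\<lambda>n. ip (Y n) e) \<longlonglongrightarrow> a e"
    proof (cases "\<exists>n. e \<in> F n")
      case True
      then obtain N where "e \<in> F N" ..
      then have "\<forall>n\<ge>N. ip (Y n) e = a e" using co(1)[OF e] mono by (auto simp: subset_iff)
      then show ?thesis by (intro tendsto_eventually) (auto simp: eventually_sequentially)
    next
      case False
      have "q e \<le> 0 + r" if r: "r > 0" for r
      proof -
        obtain n where n: "inverse (real (Suc n)) < r" using reals_Archimedean[OF r] by auto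
        have "sum q (insert e (F n)) \<le> S" by (rule leS) (use F e in auto)
        then have "q e + sum q (F n) \<le> S" using False F by simp
        then show ?thesis using SF[of n] n by (simp add: inverse_eq_divide)
      qed
      then have "q e \<le> 0" by (rule field_le_epsilon)
      then have "a e = 0" by (simp add: q_def)
      then show ?thesis using co(1)[OF e] False by simp
    qed
  qed
  have "(nm y)\<^sup>2 = S"
  proof (rule LIMSEQ_unique)
    show "(\<lambda>n. (nm (Y n))\<^sup>2) \<longlonglongrightarrow> (nm y)\<^sup>2"
      by (intro tendsto_power vconv_nm) (use Y y in auto)
    have bounds: "S - 1 / real (Suc n) \<le> (nm (Y n))\<^sup>2" "(nm (Y n))\<^sup>2 \<le> S" for n
    proof -
      have "(nm (Y n))\<^sup>2 = sum q (F n)" unfolding q_def by (rule co(2))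
      then show "S - 1 / real (Suc n) \<le> (nm (Y n))\<^sup>2" "(nm (Y n))\<^sup>2 \<le> S"
        using SF[of n] leS[OF F, of n] by linarith+
    qed
    have "(\<lambda>n. S - 1 / real (Suc n)) \<longlonglongrightarrow> S"
      using tendsto_diff[OF tendsto_const[of S sequentially] LIMSEQ_inverse_real_of_nat]
      unfolding inverse_eq_divide by simp
    then show "(\<lambda>n. (nm (Y n))\<^sup>2) \<longlonglongrightarrow> S"
    proof (rule tendsto_sandwich[rotated 2])
      show "(\<lambda>n. S) \<longlonglongrightarrow> S" by simp
    qed (use bounds in \<open>simp_all add: always_eventually del: of_nat_Suc\<close>)
  qed
  then show ?thesis using y coord by (auto simp: S_def q_def)
qed

lemma coord_summable:
  assumes "x \<in> V" "A \<subseteq> E" shows "(\<lambda>e. (cmod (ip x e))\<^sup>2) summable_on A"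
proof (rule nonneg_bdd_above_summable_on)
  show "bdd_above (sum (\<lambda>e. (cmod (ip x e))\<^sup>2) ` {F. F \<subseteq> A \<and> finite F})"
    using bessel[OF _ _ assms(1)] assms(2) by (intro bdd_aboveI[of _ "(nm x)\<^sup>2"]) blast
qed auto

text \<open>\<open>riesz_fischer\<close> produces a vector with the coordinates of \<open>x\<close>
  whose squared norm is the sum; by totality it is \<open>x\<close>.\<close>

lemma parseval:
  assumes x: "x \<in> V" shows "(nm x)\<^sup>2 = (\<Sum>\<^sub>\<infinity>e\<in>E. (cmod (ip x e))\<^sup>2)"
proof -
  obtain y where y: "y \<in> V" "\<forall>e\<in>E. ip y e = ip x e" "(nm y)\<^sup>2 = (\<Sum>\<^sub>\<infinity>e\<in>E. (cmod (ip x e))\<^sup>2)"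
    using riesz_fischer[OF coord_summable[OF x subset_refl]] by blast
  then have "y = x" using x by (intro coord_eqI) auto
  then show ?thesis using y by simp
qed

definition mass :: "'a set \<Rightarrow> 'a \<Rightarrow> real" where
  "mass A x = (\<Sum>\<^sub>\<infinity>e\<in>E \<inter> A. (cmod (ip x e))\<^sup>2)"

definition bounded_symbol :: "('a \<Rightarrow> complex) \<Rightarrow> bool" where
  "bounded_symbol g \<longleftrightarrow> (\<exists>M. \<forall>e\<in>E. cmod (g e) \<le> M)"

text \<open>The diagonal operator with symbol \<open>g\<close>, given through coordinates, which
  determine the value whenever \<open>g\<close> is bounded on \<open>E\<close>. For an indicator it
  is the orthogonal projection onto the closed span of a part of the basis.\<close>

definition dg :: "('a \<Rightarrow> complex) \<Rightarrow> 'a \<Rightarrow> 'a" where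
  "dg g x = (SOME y. y \<in> V \<and> (\<forall>e\<in>E. ip y e = g e * ip x e))"

lemma dg:
  assumes g: "bounded_symbol g" and x: "x \<in> V"
  shows "dg g x \<in> V" "e \<in> E \<Longrightarrow> ip (dg g x) e = g e * ip x e"
proof -
  obtain M where M: "\<And>e. e \<in> E \<Longrightarrow> cmod (g e) \<le> M" using g by (auto simp: bounded_symbol_def)
  have "(\<lambda>e. (cmod (g e * ip x e))\<^sup>2) summable_on E"
  proof (rule summable_on_comparison_test)
    show "(\<lambda>e. M\<^sup>2 * (cmod (ip x e))\<^sup>2) summable_on E"
      by (intro summable_on_cmult_right coord_summable x) simp
    show "(cmod (g e * ip x e))\<^sup>2 \<le> M\<^sup>2 * (cmod (ip x e))\<^sup>2" if "e \<in> E" for e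
      using M[OF that] by (auto simp: norm_mult power_mult_distrib intro!: mult_right_mono power_mono)
  qed auto
  from riesz_fischer[OF this] have "\<exists>y. y \<in> V \<and> (\<forall>e\<in>E. ip y e = g e * ip x e)" by blast
  from someI_ex[OF this] show "dg g x \<in> V" "e \<in> E \<Longrightarrow> ip (dg g x) e = g e * ip x e"
    by (auto simp: dg_def)
qed

lemma nm_le_coord:
  assumes "x \<in> V" "y \<in> V" "M \<ge> 0" "\<And>e. e \<in> E \<Longrightarrow> cmod (ip y e) \<le> M * cmod (ip x e)"
  shows "nm y \<le> M * nm x"
proof (rule power2_le_imp_le)
  have "(nm y)\<^sup>2 \<le> (\<Sum>\<^sub>\<infinity>e\<in>E. M\<^sup>2 * (cmod (ip x e))\<^sup>2)"
    unfolding parseval[OF assms(2)]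
  proof (rule infsum_mono)
    show "(cmod (ip y e))\<^sup>2 \<le> M\<^sup>2 * (cmod (ip x e))\<^sup>2" if "e \<in> E" for e
      unfolding power_mult_distrib[symmetric] using assms(4)[OF that] by (intro power_mono) auto
  qed (intro summable_on_cmult_right coord_summable assms; simp)+
  also have "\<dots> = (M * nm x)\<^sup>2"
    using parseval[OF assms(1)] by (simp add: infsum_cmult_right' power_mult_distrib)
  finally show "(nm y)\<^sup>2 \<le> (M * nm x)\<^sup>2" .
qed (use assms in simp)

lemma lin_dg: "bounded_symbol g \<Longrightarrow> lin (dg g)"
  unfolding lin_def by (auto simp: dg algebra_simps intro!: coord_eqI)

text \<open>Parseval for \<open>x + c y\<close> has no cross terms because at each basis vector one
  summand vanishes, so \<open>Re (ip x (c y))\<close> is 0; the choices 1 and \<open>i\<close> for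
  \<open>c\<close> give the real and imaginary parts.\<close>

lemma orthogonal_support:
  assumes "x \<in> V" "y \<in> V" "\<And>e. e \<in> E \<Longrightarrow> ip x e = 0 \<or> ip y e = 0"
  shows "ip x y = 0"
proof -
  have *: "Re (ip x (c \<star> y)) = 0" for c
  proof -
    have "(nm (x \<boxplus> c \<star> y))\<^sup>2 = (\<Sum>\<^sub>\<infinity>e\<in>E. (cmod (ip x e))\<^sup>2 + (cmod (ip (c \<star> y) e))\<^sup>2)"
    proof (subst parseval)
      have "(cmod (ip (x \<boxplus> c \<star> y) e))\<^sup>2 = (cmod (ip x e))\<^sup>2 + (cmod (ip (c \<star> y) e))\<^sup>2" if "e \<in> E" for e
        using assms(3)[OF that] assms(1,2) that by auto
      then show "(\<Sum>\<^sub>\<infinity>e\<in>E. (cmod (ip (x \<boxplus> c \<star> y) e))\<^sup>2) =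
          (\<Sum>\<^sub>\<infinity>e\<in>E. (cmod (ip x e))\<^sup>2 + (cmod (ip (c \<star> y) e))\<^sup>2)"
        by (rule infsum_cong)
    qed (use assms in auto)
    also have "\<dots> = (nm x)\<^sup>2 + (nm (c \<star> y))\<^sup>2"
      using assms by (subst infsum_add) (auto simp: parseval intro!: coord_summable)
    finally show ?thesis using nm_sq_ad[of x "c \<star> y"] assms by simp
  qed
  show ?thesis using *[of 1] *[of \<i>] assms by (simp add: complex_eq_iff)
qed

lemma bounded_symbol_indicator [simp]: "bounded_symbol (indicator A)"
  by (auto simp: bounded_symbol_def indicator_def intro!: exI[of _ 1])

lemma mass_eq_nm: "x \<in> V \<Longrightarrow> mass A x = (nm (dg (indicator A) x))\<^sup>2"
  unfolding mass_def
  by (subst parseval) (auto simp: dg indicator_def intro!: infsum_cong_neutral)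

lemma mass_Un: "x \<in> V \<Longrightarrow> A \<inter> B = {} \<Longrightarrow> mass (A \<union> B) x = mass A x + mass B x"
  unfolding mass_def Int_Un_distrib
  by (rule infsum_Un_disjoint) (auto intro!: coord_summable)

lemma mass_nonneg: "0 \<le> mass A x"
  by (simp add: mass_def infsum_nonneg)

lemma mass_empty [simp]: "mass {} x = 0"
  by (simp add: mass_def)

lemma mass_UNIV: "x \<in> V \<Longrightarrow> E \<subseteq> A \<Longrightarrow> mass A x = (nm x)\<^sup>2"
  by (simp add: mass_def parseval Int_absorb2)

lemma mass_finite: "finite F \<Longrightarrow> F \<subseteq> E \<Longrightarrow> mass F x = (\<Sum>e\<in>F. (cmod (ip x e))\<^sup>2)"
  by (simp add: mass_def Int_absorb1)

lemma mass_Union: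
  assumes "x \<in> V" "finite J" "\<And>A B. A \<in> J \<Longrightarrow> B \<in> J \<Longrightarrow> A \<noteq> B \<Longrightarrow> A \<inter> B = {}"
  shows "mass (\<Union>J) x = (\<Sum>A\<in>J. mass A x)"
  using assms(2,3)
proof (induction J rule: finite_induct)
  case (insert A J)
  have "A \<inter> \<Union>J = {}" using insert.prems insert.hyps(2) by fastforce
  then show ?case using insert mass_Un[OF assms(1), of A "\<Union>J"] by simp
qed simp

end

section \<open>Unitaries moving one vector near another\<close>

definition (in hilbert) unitary :: "('v \<Rightarrow> 'v) \<Rightarrow> bool" where
  "unitary g \<longleftrightarrow> lin g \<and> g ` V = V \<and> (\<forall>x\<in>V. \<forall>y\<in>V. ip (g x) (g y) = ip x y)"

context hilbert
begin

lemma unitaryD: "unitary g \<Longrightarrow> lin g" "unitary g \<Longrightarrow> g ` V = V"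
    "unitary g \<Longrightarrow> x \<in> V \<Longrightarrow> y \<in> V \<Longrightarrow> ip (g x) (g y) = ip x y"
  by (simp_all add: unitary_def)

lemma unitary_nm: "unitary g \<Longrightarrow> x \<in> V \<Longrightarrow> nm (g x) = nm x"
  by (simp add: nm_def unitary_def)

lemma unitary_id: "unitary (\<lambda>x. x)"
  by (simp add: unitary_def lin_id)

lemma unitary_comp: "unitary g \<Longrightarrow> unitary h \<Longrightarrow> unitary (\<lambda>x. h (g x))"
  unfolding unitary_def by (auto simp: lin_comp image_image[symmetric])

text \<open>For nonzero \<open>v\<close> the condition on \<open>t\<close> says that
  \<open>1 - t * (nm v)^2\<close> has absolute value 1: the map fixes the orthogonal complement of
  \<open>v\<close> and multiplies \<open>v\<close> by that number. The inverse is the same map with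
  \<open>cnj t\<close>.\<close>

lemma unitary_reflection:
  assumes v: "v \<in> V" and t: "t + cnj t = t * cnj t * of_real ((nm v)\<^sup>2)"
  shows "unitary (\<lambda>z. z \<boxminus> (t * ip z v) \<star> v)"
  unfolding unitary_def
proof (intro conjI ballI)
  show "lin (\<lambda>z. z \<boxminus> (t * ip z v) \<star> v)"
    unfolding lin_def
  proof (intro conjI ballI allI)
    fix x y assume "x \<in> V" "y \<in> V"
    then show "(x \<boxplus> y) \<boxminus> (t * ip (x \<boxplus> y) v) \<star> v = (x \<boxminus> (t * ip x v) \<star> v) \<boxplus> (y \<boxminus> (t * ip y v) \<star> v)"
      using v by (intro vec_eqI) (auto simp: algebra_simps)
  next
    fix x c assume "x \<in> V"
    then show "c \<star> x \<boxminus> (t * ip (c \<star> x) v) \<star> v = c \<star> (x \<boxminus> (t * ip x v) \<star> v)"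
      using v by (intro vec_eqI) (auto simp: algebra_simps)
  qed (use v in auto)
  fix x y assume xy: "x \<in> V" "y \<in> V"
  have vy: "cnj (ip y v) = ip v y" using ip_commute[OF xy(2) v] by simp
  have "ip (x \<boxminus> (t * ip x v) \<star> v) (y \<boxminus> (t * ip y v) \<star> v)
      = ip x y - (t + cnj t - t * cnj t * ip v v) * ip x v * ip v y"
    using xy v by (simp add: vy algebra_simps)
  then show "ip (x \<boxminus> (t * ip x v) \<star> v) (y \<boxminus> (t * ip y v) \<star> v) = ip x y"
    using t by (simp add: ip_self[OF v])
next
  show "(\<lambda>z. z \<boxminus> (t * ip z v) \<star> v) ` V = V"
  proof
    show "V \<subseteq> (\<lambda>z. z \<boxminus> (t * ip z v) \<star> v) ` V"
    proof
      fix x assume x: "x \<in> V"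
      let ?z = "x \<boxminus> (cnj t * ip x v) \<star> v"
      have "x = ?z \<boxminus> (t * ip ?z v) \<star> v"
      proof (rule vec_eqI)
        fix y assume y: "y \<in> V"
        have "ip (?z \<boxminus> (t * ip ?z v) \<star> v) y = ip x y - (t + cnj t - t * cnj t * ip v v) * ip x v * ip v y"
          using x y v by (simp add: algebra_simps)
        then show "ip x y = ip (?z \<boxminus> (t * ip ?z v) \<star> v) y" using t by (simp add: ip_self[OF v])
      qed (use x v in auto)
      then show "x \<in> (\<lambda>z. z \<boxminus> (t * ip z v) \<star> v) ` V" using x v by blast
    qed
  qed (use v in auto)
qed

text \<open>A complex Householder reflection; \<open>2 Re (1 - \<langle>u,w\<rangle>)\<close> equals \<open>\<parallel>u - w\<parallel>\<^sup>2\<close> for unit vectors,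
  which makes the reflection unitary.\<close>

lemma householder:
  assumes u: "u \<in> V" and w: "w \<in> V" and eq: "nm u = nm w"
  obtains t where "unitary (\<lambda>z. z \<boxminus> (t * ip z (u \<boxminus> w)) \<star> (u \<boxminus> w))"
    "u \<boxminus> (t * ip u (u \<boxminus> w)) \<star> (u \<boxminus> w) = w"
proof (cases "u = w")
  case True
  have "unitary (\<lambda>z. z \<boxminus> (0 * ip z (u \<boxminus> w)) \<star> (u \<boxminus> w))"
    by (rule unitary_reflection) (use u w in auto)
  moreover have "u \<boxminus> (0 * ip u (u \<boxminus> w)) \<star> (u \<boxminus> w) = w"
    using True u w by (intro vec_eqI) auto
  ultimately show ?thesis by (rule that)
next
  case False
  define v where "v = u \<boxminus> w"
  have v: "v \<in> V" using u w by (simp add: v_def)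
  define p where "p = ip u v"
  have "ip w u = cnj (ip u w)" by (rule ip_commute[OF u w])
  moreover have "ip w w = ip u u" using eq by (simp add: ip_self u w)
  ultimately have vv: "ip v v = p + cnj p"
    using u w ip_self[OF u] by (simp add: v_def p_def algebra_simps)
  have p: "p \<noteq> 0"
  proof
    assume "p = 0"
    then have "nm v = 0" using vv ip_self[OF v] by simp
    then show False using False mi_eq_zr[OF u w] by (simp add: v_def)
  qed
  \<comment> \<open>\<open>ip v v = p + cnj p\<close> because \<open>u\<close> and \<open>w\<close>
    have equal length. So the reciprocal of \<open>p\<close> satisfies the unitarity condition, and
    \<open>t * ip u v = 1\<close> sends \<open>u\<close> to \<open>u - v = w\<close>.\<close>
  define t where "t = 1 / p"
  have "t + cnj t = t * cnj t * of_real ((nm v)\<^sup>2)"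
    using p by (simp add: ip_self[OF v, symmetric] vv t_def field_simps del: of_real_power)
  then have "unitary (\<lambda>z. z \<boxminus> (t * ip z v) \<star> v)" by (rule unitary_reflection[OF v])
  moreover have "u \<boxminus> (t * ip u v) \<star> v = w"
  proof -
    have "t * ip u v = 1" using p by (simp add: t_def p_def)
    then show ?thesis using u w by (intro vec_eqI) (simp_all add: v_def)
  qed
  ultimately show ?thesis using that by (simp add: v_def)
qed

end

context hilbert_onb
begin

text \<open>The symbols of diagonal operators that are scalar on every part; reflections in vectors
  supported in a single part commute with all of them.\<close>

definition constant_on_parts :: "'a set set \<Rightarrow> ('a \<Rightarrow> complex) \<Rightarrow> bool" where
  "constant_on_parts J p \<longleftrightarrow> bounded_symbol p \<and> (\<forall>A\<in>J. \<exists>c. \<forall>e\<in>A. p e = c)"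

lemma dg_const:
  assumes "bounded_symbol p" "A \<subseteq> E" "\<And>e. e \<in> A \<Longrightarrow> p e = c" "v \<in> V"
    "\<And>e. e \<in> E - A \<Longrightarrow> ip v e = 0"
  shows "dg p v = c \<star> v" and "z \<in> V \<Longrightarrow> ip (dg p z) v = c * ip z v"
proof -
  show "dg p v = c \<star> v"
  proof (rule coord_eqI)
    fix e assume e: "e \<in> E"
    show "ip (dg p v) e = ip (c \<star> v) e"
      using assms e by (cases "e \<in> A") (auto simp: dg)
  qed (use assms in \<open>auto simp: dg\<close>)
  assume z: "z \<in> V"
  let ?y = "dg p z \<boxminus> c \<star> z"
  have "ip ?y v = 0"
    by (rule orthogonal_support) (use assms z in \<open>auto simp: dg\<close>)
  then show "ip (dg p z) v = c * ip z v" using assms z by (simp add: dg)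
qed

text \<open>\<open>v\<close> is an eigenvector of \<open>dg p\<close> with eigenvalue
  \<open>c\<close>, and pairing with \<open>v\<close> extracts the same factor \<open>c\<close> from
  \<open>dg p z\<close>, so both correction terms agree.\<close>

lemma reflection_commutes:
  assumes p: "bounded_symbol p" and A: "A \<subseteq> E" "\<And>e. e \<in> A \<Longrightarrow> p e = c"
    and v: "v \<in> V" "\<And>e. e \<in> E - A \<Longrightarrow> ip v e = 0" and z: "z \<in> V"
  shows "dg p (z \<boxminus> (t * ip z v) \<star> v) = dg p z \<boxminus> (t * ip (dg p z) v) \<star> v"
proof -
  have "dg p v = c \<star> v" by (rule dg_const(1)[OF p A(1) _ v(1)]) (use A v in auto)
  then have eq: "dg p (z \<boxminus> (t * ip z v) \<star> v) = dg p z \<boxminus> (t * ip z v) \<star> c \<star> v"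
    using lin_mi[OF lin_dg[OF p], of z "(t * ip z v) \<star> v"] lin_sm[OF lin_dg[OF p]] v z by simp
  have d2: "ip (dg p z) v = c * ip z v"
    by (rule dg_const(2)[OF p A(1) _ v(1) _ z]) (use A v in auto)
  have "dg p z \<boxminus> (t * ip z v) \<star> c \<star> v = dg p z \<boxminus> (t * ip (dg p z) v) \<star> v"
    unfolding d2 using v z dg(1)[OF p z] by (intro vec_eqI) (auto simp: algebra_simps)
  then show ?thesis using eq by simp
qed

lemma constant_on_parts_indicator:
  assumes "\<And>B. B \<in> J \<Longrightarrow> A \<inter> B = {}" shows "constant_on_parts J (indicator A)"
  using assms unfolding constant_on_parts_def by (auto simp: indicator_def disjoint_iff intro!: exI[of _ 0])

text \<open>A product of reflections, one for each part. The reflection for \<open>A\<close> acts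
  inside the closed span of \<open>A\<close> and turns the projection of \<open>x\<close> into the
  direction of the projection of \<open>y\<close>; what remains on \<open>A\<close> is the
  difference of their lengths. Disjointness keeps the reflections of different parts from
  interfering.\<close>

lemma partition_unitary:
  assumes "finite J" "\<And>A B. A \<in> J \<Longrightarrow> B \<in> J \<Longrightarrow> A \<noteq> B \<Longrightarrow> A \<inter> B = {}" "\<Union>J \<subseteq> E"
    and x: "x \<in> V" and y: "y \<in> V"
  shows "\<exists>g. unitary g \<and> (\<forall>z\<in>V. (\<forall>e\<in>\<Union>J. ip z e = 0) \<longrightarrow> g z = z) \<and>
     (\<forall>p. constant_on_parts J p \<longrightarrow> (\<forall>z\<in>V. dg p (g z) = g (dg p z))) \<and>
     (\<forall>A\<in>J. nm (dg (indicator A) (g x) \<boxminus> dg (indicator A) y)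
        = \<bar>nm (dg (indicator A) x) - nm (dg (indicator A) y)\<bar>)"
  using assms(1-3)
proof (induction J rule: finite_induct)
  case empty
  show ?case by (rule exI[of _ "\<lambda>x. x"]) (simp add: unitary_id)
next
  case (insert A J)
  have disj: "A \<inter> B = {}" if "B \<in> J" for B using insert.prems(1)[of A B] insert.hyps(2) that by auto
  have AE: "A \<subseteq> E" using insert.prems by auto
  have "\<exists>g. unitary g \<and> (\<forall>z\<in>V. (\<forall>e\<in>\<Union>J. ip z e = 0) \<longrightarrow> g z = z) \<and>
     (\<forall>p. constant_on_parts J p \<longrightarrow> (\<forall>z\<in>V. dg p (g z) = g (dg p z))) \<and>
     (\<forall>A\<in>J. nm (dg (indicator A) (g x) \<boxminus> dg (indicator A) y)
        = \<bar>nm (dg (indicator A) x) - nm (dg (indicator A) y)\<bar>)"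
    by (rule insert.IH) (use insert.prems in auto)
  then obtain g where gg: "unitary g \<and> (\<forall>z\<in>V. (\<forall>e\<in>\<Union>J. ip z e = 0) \<longrightarrow> g z = z) \<and>
     (\<forall>p. constant_on_parts J p \<longrightarrow> (\<forall>z\<in>V. dg p (g z) = g (dg p z))) \<and>
     (\<forall>A\<in>J. nm (dg (indicator A) (g x) \<boxminus> dg (indicator A) y)
        = \<bar>nm (dg (indicator A) x) - nm (dg (indicator A) y)\<bar>)" ..
  have g: "unitary g" and g_fix: "\<And>z. z \<in> V \<Longrightarrow> (\<And>e. e \<in> \<Union>J \<Longrightarrow> ip z e = 0) \<Longrightarrow> g z = z"
    and g_comm: "\<And>p z. constant_on_parts J p \<Longrightarrow> z \<in> V \<Longrightarrow> dg p (g z) = g (dg p z)"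
    and g_dist: "\<And>B. B \<in> J \<Longrightarrow> nm (dg (indicator B) (g x) \<boxminus> dg (indicator B) y)
        = \<bar>nm (dg (indicator B) x) - nm (dg (indicator B) y)\<bar>"
    using gg by blast+
  have gV: "g z \<in> V" if "z \<in> V" for z using unitaryD(1)[OF g] that by blast
  define u where "u = dg (indicator A) x"
  define w where "w = dg (indicator A) y"
  have uw: "u \<in> V" "w \<in> V" using x y by (auto simp: u_def w_def dg)
  have supp: "ip u e = 0" "ip w e = 0" if "e \<in> E - A" for e
    using that x y by (auto simp: u_def w_def dg)
  \<comment> \<open>\<open>s\<close> has the length of \<open>u\<close> and the direction of
    \<open>w\<close>. Where one of them vanishes there is no direction to adjust, and
    \<open>s = u\<close> already attains the difference of lengths.\<close>
  define s where "s = (if nm u = 0 \<or> nm w = 0 then u else of_real (nm u / nm w) \<star> w)"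
  have s: "s \<in> V" "\<And>e. e \<in> E - A \<Longrightarrow> ip s e = 0" using uw supp by (auto simp: s_def)
  have s_u: "nm u = nm s" using uw by (auto simp: s_def nm_sm norm_divide)
  have sw: "nm (s \<boxminus> w) = \<bar>nm u - nm w\<bar>"
  proof (cases "nm u = 0 \<or> nm w = 0")
    case True
    then have "u = zr \<or> w = zr" using uw nm_eq_0 by blast
    then have "nm (u \<boxminus> w) = \<bar>nm u - nm w\<bar>"
    proof
      assume "u = zr"
      moreover have "zr \<boxminus> w = (-1) \<star> w" using uw by (intro vec_eqI) auto
      ultimately show ?thesis using uw by (simp add: nm_sm)
    next
      assume "w = zr"
      moreover have "u \<boxminus> zr = u" using uw by (intro vec_eqI) auto
      ultimately show ?thesis using uw by simp
    qed
    then show ?thesis using True by (simp add: s_def)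
  next
    case False
    then have "s \<boxminus> w = of_real (nm u / nm w - 1) \<star> w"
      using uw by (intro vec_eqI) (auto simp: s_def algebra_simps)
    then have "nm (s \<boxminus> w) = \<bar>nm u / nm w - 1\<bar> * nm w" using uw by (simp add: nm_sm del: of_real_diff of_real_divide)
    also have "\<dots> = \<bar>(nm u / nm w - 1) * nm w\<bar>" using nm_nonneg[OF uw(2)] by (simp only: abs_mult abs_of_nonneg)
    also have "(nm u / nm w - 1) * nm w = nm u - nm w" using False by (simp add: left_diff_distrib)
    finally show ?thesis .
  qed
  obtain t where t: "unitary (\<lambda>z. z \<boxminus> (t * ip z (u \<boxminus> s)) \<star> (u \<boxminus> s))"
    "u \<boxminus> (t * ip u (u \<boxminus> s)) \<star> (u \<boxminus> s) = s"
    by (rule householder[OF uw(1) s(1) s_u]) (rule that)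
  define v where "v = u \<boxminus> s"
  have v: "v \<in> V" "\<And>e. e \<in> E - A \<Longrightarrow> ip v e = 0" using uw s supp by (auto simp: v_def)
  define h where "h z = z \<boxminus> (t * ip z v) \<star> v" for z
  have h: "unitary h" "h u = s" using t by (simp_all add: h_def[abs_def] v_def)
  have hV: "h z \<in> V" if "z \<in> V" for z using unitaryD(1)[OF h(1)] that by blast
  have h_comm: "dg p (h z) = h (dg p z)" if "bounded_symbol p" "\<And>e. e \<in> A \<Longrightarrow> p e = c" "z \<in> V" for p c z
    unfolding h_def by (rule reflection_commutes[OF that(1) AE that(2) v that(3)])
  have h_fix: "h z = z" if z: "z \<in> V" "\<And>e. e \<in> A \<Longrightarrow> ip z e = 0" for z
  proof -
    have zv: "ip z v = 0" by (rule orthogonal_support) (use z v in auto)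
    show ?thesis unfolding h_def zv using z(1) v(1) by (intro vec_eqI) simp_all
  qed
  show ?case
  proof (intro exI[of _ "\<lambda>z. h (g z)"] conjI allI impI ballI)
    show "unitary (\<lambda>z. h (g z))" by (rule unitary_comp[OF g h(1)])
  next
    fix z assume z: "z \<in> V" "\<forall>e\<in>\<Union>(insert A J). ip z e = 0"
    then have "g z = z" by (intro g_fix) auto
    moreover have "h z = z" by (rule h_fix) (use z in auto)
    ultimately show "h (g z) = z" by simp
  next
    fix p z assume p: "constant_on_parts (insert A J) p" and z: "z \<in> V"
    then obtain c where c: "\<And>e. e \<in> A \<Longrightarrow> p e = c" by (auto simp: constant_on_parts_def)
    have p': "constant_on_parts J p" "bounded_symbol p" using p by (auto simp: constant_on_parts_def)
    show "dg p (h (g z)) = h (g (dg p z))"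
      using h_comm[OF p'(2) c gV[OF z]] g_comm[OF p'(1) z] by simp
  next
    fix B assume B: "B \<in> insert A J"
    show "nm (dg (indicator B) (h (g x)) \<boxminus> dg (indicator B) y)
        = \<bar>nm (dg (indicator B) x) - nm (dg (indicator B) y)\<bar>"
    proof (cases "B = A")
      case True
      have "dg (indicator A) (h (g x)) = h (dg (indicator A) (g x))"
        by (rule h_comm[where c = 1]) (use gV x in auto)
      also have "dg (indicator A) (g x) = g u"
        unfolding u_def by (rule g_comm[OF constant_on_parts_indicator[OF disj] x])
      also have "g u = u"
      proof (rule g_fix[OF uw(1)])
        show "ip u e = 0" if "e \<in> \<Union>J" for e
          using that insert.prems(2) disj by (intro supp) blast
      qed
      finally show ?thesis using True h sw by (simp add: u_def w_def)
    next
      case False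
      then have BJ: "B \<in> J" using B by simp
      have "dg (indicator B) (h (g x)) = h (dg (indicator B) (g x))"
        by (rule h_comm[where c = 0]) (use gV x disj[OF BJ] in \<open>auto simp: indicator_def\<close>)
      also have "\<dots> = dg (indicator B) (g x)"
        by (rule h_fix) (use gV[OF x] disj[OF BJ] AE in \<open>auto simp: dg indicator_def subset_iff disjoint_iff\<close>)
      finally show ?thesis using g_dist[OF BJ] by simp
    qed
  qed
qed

text \<open>The vectors of \<open>F\<close> are fixed, so the coordinates of \<open>x\<close> along
  \<open>F\<close> survive. On each part the squared remainder \<open>(a - b)^2\<close> of the two
  lengths is at most \<open>|a^2 - b^2|\<close>, which expresses the bound through masses, the
  quantities available for a type.\<close>

lemma partition_approx_conjugate:
  assumes J: "finite J" "\<And>A B. A \<in> J \<Longrightarrow> B \<in> J \<Longrightarrow> A \<noteq> B \<Longrightarrow> A \<inter> B = {}"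
    and F: "finite F" "F \<subseteq> E" "\<Union>J = E - F"
    and x: "x \<in> V" and y: "y \<in> V"
  obtains g where "unitary g" "\<forall>z\<in>V. (\<forall>e\<in>E - F. ip z e = 0) \<longrightarrow> g z = z"
    "\<forall>p. constant_on_parts J p \<longrightarrow> (\<forall>z\<in>V. dg p (g z) = g (dg p z))"
    "(nm (g x \<boxminus> y))\<^sup>2 \<le> (\<Sum>e\<in>F. (cmod (ip x e - ip y e))\<^sup>2) + (\<Sum>A\<in>J. \<bar>mass A x - mass A y\<bar>)"
proof -
  have "\<Union>J \<subseteq> E" using F by auto
  from partition_unitary[OF J this x y] obtain g where
    gg: "unitary g \<and> (\<forall>z\<in>V. (\<forall>e\<in>\<Union>J. ip z e = 0) \<longrightarrow> g z = z) \<and>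
     (\<forall>p. constant_on_parts J p \<longrightarrow> (\<forall>z\<in>V. dg p (g z) = g (dg p z))) \<and>
     (\<forall>A\<in>J. nm (dg (indicator A) (g x) \<boxminus> dg (indicator A) y)
        = \<bar>nm (dg (indicator A) x) - nm (dg (indicator A) y)\<bar>)" by blast
  have g: "unitary g"
    and g_fix: "\<And>z. z \<in> V \<Longrightarrow> (\<And>e. e \<in> \<Union>J \<Longrightarrow> ip z e = 0) \<Longrightarrow> g z = z"
    and g_comm: "\<And>p z. constant_on_parts J p \<Longrightarrow> z \<in> V \<Longrightarrow> dg p (g z) = g (dg p z)"
    and g_dist: "\<And>B. B \<in> J \<Longrightarrow> nm (dg (indicator B) (g x) \<boxminus> dg (indicator B) y)
        = \<bar>nm (dg (indicator B) x) - nm (dg (indicator B) y)\<bar>"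
    using gg by blast+
  have gx: "g x \<in> V" using unitaryD(1)[OF g] x by blast
  define z where "z = g x \<boxminus> y"
  have z: "z \<in> V" using gx y by (simp add: z_def)
  have g_coord: "ip (g x) e = ip x e" if e: "e \<in> F" for e
  proof -
    have eE: "e \<in> E" using e F by blast
    have "g e = e"
    proof (rule g_fix)
      show "ip e e' = 0" if "e' \<in> \<Union>J" for e' using that e eE F(3) by (auto simp: E_ip)
    qed (use eE in auto)
    then show ?thesis using unitaryD(3)[OF g x, of e] eE by simp
  qed
  have "(nm z)\<^sup>2 = mass (F \<union> \<Union>J) z" using F z by (subst mass_UNIV) auto
  also have "\<dots> = mass F z + mass (\<Union>J) z" by (rule mass_Un[OF z]) (use F in auto)
  also have "mass (\<Union>J) z = (\<Sum>A\<in>J. mass A z)" by (rule mass_Union[OF z J])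
  also have "mass F z = (\<Sum>e\<in>F. (cmod (ip x e - ip y e))\<^sup>2)"
    unfolding mass_finite[OF F(1,2)]
  proof (rule sum.cong)
    fix e assume e: "e \<in> F"
    then have "e \<in> V" using F by auto
    then have "ip z e = ip x e - ip y e" using gx y g_coord[OF e] by (simp add: z_def)
    then show "(cmod (ip z e))\<^sup>2 = (cmod (ip x e - ip y e))\<^sup>2" by simp
  qed simp
  also have "(\<Sum>A\<in>J. mass A z) \<le> (\<Sum>A\<in>J. \<bar>mass A x - mass A y\<bar>)"
  proof (rule sum_mono)
    fix A assume A: "A \<in> J"
    let ?a = "nm (dg (indicator A) x)" and ?b = "nm (dg (indicator A) y)"
    have ab: "0 \<le> ?a" "0 \<le> ?b" using x y by (auto simp: dg)
    have "dg (indicator A) z = dg (indicator A) (g x) \<boxminus> dg (indicator A) y"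
      unfolding z_def by (rule lin_mi[OF lin_dg[OF bounded_symbol_indicator] gx y])
    then have "mass A z = \<bar>?a - ?b\<bar>\<^sup>2" using g_dist[OF A] by (simp add: mass_eq_nm[OF z])
    also have "\<dots> \<le> \<bar>?a - ?b\<bar> * (?a + ?b)"
      unfolding power2_eq_square using ab by (intro mult_left_mono) auto
    also have "\<dots> = \<bar>?a\<^sup>2 - ?b\<^sup>2\<bar>"
      using ab by (simp add: power2_eq_square square_diff_square_factored abs_mult mult.commute)
    finally show "mass A z \<le> \<bar>mass A x - mass A y\<bar>" by (simp add: mass_eq_nm x y)
  qed
  finally have "(nm (g x \<boxminus> y))\<^sup>2 \<le> (\<Sum>e\<in>F. (cmod (ip x e - ip y e))\<^sup>2) + (\<Sum>A\<in>J. \<bar>mass A x - mass A y\<bar>)"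
    by (simp add: z_def)
  then show ?thesis
    by (rule that[OF g, rotated 2]) (use g_fix F(3) g_comm in simp_all)
qed

end

section \<open>Continuity and compactness of continuous logic\<close>

lemma subsequence_convergent_coords:
  fixes X :: "nat \<Rightarrow> nat \<Rightarrow> real"
  assumes "\<And>k i. i < n \<Longrightarrow> X k i \<in> {0..1}"
  shows "\<exists>r l. strict_mono (r :: nat \<Rightarrow> nat) \<and> (\<forall>i<n. l i \<in> {0..1} \<and> (\<lambda>k. X (r k) i) \<longlonglongrightarrow> l i)"
  using assms
proof (induction n)
  case 0
  show ?case by (rule exI[of _ id]) (simp add: strict_mono_def)
next
  case (Suc n)
  then obtain r l where r: "strict_mono (r :: nat \<Rightarrow> nat)"
    and l: "\<forall>i<n. l i \<in> {0..1} \<and> (\<lambda>k. X (r k) i) \<longlonglongrightarrow> l i" by auto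
  have "\<forall>k. X (r k) n \<in> {0..1}" using Suc.prems by simp
  then obtain a s where a: "a \<in> {0..1}" and s: "strict_mono s" "((\<lambda>k. X (r k) n) \<circ> s) \<longlonglongrightarrow> a"
    using compact_Icc[of 0 "1::real"] unfolding compact_def by metis
  have "strict_mono (r \<circ> s)" using r s(1) by (rule strict_mono_o)
  moreover have "(l(n := a)) i \<in> {0..1} \<and> (\<lambda>k. X ((r \<circ> s) k) i) \<longlonglongrightarrow> (l(n := a)) i" if "i < Suc n" for i
  proof (cases "i = n")
    case True
    then show ?thesis using a s by (simp add: o_def)
  next
    case False
    then have "i < n" using that by simp
    then show ?thesis using l LIMSEQ_subseq_LIMSEQ[OF _ s(1), of "\<lambda>k. X (r k) i" "l i"] False
      by (simp add: o_def)
  qed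
  ultimately show ?case by blast
qed

text \<open>Heine-Cantor on the cube: counterexamples with tolerance \<open>1 / (k + 1)\<close>
  would accumulate at a point \<open>L\<close>, where continuity with \<open>e / 2\<close>
  contradicts the separation of their values.\<close>

lemma connective_uniformly_continuous:
  assumes u: "connective n u" and e: "e > 0"
  shows "\<exists>d>0. \<forall>xs\<in>unit_cube n. \<forall>ys\<in>unit_cube n. (\<forall>i<n. \<bar>ys ! i - xs ! i\<bar> \<le> d) \<longrightarrow> \<bar>u ys - u xs\<bar> < e"
proof (rule ccontr)
  assume neg: "\<not> ?thesis"
  have "\<exists>xs ys. xs \<in> unit_cube n \<and> ys \<in> unit_cube n \<and>
      (\<forall>i<n. \<bar>ys ! i - xs ! i\<bar> \<le> inverse (real (Suc k))) \<and> \<not> \<bar>u ys - u xs\<bar> < e" for k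
  proof -
    have "inverse (real (Suc k)) > 0" by simp
    then show ?thesis using neg by blast
  qed
  then obtain X Y where X: "\<And>k. X k \<in> unit_cube n" and Y: "\<And>k. Y k \<in> unit_cube n"
    and XY: "\<And>k i. i < n \<Longrightarrow> \<bar>Y k ! i - X k ! i\<bar> \<le> inverse (real (Suc k))"
    and far: "\<And>k. \<not> \<bar>u (Y k) - u (X k)\<bar> < e" by metis
  have "X k ! i \<in> {0..1}" if "i < n" for k i
    using X[of k] that nth_mem[of i "X k"] unfolding unit_cube_def by blast
  from subsequence_convergent_coords[of n "\<lambda>k i. X k ! i", OF this]
  obtain r l where r: "strict_mono (r :: nat \<Rightarrow> nat)"
    and l: "\<And>i. i < n \<Longrightarrow> l i \<in> {0..1}" "\<And>i. i < n \<Longrightarrow> (\<lambda>k. X (r k) ! i) \<longlonglongrightarrow> l i" by auto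
  define L where "L = map l [0..<n]"
  have L: "L \<in> unit_cube n" using l(1) by (auto simp: L_def unit_cube_def)
  have "e / 2 > 0" using e by simp
  then obtain d where d: "d > 0" "\<And>ys. ys \<in> unit_cube n \<Longrightarrow> (\<forall>i<n. \<bar>ys ! i - L ! i\<bar> < d) \<Longrightarrow> \<bar>u ys - u L\<bar> < e / 2"
    using u L unfolding connective_def by blast
  have Xl: "\<forall>\<^sub>F k in sequentially. \<forall>i\<in>{..<n}. dist (X (r k) ! i) (l i) < d / 2"
    using tendstoD[OF l(2), of _ "d / 2"] d(1) by (intro eventually_ball_finite) simp_all
  have "(\<lambda>k. inverse (real (Suc (r k)))) \<longlonglongrightarrow> 0"
    using LIMSEQ_subseq_LIMSEQ[OF LIMSEQ_inverse_real_of_nat r] by (simp add: o_def)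
  then have "\<forall>\<^sub>F k in sequentially. inverse (real (Suc (r k))) < d / 2"
    by (rule order_tendstoD) (use d in simp)
  with Xl have "\<forall>\<^sub>F k in sequentially. (\<forall>i\<in>{..<n}. dist (X (r k) ! i) (l i) < d / 2) \<and>
      inverse (real (Suc (r k))) < d / 2" by (rule eventually_conj)
  then obtain k where k: "\<And>i. i < n \<Longrightarrow> \<bar>X (r k) ! i - l i\<bar> < d / 2" "inverse (real (Suc (r k))) < d / 2"
    unfolding eventually_sequentially dist_real_def by blast
  have "\<bar>u (X (r k)) - u L\<bar> < e / 2"
    by (rule d(2)[OF X]) (use k(1) d(1) in \<open>fastforce simp: L_def\<close>)
  moreover have "\<bar>u (Y (r k)) - u L\<bar> < e / 2"
  proof (rule d(2)[OF Y], intro allI impI)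
    fix i assume i: "i < n"
    have "\<bar>Y (r k) ! i - X (r k) ! i\<bar> < d / 2" using XY[OF i, of "r k"] k(2) by linarith
    then have "\<bar>Y (r k) ! i - l i\<bar> < d" using k(1)[OF i] by linarith
    then show "\<bar>Y (r k) ! i - L ! i\<bar> < d" using i by (simp add: L_def)
  qed
  ultimately have "\<bar>u (Y (r k)) - u (X (r k))\<bar> < e" by linarith
  then show False using far by blast
qed

text \<open>Tychonoff's theorem for a product of intervals. The closures of the sets of value
  profiles meeting finitely many constraints have the finite intersection property, and a common
  point is \<open>q\<close>. It plays the role of an element of a saturated extension, kept only as
  its family of values. The interval reaches down to -1 so that real and imaginary parts of
  coordinates may be among the observed quantities.\<close>

lemma approximate_compactness:
  fixes \<phi> :: "'x \<Rightarrow> 'i \<Rightarrow> real" and Cst :: "('i \<times> real) set"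
  assumes bnd: "\<And>x i. x \<in> X \<Longrightarrow> \<phi> x i \<in> {-1..1}"
    and sat: "\<And>C e. finite C \<Longrightarrow> C \<subseteq> Cst \<Longrightarrow> e > 0 \<Longrightarrow> \<exists>x\<in>X. \<forall>(i, c)\<in>C. \<bar>\<phi> x i - c\<bar> < e"
  obtains q where "\<And>i c. (i, c) \<in> Cst \<Longrightarrow> q i = c"
    "\<And>F e. finite F \<Longrightarrow> e > 0 \<Longrightarrow> \<exists>x\<in>X. \<forall>i\<in>F. \<bar>\<phi> x i - q i\<bar> < e"
proof -
  define P where "P = (PiE UNIV (\<lambda>_. {-1..1}) :: ('i \<Rightarrow> real) set)"
  have P: "compact P"
    unfolding P_def compactin_euclidean_iff[symmetric] euclidean_product_topology[symmetric] compactin_PiE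
    by simp
  define A where "A = (\<lambda>(C, e). \<phi> ` {x \<in> X. \<forall>(i, c)\<in>C. \<bar>\<phi> x i - c\<bar> < e})"
  define I where "I = {(C, e). finite C \<and> C \<subseteq> Cst \<and> (e :: real) > 0}"
  have AP: "A p \<subseteq> P" for p using bnd by (auto simp: A_def P_def split: prod.splits)
  have "P \<inter> (\<Inter>p\<in>I. closure (A p)) \<noteq> {}"
  proof (rule compact_imp_fip_image[OF P])
    fix I' assume I': "finite I'" "I' \<subseteq> I"
    define C where "C = (\<Union>p\<in>I'. fst p)"
    define e where "e = Min (insert 1 (snd ` I'))"
    have e: "e > 0" "\<And>p. p \<in> I' \<Longrightarrow> e \<le> snd p" using I' by (auto simp: e_def I_def subset_iff)
    have "finite C" "C \<subseteq> Cst" using I' by (auto simp: C_def I_def subset_iff)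
    from sat[OF this e(1)] obtain x where x: "x \<in> X" "\<forall>(i, c)\<in>C. \<bar>\<phi> x i - c\<bar> < e" by blast
    have "\<phi> x \<in> A p" if "p \<in> I'" for p
    proof (cases p)
      case (Pair D d)
      have "\<bar>\<phi> x i - c\<bar> < d" if "(i, c) \<in> D" for i c
        using x(2) that Pair \<open>p \<in> I'\<close> e(2)[OF \<open>p \<in> I'\<close>] unfolding C_def by force
      then show ?thesis using x(1) Pair unfolding A_def by auto
    qed
    then have "\<phi> x \<in> closure (A p)" if "p \<in> I'" for p using that closure_subset by blast
    moreover have "\<phi> x \<in> P" using x bnd by (auto simp: P_def)
    ultimately show "P \<inter> (\<Inter>p\<in>I'. closure (A p)) \<noteq> {}" by blast
  qed auto
  then obtain q where q: "\<And>p. p \<in> I \<Longrightarrow> q \<in> closure (A p)" by blast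
  have near: "\<exists>x\<in>X. (\<forall>(i, c)\<in>C. \<bar>\<phi> x i - c\<bar> < e) \<and> (\<forall>i\<in>F. \<bar>\<phi> x i - q i\<bar> < d)"
    if C: "finite C" "C \<subseteq> Cst" "e > 0" and F: "finite F" "d > 0" for C e F d
  proof -
    define U where "U = (\<Inter>i\<in>F. (\<lambda>f. f i) -` {q i - d <..< q i + d})"
    have "open U" unfolding U_def
      by (intro open_INT F(1) ballI open_vimage continuous_on_product_coordinates) auto
    moreover have "q \<in> U" using F(2) by (auto simp: U_def)
    moreover have "q \<in> closure (A (C, e))" using C by (intro q) (simp add: I_def)
    ultimately obtain f where "f \<in> A (C, e)" "f \<in> U"
      using open_Int_closure_eq_empty[of U "A (C, e)"] by blast
    then obtain x where x: "x \<in> X" "\<forall>(i, c)\<in>C. \<bar>\<phi> x i - c\<bar> < e" "\<phi> x \<in> U" unfolding A_def by auto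
    have "\<bar>\<phi> x i - q i\<bar> < d" if "i \<in> F" for i using x(3) that unfolding U_def by (auto simp: abs_less_iff)
    then show ?thesis using x by blast
  qed
  show ?thesis
  proof
    fix i c assume ic: "(i, c) \<in> Cst"
    have "\<bar>q i - c\<bar> \<le> 0 + e" if e: "e > 0" for e
    proof -
      obtain x where "\<bar>\<phi> x i - c\<bar> < e / 2" "\<bar>\<phi> x i - q i\<bar> < e / 2"
        using near[of "{(i, c)}" "e / 2" "{i}" "e / 2"] ic e by auto
      then show ?thesis by linarith
    qed
    then have "\<bar>q i - c\<bar> \<le> 0" by (rule field_le_epsilon)
    then show "q i = c" by simp
  next
    fix F :: "'i set" and e :: real assume "finite F" "e > 0"
    then show "\<exists>x\<in>X. \<forall>i\<in>F. \<bar>\<phi> x i - q i\<bar> < e" using near[of "{}" 1 F e] by auto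
  qed
qed

lemma abs_cSUP_diff_le:
  fixes f g :: "'a \<Rightarrow> real"
  assumes "A \<noteq> {}" "\<And>a. a \<in> A \<Longrightarrow> \<bar>f a - g a\<bar> \<le> e" "\<And>a. a \<in> A \<Longrightarrow> f a \<in> {0..1}" "\<And>a. a \<in> A \<Longrightarrow> g a \<in> {0..1}"
  shows "\<bar>(SUP a\<in>A. f a) - (SUP a\<in>A. g a)\<bar> \<le> e" and "\<bar>(INF a\<in>A. f a) - (INF a\<in>A. g a)\<bar> \<le> e"
proof -
  have b: "bdd_above (f ` A)" "bdd_above (g ` A)" "bdd_below (f ` A)" "bdd_below (g ` A)"
    using assms(3,4) by (auto intro!: bdd_aboveI[of _ 1] bdd_belowI[of _ 0])
  have "f a \<le> (SUP a\<in>A. g a) + e" "g a \<le> (SUP a\<in>A. f a) + e"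
    "(INF a\<in>A. g a) - e \<le> f a" "(INF a\<in>A. f a) - e \<le> g a" if "a \<in> A" for a
    using assms(2)[OF that] cSUP_upper[OF that b(1)] cSUP_upper[OF that b(2)]
      cINF_lower[OF b(3) that] cINF_lower[OF b(4) that] by linarith+
  then have "(SUP a\<in>A. f a) \<le> (SUP a\<in>A. g a) + e" "(SUP a\<in>A. g a) \<le> (SUP a\<in>A. f a) + e"
    "(INF a\<in>A. g a) - e \<le> (INF a\<in>A. f a)" "(INF a\<in>A. f a) - e \<le> (INF a\<in>A. g a)"
    using assms(1) by (auto intro!: cSUP_least cINF_greatest)
  then show "\<bar>(SUP a\<in>A. f a) - (SUP a\<in>A. g a)\<bar> \<le> e" "\<bar>(INF a\<in>A. f a) - (INF a\<in>A. g a)\<bar> \<le> e"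
    by linarith+
qed

section \<open>Dependence of values on free variables, and renaming\<close>

lemma tval_cong: "(\<And>i. i \<in> trm_vars t \<Longrightarrow> v i = w i) \<Longrightarrow> tval H T t v = tval H T t w"
  by (induction t) auto

lemma fval_cong: "(\<And>i. i \<in> free_vars f \<Longrightarrow> v i = w i) \<Longrightarrow> fval H T f v = fval H T f w"
proof (induction f arbitrary: v w)
  case (FDist s t)
  then have "tval H T s v = tval H T s w" "tval H T t v = tval H T t w" by (auto intro!: tval_cong)
  then show ?case by simp
next
  case (FNorm t)
  then have "tval H T t v = tval H T t w" by (auto intro!: tval_cong)
  then show ?case by simp
next
  case (FConn u fs)
  have "map (\<lambda>f. fval H T f v) fs = map (\<lambda>f. fval H T f w) fs"
    using FConn.prems by (intro map_cong refl FConn.IH) auto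
  then show ?case by (simp only: fval.simps)
next
  case (FSup n f)
  have "fval H T f (v(n := a)) = fval H T f (w(n := a))" for a
    by (rule FSup.IH) (use FSup.prems in auto)
  then show ?case by simp
next
  case (FInf n f)
  have "fval H T f (v(n := a)) = fval H T f (w(n := a))" for a
    by (rule FInf.IH) (use FInf.prems in auto)
  then show ?case by simp
qed

lemma tval_rename: "tval H T (trm_rename r t) v = tval H T t (v \<circ> r)"
  by (induction t) auto

lemma fval_rename:
  assumes r: "inj r" shows "fval H T (fml_rename r f) v = fval H T f (v \<circ> r)"
proof (induction f arbitrary: v)
  case (FConn u fs)
  have "map (\<lambda>f. fval H T f v) (map (fml_rename r) fs) = map (\<lambda>f. fval H T f (v \<circ> r)) fs"
    using FConn.IH by (simp add: o_def)
  then show ?case by (simp only: fval.simps fml_rename.simps)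
next
  case (FSup n f)
  have "v(r n := a) \<circ> r = (v \<circ> r)(n := a)" for a using r by (auto simp: fun_eq_iff inj_eq)
  then show ?case by (simp only: fval.simps fml_rename.simps FSup.IH)
next
  case (FInf n f)
  have "v(r n := a) \<circ> r = (v \<circ> r)(n := a)" for a using r by (auto simp: fun_eq_iff inj_eq)
  then show ?case by (simp only: fval.simps fml_rename.simps FInf.IH)
qed (simp_all add: tval_rename)

lemma trm_rename_pars [simp]: "trm_pars (trm_rename r t) = trm_pars t"
  by (induction t) auto

lemma fml_rename_pars [simp]: "fml_pars (fml_rename r f) = fml_pars f"
  by (induction f) auto

lemma wf_fml_rename [simp]: "wf_fml (fml_rename r f) = wf_fml f"
  by (induction f) auto

lemma trm_rename_vars [simp]: "trm_vars (trm_rename r t) = r ` trm_vars t"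
  by (induction t) auto

lemma fml_rename_vars: "inj r \<Longrightarrow> free_vars (fml_rename r f) = r ` free_vars f"
  by (induction f) (auto simp: image_Un image_set_diff)

section \<open>Hilbert space records as instances of the abstract locale\<close>

lemma (in complex_hilbert_space) zero_smult: "x \<in> carrier H \<Longrightarrow> 0 \<odot>\<^bsub>H\<^esub> x = \<zero>\<^bsub>H\<^esub>"
  using smult_l_null[of x] by (simp add: complex_cring_def)

lemma (in complex_hilbert_space) smult_scalar_closed: "x \<in> carrier H \<Longrightarrow> c \<odot>\<^bsub>H\<^esub> x \<in> carrier H"
  using smult_closed[of c x] by (simp add: complex_cring_def)

lemma (in complex_hilbert_space) uminus_eq_smult: "x \<in> carrier H \<Longrightarrow> \<ominus>\<^bsub>H\<^esub> x = (-1) \<odot>\<^bsub>H\<^esub> x"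
proof -
  assume x: "x \<in> carrier H"
  have "((-1) + 1) \<odot>\<^bsub>H\<^esub> x = (-1) \<odot>\<^bsub>H\<^esub> x \<oplus>\<^bsub>H\<^esub> 1 \<odot>\<^bsub>H\<^esub> x"
    using smult_l_distr[of "-1" 1 x] x by (simp add: complex_cring_def)
  moreover have "1 \<odot>\<^bsub>H\<^esub> x = x" using smult_one[OF x] by (simp add: complex_cring_def)
  ultimately have "(-1) \<odot>\<^bsub>H\<^esub> x \<oplus>\<^bsub>H\<^esub> x = \<zero>\<^bsub>H\<^esub>" using zero_smult[OF x] by simp
  then show ?thesis using x smult_scalar_closed[OF x, of "-1"] by (metis minus_equality)
qed

lemma (in complex_hilbert_space) minus_eq_smult:
  "x \<in> carrier H \<Longrightarrow> y \<in> carrier H \<Longrightarrow> x \<ominus>\<^bsub>H\<^esub> y = x \<oplus>\<^bsub>H\<^esub> (-1) \<odot>\<^bsub>H\<^esub> y"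
  by (simp add: minus_eq uminus_eq_smult)

sublocale complex_hilbert_space \<subseteq> Hil: hilbert "carrier H" "\<zero>\<^bsub>H\<^esub>" "add H" "smult H" "hinner H"
proof
  show "\<zero>\<^bsub>H\<^esub> \<in> carrier H" by simp
next
  fix x y z c assume xy: "x \<in> carrier H" "y \<in> carrier H"
  then show "x \<oplus>\<^bsub>H\<^esub> y \<in> carrier H" "c \<odot>\<^bsub>H\<^esub> x \<in> carrier H"
    by (simp_all add: smult_scalar_closed)
  show "hinner H \<zero>\<^bsub>H\<^esub> y = 0"
    using hinner_smult_left[OF xy(2,2), of 0] by (simp add: zero_smult xy)
  show "hinner H (c \<odot>\<^bsub>H\<^esub> x) y = c * hinner H x y" "hinner H y x = cnj (hinner H x y)"
    "0 \<le> Re (hinner H x x)"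
    using xy hinner_smult_left hinner_commute hinner_nonneg by blast+
  show "hinner H (x \<oplus>\<^bsub>H\<^esub> y) z = hinner H x z + hinner H y z" if "z \<in> carrier H"
    using that xy hinner_add_left by blast
  assume "hinner H (x \<oplus>\<^bsub>H\<^esub> (-1) \<odot>\<^bsub>H\<^esub> y) (x \<oplus>\<^bsub>H\<^esub> (-1) \<odot>\<^bsub>H\<^esub> y) = 0"
  then have "x \<ominus>\<^bsub>H\<^esub> y = \<zero>\<^bsub>H\<^esub>"
    using hinner_definite[of "x \<ominus>\<^bsub>H\<^esub> y"] xy minus_closed[OF xy] by (simp add: minus_eq_smult)
  then show "x = y" using xy by (metis a_inv_closed minus_eq minus_equality minus_minus)
next
  fix X :: "nat \<Rightarrow> 'u"
  assume X: "\<And>n. X n \<in> carrier H" and C: "\<And>e. e > 0 \<Longrightarrow> \<exists>N. \<forall>i\<ge>N. \<forall>j\<ge>N.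
     sqrt (Re (hinner H (X i \<oplus>\<^bsub>H\<^esub> (-1) \<odot>\<^bsub>H\<^esub> X j) (X i \<oplus>\<^bsub>H\<^esub> (-1) \<odot>\<^bsub>H\<^esub> X j))) < e"
  have "\<exists>l\<in>carrier H. (\<lambda>n. hnorm H (X n \<ominus>\<^bsub>H\<^esub> l)) \<longlonglongrightarrow> 0"
    by (rule hcomplete[OF X]) (use C X in \<open>simp add: hnorm_def minus_eq_smult\<close>)
  then obtain l where l: "l \<in> carrier H" "(\<lambda>n. hnorm H (X n \<ominus>\<^bsub>H\<^esub> l)) \<longlonglongrightarrow> 0" by blast
  then show "\<exists>l\<in>carrier H. (\<lambda>n. sqrt (Re (hinner H (X n \<oplus>\<^bsub>H\<^esub> (-1) \<odot>\<^bsub>H\<^esub> l)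
      (X n \<oplus>\<^bsub>H\<^esub> (-1) \<odot>\<^bsub>H\<^esub> l)))) \<longlonglongrightarrow> 0"
    using X by (intro bexI[of _ l]) (simp_all add: hnorm_def minus_eq_smult)
qed

lemma (in complex_hilbert_space) hnorm_eq: "hnorm H x = Hil.nm x"
  by (simp add: hnorm_def Hil.nm_def)

section \<open>Approximate automorphisms of a model\<close>

locale contraction_model = complex_hilbert_space H for H :: "'u hilb" +
  fixes T :: "'u \<Rightarrow> 'u"
  assumes lin_op: "Hil.lin T" and op_le: "x \<in> carrier H \<Longrightarrow> Hil.nm (T x) \<le> Hil.nm x"
begin

abbreviation "B1 \<equiv> unit_ball H"

abbreviation sub :: "'u \<Rightarrow> 'u \<Rightarrow> 'u" (infixl "\<boxminus>" 65) where
  "x \<boxminus> y \<equiv> x \<oplus>\<^bsub>H\<^esub> (-1) \<odot>\<^bsub>H\<^esub> y"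

lemma ball_iff: "x \<in> B1 \<longleftrightarrow> x \<in> carrier H \<and> Hil.nm x \<le> 1"
  by (simp add: unit_ball_def hnorm_eq)

lemma ballD: "x \<in> B1 \<Longrightarrow> x \<in> carrier H" "x \<in> B1 \<Longrightarrow> Hil.nm x \<le> 1"
  by (simp_all add: ball_iff)

lemma zero_ball: "\<zero>\<^bsub>H\<^esub> \<in> B1"
  by (simp add: ball_iff)

lemma op_ball: "x \<in> B1 \<Longrightarrow> T x \<in> B1"
  using op_le[of x] Hil.linD[OF lin_op] by (auto simp: ball_iff)

lemma tval_ball: "trm_pars t \<subseteq> B1 \<Longrightarrow> range v \<subseteq> B1 \<Longrightarrow> tval H T t v \<in> B1"
proof (induction t)
  case (TMinus t)
  then have "tval H T t v \<in> B1" by simp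
  then show ?case by (simp add: ball_iff uminus_eq_smult Hil.nm_sm)
next
  case (TImag t)
  then have "tval H T t v \<in> B1" by simp
  then show ?case by (simp add: ball_iff Hil.nm_sm)
next
  case (TAvg s t)
  then have "tval H T s v \<in> B1" "tval H T t v \<in> B1" by simp_all
  then show ?case
    using Hil.nm_triangle[of "tval H T s v" "tval H T t v"] by (simp add: ball_iff Hil.nm_sm)
next
  case (TOp t)
  then show ?case using op_ball by simp
qed (auto simp: zero_ball)

lemma fval_FDist: "s' = tval H T s v \<Longrightarrow> t' = tval H T t v \<Longrightarrow> s' \<in> B1 \<Longrightarrow> t' \<in> B1 \<Longrightarrow>
    fval H T (FDist s t) v = Hil.nm (s' \<boxminus> t') / 2"
  using ballD by (simp add: hnorm_eq minus_eq_smult)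

lemma fval_range:
  "wf_fml f \<Longrightarrow> fml_pars f \<subseteq> B1 \<Longrightarrow> range v \<subseteq> B1 \<Longrightarrow> fval H T f v \<in> {0..1}"
proof (induction f arbitrary: v)
  case (FDist s t)
  then have st: "tval H T s v \<in> B1" "tval H T t v \<in> B1" by (simp_all add: tval_ball)
  then have "Hil.nm (tval H T s v \<boxminus> tval H T t v) \<le> 2"
    using Hil.nm_triangle_mi[of "tval H T s v" "tval H T t v"] by (simp add: ball_iff)
  then show ?case unfolding fval_FDist[OF refl refl st] using ballD(1)[OF st(1)] ballD(1)[OF st(2)] by simp
next
  case (FNorm t)
  then have "tval H T t v \<in> B1" by (simp add: tval_ball)
  then show ?case by (simp add: hnorm_eq ball_iff)
next
  case (FConn u fs)
  have "fval H T f v \<in> {0..1}" if "f \<in> set fs" for f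
    by (rule FConn.IH[OF that]) (use FConn.prems that in auto)
  then have "map (\<lambda>f. fval H T f v) fs \<in> unit_cube (length fs)"
    by (auto simp: unit_cube_def)
  then show ?case using FConn.prems(1) by (simp add: connective_def del: atLeastAtMost_iff)
next
  case (FSup n f)
  have *: "fval H T f (v(n := a)) \<in> {0..1}" if "a \<in> B1" for a
    by (rule FSup.IH) (use FSup.prems that in auto)
  have "(SUP a\<in>B1. fval H T f (v(n := a))) \<le> 1"
    by (rule cSUP_least) (use zero_ball * in auto)
  moreover have "fval H T f (v(n := \<zero>\<^bsub>H\<^esub>)) \<le> (SUP a\<in>B1. fval H T f (v(n := a)))"
    by (rule cSUP_upper[OF zero_ball]) (use * in \<open>auto intro!: bdd_aboveI[of _ 1]\<close>)
  ultimately show ?case using *[OF zero_ball] by simp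
next
  case (FInf n f)
  have *: "fval H T f (v(n := a)) \<in> {0..1}" if "a \<in> B1" for a
    by (rule FInf.IH) (use FInf.prems that in auto)
  have "0 \<le> (INF a\<in>B1. fval H T f (v(n := a)))"
    by (rule cINF_greatest) (use zero_ball * in auto)
  moreover have "(INF a\<in>B1. fval H T f (v(n := a))) \<le> fval H T f (v(n := \<zero>\<^bsub>H\<^esub>))"
    by (rule cINF_lower[OF _ zero_ball]) (use * in \<open>auto intro!: bdd_belowI[of _ 0]\<close>)
  ultimately show ?case using *[OF zero_ball] by simp
qed

text \<open>For \<open>d = 0\<close> these are automorphisms of the model over \<open>B\<close>.
  Only the parameters have to stay near their place; other vectors may move far.\<close>

definition almost_automorphism :: "real \<Rightarrow> 'u set \<Rightarrow> ('u \<Rightarrow> 'u) \<Rightarrow> bool" where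
  "almost_automorphism d B g \<longleftrightarrow> Hil.unitary g \<and> (\<forall>z\<in>B1. Hil.nm (T (g z) \<boxminus> g (T z)) \<le> d) \<and>
     (\<forall>b\<in>B. Hil.nm (g b \<boxminus> b) \<le> d)"

lemma almost_automorphism_mono:
  "almost_automorphism d B g \<Longrightarrow> d \<le> d' \<Longrightarrow> B' \<subseteq> B \<Longrightarrow> almost_automorphism d' B' g"
  unfolding almost_automorphism_def by (meson order_trans subsetD)

lemma unitary_ball: assumes "Hil.unitary g" shows "g ` B1 = B1"
proof
  show "g ` B1 \<subseteq> B1"
    using Hil.unitary_nm[OF assms] Hil.linD[OF Hil.unitaryD(1)[OF assms]] by (auto simp: ball_iff)
  show "B1 \<subseteq> g ` B1"
  proof
    fix x assume x: "x \<in> B1"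
    then obtain y where "y \<in> carrier H" "x = g y"
      using Hil.unitaryD(2)[OF assms] ballD(1) by blast
    then show "x \<in> g ` B1" using x Hil.unitary_nm[OF assms] by (auto simp: ball_iff)
  qed
qed

text \<open>The factor \<open>n\<close> counts occurrences: a parameter costs one displacement, an
  operator symbol one commutator, and the other symbols commute with the linear map
  \<open>g\<close>. Errors already present are not enlarged by \<open>T\<close>, a
  contraction.\<close>

lemma tval_almost_automorphism:
  assumes "trm_pars t \<subseteq> B1"
  shows "\<exists>n\<ge>0. \<forall>d\<ge>0. \<forall>g v. almost_automorphism d (trm_pars t) g \<longrightarrow> range v \<subseteq> B1 \<longrightarrow>
     Hil.nm (tval H T t (g \<circ> v) \<boxminus> g (tval H T t v)) \<le> n * d"
  using assms
proof (induction t)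
  case (Var i)
  have "Hil.nm (tval H T (Var i) (g \<circ> v) \<boxminus> g (tval H T (Var i) v)) \<le> 0 * d"
    if "almost_automorphism d (trm_pars (Var i)) g" "range v \<subseteq> B1" for d g v
  proof -
    have "v i \<in> carrier H" using that(2) ballD(1) by blast
    then have "g (v i) \<in> carrier H"
      using that(1) Hil.linD[OF Hil.unitaryD(1)] by (auto simp: almost_automorphism_def)
    then show ?thesis using Hil.mi_eq_zr[of "g (v i)" "g (v i)"] by simp
  qed
  then show ?case by blast
next
  case (Par b)
  have "Hil.nm (tval H T (Par b) (g \<circ> v) \<boxminus> g (tval H T (Par b) v)) \<le> 1 * d"
    if "almost_automorphism d (trm_pars (Par b)) g" for d g v
  proof -
    have b: "b \<in> carrier H" using Par ballD(1) by simp
    then have "g b \<in> carrier H"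
      using that(1) Hil.linD[OF Hil.unitaryD(1)] by (auto simp: almost_automorphism_def)
    then show ?thesis using that Hil.nm_mi_commute[of b "g b"] b by (simp add: almost_automorphism_def)
  qed
  then show ?case by (metis zero_le_one)
next
  case TZero
  have "Hil.nm (tval H T TZero (g \<circ> v) \<boxminus> g (tval H T TZero v)) \<le> 0 * d"
    if "almost_automorphism d (trm_pars TZero) g" for d g v
  proof -
    have "g \<zero>\<^bsub>H\<^esub> = \<zero>\<^bsub>H\<^esub>"
      using that Hil.lin_zr[OF Hil.unitaryD(1)] by (auto simp: almost_automorphism_def)
    then show ?thesis using Hil.mi_eq_zr[of "\<zero>\<^bsub>H\<^esub>" "\<zero>\<^bsub>H\<^esub>"] by simp
  qed
  then show ?case by blast
next
  case (TMinus t)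
  have "trm_pars t \<subseteq> B1" using TMinus.prems by simp
  from TMinus.IH[OF this] obtain n where n: "n \<ge> 0" "\<And>d g v. d \<ge> 0 \<Longrightarrow> almost_automorphism d (trm_pars t) g \<Longrightarrow>
      range v \<subseteq> B1 \<Longrightarrow> Hil.nm (tval H T t (g \<circ> v) \<boxminus> g (tval H T t v)) \<le> n * d" by blast
  have "Hil.nm (tval H T (TMinus t) (g \<circ> v) \<boxminus> g (tval H T (TMinus t) v)) \<le> n * d"
    if "d \<ge> 0" and g: "almost_automorphism d (trm_pars (TMinus t)) g" and v: "range v \<subseteq> B1" for d g v
  proof -
    have u: "Hil.unitary g" using g by (simp add: almost_automorphism_def)
    note lg = Hil.unitaryD(1)[OF u]
    have gv: "range (g \<circ> v) \<subseteq> B1" using v unitary_ball[OF u] by fastforce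
    let ?a = "tval H T t (g \<circ> v)" and ?b = "tval H T t v"
    have ab: "?a \<in> carrier H" "?b \<in> carrier H" "g ?b \<in> carrier H"
      using tval_ball[OF _ gv] tval_ball[OF _ v] TMinus.prems ballD(1) Hil.linD[OF lg] by auto
    have "tval H T (TMinus t) (g \<circ> v) \<boxminus> g (tval H T (TMinus t) v) = (-1) \<odot>\<^bsub>H\<^esub> (?a \<boxminus> g ?b)"
      using ab by (intro Hil.vec_eqI) (auto simp: uminus_eq_smult Hil.lin_sm[OF lg])
    then show ?thesis using n(2)[OF that(1) _ v, of g] g ab by (simp add: Hil.nm_sm)
  qed
  then show ?case using n(1) by blast
next
  case (TImag t)
  have "trm_pars t \<subseteq> B1" using TImag.prems by simp
  from TImag.IH[OF this] obtain n where n: "n \<ge> 0" "\<And>d g v. d \<ge> 0 \<Longrightarrow> almost_automorphism d (trm_pars t) g \<Longrightarrow>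
      range v \<subseteq> B1 \<Longrightarrow> Hil.nm (tval H T t (g \<circ> v) \<boxminus> g (tval H T t v)) \<le> n * d" by blast
  have "Hil.nm (tval H T (TImag t) (g \<circ> v) \<boxminus> g (tval H T (TImag t) v)) \<le> n * d"
    if "d \<ge> 0" and g: "almost_automorphism d (trm_pars (TImag t)) g" and v: "range v \<subseteq> B1" for d g v
  proof -
    have u: "Hil.unitary g" using g by (simp add: almost_automorphism_def)
    note lg = Hil.unitaryD(1)[OF u]
    have gv: "range (g \<circ> v) \<subseteq> B1" using v unitary_ball[OF u] by fastforce
    let ?a = "tval H T t (g \<circ> v)" and ?b = "tval H T t v"
    have ab: "?a \<in> carrier H" "?b \<in> carrier H" "g ?b \<in> carrier H"
      using tval_ball[OF _ gv] tval_ball[OF _ v] TImag.prems ballD(1) Hil.linD[OF lg] by auto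
    have "tval H T (TImag t) (g \<circ> v) \<boxminus> g (tval H T (TImag t) v) = \<i> \<odot>\<^bsub>H\<^esub> (?a \<boxminus> g ?b)"
      using ab by (intro Hil.vec_eqI) (auto simp: Hil.lin_sm[OF lg] algebra_simps)
    then show ?thesis using n(2)[OF that(1) _ v, of g] g ab by (simp add: Hil.nm_sm)
  qed
  then show ?case using n(1) by blast
next
  case (TAvg s t)
  have st: "trm_pars s \<subseteq> B1" "trm_pars t \<subseteq> B1" using TAvg.prems by simp_all
  from TAvg.IH(1)[OF st(1)] obtain m where m: "m \<ge> 0" "\<And>d g v. d \<ge> 0 \<Longrightarrow> almost_automorphism d (trm_pars s) g \<Longrightarrow>
      range v \<subseteq> B1 \<Longrightarrow> Hil.nm (tval H T s (g \<circ> v) \<boxminus> g (tval H T s v)) \<le> m * d" by blast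
  from TAvg.IH(2)[OF st(2)] obtain n where n: "n \<ge> 0" "\<And>d g v. d \<ge> 0 \<Longrightarrow> almost_automorphism d (trm_pars t) g \<Longrightarrow>
      range v \<subseteq> B1 \<Longrightarrow> Hil.nm (tval H T t (g \<circ> v) \<boxminus> g (tval H T t v)) \<le> n * d" by blast
  have "Hil.nm (tval H T (TAvg s t) (g \<circ> v) \<boxminus> g (tval H T (TAvg s t) v)) \<le> (m + n) * d"
    if d: "d \<ge> 0" and g: "almost_automorphism d (trm_pars (TAvg s t)) g" and v: "range v \<subseteq> B1" for d g v
  proof -
    have u: "Hil.unitary g" using g by (simp add: almost_automorphism_def)
    note lg = Hil.unitaryD(1)[OF u]
    have gv: "range (g \<circ> v) \<subseteq> B1" using v unitary_ball[OF u] by fastforce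
    let ?a = "tval H T t (g \<circ> v)" and ?b = "tval H T t v"
    let ?c = "tval H T s (g \<circ> v)" and ?e = "tval H T s v"
    have ab: "?a \<in> carrier H" "?b \<in> carrier H" "g ?b \<in> carrier H"
      "?c \<in> carrier H" "?e \<in> carrier H" "g ?e \<in> carrier H"
      using tval_ball[OF _ gv] tval_ball[OF _ v] TAvg.prems ballD(1) Hil.linD[OF lg] by auto
    have "tval H T (TAvg s t) (g \<circ> v) \<boxminus> g (tval H T (TAvg s t) v)
        = (1/2) \<odot>\<^bsub>H\<^esub> ((?c \<boxminus> g ?e) \<oplus>\<^bsub>H\<^esub> (?a \<boxminus> g ?b))"
      using ab by (intro Hil.vec_eqI) (auto simp: Hil.lin_sm[OF lg] Hil.lin_ad[OF lg] algebra_simps)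
    then have "Hil.nm (tval H T (TAvg s t) (g \<circ> v) \<boxminus> g (tval H T (TAvg s t) v))
        = Hil.nm ((?c \<boxminus> g ?e) \<oplus>\<^bsub>H\<^esub> (?a \<boxminus> g ?b)) / 2" using ab by (simp add: Hil.nm_sm)
    also have "\<dots> \<le> (Hil.nm (?c \<boxminus> g ?e) + Hil.nm (?a \<boxminus> g ?b)) / 2"
      using Hil.nm_triangle[of "?c \<boxminus> g ?e" "?a \<boxminus> g ?b"] ab by simp
    also have "\<dots> \<le> (m * d + n * d) / 2"
      using m(2)[OF d _ v, of g] n(2)[OF d _ v, of g] almost_automorphism_mono[OF g order_refl]
      by (intro divide_right_mono add_mono) auto
    also have "\<dots> \<le> (m + n) * d" using m(1) n(1) d by (simp add: algebra_simps)
    finally show ?thesis .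
  qed
  moreover have "m + n \<ge> 0" using m n by simp
  ultimately show ?case by blast
next
  case (TOp t)
  have "trm_pars t \<subseteq> B1" using TOp.prems by simp
  from TOp.IH[OF this] obtain n where n: "n \<ge> 0" "\<And>d g v. d \<ge> 0 \<Longrightarrow> almost_automorphism d (trm_pars t) g \<Longrightarrow>
      range v \<subseteq> B1 \<Longrightarrow> Hil.nm (tval H T t (g \<circ> v) \<boxminus> g (tval H T t v)) \<le> n * d" by blast
  have "Hil.nm (tval H T (TOp t) (g \<circ> v) \<boxminus> g (tval H T (TOp t) v)) \<le> (n + 1) * d"
    if d: "d \<ge> 0" and g: "almost_automorphism d (trm_pars (TOp t)) g" and v: "range v \<subseteq> B1" for d g v
  proof -
    have u: "Hil.unitary g" using g by (simp add: almost_automorphism_def)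
    note lg = Hil.unitaryD(1)[OF u]
    have gv: "range (g \<circ> v) \<subseteq> B1" using v unitary_ball[OF u] by fastforce
    let ?a = "tval H T t (g \<circ> v)" and ?b = "tval H T t v"
    have b: "?b \<in> B1" using tval_ball[OF _ v] TOp.prems by simp
    have ab: "?a \<in> carrier H" "?b \<in> carrier H" "g ?b \<in> carrier H" "T ?a \<in> carrier H"
      "T (g ?b) \<in> carrier H" "g (T ?b) \<in> carrier H"
      using tval_ball[OF _ gv] b TOp.prems ballD(1) Hil.linD[OF lg] Hil.linD[OF lin_op] by auto
    have "Hil.nm (T ?a \<boxminus> g (T ?b)) \<le> Hil.nm (T ?a \<boxminus> T (g ?b)) + Hil.nm (T (g ?b) \<boxminus> g (T ?b))"
      by (rule Hil.nm_dist_triangle) (use ab in auto)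
    moreover have "Hil.nm (T ?a \<boxminus> T (g ?b)) \<le> n * d"
    proof -
      have "T ?a \<boxminus> T (g ?b) = T (?a \<boxminus> g ?b)" using Hil.lin_mi[OF lin_op ab(1,3)] by simp
      then have "Hil.nm (T ?a \<boxminus> T (g ?b)) \<le> Hil.nm (?a \<boxminus> g ?b)" using op_le[of "?a \<boxminus> g ?b"] ab by simp
      also have "\<dots> \<le> n * d" using n(2)[OF d _ v, of g] g by simp
      finally show ?thesis .
    qed
    moreover have "Hil.nm (T (g ?b) \<boxminus> g (T ?b)) \<le> d" using g b by (simp add: almost_automorphism_def)
    ultimately show ?thesis by (simp add: algebra_simps)
  qed
  moreover have "n + 1 \<ge> 0" using n by simp
  ultimately show ?case by blast
qed

text \<open>Uniform continuity absorbs the errors at connectives. At quantifiers no new error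
  arises: a unitary maps the unit ball onto itself, so the bound variable can be reparametrised by
  \<open>g\<close>.\<close>

lemma fval_almost_automorphism:
  assumes "wf_fml f" "fml_pars f \<subseteq> B1" "e > 0"
  shows "\<exists>d>0. \<forall>g v. almost_automorphism d (fml_pars f) g \<longrightarrow> range v \<subseteq> B1 \<longrightarrow>
     \<bar>fval H T f (g \<circ> v) - fval H T f v\<bar> \<le> e"
  using assms
proof (induction f arbitrary: e)
  case (FDist s t)
  obtain m where m: "m \<ge> 0" "\<And>d g v. d \<ge> 0 \<Longrightarrow> almost_automorphism d (trm_pars s) g \<Longrightarrow>
      range v \<subseteq> B1 \<Longrightarrow> Hil.nm (tval H T s (g \<circ> v) \<boxminus> g (tval H T s v)) \<le> m * d"
    using tval_almost_automorphism[of s] FDist.prems(2) unfolding fml.set by blast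
  obtain n where n: "n \<ge> 0" "\<And>d g v. d \<ge> 0 \<Longrightarrow> almost_automorphism d (trm_pars t) g \<Longrightarrow>
      range v \<subseteq> B1 \<Longrightarrow> Hil.nm (tval H T t (g \<circ> v) \<boxminus> g (tval H T t v)) \<le> n * d"
    using tval_almost_automorphism[of t] FDist.prems(2) unfolding fml.set by blast
  define d where "d = e / (m + n + 1)"
  have d: "d > 0" "(m + n) * d \<le> e"
    using m n FDist.prems(3) by (auto simp: d_def pos_divide_le_eq field_simps)
  have "\<bar>fval H T (FDist s t) (g \<circ> v) - fval H T (FDist s t) v\<bar> \<le> e"
    if g: "almost_automorphism d (fml_pars (FDist s t)) g" and v: "range v \<subseteq> B1" for g v
  proof -
    have u: "Hil.unitary g" using g by (simp add: almost_automorphism_def)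
    note lg = Hil.unitaryD(1)[OF u]
    have gv: "range (g \<circ> v) \<subseteq> B1" using v unitary_ball[OF u] by fastforce
    let ?a = "tval H T t (g \<circ> v)" and ?b = "tval H T t v"
    let ?c = "tval H T s (g \<circ> v)" and ?x = "tval H T s v"
    have abB: "?a \<in> B1" "?b \<in> B1" "?c \<in> B1" "?x \<in> B1"
      using tval_ball[OF _ gv] tval_ball[OF _ v] FDist.prems by auto
    have ab: "?a \<in> carrier H" "?b \<in> carrier H" "g ?b \<in> carrier H"
      "?c \<in> carrier H" "?x \<in> carrier H" "g ?x \<in> carrier H"
      using abB ballD(1) Hil.linD[OF lg] by auto
    have eq: "Hil.nm (g ?x \<boxminus> g ?b) = Hil.nm (?x \<boxminus> ?b)"
      using Hil.unitary_nm[OF u, of "?x \<boxminus> ?b"] Hil.lin_mi[OF lg ab(5,2)] ab by simp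
    have "(?c \<boxminus> ?a) \<boxminus> (g ?x \<boxminus> g ?b) = (?c \<boxminus> g ?x) \<boxminus> (?a \<boxminus> g ?b)"
      using ab by (intro Hil.vec_eqI) auto
    then have "\<bar>Hil.nm (?c \<boxminus> ?a) - Hil.nm (g ?x \<boxminus> g ?b)\<bar> \<le> Hil.nm ((?c \<boxminus> g ?x) \<boxminus> (?a \<boxminus> g ?b))"
      using Hil.nm_diff_le[of "?c \<boxminus> ?a" "g ?x \<boxminus> g ?b"] ab by simp
    also have "\<dots> \<le> Hil.nm (?c \<boxminus> g ?x) + Hil.nm (?a \<boxminus> g ?b)"
      by (rule Hil.nm_triangle_mi) (use ab in auto)
    also have "\<dots> \<le> m * d + n * d"
      using m(2)[of d g v] n(2)[of d g v] d(1) v almost_automorphism_mono[OF g order_refl]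
      by (intro add_mono) auto
    also have "\<dots> \<le> e" using d(2) by (simp add: algebra_simps)
    finally have "\<bar>Hil.nm (?c \<boxminus> ?a) - Hil.nm (?x \<boxminus> ?b)\<bar> \<le> e" unfolding eq .
    then show ?thesis
      unfolding fval_FDist[OF refl refl abB(3,1)] fval_FDist[OF refl refl abB(4,2)] by linarith
  qed
  then show ?case using d(1) by blast
next
  case (FNorm t)
  obtain n where n: "n \<ge> 0" "\<And>d g v. d \<ge> 0 \<Longrightarrow> almost_automorphism d (trm_pars t) g \<Longrightarrow>
      range v \<subseteq> B1 \<Longrightarrow> Hil.nm (tval H T t (g \<circ> v) \<boxminus> g (tval H T t v)) \<le> n * d"
    using tval_almost_automorphism[of t] FNorm.prems(2) unfolding fml.set by blast
  define d where "d = e / (n + 1)"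
  have d: "d > 0" "n * d \<le> e"
    using n FNorm.prems(3) by (auto simp: d_def pos_divide_le_eq field_simps)
  have "\<bar>fval H T (FNorm t) (g \<circ> v) - fval H T (FNorm t) v\<bar> \<le> e"
    if g: "almost_automorphism d (fml_pars (FNorm t)) g" and v: "range v \<subseteq> B1" for g v
  proof -
    have u: "Hil.unitary g" using g by (simp add: almost_automorphism_def)
    note lg = Hil.unitaryD(1)[OF u]
    have gv: "range (g \<circ> v) \<subseteq> B1" using v unitary_ball[OF u] by fastforce
    let ?a = "tval H T t (g \<circ> v)" and ?b = "tval H T t v"
    have ab: "?a \<in> carrier H" "?b \<in> carrier H" "g ?b \<in> carrier H"
      using tval_ball[OF _ gv] tval_ball[OF _ v] FNorm.prems ballD(1) Hil.linD[OF lg] by auto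
    have "\<bar>Hil.nm ?a - Hil.nm (g ?b)\<bar> \<le> n * d"
      using Hil.nm_diff_le[OF ab(1,3)] n(2)[of d g v] d(1) v g by simp
    then show ?thesis using d(2) Hil.unitary_nm[OF u ab(2)] by (simp add: hnorm_eq)
  qed
  then show ?case using d(1) by blast
next
  case (FConn u fs)
  have "connective (length fs) u" using FConn.prems by simp
  from connective_uniformly_continuous[OF this FConn.prems(3)]
  obtain r where r: "r > 0" "\<And>xs ys. xs \<in> unit_cube (length fs) \<Longrightarrow> ys \<in> unit_cube (length fs) \<Longrightarrow>
      (\<forall>i<length fs. \<bar>ys ! i - xs ! i\<bar> \<le> r) \<Longrightarrow> \<bar>u ys - u xs\<bar> < e" by blast
  have "\<exists>d>0. \<forall>g v. almost_automorphism d (fml_pars f) g \<longrightarrow> range v \<subseteq> B1 \<longrightarrow>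
     \<bar>fval H T f (g \<circ> v) - fval H T f v\<bar> \<le> r" if "f \<in> set fs" for f
    by (rule FConn.IH[OF that]) (use FConn.prems that r in auto)
  then obtain D where D: "\<And>f. f \<in> set fs \<Longrightarrow> D f > 0"
    "\<And>f g v. f \<in> set fs \<Longrightarrow> almost_automorphism (D f) (fml_pars f) g \<Longrightarrow> range v \<subseteq> B1 \<Longrightarrow>
     \<bar>fval H T f (g \<circ> v) - fval H T f v\<bar> \<le> r" by metis
  define d where "d = Min (insert 1 (D ` set fs))"
  have d: "d > 0" "\<And>f. f \<in> set fs \<Longrightarrow> d \<le> D f" using D(1) by (auto simp: d_def)
  have "\<bar>fval H T (FConn u fs) (g \<circ> v) - fval H T (FConn u fs) v\<bar> \<le> e"
    if g: "almost_automorphism d (fml_pars (FConn u fs)) g" and v: "range v \<subseteq> B1" for g v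
  proof -
    have "Hil.unitary g" using g by (simp add: almost_automorphism_def)
    then have gv: "range (g \<circ> v) \<subseteq> B1" using v unitary_ball by fastforce
    have "\<bar>u (map (\<lambda>f. fval H T f (g \<circ> v)) fs) - u (map (\<lambda>f. fval H T f v) fs)\<bar> < e"
    proof (rule r(2))
      have rng: "fval H T f w \<in> {0..1}" if "f \<in> set fs" "range w \<subseteq> B1" for f w
        by (rule fval_range) (use that FConn.prems in auto)
      show "map (\<lambda>f. fval H T f v) fs \<in> unit_cube (length fs)"
        "map (\<lambda>f. fval H T f (g \<circ> v)) fs \<in> unit_cube (length fs)"
        using rng v gv by (auto simp: unit_cube_def simp del: atLeastAtMost_iff)
      have "\<bar>fval H T f (g \<circ> v) - fval H T f v\<bar> \<le> r" if "f \<in> set fs" for f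
        by (rule D(2)[OF that _ v], rule almost_automorphism_mono[OF g d(2)[OF that]]) (use that in auto)
      then show "\<forall>i<length fs. \<bar>map (\<lambda>f. fval H T f (g \<circ> v)) fs ! i - map (\<lambda>f. fval H T f v) fs ! i\<bar> \<le> r"
        by simp
    qed
    then show ?thesis by simp
  qed
  then show ?case using d(1) by blast
next
  case (FSup n f)
  have "wf_fml f" "fml_pars f \<subseteq> B1" using FSup.prems by simp_all
  from FSup.IH[OF this FSup.prems(3)] obtain d where
    d: "d > 0" "\<And>g v. almost_automorphism d (fml_pars f) g \<Longrightarrow> range v \<subseteq> B1 \<Longrightarrow>
     \<bar>fval H T f (g \<circ> v) - fval H T f v\<bar> \<le> e" by blast
  have "\<bar>fval H T (FSup n f) (g \<circ> v) - fval H T (FSup n f) v\<bar> \<le> e"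
    if g: "almost_automorphism d (fml_pars (FSup n f)) g" and v: "range v \<subseteq> B1" for g v
  proof -
    have u: "Hil.unitary g" using g by (simp add: almost_automorphism_def)
    have vn: "range (v(n := a)) \<subseteq> B1" if "a \<in> B1" for a using that v by auto
    then have gv: "range (g \<circ> v(n := a)) \<subseteq> B1" if "a \<in> B1" for a
      using that unitary_ball[OF u] by (metis image_comp image_mono)
    have "(SUP a\<in>B1. fval H T f ((g \<circ> v)(n := a))) = (SUP a\<in>g ` B1. fval H T f ((g \<circ> v)(n := a)))"
      by (simp add: unitary_ball[OF u])
    also have "\<dots> = (SUP a\<in>B1. fval H T f (g \<circ> v(n := a)))"
      by (simp add: image_comp o_def fun_upd_comp[of g, unfolded o_def, symmetric])
    finally have "fval H T (FSup n f) (g \<circ> v) = (SUP a\<in>B1. fval H T f (g \<circ> v(n := a)))" by simp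
    moreover have "\<bar>(SUP a\<in>B1. fval H T f (g \<circ> v(n := a))) - (SUP a\<in>B1. fval H T f (v(n := a)))\<bar> \<le> e"
      by (rule abs_cSUP_diff_le(1))
        (use zero_ball d(2) g vn gv fval_range[of f] FSup.prems in \<open>auto simp del: atLeastAtMost_iff\<close>)
    ultimately show ?thesis by simp
  qed
  then show ?case using d(1) by blast
next
  case (FInf n f)
  have "wf_fml f" "fml_pars f \<subseteq> B1" using FInf.prems by simp_all
  from FInf.IH[OF this FInf.prems(3)] obtain d where
    d: "d > 0" "\<And>g v. almost_automorphism d (fml_pars f) g \<Longrightarrow> range v \<subseteq> B1 \<Longrightarrow>
     \<bar>fval H T f (g \<circ> v) - fval H T f v\<bar> \<le> e" by blast
  have "\<bar>fval H T (FInf n f) (g \<circ> v) - fval H T (FInf n f) v\<bar> \<le> e"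
    if g: "almost_automorphism d (fml_pars (FInf n f)) g" and v: "range v \<subseteq> B1" for g v
  proof -
    have u: "Hil.unitary g" using g by (simp add: almost_automorphism_def)
    have vn: "range (v(n := a)) \<subseteq> B1" if "a \<in> B1" for a using that v by auto
    then have gv: "range (g \<circ> v(n := a)) \<subseteq> B1" if "a \<in> B1" for a
      using that unitary_ball[OF u] by (metis image_comp image_mono)
    have "(INF a\<in>B1. fval H T f ((g \<circ> v)(n := a))) = (INF a\<in>g ` B1. fval H T f ((g \<circ> v)(n := a)))"
      by (simp add: unitary_ball[OF u])
    also have "\<dots> = (INF a\<in>B1. fval H T f (g \<circ> v(n := a)))"
      by (simp add: image_comp o_def fun_upd_comp[of g, unfolded o_def, symmetric])
    finally have "fval H T (FInf n f) (g \<circ> v) = (INF a\<in>B1. fval H T f (g \<circ> v(n := a)))" by simp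
    moreover have "\<bar>(INF a\<in>B1. fval H T f (g \<circ> v(n := a))) - (INF a\<in>B1. fval H T f (v(n := a)))\<bar> \<le> e"
      by (rule abs_cSUP_diff_le(2))
        (use zero_ball d(2) g vn gv fval_range[of f] FInf.prems in \<open>auto simp del: atLeastAtMost_iff\<close>)
    ultimately show ?thesis by simp
  qed
  then show ?case using d(1) by blast
qed

end

section \<open>Point masses on a countable compact set\<close>

definition clopen_in :: "complex set \<Rightarrow> complex set \<Rightarrow> bool" where
  "clopen_in K C \<longleftrightarrow> C \<subseteq> K \<and> closed C \<and> closed (K - C)"

lemma clopen_in_self: "compact K \<Longrightarrow> clopen_in K K"
  by (simp add: clopen_in_def compact_imp_closed)

lemma clopen_in_Diff: assumes "clopen_in K C" "clopen_in K D" shows "clopen_in K (C - D)"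
proof -
  have "C - D = C \<inter> (K - D)" "K - (C - D) = (K - C) \<union> D" using assms by (auto simp: clopen_in_def)
  then show ?thesis using assms unfolding clopen_in_def by auto
qed

lemma clopen_in_Int: assumes "clopen_in K C" "clopen_in K D" shows "clopen_in K (C \<inter> D)"
proof -
  have "K - (C \<inter> D) = (K - C) \<union> (K - D)" by auto
  then show ?thesis using assms unfolding clopen_in_def by auto
qed

lemma clopen_in_Union: assumes "compact K" "finite P" "\<And>C. C \<in> P \<Longrightarrow> clopen_in K C" shows "clopen_in K (\<Union>P)"
  using assms(2,3)
proof (induction P rule: finite_induct)
  case empty
  show ?case using assms(1) by (simp add: clopen_in_def compact_imp_closed)
next
  case (insert C P)
  have "K - \<Union>(insert C P) = (K - C) \<inter> (K - \<Union>P)" by auto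
  then show ?case using insert by (auto simp: clopen_in_def)
qed

text \<open>The distances from \<open>z\<close> to points of \<open>K\<close> form a countable set,
  so some radius below \<open>r\<close> is not among them; on \<open>K\<close> the open and the
  closed ball of that radius coincide.\<close>

lemma clopen_ball:
  assumes K: "compact K" "countable K" and r: "r > 0" and z: "z \<in> K"
  obtains s where "0 < s" "s < r" "clopen_in K (K \<inter> ball z s)"
proof -
  have "countable (dist z ` K)" using K by simp
  then have "\<not> {0<..<r} \<subseteq> dist z ` K" using uncountable_open_interval[of 0 r] r countable_subset by blast
  then obtain s where s: "0 < s" "s < r" "s \<notin> dist z ` K" by (meson greaterThanLessThan_iff subsetI)
  then have "K \<inter> ball z s = K \<inter> cball z s" by (force simp: less_le)
  then have "closed (K \<inter> ball z s)" using compact_Int_closed[OF K(1), of "cball z s"] compact_imp_closed by simp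
  moreover have "K - K \<inter> ball z s = K - ball z s" by auto
  then have "closed (K - K \<inter> ball z s)" using compact_imp_closed[OF compact_diff[OF K(1) open_ball]] by simp
  ultimately have "clopen_in K (K \<inter> ball z s)" by (simp add: clopen_in_def)
  then show ?thesis using that s by blast
qed

lemma clopen_cover:
  assumes K: "compact K" and C: "\<And>z. z \<in> K \<Longrightarrow> clopen_in K (C z) \<and> z \<in> C z"
  obtains L where "finite L" "L \<subseteq> K" "K = (\<Union>z\<in>L. C z)"
proof -
  have cov: "K \<subseteq> (\<Union>z\<in>K. - (K - C z))" using C by blast
  have op: "open (- (K - C z))" if "z \<in> K" for z using C[OF that] unfolding clopen_in_def by (intro open_Compl) blast
  obtain L where L: "L \<subseteq> K" "finite L" "K \<subseteq> (\<Union>z\<in>L. - (K - C z))"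
    by (rule compactE_image[OF K op cov])
  have "C z \<subseteq> K" if "z \<in> L" for z using C that L(1) by (auto simp: clopen_in_def)
  then have "K = (\<Union>z\<in>L. C z)" using L(3) by blast
  then show ?thesis using that L by blast
qed

lemma disjoint_refinement:
  assumes K: "compact K" and L: "finite L" "\<And>z. z \<in> L \<Longrightarrow> clopen_in K (C z)"
  shows "\<exists>P. finite P \<and> (\<forall>A\<in>P. clopen_in K A \<and> (\<exists>z\<in>L. A \<subseteq> C z)) \<and>
     (\<forall>A\<in>P. \<forall>B\<in>P. A \<noteq> B \<longrightarrow> A \<inter> B = {}) \<and> \<Union>P = (\<Union>z\<in>L. C z)"
  using L
proof (induction L rule: finite_induct)
  case empty
  show ?case by (rule exI[of _ "{}"]) auto
next
  case (insert z L)
  have "\<exists>P. finite P \<and> (\<forall>A\<in>P. clopen_in K A \<and> (\<exists>z\<in>L. A \<subseteq> C z)) \<and>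
     (\<forall>A\<in>P. \<forall>B\<in>P. A \<noteq> B \<longrightarrow> A \<inter> B = {}) \<and> \<Union>P = (\<Union>z\<in>L. C z)"
    by (rule insert.IH) (use insert.prems in simp)
  then obtain P where P: "finite P" "\<forall>A\<in>P. clopen_in K A \<and> (\<exists>z\<in>L. A \<subseteq> C z)"
     "\<forall>A\<in>P. \<forall>B\<in>P. A \<noteq> B \<longrightarrow> A \<inter> B = {}" "\<Union>P = (\<Union>z\<in>L. C z)"
    by (elim exE conjE) (rule that)
  define D where "D = C z - \<Union>P"
  have D: "clopen_in K D" unfolding D_def
  proof (rule clopen_in_Diff[OF _ clopen_in_Union[OF K P(1)]])
    show "clopen_in K (C z)" by (rule insert.prems) simp
    show "clopen_in K A" if "A \<in> P" for A using P(2) that by blast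
  qed
  have disj: "D \<inter> A = {}" if "A \<in> P" for A using that by (auto simp: D_def)
  show ?case
  proof (rule exI[of _ "insert D P"], intro conjI ballI impI)
    show "finite (insert D P)" using P(1) by simp
    show "\<Union>(insert D P) = (\<Union>z\<in>insert z L. C z)" using P(4) by (auto simp: D_def)
    fix A assume A: "A \<in> insert D P"
    then show "clopen_in K A" using D P(2) by (metis insertE)
    show "\<exists>z\<in>insert z L. A \<subseteq> C z"
    proof (cases "A = D")
      case False
      then have "\<exists>z\<in>L. A \<subseteq> C z" using A P(2) by simp
      then show ?thesis by simp
    qed (simp add: D_def Diff_subset)
    fix B assume "B \<in> insert D P" "A \<noteq> B"
    then show "A \<inter> B = {}" using A disj P(3) by (metis inf_commute insertE)
  qed
qed

text \<open>The pieces refine a finite cover by small clopen balls. The centre \<open>c A\<close>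
  later replaces every eigenvalue in \<open>A\<close>, with error at most \<open>e\<close>.\<close>

lemma clopen_partition:
  assumes K: "compact K" "countable K" and e: "e > 0"
  obtains P c where "finite P" "\<And>A. A \<in> P \<Longrightarrow> clopen_in K A" "\<And>A z. A \<in> P \<Longrightarrow> z \<in> A \<Longrightarrow> cmod (z - c A) \<le> e"
     "\<And>A B. A \<in> P \<Longrightarrow> B \<in> P \<Longrightarrow> A \<noteq> B \<Longrightarrow> A \<inter> B = {}" "\<Union>P = K"
proof -
  have "\<exists>s. 0 < s \<and> s < e \<and> clopen_in K (K \<inter> ball z s)" if "z \<in> K" for z
    using clopen_ball[OF K e that] by metis
  then obtain s where s: "\<And>z. z \<in> K \<Longrightarrow> 0 < s z \<and> s z < e \<and> clopen_in K (K \<inter> ball z (s z))" by metis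
  obtain L where L: "finite L" "L \<subseteq> K" "K = (\<Union>z\<in>L. K \<inter> ball z (s z))"
  proof (rule clopen_cover[OF K(1), of "\<lambda>z. K \<inter> ball z (s z)"])
    show "clopen_in K (K \<inter> ball z (s z)) \<and> z \<in> K \<inter> ball z (s z)" if "z \<in> K" for z
      using s[OF that] that by simp
  qed
  have cl: "clopen_in K (K \<inter> ball z (s z))" if "z \<in> L" for z using s[of z] that L(2) by blast
  have "\<exists>P. finite P \<and> (\<forall>A\<in>P. clopen_in K A \<and> (\<exists>z\<in>L. A \<subseteq> K \<inter> ball z (s z))) \<and>
     (\<forall>A\<in>P. \<forall>B\<in>P. A \<noteq> B \<longrightarrow> A \<inter> B = {}) \<and> \<Union>P = (\<Union>z\<in>L. K \<inter> ball z (s z))"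
    by (rule disjoint_refinement[OF K(1) L(1)]) (rule cl)
  then obtain P where P: "finite P" "\<forall>A\<in>P. clopen_in K A \<and> (\<exists>z\<in>L. A \<subseteq> K \<inter> ball z (s z))"
     "\<forall>A\<in>P. \<forall>B\<in>P. A \<noteq> B \<longrightarrow> A \<inter> B = {}" "\<Union>P = (\<Union>z\<in>L. K \<inter> ball z (s z))"
    by (elim exE conjE) (rule that)
  have "\<exists>c. \<forall>z\<in>A. cmod (z - c) \<le> e" if A: "A \<in> P" for A
  proof -
    obtain c where c: "c \<in> L" "A \<subseteq> K \<inter> ball c (s c)" using P(2) A by blast
    have "cmod (z - c) \<le> e" if "z \<in> A" for z
    proof -
      have "dist c z < s c" "s c < e" using c that s[of c] L(2) by auto
      then show ?thesis by (simp add: dist_norm norm_minus_commute)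
    qed
    then show ?thesis by blast
  qed
  then obtain c where "\<And>A z. A \<in> P \<Longrightarrow> z \<in> A \<Longrightarrow> cmod (z - c A) \<le> e" by metis
  moreover have "\<Union>P = K" using P(4) L(3) by simp
  ultimately show ?thesis by (intro that[of P c]) (use P in blast)+
qed

text \<open>\<open>N\<close> abstracts the limiting spectral mass of a type. Limits preserve finite
  additivity but in general not countable additivity.\<close>

locale clopen_content =
  fixes K :: "complex set" and N :: "complex set \<Rightarrow> real"
  assumes compact_K: "compact K" and countable_K: "countable K"
    and N_nonneg: "0 \<le> N C" and N_Un: "C \<inter> D = {} \<Longrightarrow> N (C \<union> D) = N C + N D"
begin

text \<open>The infimum over clopen neighbourhoods can differ from \<open>N {z}\<close>: the mass
  that approximating vectors have at eigenvalues tending to \<open>z\<close> is counted here,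
  although no single eigenvalue need retain it.\<close>

definition point_mass :: "complex \<Rightarrow> real" where
  "point_mass z = Inf {N C | C. clopen_in K C \<and> z \<in> C}"

lemma N_mono: assumes "C \<subseteq> D" shows "N C \<le> N D"
proof -
  have "N D = N C + N (D - C)" using N_Un[of C "D - C"] assms by (simp add: Un_absorb1)
  then show ?thesis using N_nonneg[of "D - C"] by simp
qed

lemma N_subadd: "N (C \<union> D) \<le> N C + N D"
proof -
  have "N (C \<union> D) = N C + N (D - C)" using N_Un[of C "D - C"] by simp
  then show ?thesis using N_mono[of "D - C" D] by simp
qed

lemma N_empty: "N {} = 0"
  using N_Un[of "{}" "{}"] by simp

lemma N_UN_le: "finite L \<Longrightarrow> N (\<Union>z\<in>L. C z) \<le> (\<Sum>z\<in>L. N (C z))"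
proof (induction L rule: finite_induct)
  case (insert z L)
  then show ?case using N_subadd[of "C z" "\<Union>z\<in>L. C z"] by simp
qed (simp add: N_empty)

lemma N_Union: "finite P \<Longrightarrow> (\<And>A B. A \<in> P \<Longrightarrow> B \<in> P \<Longrightarrow> A \<noteq> B \<Longrightarrow> A \<inter> B = {}) \<Longrightarrow> N (\<Union>P) = (\<Sum>A\<in>P. N A)"
proof (induction P rule: finite_induct)
  case (insert A P)
  have "A \<inter> \<Union>P = {}" using insert.prems insert.hyps(2) by fastforce
  then show ?case using insert N_Un[of A "\<Union>P"] by simp
qed (simp add: N_empty)

lemma point_mass_le: "clopen_in K C \<Longrightarrow> z \<in> C \<Longrightarrow> point_mass z \<le> N C"
  unfolding point_mass_def by (rule cInf_lower) (auto intro!: bdd_belowI[of _ 0] N_nonneg)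

text \<open>A clopen ball around one point, small enough to avoid the others, splits
  \<open>C\<close> into two clopen sets; additivity and induction on the number of points finish the
  argument.\<close>

lemma sum_point_mass_le:
  assumes "finite L" "L \<subseteq> C" "clopen_in K C" shows "(\<Sum>z\<in>L. point_mass z) \<le> N C"
  using assms
proof (induction L arbitrary: C rule: finite_induct)
  case empty
  then show ?case by (simp add: N_nonneg)
next
  case (insert z L)
  obtain d where d: "d > 0" "\<And>w. w \<in> L \<Longrightarrow> w \<noteq> z \<Longrightarrow> d \<le> dist z w"
    using finite_set_avoid[OF insert.hyps(1), of z] by auto
  have zK: "z \<in> K" using insert.prems by (auto simp: clopen_in_def)
  obtain s where s: "0 < s" "s < d" "clopen_in K (K \<inter> ball z s)"
    by (rule clopen_ball[OF compact_K countable_K d(1) zK])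
  let ?D = "K \<inter> ball z s"
  have "N C = N (C \<inter> ?D) + N (C - ?D)" using N_Un[of "C \<inter> ?D" "C - ?D"]
    by (metis Diff_disjoint Int_Diff_Un Int_Diff_disjoint)
  moreover have "point_mass z \<le> N (C \<inter> ?D)"
    by (rule point_mass_le[OF clopen_in_Int]) (use insert.prems s zK in auto)
  moreover have "(\<Sum>z\<in>L. point_mass z) \<le> N (C - ?D)"
  proof (rule insert.IH)
    show "L \<subseteq> C - ?D" using insert.prems insert.hyps(2) d(2) s(2) by force
    show "clopen_in K (C - ?D)" using insert.prems s by (intro clopen_in_Diff) auto
  qed
  ultimately show ?case using insert.hyps by simp
qed

text \<open>The neighbourhood of \<open>z\<close> exceeds the point mass by less than
  \<open>e / 2^(n z + 1)\<close>, with \<open>n\<close> an injection of \<open>K\<close> into the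
  naturals. A finite subcover then has total excess at most \<open>e\<close>, although the number of
  its members is not known when the neighbourhoods are chosen.\<close>

lemma point_masses_exhaust:
  assumes e: "e > 0"
  obtains L where "finite L" "L \<subseteq> K" "N K \<le> (\<Sum>z\<in>L. point_mass z) + e"
proof -
  define n where "n = to_nat_on K"
  have "\<exists>C. clopen_in K C \<and> z \<in> C \<and> N C < point_mass z + e * (1/2) ^ Suc (n z)" if z: "z \<in> K" for z
  proof -
    have "Inf {N C | C. clopen_in K C \<and> z \<in> C} < point_mass z + e * (1/2) ^ Suc (n z)"
      using e by (simp add: point_mass_def)
    moreover have "{N C | C. clopen_in K C \<and> z \<in> C} \<noteq> {}" using clopen_in_self[OF compact_K] z by blast
    ultimately obtain r where "r \<in> {N C | C. clopen_in K C \<and> z \<in> C}" "r < point_mass z + e * (1/2) ^ Suc (n z)"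
      by (meson cInf_lessD)
    then show ?thesis by blast
  qed
  then obtain C where C: "\<And>z. z \<in> K \<Longrightarrow> clopen_in K (C z) \<and> z \<in> C z"
    "\<And>z. z \<in> K \<Longrightarrow> N (C z) < point_mass z + e * (1/2) ^ Suc (n z)" by metis
  obtain L where L: "finite L" "L \<subseteq> K" "K = (\<Union>z\<in>L. C z)"
    by (rule clopen_cover[OF compact_K C(1)])
  have "N K \<le> (\<Sum>z\<in>L. N (C z))" using N_UN_le[OF L(1), of C] L(3) by simp
  also have "\<dots> \<le> (\<Sum>z\<in>L. point_mass z + e * (1/2) ^ Suc (n z))"
    using C(2) L(2) by (intro sum_mono) (auto intro: less_imp_le)
  also have "\<dots> = (\<Sum>z\<in>L. point_mass z) + e * (\<Sum>z\<in>L. (1/2) ^ Suc (n z))"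
    by (simp add: sum.distrib sum_distrib_left)
  also have "(\<Sum>z\<in>L. (1/2) ^ Suc (n z)) \<le> (1::real)"
  proof -
    have "inj_on n L" using L(2) countable_K unfolding n_def by (meson inj_on_subset inj_on_to_nat_on)
    then have "(\<Sum>z\<in>L. (1/2::real) ^ Suc (n z)) = (\<Sum>k\<in>n ` L. (1/2) ^ Suc k)"
      by (simp add: sum.reindex)
    also have "\<dots> \<le> (\<Sum>k. (1/2) ^ Suc k)"
      using power_half_series L(1) by (intro sum_le_suminf) (auto simp: sums_iff)
    also have "\<dots> = 1" using power_half_series by (simp add: sums_iff)
    finally show ?thesis .
  qed
  finally have "N K \<le> (\<Sum>z\<in>L. point_mass z) + e" using e by (simp add: mult_left_le)
  then show ?thesis using that L by blast
qed

end

section \<open>Estimates for rounded data\<close>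

lemma floor_eq_imp_close:
  fixes a b M :: real
  assumes "M > 0" "\<lfloor>M * a\<rfloor> = \<lfloor>M * b\<rfloor>" shows "\<bar>a - b\<bar> \<le> 1 / M"
proof -
  have "\<bar>M * a - M * b\<bar> < 1" using assms(2) by linarith
  then have "M * \<bar>a - b\<bar> < 1" using assms(1) by (simp add: abs_mult flip: right_diff_distrib)
  then show ?thesis using assms(1) by (simp add: field_simps)
qed

text \<open>\<open>I\<close> carries both sequences up to squared mass \<open>eps\<close>. On
  \<open>I\<close> each of at most \<open>eps * M\<close> terms is at most \<open>4 / M\<close>,
  giving \<open>4 * eps\<close> in both sums. Outside, \<open>|a - b|^2 <= 2 |a|^2 + 2 |b|^2\<close>
  contributes another \<open>4 * eps\<close>, and the difference of squares only
  \<open>2 * eps\<close>.\<close>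

lemma l2_code_estimates:
  fixes a b :: "'e \<Rightarrow> complex"
  assumes I: "finite I" and G: "finite G" "G \<subseteq> D" and M: "M \<ge> 1" "real (card I) \<le> eps * M"
    and tail_a: "\<And>G. finite G \<Longrightarrow> G \<subseteq> D - I \<Longrightarrow> (\<Sum>e\<in>G. (cmod (a e))\<^sup>2) \<le> eps"
    and tail_b: "\<And>G. finite G \<Longrightarrow> G \<subseteq> D - I \<Longrightarrow> (\<Sum>e\<in>G. (cmod (b e))\<^sup>2) \<le> eps"
    and close: "\<And>e. e \<in> I \<Longrightarrow> cmod (a e - b e) \<le> 2 / M"
    and one: "\<And>e. e \<in> G \<Longrightarrow> cmod (a e) \<le> 1" "\<And>e. e \<in> G \<Longrightarrow> cmod (b e) \<le> 1"
  shows "(\<Sum>e\<in>G. (cmod (a e - b e))\<^sup>2) \<le> 8 * eps"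
    and "(\<Sum>e\<in>G. \<bar>(cmod (a e))\<^sup>2 - (cmod (b e))\<^sup>2\<bar>) \<le> 6 * eps"
proof -
  have split: "sum f G = sum f (G \<inter> I) + sum f (G - I)" for f :: "'e \<Rightarrow> real"
    using sum.Int_Diff[OF G(1)] .
  have "4 / M * real (card (G \<inter> I)) \<le> 4 / M * real (card I)"
    using M(1) I by (intro mult_left_mono) (auto intro!: card_mono)
  also have "\<dots> \<le> 4 / M * (eps * M)" using M by (intro mult_left_mono) auto
  also have "\<dots> = 4 * eps" using M(1) by simp
  finally have card: "4 / M * real (card (G \<inter> I)) \<le> 4 * eps" .
  have ta: "(\<Sum>e\<in>G - I. (cmod (a e))\<^sup>2) \<le> eps" by (rule tail_a) (use G in auto)
  have tb: "(\<Sum>e\<in>G - I. (cmod (b e))\<^sup>2) \<le> eps" by (rule tail_b) (use G in auto)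
  have "(\<Sum>e\<in>G \<inter> I. (cmod (a e - b e))\<^sup>2) \<le> (\<Sum>e\<in>G \<inter> I. 4 / M)"
  proof (rule sum_mono)
    fix e assume "e \<in> G \<inter> I"
    then have "(cmod (a e - b e))\<^sup>2 \<le> (2 / M)\<^sup>2" using close by (intro power_mono) auto
    also have "\<dots> \<le> 4 / M" using M(1) by (simp add: power2_eq_square field_simps)
    finally show "(cmod (a e - b e))\<^sup>2 \<le> 4 / M" .
  qed
  then have "(\<Sum>e\<in>G \<inter> I. (cmod (a e - b e))\<^sup>2) \<le> 4 * eps" using card by (simp add: mult.commute)
  moreover have "(\<Sum>e\<in>G - I. (cmod (a e - b e))\<^sup>2) \<le> (\<Sum>e\<in>G - I. 2 * (cmod (a e))\<^sup>2 + 2 * (cmod (b e))\<^sup>2)"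
  proof (rule sum_mono)
    fix e
    have "(cmod (a e - b e))\<^sup>2 \<le> (cmod (a e) + cmod (b e))\<^sup>2"
      by (intro power_mono norm_triangle_ineq4) auto
    also have "\<dots> \<le> 2 * (cmod (a e))\<^sup>2 + 2 * (cmod (b e))\<^sup>2"
      using sum_squares_bound[of "cmod (a e)" "cmod (b e)"] by (simp add: power2_sum)
    finally show "(cmod (a e - b e))\<^sup>2 \<le> 2 * (cmod (a e))\<^sup>2 + 2 * (cmod (b e))\<^sup>2" .
  qed
  then have "(\<Sum>e\<in>G - I. (cmod (a e - b e))\<^sup>2) \<le> 4 * eps"
    using ta tb by (simp add: sum.distrib flip: sum_distrib_left)
  ultimately show "(\<Sum>e\<in>G. (cmod (a e - b e))\<^sup>2) \<le> 8 * eps" unfolding split by linarith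
  have "(\<Sum>e\<in>G \<inter> I. \<bar>(cmod (a e))\<^sup>2 - (cmod (b e))\<^sup>2\<bar>) \<le> (\<Sum>e\<in>G \<inter> I. 4 / M)"
  proof (rule sum_mono)
    fix e assume e: "e \<in> G \<inter> I"
    have "\<bar>(cmod (a e))\<^sup>2 - (cmod (b e))\<^sup>2\<bar> = \<bar>cmod (a e) - cmod (b e)\<bar> * (cmod (a e) + cmod (b e))"
      by (simp add: power2_eq_square square_diff_square_factored abs_mult)
    also have "\<dots> \<le> 2 / M * 2"
      using close[of e] one[of e] e norm_triangle_ineq3[of "a e" "b e"] M(1) by (intro mult_mono) auto
    finally show "\<bar>(cmod (a e))\<^sup>2 - (cmod (b e))\<^sup>2\<bar> \<le> 4 / M" by simp
  qed
  then have "(\<Sum>e\<in>G \<inter> I. \<bar>(cmod (a e))\<^sup>2 - (cmod (b e))\<^sup>2\<bar>) \<le> 4 * eps" using card by (simp add: mult.commute)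
  moreover have "(\<Sum>e\<in>G - I. \<bar>(cmod (a e))\<^sup>2 - (cmod (b e))\<^sup>2\<bar>) \<le> (\<Sum>e\<in>G - I. (cmod (a e))\<^sup>2 + (cmod (b e))\<^sup>2)"
  proof (rule sum_mono)
    fix e
    show "\<bar>(cmod (a e))\<^sup>2 - (cmod (b e))\<^sup>2\<bar> \<le> (cmod (a e))\<^sup>2 + (cmod (b e))\<^sup>2"
      unfolding abs_le_iff by simp
  qed
  then have "(\<Sum>e\<in>G - I. \<bar>(cmod (a e))\<^sup>2 - (cmod (b e))\<^sup>2\<bar>) \<le> 2 * eps"
    using ta tb by (simp add: sum.distrib)
  ultimately show "(\<Sum>e\<in>G. \<bar>(cmod (a e))\<^sup>2 - (cmod (b e))\<^sup>2\<bar>) \<le> 6 * eps" unfolding split by linarith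
qed

text \<open>On each piece the mass splits into the point masses of \<open>L\<close> inside it and a
  nonnegative excess. The excesses of \<open>Np\<close> add up to at most \<open>eps\<close>, those
  of \<open>Nq\<close> likewise, and errors of \<open>1 / M\<close> in at most
  \<open>eps * M\<close> point masses cost a third \<open>eps\<close>, whatever the number of
  pieces.\<close>

lemma content_code_estimate:
  assumes p: "clopen_content K Np" and q: "clopen_content K Nq"
    and P: "finite P" "\<And>A. A \<in> P \<Longrightarrow> clopen_in K A"
      "\<And>A B. A \<in> P \<Longrightarrow> B \<in> P \<Longrightarrow> A \<noteq> B \<Longrightarrow> A \<inter> B = {}" "\<Union>P = K"
    and L: "finite L" "L \<subseteq> K" and M: "M \<ge> 1" "real (card L) \<le> eps * M"
    and Lp: "Np K \<le> (\<Sum>z\<in>L. clopen_content.point_mass K Np z) + eps"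
    and Lq: "Nq K \<le> (\<Sum>z\<in>L. clopen_content.point_mass K Nq z) + eps"
    and close: "\<And>z. z \<in> L \<Longrightarrow>
      \<bar>clopen_content.point_mass K Np z - clopen_content.point_mass K Nq z\<bar> \<le> 1 / M"
  shows "(\<Sum>A\<in>P. \<bar>Np A - Nq A\<bar>) \<le> 3 * eps"
proof -
  interpret p: clopen_content K Np by fact
  interpret q: clopen_content K Nq by fact
  define f where "f = p.point_mass"
  define g where "g = q.point_mass"
  have total: "(\<Sum>A\<in>P. \<Sum>z\<in>L \<inter> A. h z) = (\<Sum>z\<in>L. h z)" for h :: "complex \<Rightarrow> real"
  proof -
    have "(\<Sum>z\<in>(\<Union>A\<in>P. L \<inter> A). h z) = (\<Sum>A\<in>P. \<Sum>z\<in>L \<inter> A. h z)"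
      using P(1,3) L(1) by (intro sum.UNION_disjoint) auto
    moreover have "(\<Union>A\<in>P. L \<inter> A) = L" using L(2) P(4) by auto
    ultimately show ?thesis by simp
  qed
  have "\<bar>Np A - Nq A\<bar> \<le> (Np A - (\<Sum>z\<in>L \<inter> A. f z)) + (\<Sum>z\<in>L \<inter> A. \<bar>f z - g z\<bar>) + (Nq A - (\<Sum>z\<in>L \<inter> A. g z))"
    if A: "A \<in> P" for A
  proof -
    have "(\<Sum>z\<in>L \<inter> A. f z) \<le> Np A" unfolding f_def
      by (rule p.sum_point_mass_le) (use L P(2)[OF A] in auto)
    moreover have "(\<Sum>z\<in>L \<inter> A. g z) \<le> Nq A" unfolding g_def
      by (rule q.sum_point_mass_le) (use L P(2)[OF A] in auto)
    moreover have "\<bar>(\<Sum>z\<in>L \<inter> A. f z) - (\<Sum>z\<in>L \<inter> A. g z)\<bar> \<le> (\<Sum>z\<in>L \<inter> A. \<bar>f z - g z\<bar>)"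
      unfolding sum_subtractf[symmetric] by (rule sum_abs)
    ultimately show ?thesis by linarith
  qed
  then have "(\<Sum>A\<in>P. \<bar>Np A - Nq A\<bar>) \<le>
      (\<Sum>A\<in>P. (Np A - (\<Sum>z\<in>L \<inter> A. f z)) + (\<Sum>z\<in>L \<inter> A. \<bar>f z - g z\<bar>) + (Nq A - (\<Sum>z\<in>L \<inter> A. g z)))"
    by (rule sum_mono)
  also have "\<dots> = (Np K - (\<Sum>z\<in>L. f z)) + (\<Sum>z\<in>L. \<bar>f z - g z\<bar>) + (Nq K - (\<Sum>z\<in>L. g z))"
    using p.N_Union[OF P(1,3)] q.N_Union[OF P(1,3)] P(4)
    by (simp add: sum.distrib sum_subtractf total)
  also have "(\<Sum>z\<in>L. \<bar>f z - g z\<bar>) \<le> (\<Sum>z\<in>L. 1 / M)"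
    using close by (intro sum_mono) (simp add: f_def g_def)
  also have "\<dots> \<le> eps" using M by (simp add: pos_divide_le_eq)
  finally show ?thesis using Lp Lq by (simp add: f_def g_def)
qed

section \<open>Formulas over parameters, amalgamation and distance of types\<close>

lemma finite_fml_pars: "finite (fml_pars f)"
proof -
  have "finite (trm_pars t)" for t :: "'a trm" by (induction t) auto
  then show ?thesis by (induction f) auto
qed

lemma fmls_over_D: "f \<in> fmls_over B n \<Longrightarrow> wf_fml f" "f \<in> fmls_over B n \<Longrightarrow> fml_pars f \<subseteq> B"
  "f \<in> fmls_over B n \<Longrightarrow> free_vars f \<subseteq> {..<n}"
  by (simp_all add: fmls_over_def)

abbreviation swap01 :: "nat \<Rightarrow> nat" where "swap01 \<equiv> id(0 := 1, 1 := 0)"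

lemma inj_swap01: "inj swap01"
  by (auto simp: inj_def split: if_splits)

lemma fmls_over_mono: "n \<le> m \<Longrightarrow> fmls_over B n \<subseteq> fmls_over B m"
proof -
  assume "n \<le> m"
  then have "{..<n} \<subseteq> {..<m}" by auto
  then show ?thesis unfolding fmls_over_def by (intro Collect_mono impI) (meson order_trans)
qed

lemma swap01_fmls_over: "f \<in> fmls_over B 1 \<Longrightarrow> fml_rename swap01 f \<in> fmls_over B 2"
proof -
  assume f: "f \<in> fmls_over B 1"
  have "swap01 ` free_vars f \<subseteq> swap01 ` {..<1}" by (rule image_mono[OF fmls_over_D(3)[OF f]])
  also have "\<dots> \<subseteq> {..<2}" by auto
  finally show ?thesis
    using fmls_over_D(1,2)[OF f]
    unfolding fmls_over_def mem_Collect_eq fml_rename_vars[OF inj_swap01] wf_fml_rename fml_rename_pars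
    by blast
qed

lemma fval_at_0: "f \<in> fmls_over B 1 \<Longrightarrow> v 0 = w 0 \<Longrightarrow> fval H T f v = fval H T f w"
  by (rule fval_cong) (use fmls_over_D(3)[of f B 1] in force)

context contraction_model
begin

lemma types_overD:
  assumes "p \<in> types_over H T B n" "finite F" "F \<subseteq> fmls_over B n" "e > 0"
  obtains v where "range v \<subseteq> B1" "\<And>f. f \<in> F \<Longrightarrow> \<bar>fval H T f v - p f\<bar> < e"
proof -
  have "\<exists>v. range v \<subseteq> B1 \<and> (\<forall>f\<in>F. \<bar>fval H T f v - p f\<bar> < e)"
    using assms(1)[unfolded types_over_def mem_Collect_eq] assms(2-4) by simp
  then obtain v where "range v \<subseteq> B1" "\<forall>f\<in>F. \<bar>fval H T f v - p f\<bar> < e" by (elim exE conjE) (rule that)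
  then show ?thesis by (intro that[of v]) simp_all
qed

text \<open>Pairs of vectors at norm distance at most \<open>s\<close> that approximate
  \<open>p\<close> and \<open>q\<close> on finite sets of formulas yield, by compactness, the type
  of a pair. The second variable is reached through the renaming \<open>swap01\<close>. The bound on
  the distance is put on the pairs themselves and so survives in the limit, halved since
  \<open>FDist\<close> is half the norm.\<close>

lemma amalgam:
  assumes B: "B \<subseteq> B1"
    and sat: "\<And>F1 F2 d. finite F1 \<Longrightarrow> F1 \<subseteq> fmls_over B 1 \<Longrightarrow> finite F2 \<Longrightarrow> F2 \<subseteq> fmls_over B 1 \<Longrightarrow> d > 0 \<Longrightarrow>
      \<exists>v. range v \<subseteq> B1 \<and> Hil.nm (v 0 \<boxminus> v 1) \<le> s \<and> (\<forall>f\<in>F1. \<bar>fval H T f v - p f\<bar> < d) \<and>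
        (\<forall>f\<in>F2. \<bar>fval H T f (v \<circ> swap01) - q f\<bar> < d)"
  shows "\<exists>r\<in>types_over H T B 2. (\<forall>f\<in>fmls_over B 1. r f = p f \<and> r (fml_rename swap01 f) = q f) \<and>
    r (FDist (Var 0) (Var 1)) \<le> s / 2"
proof -
  define X where "X = {v :: nat \<Rightarrow> 'u. range v \<subseteq> B1 \<and> Hil.nm (v 0 \<boxminus> v 1) \<le> s}"
  define \<phi> where "\<phi> v f = (if f \<in> fmls_over B 2 then fval H T f v else 0)" for v f
  define C1 where "C1 = (\<lambda>f. (f, p f)) ` fmls_over B 1"
  define C2 where "C2 = (\<lambda>f. (fml_rename swap01 f, q f)) ` fmls_over B 1"
  have sub: "fmls_over B 1 \<subseteq> fmls_over B 2" by (rule fmls_over_mono) simp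
  have bnd: "\<phi> v f \<in> {-1..1}" if "v \<in> X" for v f
  proof (cases "f \<in> fmls_over B 2")
    case True
    have "fval H T f v \<in> {0..1}"
      by (rule fval_range) (use that fmls_over_D[OF True] B in \<open>auto simp: X_def\<close>)
    then show ?thesis using True by (simp add: \<phi>_def)
  qed (simp add: \<phi>_def)
  have sat': "\<exists>v\<in>X. \<forall>(i, c)\<in>C. \<bar>\<phi> v i - c\<bar> < e" if C: "finite C" "C \<subseteq> C1 \<union> C2" "e > 0" for C e
  proof -
    have "finite (C \<inter> C1)" "C \<inter> C1 \<subseteq> (\<lambda>f. (f, p f)) ` fmls_over B 1" using C by (auto simp: C1_def)
    then obtain F1 where F1: "F1 \<subseteq> fmls_over B 1" "finite F1" "C \<inter> C1 = (\<lambda>f. (f, p f)) ` F1"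
      by (meson finite_subset_image)
    have "finite (C \<inter> C2)" "C \<inter> C2 \<subseteq> (\<lambda>f. (fml_rename swap01 f, q f)) ` fmls_over B 1"
      using C by (auto simp: C2_def)
    then obtain F2 where F2: "F2 \<subseteq> fmls_over B 1" "finite F2"
      "C \<inter> C2 = (\<lambda>f. (fml_rename swap01 f, q f)) ` F2"
      by (meson finite_subset_image)
    obtain v where v: "range v \<subseteq> B1" "Hil.nm (v 0 \<boxminus> v 1) \<le> s" "\<forall>f\<in>F1. \<bar>fval H T f v - p f\<bar> < e"
        "\<forall>f\<in>F2. \<bar>fval H T f (v \<circ> swap01) - q f\<bar> < e"
      using sat[OF F1(2,1) F2(2,1) C(3)] by blast
    have "\<bar>\<phi> v i - c\<bar> < e" if ic: "(i, c) \<in> C" for i c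
    proof (cases "(i, c) \<in> C1")
      case True
      then have "(i, c) \<in> (\<lambda>f. (f, p f)) ` F1" using ic F1(3) by blast
      then have "i \<in> F1" "c = p i" by auto
      then show ?thesis using v(3) F1(1) sub by (auto simp: \<phi>_def)
    next
      case False
      then have "(i, c) \<in> (\<lambda>f. (fml_rename swap01 f, q f)) ` F2" using ic F2(3) C(2) by blast
      then obtain f where f: "f \<in> F2" "i = fml_rename swap01 f" "c = q f" by auto
      then have "i \<in> fmls_over B 2" using F2(1) swap01_fmls_over by blast
      then show ?thesis using f v(4) fval_rename[OF inj_swap01, of H T f v] by (simp add: \<phi>_def)
    qed
    then show ?thesis using v(1,2) by (intro bexI[of _ v]) (auto simp: X_def)
  qed
  obtain r where r: "\<And>i c. (i, c) \<in> C1 \<union> C2 \<Longrightarrow> r i = c"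
    "\<And>F e. finite F \<Longrightarrow> e > 0 \<Longrightarrow> \<exists>v\<in>X. \<forall>i\<in>F. \<bar>\<phi> v i - r i\<bar> < e"
  proof (rule approximate_compactness[of X \<phi> "C1 \<union> C2"])
    show "\<phi> v f \<in> {-1..1}" if "v \<in> X" for v f by (rule bnd[OF that])
    show "\<exists>v\<in>X. \<forall>(i, c)\<in>C. \<bar>\<phi> v i - c\<bar> < e" if "finite C" "C \<subseteq> C1 \<union> C2" "e > 0" for C e
      by (rule sat'[OF that])
  qed (rule that)
  define r' where "r' = restrict r (fmls_over B 2)"
  have near: "\<exists>v\<in>X. \<forall>f\<in>F. \<bar>fval H T f v - r' f\<bar> < e" if F: "finite F" "F \<subseteq> fmls_over B 2" "e > 0" for F e
  proof -
    obtain v where v: "v \<in> X" "\<forall>i\<in>F. \<bar>\<phi> v i - r i\<bar> < e" using r(2)[OF F(1,3)] by blast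
    have "\<bar>fval H T f v - r' f\<bar> < e" if "f \<in> F" for f
      using v(2) that F(2) by (auto simp: \<phi>_def r'_def)
    then show ?thesis using v(1) by blast
  qed
  have type: "r' \<in> types_over H T B 2"
    unfolding types_over_def
  proof (intro CollectI conjI allI impI)
    show "r' \<in> extensional (fmls_over B 2)" by (simp add: r'_def)
    fix F e assume "finite F" "F \<subseteq> fmls_over B 2" "(e :: real) > 0"
    from near[OF this] show "\<exists>v. range v \<subseteq> B1 \<and> (\<forall>f\<in>F. \<bar>fval H T f v - r' f\<bar> < e)"
      by (auto simp: X_def)
  qed
  have ext: "r' f = p f \<and> r' (fml_rename swap01 f) = q f" if f: "f \<in> fmls_over B 1" for f
  proof -
    have "r f = p f" by (rule r(1)) (use f in \<open>auto simp: C1_def\<close>)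
    moreover have "r (fml_rename swap01 f) = q f" by (rule r(1)) (use f in \<open>auto simp: C2_def\<close>)
    ultimately show ?thesis using f sub swap01_fmls_over by (auto simp: r'_def)
  qed
  have "r' (FDist (Var 0) (Var 1)) \<le> s / 2 + e" if e: "e > 0" for e
  proof -
    have "FDist (Var 0) (Var 1) \<in> fmls_over B 2" by (auto simp: fmls_over_def)
    then obtain v where v: "v \<in> X" "\<bar>fval H T (FDist (Var 0) (Var 1)) v - r' (FDist (Var 0) (Var 1))\<bar> < e"
      using near[of "{FDist (Var 0) (Var 1)}" e] e by auto
    have "v 0 \<in> B1" "v 1 \<in> B1" using v(1) by (auto simp: X_def)
    then have "fval H T (FDist (Var 0) (Var 1)) v = Hil.nm (v 0 \<boxminus> v 1) / 2"
      by (intro fval_FDist) simp_all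
    also have "\<dots> \<le> s / 2" using v(1) by (simp add: X_def)
    finally show ?thesis using v(2) by linarith
  qed
  then have "r' (FDist (Var 0) (Var 1)) \<le> s / 2" by (rule field_le_epsilon)
  then show ?thesis using type ext by blast
qed

text \<open>An infimum of reals is a lower bound only for a set bounded below; values of the
  distance formula are nonnegative and remain so in the limit.\<close>

lemma type_dist_le:
  assumes B: "B \<subseteq> B1" and r: "r \<in> types_over H T B 2"
    "\<forall>f\<in>fmls_over B 1. r f = p f \<and> r (fml_rename swap01 f) = q f"
  shows "type_dist H T B p q \<le> r (FDist (Var 0) (Var 1))"
  unfolding type_dist_def
proof (rule cInf_lower)
  show "bdd_below {r (FDist (Var 0) (Var 1)) |r. r \<in> types_over H T B 2 \<and>
      (\<forall>f\<in>fmls_over B 1. r f = p f \<and> r (fml_rename swap01 f) = q f)}"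
  proof (rule bdd_belowI[of _ 0], safe)
    fix r assume r: "r \<in> types_over H T B 2"
    have f: "FDist (Var 0) (Var 1) \<in> fmls_over B 2" by (auto simp: fmls_over_def)
    have "0 \<le> r (FDist (Var 0) (Var 1)) + e" if e: "e > 0" for e
    proof -
      obtain v where v: "range v \<subseteq> B1" "\<bar>fval H T (FDist (Var 0) (Var 1)) v - r (FDist (Var 0) (Var 1))\<bar> < e"
        using types_overD[OF r, of "{FDist (Var 0) (Var 1)}" e] f e by (metis empty_subsetI finite.emptyI
            finite.insertI insert_subset singletonI)
      have "fval H T (FDist (Var 0) (Var 1)) v \<in> {0..1}"
        by (rule fval_range) (use v fmls_over_D[OF f] B in auto)
      then have "0 \<le> fval H T (FDist (Var 0) (Var 1)) v" by (simp only: atLeastAtMost_iff)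
      then show ?thesis using v(2) by linarith
    qed
    then show "0 \<le> r (FDist (Var 0) (Var 1))" by (rule field_le_epsilon)
  qed
qed (use r in blast)

end

section \<open>Types over a diagonal operator\<close>

locale diagonal_model = contraction_model H T +
    onb: hilbert_onb "carrier H" "\<zero>\<^bsub>H\<^esub>" "add H" "smult H" "hinner H" E
  for H :: "'u hilb" and T and E +
  fixes \<kappa> :: "'u \<Rightarrow> complex" and K :: "complex set"
  assumes op_coord: "x \<in> carrier H \<Longrightarrow> e \<in> E \<Longrightarrow> hinner H (T x) e = \<kappa> e * hinner H x e"
    and eigenvalue_in: "e \<in> E \<Longrightarrow> \<kappa> e \<in> K"
    and K_compact: "compact K" and K_countable: "countable K"
begin

text \<open>The scalar spectral measure of \<open>x\<close> for the diagonal operator, defined on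
  every set of complex numbers.\<close>

definition cmass :: "complex set \<Rightarrow> 'u \<Rightarrow> real" where
  "cmass C x = onb.mass {e. \<kappa> e \<in> C} x"

text \<open>\<open>l\<close> and \<open>N\<close> are a cluster point of the coordinates and masses
  of vectors approximating \<open>p\<close>. They need not be determined by the type; any cluster
  point serves, provided that formulas, coordinates and masses are approximated by the same vector
  \<open>v 0\<close>.\<close>

definition limit_data :: "'u set \<Rightarrow> ('u fml \<Rightarrow> real) \<Rightarrow> ('u \<Rightarrow> complex) \<Rightarrow> (complex set \<Rightarrow> real) \<Rightarrow> bool" where
  "limit_data B p l N \<longleftrightarrow> (\<forall>F G P d. finite F \<longrightarrow> F \<subseteq> fmls_over B 1 \<longrightarrow> finite G \<longrightarrow> G \<subseteq> E \<longrightarrow>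
     finite P \<longrightarrow> d > 0 \<longrightarrow> (\<exists>v. range v \<subseteq> B1 \<and> (\<forall>f\<in>F. \<bar>fval H T f v - p f\<bar> < d) \<and>
       (\<forall>e\<in>G. cmod (hinner H (v 0) e - l e) < d) \<and> (\<forall>C\<in>P. \<bar>cmass C (v 0) - N C\<bar> < d)))"

lemma nm_E: "e \<in> E \<Longrightarrow> Hil.nm e = 1"
  by (simp add: Hil.nm_def onb.E_ip)

lemma coord_le_1: assumes "x \<in> B1" "e \<in> E" shows "cmod (hinner H x e) \<le> 1"
  using Hil.cauchy_schwarz[of x e] assms ballD[of x] nm_E[of e] onb.E_closed[of e] by simp

lemma cmass_Un: "x \<in> carrier H \<Longrightarrow> C \<inter> D = {} \<Longrightarrow> cmass (C \<union> D) x = cmass C x + cmass D x"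
  unfolding cmass_def by (subst onb.mass_Un[symmetric]) (auto intro!: arg_cong[of _ _ "\<lambda>A. onb.mass A x"])

lemma cmass_nonneg: "0 \<le> cmass C x"
  unfolding cmass_def by (rule onb.mass_nonneg)

lemma cmass_le_1: assumes "x \<in> B1" shows "cmass C x \<le> 1"
proof -
  have x: "x \<in> carrier H" "Hil.nm x \<le> 1" using ballD[OF assms] by auto
  have "cmass C x + cmass (- C) x = cmass (C \<union> - C) x" by (rule cmass_Un[symmetric, OF x(1)]) auto
  also have "\<dots> = (Hil.nm x)\<^sup>2" unfolding cmass_def by (rule onb.mass_UNIV[OF x(1)]) auto
  also have "\<dots> \<le> 1" using x by (simp add: power_le_one)
  finally show ?thesis using cmass_nonneg[of "- C" x] by linarith
qed

text \<open>The observed quantities are formulas over \<open>B\<close>, real and imaginary parts of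
  coordinates, and masses, collected in one sum type. Compactness is applied with the formula values
  of \<open>p\<close> as constraints and the other quantities left free.\<close>

lemma limit_data_exists:
  assumes B: "B \<subseteq> B1" and p: "p \<in> types_over H T B 1"
  shows "\<exists>l N. limit_data B p l N"
proof -
  define X where "X = {v :: nat \<Rightarrow> 'u. range v \<subseteq> B1}"
  define \<phi> :: "(nat \<Rightarrow> 'u) \<Rightarrow> ('u fml + 'u \<times> bool) + complex set \<Rightarrow> real" where
    "\<phi> v i = (case i of Inl (Inl f) \<Rightarrow> if f \<in> fmls_over B 1 then fval H T f v else 0
      | Inl (Inr (e, b)) \<Rightarrow> if e \<in> E then (if b then Re else Im) (hinner H (v 0) e) else 0
      | Inr C \<Rightarrow> cmass C (v 0))" for v i
  define Cst where "Cst = (\<lambda>f. (Inl (Inl f) :: ('u fml + 'u \<times> bool) + complex set, p f)) ` fmls_over B 1"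
  obtain q where q: "\<And>i c. (i, c) \<in> Cst \<Longrightarrow> q i = c"
    "\<And>F e. finite F \<Longrightarrow> e > 0 \<Longrightarrow> \<exists>x\<in>X. \<forall>i\<in>F. \<bar>\<phi> x i - q i\<bar> < e"
  proof (rule approximate_compactness[of X \<phi> Cst])
    fix v i assume v: "v \<in> X"
    then have v0: "v 0 \<in> B1" and rv: "range v \<subseteq> B1" by (auto simp: X_def)
    show "\<phi> v i \<in> {-1..1}"
    proof (cases i)
      case (Inl j)
      show ?thesis
      proof (cases j)
        case (Inl f)
        have "fval H T f v \<in> {0..1}" if "f \<in> fmls_over B 1"
          by (rule fval_range) (use that fmls_over_D B rv in blast)+
        then show ?thesis using \<open>i = Inl j\<close> Inl by (auto simp: \<phi>_def)
      next
        case (Inr eb)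
        obtain e b where eb: "eb = (e, b)" by (cases eb)
        have "\<bar>(if b then Re else Im) (hinner H (v 0) e)\<bar> \<le> 1" if "e \<in> E"
          using coord_le_1[OF v0 that] abs_Re_le_cmod[of "hinner H (v 0) e"] abs_Im_le_cmod[of "hinner H (v 0) e"]
          by auto
        then show ?thesis using \<open>i = Inl j\<close> Inr eb by (auto simp: \<phi>_def abs_le_iff)
      qed
    next
      case (Inr C)
      then show ?thesis using cmass_nonneg[of C "v 0"] cmass_le_1[OF v0, of C] by (simp add: \<phi>_def)
    qed
  next
    fix C e assume C: "finite C" "C \<subseteq> Cst" "(e :: real) > 0"
    then obtain F where F: "F \<subseteq> fmls_over B 1" "finite F" "C = (\<lambda>f. (Inl (Inl f), p f)) ` F"
      unfolding Cst_def by (meson finite_subset_image)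
    obtain v where "range v \<subseteq> B1" "\<And>f. f \<in> F \<Longrightarrow> \<bar>fval H T f v - p f\<bar> < e"
      by (rule types_overD[OF p F(2,1) C(3)]) (rule that)
    then show "\<exists>x\<in>X. \<forall>(i, c)\<in>C. \<bar>\<phi> x i - c\<bar> < e"
      using F(1) by (intro bexI[of _ v]) (auto simp: F(3) X_def \<phi>_def)
  qed (rule that)
  define l where "l e = Complex (q (Inl (Inr (e, True)))) (q (Inl (Inr (e, False))))" for e
  define N where "N C = q (Inr C)" for C
  have "limit_data B p l N"
    unfolding limit_data_def
  proof (intro allI impI)
    fix F G and P :: "complex set set" and d assume F: "finite F" "F \<subseteq> fmls_over B 1" and G: "finite G" "G \<subseteq> E"
      and P: "finite P" and d: "(d :: real) > 0"
    define I :: "(('u fml + 'u \<times> bool) + complex set) set" where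
      "I = Inl ` Inl ` F \<union> Inl ` Inr ` (G \<times> UNIV) \<union> Inr ` P"
    have "finite I" using F G P by (simp add: I_def)
    then obtain v where v: "v \<in> X" "\<forall>i\<in>I. \<bar>\<phi> v i - q i\<bar> < d / 2"
      using q(2)[of I "d / 2"] d by auto
    have 1: "\<bar>fval H T f v - p f\<bar> < d" if f: "f \<in> F" for f
    proof -
      have "q (Inl (Inl f)) = p f" by (rule q(1)) (use f F(2) in \<open>auto simp: Cst_def\<close>)
      moreover have "\<bar>\<phi> v (Inl (Inl f)) - q (Inl (Inl f))\<bar> < d / 2" using v(2) f by (auto simp: I_def)
      moreover have "\<phi> v (Inl (Inl f)) = fval H T f v" using f F(2) by (auto simp: \<phi>_def)
      ultimately show ?thesis using d by simp
    qed
    have 2: "cmod (hinner H (v 0) e - l e) < d" if e: "e \<in> G" for e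
    proof -
      have "\<bar>\<phi> v (Inl (Inr (e, b))) - q (Inl (Inr (e, b)))\<bar> < d / 2" for b
        using v(2) e by (auto simp: I_def)
      from this[of True] this[of False]
      have "\<bar>Re (hinner H (v 0) e - l e)\<bar> < d / 2" "\<bar>Im (hinner H (v 0) e - l e)\<bar> < d / 2"
        using e G(2) by (auto simp: \<phi>_def l_def)
      then show ?thesis using cmod_le[of "hinner H (v 0) e - l e"] by linarith
    qed
    have 3: "\<bar>cmass C (v 0) - N C\<bar> < d" if C: "C \<in> P" for C
    proof -
      have "\<bar>\<phi> v (Inr C) - q (Inr C)\<bar> < d / 2" using v(2) C by (auto simp: I_def)
      moreover have "\<phi> v (Inr C) = cmass C (v 0)" by (simp add: \<phi>_def)
      ultimately show ?thesis using d by (simp add: N_def)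
    qed
    show "\<exists>v. range v \<subseteq> B1 \<and> (\<forall>f\<in>F. \<bar>fval H T f v - p f\<bar> < d) \<and>
       (\<forall>e\<in>G. cmod (hinner H (v 0) e - l e) < d) \<and> (\<forall>C\<in>P. \<bar>cmass C (v 0) - N C\<bar> < d)"
      using v(1) 1 2 3 by (intro exI[of _ v]) (simp add: X_def)
  qed
  then show ?thesis by blast
qed

lemma limit_dataD:
  assumes "limit_data B p l N" "finite F" "F \<subseteq> fmls_over B 1" "finite G" "G \<subseteq> E" "finite P" "d > 0"
  obtains v where "range v \<subseteq> B1" "\<forall>f\<in>F. \<bar>fval H T f v - p f\<bar> < d"
    "\<forall>e\<in>G. cmod (hinner H (v 0) e - l e) < d" "\<forall>C\<in>P. \<bar>cmass C (v 0) - N C\<bar> < d"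
proof -
  have "\<exists>v. range v \<subseteq> B1 \<and> (\<forall>f\<in>F. \<bar>fval H T f v - p f\<bar> < d) \<and>
       (\<forall>e\<in>G. cmod (hinner H (v 0) e - l e) < d) \<and> (\<forall>C\<in>P. \<bar>cmass C (v 0) - N C\<bar> < d)"
    using assms(1)[unfolded limit_data_def] assms(2-7) by simp
  then show ?thesis by (elim exE conjE) (rule that)
qed

lemma limit_data_clopen_content:
  assumes D: "limit_data B p l N" shows "clopen_content K N"
proof
  show "compact K" "countable K" by (rule K_compact, rule K_countable)
  fix C D :: "complex set"
  show "0 \<le> N C"
  proof (rule field_le_epsilon)
    fix d :: real assume d: "d > 0"
    obtain v :: "nat \<Rightarrow> 'u" where "range v \<subseteq> B1" "\<forall>A\<in>{C}. \<bar>cmass A (v 0) - N A\<bar> < d"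
      by (rule limit_dataD[OF D finite.emptyI empty_subsetI finite.emptyI empty_subsetI _ d, of "{C}"]) (simp, rule that, assumption+)
    then show "0 \<le> N C + d" using cmass_nonneg[of C "v 0"] by force
  qed
  assume CD: "C \<inter> D = {}"
  have "\<bar>N (C \<union> D) - (N C + N D)\<bar> \<le> 0"
  proof (rule field_le_epsilon)
    fix d :: real assume d: "d > 0"
    then have d3: "d / 3 > 0" by simp
    obtain v :: "nat \<Rightarrow> 'u" where v: "range v \<subseteq> B1" "\<forall>A\<in>{C, D, C \<union> D}. \<bar>cmass A (v 0) - N A\<bar> < d / 3"
      by (rule limit_dataD[OF D finite.emptyI empty_subsetI finite.emptyI empty_subsetI _ d3, of "{C, D, C \<union> D}"]) (simp, rule that, assumption+)
    have "v 0 \<in> carrier H" using v(1) ballD(1) by blast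
    then have "cmass (C \<union> D) (v 0) = cmass C (v 0) + cmass D (v 0)" by (rule cmass_Un[OF _ CD])
    then show "\<bar>N (C \<union> D) - (N C + N D)\<bar> \<le> 0 + d"
      using v(2) by (simp add: abs_if split: if_splits)
  qed
  then show "N (C \<union> D) = N C + N D" by simp
qed

lemma limit_data_bessel:
  assumes D: "limit_data B p l N" and G: "finite G" "G \<subseteq> E"
  shows "(\<Sum>e\<in>G. (cmod (l e))\<^sup>2) \<le> 1" and "e \<in> E \<Longrightarrow> cmod (l e) \<le> 1"
proof -
  have one: "cmod (l e) \<le> 1" if e: "e \<in> E" for e
  proof (rule field_le_epsilon)
    fix d :: real assume d: "d > 0"
    obtain v :: "nat \<Rightarrow> 'u" where v: "range v \<subseteq> B1" "\<forall>e'\<in>{e}. cmod (hinner H (v 0) e' - l e') < d"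
      by (rule limit_dataD[OF D finite.emptyI empty_subsetI _ _ finite.emptyI d, of "{e}"]) (simp, simp add: e, rule that, assumption+)
    have "cmod (hinner H (v 0) e) \<le> 1" by (rule coord_le_1) (use v e in auto)
    then show "cmod (l e) \<le> 1 + d"
      using v(2) norm_triangle_sub[of "l e" "hinner H (v 0) e"] by (simp add: norm_minus_commute)
  qed
  then show "e \<in> E \<Longrightarrow> cmod (l e) \<le> 1" .
  show "(\<Sum>e\<in>G. (cmod (l e))\<^sup>2) \<le> 1"
  proof (rule field_le_epsilon)
    fix r :: real assume r: "r > 0"
    \<comment> \<open>An error \<open>d\<close> in a coordinate changes its squared modulus by at
      most \<open>2 * d\<close>; there are \<open>card G\<close> of them, and the summand 1 covers
      the empty set.\<close>
    define d where "d = r / (2 * real (card G) + 1)"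
    have d: "d > 0" "2 * real (card G) * d \<le> r" using r by (auto simp: d_def field_simps)
    obtain v :: "nat \<Rightarrow> 'u" where v: "range v \<subseteq> B1" "\<forall>e\<in>G. cmod (hinner H (v 0) e - l e) < d"
      by (rule limit_dataD[OF D finite.emptyI empty_subsetI G finite.emptyI d(1)]) (rule that, assumption+)
    have v0: "v 0 \<in> B1" using v by auto
    have "(\<Sum>e\<in>G. (cmod (l e))\<^sup>2) \<le> (\<Sum>e\<in>G. (cmod (hinner H (v 0) e))\<^sup>2 + 2 * d)"
    proof (rule sum_mono)
      fix e assume e: "e \<in> G"
      let ?x = "hinner H (v 0) e"
      have "(cmod (l e))\<^sup>2 - (cmod ?x)\<^sup>2 = (cmod (l e) - cmod ?x) * (cmod (l e) + cmod ?x)"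
        by (simp add: power2_eq_square algebra_simps)
      also have "\<dots> \<le> d * 2"
      proof (rule order_trans[OF mult_right_mono])
        show "cmod (l e) - cmod ?x \<le> d"
          using bspec[OF v(2) e] norm_triangle_ineq2[of "l e" ?x] by (simp add: norm_minus_commute)
        show "d * (cmod (l e) + cmod ?x) \<le> d * 2"
          using one[of e] coord_le_1[OF v0, of e] e G(2) d(1) by (intro mult_left_mono) (auto simp: subset_iff)
      qed simp
      finally show "(cmod (l e))\<^sup>2 \<le> (cmod ?x)\<^sup>2 + 2 * d" by simp
    qed
    also have "\<dots> = (\<Sum>e\<in>G. (cmod (hinner H (v 0) e))\<^sup>2) + 2 * real (card G) * d" by (simp add: sum.distrib)
    also have "\<dots> \<le> (Hil.nm (v 0))\<^sup>2 + r"
      using onb.bessel[OF G, of "v 0"] ballD[OF v0] d(2) by linarith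
    also have "\<dots> \<le> 1 + r" using ballD[OF v0] by (simp add: power_le_one)
    finally show "(\<Sum>e\<in>G. (cmod (l e))\<^sup>2) \<le> 1 + r" .
  qed
qed

lemma bounded_eigenvalues: "onb.bounded_symbol \<kappa>"
proof -
  obtain M where "\<And>z. z \<in> K \<Longrightarrow> cmod z \<le> M"
    using compact_imp_bounded[OF K_compact] by (auto simp: bounded_iff)
  then show ?thesis using eigenvalue_in by (auto simp: onb.bounded_symbol_def)
qed

text \<open>Off \<open>F\<close> the basis is partitioned by the piece containing the eigenvalue,
  and \<open>\<pi>\<close> replaces an eigenvalue by the representative of its piece. The unitary
  \<open>g\<close> commutes with the diagonal operator of \<open>\<pi>\<close>, which is within
  \<open>h\<close> of \<open>T\<close>; hence the commutator bound \<open>2 * h\<close>. The last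
  sum appears because \<open>cmass A\<close> also counts the basis vectors in \<open>F\<close>,
  whose contribution has to be removed.\<close>

lemma almost_conjugate:
  assumes h: "h \<ge> 0" and P: "finite P" "\<And>A z. A \<in> P \<Longrightarrow> z \<in> A \<Longrightarrow> cmod (z - c A) \<le> h"
      "\<And>A B. A \<in> P \<Longrightarrow> B \<in> P \<Longrightarrow> A \<noteq> B \<Longrightarrow> A \<inter> B = {}" "\<Union>P = K"
    and F: "finite F" "F \<subseteq> E" and x: "x \<in> B1" and y: "y \<in> B1"
  obtains g where "Hil.unitary g" "\<forall>z\<in>B1. Hil.nm (T (g z) \<boxminus> g (T z)) \<le> 2 * h"
    "\<forall>z\<in>carrier H. (\<forall>e\<in>E - F. hinner H z e = 0) \<longrightarrow> g z = z"
    "(Hil.nm (g x \<boxminus> y))\<^sup>2 \<le> (\<Sum>e\<in>F. (cmod (hinner H x e - hinner H y e))\<^sup>2) +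
      (\<Sum>A\<in>P. \<bar>cmass A x - cmass A y\<bar>) +
      (\<Sum>e\<in>F. \<bar>(cmod (hinner H x e))\<^sup>2 - (cmod (hinner H y e))\<^sup>2\<bar>)"
proof -
  have xy: "x \<in> carrier H" "y \<in> carrier H" using x y ballD by auto
  define part where "part A = {e \<in> E - F. \<kappa> e \<in> A}" for A
  define J where "J = part ` P"
  have J: "finite J" using P by (simp add: J_def)
  have Jd: "A \<inter> B = {}" if "A \<in> J" "B \<in> J" "A \<noteq> B" for A B
  proof -
    obtain A' B' where AB: "A' \<in> P" "B' \<in> P" "A = part A'" "B = part B'" using \<open>A \<in> J\<close> \<open>B \<in> J\<close> by (auto simp: J_def)
    then have "A' \<inter> B' = {}" using P(3) that(3) by blast
    then show ?thesis by (auto simp: AB part_def)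
  qed
  have JU: "\<Union>J = E - F" using P(4) eigenvalue_in by (auto simp: J_def part_def)
  define \<pi> where "\<pi> e = c (SOME A. A \<in> P \<and> \<kappa> e \<in> A)" for e
  have \<pi>: "\<pi> e = c A" if "A \<in> P" "\<kappa> e \<in> A" for e A
  proof -
    have "(SOME A. A \<in> P \<and> \<kappa> e \<in> A) \<in> P \<and> \<kappa> e \<in> (SOME A. A \<in> P \<and> \<kappa> e \<in> A)"
      by (rule someI[of _ A]) (use that in simp)
    then have "(SOME A. A \<in> P \<and> \<kappa> e \<in> A) = A" using P(3) that by blast
    then show ?thesis by (simp add: \<pi>_def)
  qed
  have close: "cmod (\<kappa> e - \<pi> e) \<le> h" if e: "e \<in> E" for e
  proof -
    obtain A where "A \<in> P" "\<kappa> e \<in> A" using eigenvalue_in[OF e] P(4) by blast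
    then show ?thesis using P(2) \<pi> by simp
  qed
  obtain M where M: "\<And>e. e \<in> E \<Longrightarrow> cmod (\<kappa> e) \<le> M" using bounded_eigenvalues by (auto simp: onb.bounded_symbol_def)
  have b\<pi>: "onb.bounded_symbol \<pi>"
    unfolding onb.bounded_symbol_def
  proof (intro exI ballI)
    fix e assume "e \<in> E"
    then show "cmod (\<pi> e) \<le> M + h" using M[of e] close[of e] norm_triangle_sub[of "\<pi> e" "\<kappa> e"]
      by (simp add: norm_minus_commute)
  qed
  have "onb.constant_on_parts J \<pi>"
    unfolding onb.constant_on_parts_def
  proof (intro conjI ballI b\<pi>)
    fix A assume "A \<in> J"
    then obtain A' where "A' \<in> P" "A = part A'" by (auto simp: J_def)
    then show "\<exists>c. \<forall>e\<in>A. \<pi> e = c" using \<pi> by (intro exI[of _ "c A'"]) (auto simp: part_def)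
  qed
  obtain g where g: "Hil.unitary g" "\<forall>z\<in>carrier H. (\<forall>e\<in>E - F. hinner H z e = 0) \<longrightarrow> g z = z"
    "\<forall>p. onb.constant_on_parts J p \<longrightarrow> (\<forall>z\<in>carrier H. onb.dg p (g z) = g (onb.dg p z))"
    "(Hil.nm (g x \<boxminus> y))\<^sup>2 \<le> (\<Sum>e\<in>F. (cmod (hinner H x e - hinner H y e))\<^sup>2) + (\<Sum>A\<in>J. \<bar>onb.mass A x - onb.mass A y\<bar>)"
  proof (rule onb.partition_approx_conjugate[OF J _ F JU xy])
    show "A \<inter> B = {}" if "A \<in> J" "B \<in> J" "A \<noteq> B" for A B by (rule Jd[OF that])
  qed (rule that)
  have gV: "g z \<in> carrier H" if "z \<in> carrier H" for z using Hil.unitaryD(1)[OF g(1)] that by blast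
  have T\<pi>: "Hil.nm (T z \<boxminus> onb.dg \<pi> z) \<le> h * Hil.nm z" if z: "z \<in> carrier H" for z
  proof (rule onb.nm_le_coord[OF z _ h])
      show "T z \<boxminus> onb.dg \<pi> z \<in> carrier H" using z Hil.linD[OF lin_op] onb.dg(1)[OF b\<pi>] by auto
      fix e assume e: "e \<in> E"
      have "hinner H (T z \<boxminus> onb.dg \<pi> z) e = (\<kappa> e - \<pi> e) * hinner H z e"
        using z e Hil.linD[OF lin_op] onb.dg[OF b\<pi> z] op_coord[OF z e] by (simp add: algebra_simps)
      then show "cmod (hinner H (T z \<boxminus> onb.dg \<pi> z) e) \<le> h * cmod (hinner H z e)"
        using close[OF e] by (simp add: norm_mult mult_right_mono)
    qed
  have comm: "Hil.nm (T (g z) \<boxminus> g (T z)) \<le> 2 * h" if z: "z \<in> B1" for z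
  proof -
    have zc: "z \<in> carrier H" "Hil.nm z \<le> 1" using ballD[OF z] by auto
    note lg = Hil.unitaryD(1)[OF g(1)]
    have cl: "T z \<in> carrier H" "T (g z) \<in> carrier H" "g (T z) \<in> carrier H" "onb.dg \<pi> z \<in> carrier H"
      "onb.dg \<pi> (g z) \<in> carrier H"
      using zc gV Hil.linD[OF lin_op] onb.dg(1)[OF b\<pi>] by auto
    have hz: "h * Hil.nm z \<le> h" using h zc(2) by (simp add: mult_left_le)
    have "Hil.nm (T (g z) \<boxminus> g (T z)) \<le> Hil.nm (T (g z) \<boxminus> onb.dg \<pi> (g z)) + Hil.nm (onb.dg \<pi> (g z) \<boxminus> g (T z))"
      by (rule Hil.nm_dist_triangle) (use cl in auto)
    also have "onb.dg \<pi> (g z) \<boxminus> g (T z) = g (onb.dg \<pi> z \<boxminus> T z)"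
      using g(3)[rule_format, OF \<open>onb.constant_on_parts J \<pi>\<close> zc(1)] Hil.lin_mi[OF lg cl(4,1)] by simp
    also have "Hil.nm \<dots> = Hil.nm (T z \<boxminus> onb.dg \<pi> z)"
      using Hil.unitary_nm[OF g(1)] Hil.nm_mi_commute[OF cl(4,1)] cl by simp
    also have "Hil.nm (T (g z) \<boxminus> onb.dg \<pi> (g z)) + \<dots> \<le> h * Hil.nm z + h * Hil.nm z"
      using T\<pi>[OF gV[OF zc(1)]] T\<pi>[OF zc(1)] Hil.unitary_nm[OF g(1) zc(1)] by simp
    finally show ?thesis using hz by linarith
  qed
  have "(\<Sum>A\<in>J. \<bar>onb.mass A x - onb.mass A y\<bar>) \<le> (\<Sum>A\<in>P. \<bar>onb.mass (part A) x - onb.mass (part A) y\<bar>)"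
    unfolding J_def using sum_image_le[OF P(1), of "\<lambda>A. \<bar>onb.mass A x - onb.mass A y\<bar>" part] by simp
  also have "\<dots> \<le> (\<Sum>A\<in>P. \<bar>cmass A x - cmass A y\<bar> +
      (\<Sum>e\<in>{e \<in> F. \<kappa> e \<in> A}. \<bar>(cmod (hinner H x e))\<^sup>2 - (cmod (hinner H y e))\<^sup>2\<bar>))"
  proof (rule sum_mono)
    fix A assume "A \<in> P"
    let ?F = "{e \<in> F. \<kappa> e \<in> A}"
    have m: "cmass A z = onb.mass (part A) z + (\<Sum>e\<in>?F. (cmod (hinner H z e))\<^sup>2)" if z: "z \<in> carrier H" for z
    proof -
      have "cmass A z = onb.mass (part A \<union> ?F) z"
        unfolding cmass_def onb.mass_def using F(2) by (auto simp: part_def intro!: arg_cong2[of _ _ _ _ infsum])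
      also have "\<dots> = onb.mass (part A) z + onb.mass ?F z" by (rule onb.mass_Un[OF z]) (auto simp: part_def)
      also have "onb.mass ?F z = (\<Sum>e\<in>?F. (cmod (hinner H z e))\<^sup>2)"
        by (rule onb.mass_finite) (use F in auto)
      finally show ?thesis .
    qed
    have "\<bar>(\<Sum>e\<in>?F. (cmod (hinner H x e))\<^sup>2) - (\<Sum>e\<in>?F. (cmod (hinner H y e))\<^sup>2)\<bar>
        \<le> (\<Sum>e\<in>?F. \<bar>(cmod (hinner H x e))\<^sup>2 - (cmod (hinner H y e))\<^sup>2\<bar>)"
      unfolding sum_subtractf[symmetric] by (rule sum_abs)
    then show "\<bar>onb.mass (part A) x - onb.mass (part A) y\<bar> \<le> \<bar>cmass A x - cmass A y\<bar> +
      (\<Sum>e\<in>?F. \<bar>(cmod (hinner H x e))\<^sup>2 - (cmod (hinner H y e))\<^sup>2\<bar>)"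
      using m[OF xy(1)] m[OF xy(2)] by linarith
  qed
  also have "\<dots> = (\<Sum>A\<in>P. \<bar>cmass A x - cmass A y\<bar>) +
      (\<Sum>e\<in>F. \<bar>(cmod (hinner H x e))\<^sup>2 - (cmod (hinner H y e))\<^sup>2\<bar>)"
  proof -
    have "(\<Sum>A\<in>P. \<Sum>e\<in>{e \<in> F. \<kappa> e \<in> A}. f e) = (\<Sum>e\<in>F. f e)" for f :: "'u \<Rightarrow> real"
    proof -
      have "(\<Sum>e\<in>(\<Union>A\<in>P. {e \<in> F. \<kappa> e \<in> A}). f e) = (\<Sum>A\<in>P. \<Sum>e\<in>{e \<in> F. \<kappa> e \<in> A}. f e)"
        using P(1,3) F(1) by (intro sum.UNION_disjoint) auto
      moreover have "(\<Union>A\<in>P. {e \<in> F. \<kappa> e \<in> A}) = F" using P(4) F(2) eigenvalue_in by blast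
      ultimately show ?thesis by simp
    qed
    then show ?thesis by (simp add: sum.distrib)
  qed
  finally show ?thesis using that[OF g(1) _ g(2)] comm g(4) by simp
qed

end

text \<open>A finite set whose sum is within \<open>e\<close> of the supremum leaves less than
  \<open>e\<close> to any finite set disjoint from it.\<close>

lemma bounded_sums_tail:
  fixes f :: "'a \<Rightarrow> real"
  assumes nonneg: "\<And>x. 0 \<le> f x" and bnd: "\<And>G. finite G \<Longrightarrow> G \<subseteq> D \<Longrightarrow> sum f G \<le> C" and e: "e > 0"
  shows "\<exists>I. finite I \<and> I \<subseteq> D \<and> (\<forall>G. finite G \<longrightarrow> G \<subseteq> D - I \<longrightarrow> sum f G \<le> e)"
proof -
  define A where "A = {sum f G | G. finite G \<and> G \<subseteq> D}"
  have bd: "bdd_above A" using bnd by (auto simp: A_def intro!: bdd_aboveI[of _ C])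
  have "sum f {} \<in> A" unfolding A_def by blast
  then have "A \<noteq> {}" by blast
  then obtain r where "r \<in> A" "Sup A - e < r" using less_cSupD[of A "Sup A - e"] e by auto
  then obtain I where I: "finite I" "I \<subseteq> D" "Sup A - e < sum f I" by (auto simp: A_def)
  have "sum f G \<le> e" if G: "finite G" "G \<subseteq> D - I" for G
  proof -
    have "sum f (I \<union> G) \<le> Sup A" by (rule cSup_upper[OF _ bd]) (use I G in \<open>auto simp: A_def\<close>)
    moreover have "sum f (I \<union> G) = sum f I + sum f G" using I G by (intro sum.union_disjoint) auto
    ultimately show ?thesis using I(3) by linarith
  qed
  then show ?thesis using I by blast
qed

section \<open>Support of the parameters and countable codes for types\<close>

context diagonal_model
begin

text \<open>The basis vectors that the parameters can see. Coordinates of a vector are compared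
  along these only; elsewhere it is the distribution of its mass over the eigenvalues that is
  compared.\<close>

definition support :: "'u set \<Rightarrow> 'u set" where
  "support B = {e \<in> E. \<exists>b\<in>B. hinner H b e \<noteq> 0}"

lemma support_subset: "support B \<subseteq> E"
  by (auto simp: support_def)

text \<open>The squared coordinates of one vector form a summable family, so only countably many are
  nonzero, even if \<open>E\<close> is uncountable.\<close>

lemma countable_support: assumes "countable B" "B \<subseteq> B1" shows "countable (support B)"
proof -
  have "countable {e \<in> E. hinner H b e \<noteq> 0}" if "b \<in> B" for b
  proof -
    have b: "b \<in> carrier H" using that assms(2) ballD(1) by blast
    have "(\<lambda>e. (cmod (hinner H b e))\<^sup>2) summable_on E" by (rule onb.coord_summable[OF b subset_refl])
    then have "(\<lambda>e. norm ((cmod (hinner H b e))\<^sup>2)) summable_on E" by simp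
    from Infinite_Sum.abs_summable_countable[OF this] show ?thesis by simp
  qed
  then have "countable (\<Union>b\<in>B. {e \<in> E. hinner H b e \<noteq> 0})" using assms(1) by (intro countable_UN) auto
  moreover have "support B = (\<Union>b\<in>B. {e \<in> E. hinner H b e \<noteq> 0})" by (auto simp: support_def)
  ultimately show ?thesis by simp
qed

lemma support_approx:
  assumes b: "b \<in> carrier H" "b \<in> B" and d: "d > 0"
  obtains F where "finite F" "F \<subseteq> support B" "onb.mass (E - F) b \<le> d"
proof -
  obtain F where F: "finite F" "F \<subseteq> E" "\<And>G. finite G \<Longrightarrow> G \<subseteq> E - F \<Longrightarrow> (\<Sum>e\<in>G. (cmod (hinner H b e))\<^sup>2) \<le> d"
    using bounded_sums_tail[of "\<lambda>e. (cmod (hinner H b e))\<^sup>2" E "(Hil.nm b)\<^sup>2" d] onb.bessel b d by auto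
  define F' where "F' = {e \<in> F. hinner H b e \<noteq> 0}"
  have "onb.mass (E - F') b = (\<Sum>\<^sub>\<infinity>e\<in>E - F. (cmod (hinner H b e))\<^sup>2)"
    unfolding onb.mass_def using F(2) by (intro infsum_cong_neutral) (auto simp: F'_def)
  also have "\<dots> \<le> d"
  proof (rule infsum_le_finite_sums)
    show "(\<lambda>e. (cmod (hinner H b e))\<^sup>2) summable_on E - F" by (rule onb.coord_summable[OF b(1)]) auto
    show "(\<Sum>e\<in>G. (cmod (hinner H b e))\<^sup>2) \<le> d" if "finite G" "G \<subseteq> E - F" for G by (rule F(3)[OF that])
  qed
  finally show ?thesis using that[of F'] F b(2) by (auto simp: F'_def support_def)
qed

lemma sq_diff_le:
  fixes x a :: complex
  assumes "cmod (x - a) \<le> d" "cmod x \<le> 1" "cmod a \<le> 1"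
  shows "\<bar>(cmod x)\<^sup>2 - (cmod a)\<^sup>2\<bar> \<le> 2 * d"
proof -
  have "\<bar>(cmod x)\<^sup>2 - (cmod a)\<^sup>2\<bar> = \<bar>cmod x - cmod a\<bar> * (cmod x + cmod a)"
    by (simp add: power2_eq_square square_diff_square_factored abs_mult)
  also have "\<dots> \<le> d * 2"
    using assms norm_triangle_ineq3[of x a] by (intro mult_mono) auto
  finally show ?thesis by simp
qed

text \<open>A vector near \<open>p\<close> is moved by an almost automorphism to a place close to a
  vector near \<open>q\<close>. Coordinates along a finite part \<open>F\<close> of the support
  contribute \<open>2 * 8 * eps\<close>, the masses \<open>3 * eps\<close>, the correction for
  \<open>F\<close> \<open>6 * eps\<close>, and the approximation errors one more \<open>eps\<close>:
  in all 26. The formulas for \<open>p\<close> survive the move since \<open>g\<close> almost fixes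
  their parameters and almost commutes with \<open>T\<close>.\<close>

lemma close_data_satisfiable:
  assumes B: "B \<subseteq> B1" and p: "limit_data B p lp Np" and q: "limit_data B q lq Nq"
    and e1: "\<And>G. finite G \<Longrightarrow> G \<subseteq> support B \<Longrightarrow> (\<Sum>e\<in>G. (cmod (lp e - lq e))\<^sup>2) \<le> 8 * eps"
    and e2: "\<And>G. finite G \<Longrightarrow> G \<subseteq> support B \<Longrightarrow> (\<Sum>e\<in>G. \<bar>(cmod (lp e))\<^sup>2 - (cmod (lq e))\<^sup>2\<bar>) \<le> 6 * eps"
    and e3: "\<And>P. finite P \<Longrightarrow> (\<And>A. A \<in> P \<Longrightarrow> clopen_in K A) \<Longrightarrow>
      (\<And>A B. A \<in> P \<Longrightarrow> B \<in> P \<Longrightarrow> A \<noteq> B \<Longrightarrow> A \<inter> B = {}) \<Longrightarrow> \<Union>P = K \<Longrightarrow> (\<Sum>A\<in>P. \<bar>Np A - Nq A\<bar>) \<le> 3 * eps"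
    and eps: "eps > 0" "26 * eps \<le> s\<^sup>2" "s \<ge> 0"
    and F1: "finite F1" "F1 \<subseteq> fmls_over B 1" and F2: "finite F2" "F2 \<subseteq> fmls_over B 1" and d0: "d0 > 0"
  shows "\<exists>v. range v \<subseteq> B1 \<and> Hil.nm (v 0 \<boxminus> v 1) \<le> s \<and> (\<forall>f\<in>F1. \<bar>fval H T f v - p f\<bar> < d0) \<and>
        (\<forall>f\<in>F2. \<bar>fval H T f (v \<circ> swap01) - q f\<bar> < d0)"
proof -
  have "\<exists>d>0. \<forall>g v. almost_automorphism d (fml_pars f) g \<longrightarrow> range v \<subseteq> B1 \<longrightarrow>
     \<bar>fval H T f (g \<circ> v) - fval H T f v\<bar> \<le> d0 / 2" if "f \<in> F1" for f
    by (rule fval_almost_automorphism)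
      (use that F1(2) fmls_over_D(1,2)[of f B 1] B d0 in \<open>auto simp: subset_iff\<close>)
  then obtain D where D: "\<And>f. f \<in> F1 \<Longrightarrow> D f > 0"
    "\<And>f g v. f \<in> F1 \<Longrightarrow> almost_automorphism (D f) (fml_pars f) g \<Longrightarrow> range v \<subseteq> B1 \<Longrightarrow>
     \<bar>fval H T f (g \<circ> v) - fval H T f v\<bar> \<le> d0 / 2" by metis
  \<comment> \<open>Only the formulas in \<open>F1\<close> restrict \<open>g\<close>, as the vector
    for \<open>q\<close> stays in place.\<close>
  define d where "d = Min (insert 1 (D ` F1))"
  have d: "d > 0" "\<And>f. f \<in> F1 \<Longrightarrow> d \<le> D f" using D(1) F1(1) by (auto simp: d_def)
  then have d2: "d / 2 > 0" "(d / 2)\<^sup>2 > 0" by simp_all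
  define B0 where "B0 = (\<Union>f\<in>F1. fml_pars f)"
  have "finite B0" using F1(1) finite_fml_pars by (auto simp: B0_def)
  moreover have "B0 \<subseteq> B"
    unfolding B0_def by (rule UN_least) (rule fmls_over_D(2), rule subsetD[OF F1(2)])
  ultimately have B0: "finite B0" "B0 \<subseteq> B" by simp_all
  have B0c: "b \<in> carrier H" if "b \<in> B0" for b using that B0 B ballD(1) by blast
  have "\<exists>F. finite F \<and> F \<subseteq> support B \<and> onb.mass (E - F) b \<le> (d / 2)\<^sup>2" if "b \<in> B0" for b
    by (rule support_approx[OF B0c[OF that] _ d2(2), of B]) (use that B0 in auto)
  then obtain Fb where Fb: "\<And>b. b \<in> B0 \<Longrightarrow> finite (Fb b) \<and> Fb b \<subseteq> support B \<and> onb.mass (E - Fb b) b \<le> (d / 2)\<^sup>2"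
    by metis
  define F where "F = (\<Union>b\<in>B0. Fb b)"
  have F: "finite F" "F \<subseteq> support B" using Fb B0(1) by (auto simp: F_def)
  have FE: "F \<subseteq> E" using F(2) support_subset by blast
  have tail: "onb.mass (E - F) b \<le> (d / 2)\<^sup>2" if b: "b \<in> B0" for b
  proof -
    have "onb.mass (E - Fb b) b = onb.mass ((E - F) \<union> (F - Fb b)) b"
      using FE b by (intro arg_cong[of _ _ "\<lambda>A. onb.mass A b"]) (auto simp: F_def)
    also have "\<dots> = onb.mass (E - F) b + onb.mass (F - Fb b) b"
      by (rule onb.mass_Un[OF B0c[OF b]]) auto
    finally show ?thesis using Fb[OF b] onb.mass_nonneg[of "F - Fb b" b] by linarith
  qed
  obtain P c where P: "finite P" "\<And>A. A \<in> P \<Longrightarrow> clopen_in K A"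
     "\<And>A z. A \<in> P \<Longrightarrow> z \<in> A \<Longrightarrow> cmod (z - c A) \<le> d / 2"
     "\<And>A B. A \<in> P \<Longrightarrow> B \<in> P \<Longrightarrow> A \<noteq> B \<Longrightarrow> A \<inter> B = {}" "\<Union>P = K"
    by (rule clopen_partition[OF K_compact K_countable d2(1)]) (rule that)
  define k where "k = real (card F) + real (card P)"
  \<comment> \<open>The errors amount to \<open>8 * r\<close> and \<open>4 * r\<close> for each
    element of \<open>F\<close> and \<open>2 * r\<close> for each piece, together at most
    \<open>12 * k * r\<close>. The bound 1 permits replacing \<open>r^2\<close> by
    \<open>r\<close>.\<close>
  define r where "r = Min {d0 / 2, 1, eps / (12 * k + 1)}"
  have k: "k \<ge> 0" by (simp add: k_def)
  have r: "r > 0" "r \<le> d0 / 2" "r \<le> 1" "12 * k * r \<le> eps"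
  proof -
    show "r > 0" using d0 eps k by (simp add: r_def)
    show "r \<le> d0 / 2" "r \<le> 1" unfolding r_def by (rule Min_le; simp)+
    have "r \<le> eps / (12 * k + 1)" unfolding r_def by (rule Min_le) simp_all
    then have "r * (12 * k + 1) \<le> eps" using k by (simp add: pos_le_divide_eq)
    then show "12 * k * r \<le> eps" using \<open>r > 0\<close> by (simp add: algebra_simps)
  qed
  obtain x :: "nat \<Rightarrow> 'u" where x: "range x \<subseteq> B1" "\<forall>f\<in>F1. \<bar>fval H T f x - p f\<bar> < r"
    "\<forall>e\<in>F. cmod (hinner H (x 0) e - lp e) < r" "\<forall>C\<in>P. \<bar>cmass C (x 0) - Np C\<bar> < r"
    by (rule limit_dataD[OF p F1 F(1) FE P(1) r(1)]) (rule that)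
  obtain y :: "nat \<Rightarrow> 'u" where y: "range y \<subseteq> B1" "\<forall>f\<in>F2. \<bar>fval H T f y - q f\<bar> < r"
    "\<forall>e\<in>F. cmod (hinner H (y 0) e - lq e) < r" "\<forall>C\<in>P. \<bar>cmass C (y 0) - Nq C\<bar> < r"
    by (rule limit_dataD[OF q F2 F(1) FE P(1) r(1)]) (rule that)
  have xy: "x 0 \<in> B1" "y 0 \<in> B1" using x(1) y(1) by auto
  obtain g where g: "Hil.unitary g" "\<forall>z\<in>B1. Hil.nm (T (g z) \<boxminus> g (T z)) \<le> 2 * (d / 2)"
    "\<forall>z\<in>carrier H. (\<forall>e\<in>E - F. hinner H z e = 0) \<longrightarrow> g z = z"
    "(Hil.nm (g (x 0) \<boxminus> y 0))\<^sup>2 \<le> (\<Sum>e\<in>F. (cmod (hinner H (x 0) e - hinner H (y 0) e))\<^sup>2) +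
      (\<Sum>A\<in>P. \<bar>cmass A (x 0) - cmass A (y 0)\<bar>) +
      (\<Sum>e\<in>F. \<bar>(cmod (hinner H (x 0) e))\<^sup>2 - (cmod (hinner H (y 0) e))\<^sup>2\<bar>)"
  proof (rule almost_conjugate[OF less_imp_le[OF d2(1)] P(1) _ _ P(5) F(1) FE xy])
    show "cmod (z - c A) \<le> d / 2" if "A \<in> P" "z \<in> A" for A z by (rule P(3)[OF that])
    show "A \<inter> B = {}" if "A \<in> P" "B \<in> P" "A \<noteq> B" for A B by (rule P(4)[OF that])
  qed (rule that)
  have s1: "(\<Sum>e\<in>F. (cmod (hinner H (x 0) e - hinner H (y 0) e))\<^sup>2) \<le> 16 * eps + 8 * r * real (card F)"
  proof -
    have "(\<Sum>e\<in>F. (cmod (hinner H (x 0) e - hinner H (y 0) e))\<^sup>2) \<le> (\<Sum>e\<in>F. 2 * (cmod (lp e - lq e))\<^sup>2 + 8 * r)"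
    proof (rule sum_mono)
      fix e assume e: "e \<in> F"
      let ?a = "hinner H (x 0) e - lp e" and ?b = "lq e - hinner H (y 0) e" and ?c = "lp e - lq e"
      have "hinner H (x 0) e - hinner H (y 0) e = ?c + (?a + ?b)" by simp
      then have "cmod (hinner H (x 0) e - hinner H (y 0) e) \<le> cmod ?c + (cmod ?a + cmod ?b)"
        by (metis add_left_mono norm_triangle_ineq order_trans)
      also have "\<dots> \<le> cmod ?c + 2 * r"
        using bspec[OF x(3) e] bspec[OF y(3) e] norm_minus_commute[of "lq e"] by simp
      finally have "(cmod (hinner H (x 0) e - hinner H (y 0) e))\<^sup>2 \<le> (cmod ?c + 2 * r)\<^sup>2"
        by (intro power_mono) auto
      also have "\<dots> \<le> 2 * (cmod ?c)\<^sup>2 + 2 * (2 * r)\<^sup>2"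
        using sum_squares_bound[of "cmod ?c" "2 * r"] by (simp add: power2_sum)
      also have "2 * (2 * r)\<^sup>2 \<le> 8 * r" using r(1,3) by (simp add: power2_eq_square)
      finally show "(cmod (hinner H (x 0) e - hinner H (y 0) e))\<^sup>2 \<le> 2 * (cmod ?c)\<^sup>2 + 8 * r" by simp
    qed
    also have "\<dots> = 2 * (\<Sum>e\<in>F. (cmod (lp e - lq e))\<^sup>2) + 8 * r * real (card F)"
      by (simp add: sum.distrib sum_distrib_left mult.commute)
    finally show ?thesis using e1[OF F] by linarith
  qed
  have s2: "(\<Sum>A\<in>P. \<bar>cmass A (x 0) - cmass A (y 0)\<bar>) \<le> 3 * eps + 2 * r * real (card P)"
  proof -
    have "(\<Sum>A\<in>P. \<bar>cmass A (x 0) - cmass A (y 0)\<bar>) \<le> (\<Sum>A\<in>P. \<bar>Np A - Nq A\<bar> + 2 * r)"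
    proof (rule sum_mono)
      fix A assume "A \<in> P"
      then show "\<bar>cmass A (x 0) - cmass A (y 0)\<bar> \<le> \<bar>Np A - Nq A\<bar> + 2 * r"
        using bspec[OF x(4), of A] bspec[OF y(4), of A] by linarith
    qed
    also have "\<dots> = (\<Sum>A\<in>P. \<bar>Np A - Nq A\<bar>) + 2 * r * real (card P)"
      by (simp add: sum.distrib mult.commute)
    also have "(\<Sum>A\<in>P. \<bar>Np A - Nq A\<bar>) \<le> 3 * eps" by (rule e3) (use P in auto)
    finally show ?thesis by simp
  qed
  have s3: "(\<Sum>e\<in>F. \<bar>(cmod (hinner H (x 0) e))\<^sup>2 - (cmod (hinner H (y 0) e))\<^sup>2\<bar>) \<le> 6 * eps + 4 * r * real (card F)"
  proof -
    have "(\<Sum>e\<in>F. \<bar>(cmod (hinner H (x 0) e))\<^sup>2 - (cmod (hinner H (y 0) e))\<^sup>2\<bar>)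
        \<le> (\<Sum>e\<in>F. \<bar>(cmod (lp e))\<^sup>2 - (cmod (lq e))\<^sup>2\<bar> + 4 * r)"
    proof (rule sum_mono)
      fix e assume e: "e \<in> F"
      then have eE: "e \<in> E" using FE by blast
      have "\<bar>(cmod (hinner H (x 0) e))\<^sup>2 - (cmod (lp e))\<^sup>2\<bar> \<le> 2 * r"
        by (rule sq_diff_le)
          (use bspec[OF x(3) e] coord_le_1[OF xy(1) eE] limit_data_bessel(2)[OF p finite.emptyI empty_subsetI eE] in auto)
      moreover have "\<bar>(cmod (hinner H (y 0) e))\<^sup>2 - (cmod (lq e))\<^sup>2\<bar> \<le> 2 * r"
        by (rule sq_diff_le)
          (use bspec[OF y(3) e] coord_le_1[OF xy(2) eE] limit_data_bessel(2)[OF q finite.emptyI empty_subsetI eE] in auto)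
      ultimately show "\<bar>(cmod (hinner H (x 0) e))\<^sup>2 - (cmod (hinner H (y 0) e))\<^sup>2\<bar>
          \<le> \<bar>(cmod (lp e))\<^sup>2 - (cmod (lq e))\<^sup>2\<bar> + 4 * r" by linarith
    qed
    also have "\<dots> = (\<Sum>e\<in>F. \<bar>(cmod (lp e))\<^sup>2 - (cmod (lq e))\<^sup>2\<bar>) + 4 * r * real (card F)"
      by (simp add: sum.distrib mult.commute)
    finally show ?thesis using e2[OF F] by linarith
  qed
  have "(Hil.nm (g (x 0) \<boxminus> y 0))\<^sup>2 \<le> 25 * eps + 12 * r * real (card F) + 2 * r * real (card P)"
    using g(4) s1 s2 s3 by linarith
  also have "\<dots> \<le> 25 * eps + 12 * k * r"
    using r(1) by (simp add: k_def algebra_simps)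
  also have "\<dots> \<le> s\<^sup>2" using r(4) eps(2) by linarith
  finally have near: "Hil.nm (g (x 0) \<boxminus> y 0) \<le> s" using eps(3) by (rule power2_le_imp_le)
  note lg = Hil.unitaryD(1)[OF g(1)]
  \<comment> \<open>The component of \<open>b\<close> along \<open>F\<close> is fixed by
    \<open>g\<close>; the rest has norm at most \<open>d / 2\<close> and is moved by at most twice
    its norm.\<close>
  have "Hil.nm (g b \<boxminus> b) \<le> d" if b: "b \<in> B0" for b
  proof -
    have bc: "b \<in> carrier H" by (rule B0c[OF b])
    define b1 where "b1 = onb.dg (indicator F) b"
    define b2 where "b2 = onb.dg (indicator (E - F)) b"
    have c12: "b1 \<in> carrier H" "b2 \<in> carrier H" using bc by (auto simp: b1_def b2_def onb.dg)
    have b12: "b = b1 \<oplus>\<^bsub>H\<^esub> b2"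
      by (rule onb.coord_eqI) (use bc c12 in \<open>auto simp: b1_def b2_def onb.dg indicator_def\<close>)
    have "g b1 = b1"
      using g(3) c12(1) bc by (auto simp: b1_def onb.dg indicator_def)
    then have "g b \<boxminus> b = g b2 \<boxminus> b2"
      using c12 Hil.lin_ad[OF lg c12] Hil.linD[OF lg] by (intro Hil.vec_eqI) (auto simp: b12)
    then have "Hil.nm (g b \<boxminus> b) \<le> Hil.nm (g b2) + Hil.nm b2"
      using Hil.nm_triangle_mi[of "g b2" b2] c12 Hil.linD[OF lg] by simp
    also have "\<dots> = 2 * Hil.nm b2" using Hil.unitary_nm[OF g(1) c12(2)] by simp
    also have "Hil.nm b2 \<le> d / 2"
    proof (rule power2_le_imp_le)
      show "(Hil.nm b2)\<^sup>2 \<le> (d / 2)\<^sup>2" using tail[OF b] onb.mass_eq_nm[OF bc] by (simp add: b2_def)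
    qed (use d in simp)
    finally show ?thesis by simp
  qed
  then have aa: "almost_automorphism d B0 g"
    using g(1,2) by (simp add: almost_automorphism_def)
  define v where "v = (\<lambda>i :: nat. if i = 0 then g (x 0) else if i = 1 then y 0 else \<zero>\<^bsub>H\<^esub>)"
  have gx: "g (x 0) \<in> B1" using unitary_ball[OF g(1)] xy(1) by blast
  have "range v \<subseteq> B1" using gx xy(2) zero_ball by (auto simp: v_def)
  moreover have "Hil.nm (v 0 \<boxminus> v 1) \<le> s" using near by (simp add: v_def)
  moreover have "\<bar>fval H T f v - p f\<bar> < d0" if f: "f \<in> F1" for f
  proof -
    have "fval H T f v = fval H T f (g \<circ> x)"
      by (rule fval_at_0[of f B]) (use f F1(2) in \<open>auto simp: v_def\<close>)
    moreover have "\<bar>fval H T f (g \<circ> x) - fval H T f x\<bar> \<le> d0 / 2"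
      by (rule D(2)[OF f almost_automorphism_mono[OF aa d(2)[OF f]] x(1)]) (use f in \<open>auto simp: B0_def\<close>)
    ultimately show ?thesis using bspec[OF x(2) f] r(2) by linarith
  qed
  moreover have "\<bar>fval H T f (v \<circ> swap01) - q f\<bar> < d0" if f: "f \<in> F2" for f
  proof -
    have "fval H T f (v \<circ> swap01) = fval H T f y"
      by (rule fval_at_0[of f B]) (use f F2(2) in \<open>auto simp: v_def\<close>)
    then show ?thesis using bspec[OF y(2) f] r(2) d0 by linarith
  qed
  ultimately show ?thesis by (intro exI[of _ v]) simp
qed

text \<open>At accuracy \<open>n\<close> a type is encoded by finitely many basis vectors with
  rounded coordinates, finitely many points of \<open>K\<close> with rounded point masses, and the
  rounding scale. Only countably many codes occur, and types with the same code are close, so one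
  representative of each code at each accuracy gives a dense set.\<close>

theorem types_separable_countable:
  assumes B: "countable B" "B \<subseteq> B1"
  shows "types_separable H T B"
proof -
  define Ty where "Ty = types_over H T B 1"
  have "\<exists>lN. limit_data B p (fst lN) (snd lN)" if "p \<in> Ty" for p
    using limit_data_exists[OF B(2)] that by (simp add: Ty_def)
  then obtain lN where "\<And>p. p \<in> Ty \<Longrightarrow> limit_data B p (fst (lN p)) (snd (lN p))" by metis
  then obtain l N where data: "\<And>p. p \<in> Ty \<Longrightarrow> limit_data B p (l p) (N p)"
    by (rule that[of "\<lambda>p. fst (lN p)" "\<lambda>p. snd (lN p)"])
  define pm where "pm p = clopen_content.point_mass K (N p)" for p
  have cc: "clopen_content K (N p)" if "p \<in> Ty" for p by (rule limit_data_clopen_content[OF data[OF that]])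
  have "\<exists>I. finite I \<and> I \<subseteq> support B \<and>
      (\<forall>G. finite G \<longrightarrow> G \<subseteq> support B - I \<longrightarrow> (\<Sum>e\<in>G. (cmod (l p e))\<^sup>2) \<le> 1 / real (Suc n))" if "p \<in> Ty" for p n
    by (rule bounded_sums_tail[where C = 1])
      (use limit_data_bessel(1)[OF data[OF that]] support_subset[of B] in auto)
  then obtain I where I: "\<And>p n. p \<in> Ty \<Longrightarrow> finite (I p n)" "\<And>p n. p \<in> Ty \<Longrightarrow> I p n \<subseteq> support B"
      "\<And>p n G. p \<in> Ty \<Longrightarrow> finite G \<Longrightarrow> G \<subseteq> support B - I p n \<Longrightarrow>
        (\<Sum>e\<in>G. (cmod (l p e))\<^sup>2) \<le> 1 / real (Suc n)" by metis
  have "\<exists>L. finite L \<and> L \<subseteq> K \<and> N p K \<le> (\<Sum>z\<in>L. pm p z) + 1 / real (Suc n)" if "p \<in> Ty" for p n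
    unfolding pm_def by (rule clopen_content.point_masses_exhaust[OF cc[OF that], of "1 / real (Suc n)"]) auto
  then obtain L where L: "\<And>p n. p \<in> Ty \<Longrightarrow> finite (L p n)" "\<And>p n. p \<in> Ty \<Longrightarrow> L p n \<subseteq> K"
      "\<And>p n. p \<in> Ty \<Longrightarrow> N p K \<le> (\<Sum>z\<in>L p n. pm p z) + 1 / real (Suc n)" by metis
  \<comment> \<open>The scale grows with the number of rounded values, so that errors of order
    \<open>1 / M\<close> add up to order \<open>1 / (n + 1)\<close>; the summand 1 keeps it
    positive.\<close>
  define M where "M p n = (card (I p n) + card (L p n) + 1) * Suc n" for p n
  \<comment> \<open>Rounded values are stored with their indices, so equal codes have the same sets
    \<open>I\<close> and \<open>L\<close>; the scale is stored to make the roundings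
    comparable.\<close>
  define code where "code n p = (M p n,
      (\<lambda>e. (e, \<lfloor>real (M p n) * Re (l p e)\<rfloor>, \<lfloor>real (M p n) * Im (l p e)\<rfloor>)) ` I p n,
      (\<lambda>z. (z, \<lfloor>real (M p n) * pm p z\<rfloor>)) ` L p n)" for n p
  have count: "countable (code n ` Ty)" for n
  proof (rule countable_subset)
    let ?S = "support B \<times> (UNIV :: int set) \<times> (UNIV :: int set)" and ?S' = "K \<times> (UNIV :: int set)"
    show "countable ((UNIV :: nat set) \<times> {A. finite A \<and> A \<subseteq> ?S} \<times> {A. finite A \<and> A \<subseteq> ?S'})"
      by (intro countable_SIGMA countable_Collect_finite_subset)
        (simp_all add: countable_support[OF B] K_countable)
    show "code n ` Ty \<subseteq> (UNIV :: nat set) \<times> {A. finite A \<and> A \<subseteq> ?S} \<times> {A. finite A \<and> A \<subseteq> ?S'}"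
    proof
      fix c assume "c \<in> code n ` Ty"
      then obtain p where p: "p \<in> Ty" "c = code n p" by blast
      show "c \<in> (UNIV :: nat set) \<times> {A. finite A \<and> A \<subseteq> ?S} \<times> {A. finite A \<and> A \<subseteq> ?S'}"
        unfolding p(2) code_def using I(1,2)[OF p(1), of n] L(1,2)[OF p(1), of n] by auto
    qed
  qed
  define pick where "pick n c = inv_into Ty (code n) c" for n c
  define D where "D = (\<Union>n. pick n ` code n ` Ty)"
  have D: "countable D" "D \<subseteq> Ty"
    using count by (auto simp: D_def pick_def inv_into_into)
  have "\<exists>q\<in>D. type_dist H T B p q < e" if p: "p \<in> Ty" and e: "e > 0" for p e
  proof -
    have "e\<^sup>2 / 26 > 0" using e by simp
    then obtain n where n: "inverse (real (Suc n)) < e\<^sup>2 / 26" using reals_Archimedean by blast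
    define eps where "eps = 1 / real (Suc n)"
    have eps: "eps > 0" "26 * eps \<le> e\<^sup>2" using n by (simp_all add: eps_def inverse_eq_divide)
    define q where "q = pick n (code n p)"
    have q: "q \<in> Ty" "code n q = code n p"
      using p by (auto simp: q_def pick_def inv_into_into f_inv_into_f)
    have qD: "q \<in> D" using p by (auto simp: D_def q_def)
    have MM: "M q n = M p n" using q(2) by (simp add: code_def)
    define m where "m = real (M p n)"
    have m1: "m \<ge> 1" by (simp add: m_def M_def del: of_nat_Suc of_nat_add of_nat_mult)
    have mcard: "real (card (I p n)) \<le> eps * m" "real (card (L p n)) \<le> eps * m"
      unfolding eps_def m_def M_def by (simp_all add: field_simps)
    have imI: "(\<lambda>e. (e, \<lfloor>m * Re (l q e)\<rfloor>, \<lfloor>m * Im (l q e)\<rfloor>)) ` I q n =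
        (\<lambda>e. (e, \<lfloor>m * Re (l p e)\<rfloor>, \<lfloor>m * Im (l p e)\<rfloor>)) ` I p n"
      and imL: "(\<lambda>z. (z, \<lfloor>m * pm q z\<rfloor>)) ` L q n = (\<lambda>z. (z, \<lfloor>m * pm p z\<rfloor>)) ` L p n"
      using q(2) by (simp_all add: code_def MM m_def)
    have II: "I q n = I p n" using arg_cong[OF imI, of "image fst"] by (simp add: image_image)
    have LL: "L q n = L p n" using arg_cong[OF imL, of "image fst"] by (simp add: image_image)
    have cl: "cmod (l p e - l q e) \<le> 2 / m" if "e \<in> I p n" for e
    proof -
      have "(e, \<lfloor>m * Re (l p e)\<rfloor>, \<lfloor>m * Im (l p e)\<rfloor>) \<in> (\<lambda>e. (e, \<lfloor>m * Re (l q e)\<rfloor>, \<lfloor>m * Im (l q e)\<rfloor>)) ` I q n"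
        unfolding imI using that by blast
      then have "\<lfloor>m * Re (l p e)\<rfloor> = \<lfloor>m * Re (l q e)\<rfloor>" "\<lfloor>m * Im (l p e)\<rfloor> = \<lfloor>m * Im (l q e)\<rfloor>" by auto
      then have "\<bar>Re (l p e) - Re (l q e)\<bar> \<le> 1 / m" "\<bar>Im (l p e) - Im (l q e)\<bar> \<le> 1 / m"
        using m1 by (auto intro!: floor_eq_imp_close)
      then show ?thesis using cmod_le[of "l p e - l q e"] by simp
    qed
    have cl': "\<bar>pm p z - pm q z\<bar> \<le> 1 / m" if "z \<in> L p n" for z
    proof -
      have "(z, \<lfloor>m * pm p z\<rfloor>) \<in> (\<lambda>z. (z, \<lfloor>m * pm q z\<rfloor>)) ` L q n"
        unfolding imL using that by blast
      then have "\<lfloor>m * pm p z\<rfloor> = \<lfloor>m * pm q z\<rfloor>" by auto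
      then show ?thesis using m1 by (auto intro!: floor_eq_imp_close)
    qed
    have one: "cmod (l p' e) \<le> 1" if "p' \<in> Ty" "e \<in> E" for p' e
      by (rule limit_data_bessel(2)[OF data[OF that(1)] finite.emptyI empty_subsetI that(2)])
    have est: "(\<Sum>e\<in>G. (cmod (l p e - l q e))\<^sup>2) \<le> 8 * eps \<and>
        (\<Sum>e\<in>G. \<bar>(cmod (l p e))\<^sup>2 - (cmod (l q e))\<^sup>2\<bar>) \<le> 6 * eps" if G: "finite G" "G \<subseteq> support B" for G
    proof -
      have t1: "(\<Sum>e\<in>G. (cmod (l p e))\<^sup>2) \<le> eps" if "finite G" "G \<subseteq> support B - I p n" for G
        unfolding eps_def by (rule I(3)[OF p that])
      have t2: "(\<Sum>e\<in>G. (cmod (l q e))\<^sup>2) \<le> eps" if "finite G" "G \<subseteq> support B - I p n" for G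
        unfolding eps_def by (rule I(3)[OF q(1)]) (use that II in auto)
      have GE: "e \<in> E" if "e \<in> G" for e using that G(2) support_subset by blast
      have o1: "cmod (l p e) \<le> 1" "cmod (l q e) \<le> 1" if "e \<in> G" for e
        using one[OF p GE[OF that]] one[OF q(1) GE[OF that]] by auto
      show ?thesis
        using l2_code_estimates[OF I(1)[OF p] G m1 mcard(1), of "l p" "l q", OF t1 t2 cl o1] by blast
    qed
    have est3: "(\<Sum>A\<in>P. \<bar>N p A - N q A\<bar>) \<le> 3 * eps"
      if P: "finite P" "\<And>A. A \<in> P \<Longrightarrow> clopen_in K A"
        "\<And>A B. A \<in> P \<Longrightarrow> B \<in> P \<Longrightarrow> A \<noteq> B \<Longrightarrow> A \<inter> B = {}" "\<Union>P = K" for P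
    proof (rule content_code_estimate[OF cc[OF p] cc[OF q(1)] P(1) _ _ P(4) L(1,2)[OF p] m1 mcard(2)])
      show "clopen_in K A" if "A \<in> P" for A by (rule P(2)[OF that])
      show "A \<inter> B = {}" if "A \<in> P" "B \<in> P" "A \<noteq> B" for A B by (rule P(3)[OF that])
      show "N p K \<le> (\<Sum>z\<in>L p n. clopen_content.point_mass K (N p) z) + eps"
        using L(3)[OF p, of n] by (simp add: pm_def eps_def)
      show "N q K \<le> (\<Sum>z\<in>L p n. clopen_content.point_mass K (N q) z) + eps"
        using L(3)[OF q(1), of n] by (simp add: pm_def eps_def LL)
      show "\<bar>clopen_content.point_mass K (N p) z - clopen_content.point_mass K (N q) z\<bar> \<le> 1 / m"
        if "z \<in> L p n" for z using cl'[OF that] by (simp add: pm_def)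
    qed
    have "\<exists>r\<in>types_over H T B 2. (\<forall>f\<in>fmls_over B 1. r f = p f \<and> r (fml_rename swap01 f) = q f) \<and>
        r (FDist (Var 0) (Var 1)) \<le> e / 2"
    proof (rule amalgam[OF B(2)])
      fix F1 F2 d assume F: "finite F1" "F1 \<subseteq> fmls_over B 1" "finite F2" "F2 \<subseteq> fmls_over B 1" "(d :: real) > 0"
      show "\<exists>v. range v \<subseteq> B1 \<and> Hil.nm (v 0 \<boxminus> v 1) \<le> e \<and> (\<forall>f\<in>F1. \<bar>fval H T f v - p f\<bar> < d) \<and>
          (\<forall>f\<in>F2. \<bar>fval H T f (v \<circ> swap01) - q f\<bar> < d)"
      proof (rule close_data_satisfiable[OF B(2) data[OF p] data[OF q(1)] _ _ _ eps less_imp_le[OF e] F])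
        show "(\<Sum>e\<in>G. (cmod (l p e - l q e))\<^sup>2) \<le> 8 * eps" if "finite G" "G \<subseteq> support B" for G
          using est[OF that] by blast
        show "(\<Sum>e\<in>G. \<bar>(cmod (l p e))\<^sup>2 - (cmod (l q e))\<^sup>2\<bar>) \<le> 6 * eps" if "finite G" "G \<subseteq> support B" for G
          using est[OF that] by blast
        show "(\<Sum>A\<in>P. \<bar>N p A - N q A\<bar>) \<le> 3 * eps"
          if "finite P" "\<And>A. A \<in> P \<Longrightarrow> clopen_in K A"
            "\<And>A B. A \<in> P \<Longrightarrow> B \<in> P \<Longrightarrow> A \<noteq> B \<Longrightarrow> A \<inter> B = {}" "\<Union>P = K" for P
          by (rule est3[OF that])
      qed
    qed
    then obtain r where r: "r \<in> types_over H T B 2"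
      "\<forall>f\<in>fmls_over B 1. r f = p f \<and> r (fml_rename swap01 f) = q f" "r (FDist (Var 0) (Var 1)) \<le> e / 2"
      by (elim bexE conjE) (rule that)
    have "type_dist H T B p q \<le> e / 2" using type_dist_le[OF B(2) r(1,2)] r(3) by linarith
    then show ?thesis using e qD by (intro bexI[of _ q]) auto
  qed
  then show ?thesis
    unfolding types_separable_def using D by (intro exI[of _ D]) (auto simp: Ty_def)
qed

end

section \<open>From models of the theory to diagonal operators\<close>

lemma (in complex_hilbert_space) bounded_op_lin: "bounded_op H S \<Longrightarrow> Hil.lin S"
  by (simp add: bounded_op_def Hil.lin_def)

lemma (in complex_hilbert_space) bounded_op_bdd: "bounded_op H S \<Longrightarrow> Hil.bdd S"
proof -
  assume "bounded_op H S"
  then obtain C where C: "\<forall>x\<in>carrier H. Hil.nm (S x) \<le> C * Hil.nm x"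
    unfolding bounded_op_def hnorm_eq by blast
  show ?thesis unfolding Hil.bdd_def
  proof (intro exI[of _ "max C 0"] conjI ballI)
    fix x assume x: "x \<in> carrier H"
    have "C * Hil.nm x \<le> max C 0 * Hil.nm x" using x by (intro mult_right_mono) auto
    then show "Hil.nm (S x) \<le> max C 0 * Hil.nm x" using C x by fastforce
  qed simp
qed

lemma (in complex_hilbert_space) normal_op_normal_hilbert:
  assumes "normal_op H T"
  obtains S where "normal_hilbert (carrier H) \<zero>\<^bsub>H\<^esub> (add H) (smult H) (hinner H) T S"
proof -
  obtain S where S: "bounded_op H S" "\<forall>x\<in>carrier H. \<forall>y\<in>carrier H. hinner H (T x) y = hinner H x (S y)"
    "\<forall>x\<in>carrier H. T (S x) = S (T x)"
    using assms unfolding normal_op_def is_adjoint_def by blast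
  have T: "bounded_op H T" using assms by (simp add: normal_op_def)
  have "normal_hilbert (carrier H) \<zero>\<^bsub>H\<^esub> (add H) (smult H) (hinner H) T S"
  proof
    show "Hil.lin T" "Hil.lin S" "Hil.bdd T" using T S bounded_op_lin bounded_op_bdd by blast+
    show "Hil.comm T S" using S(3) by (simp add: Hil.comm_def)
    show "hinner H (T x) y = hinner H x (S y)" if "x \<in> carrier H" "y \<in> carrier H" for x y
      using S(2) that by blast
  qed
  then show ?thesis by (rule that)
qed

text \<open>An inverse of \<open>T - c\<close> with bound \<open>C\<close> would give
  \<open>|x| <= C |T x - c x|\<close>. For an approximate eigenvector with
  \<open>e = 1 / (2 (C + 1))\<close> the right side is at most \<open>|x| / 2\<close>.\<close>

lemma (in complex_hilbert_space) approximate_eigenvalue_in_spectrum: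
  assumes T: "Hil.lin T"
    and ap: "\<And>e. e > 0 \<Longrightarrow> \<exists>x\<in>carrier H. x \<noteq> \<zero>\<^bsub>H\<^esub> \<and>
      Hil.nm (T x \<oplus>\<^bsub>H\<^esub> (-1) \<odot>\<^bsub>H\<^esub> (c \<odot>\<^bsub>H\<^esub> x)) \<le> e * Hil.nm x"
  shows "c \<in> op_spectrum H T"
  unfolding op_spectrum_def
proof (rule CollectI, rule notI)
  assume "\<exists>S. bounded_op H S \<and> (\<forall>x\<in>carrier H.
      S (T x \<ominus>\<^bsub>H\<^esub> c \<odot>\<^bsub>H\<^esub> x) = x \<and> T (S x) \<ominus>\<^bsub>H\<^esub> c \<odot>\<^bsub>H\<^esub> S x = x)"
  then obtain S where S: "bounded_op H S" "\<forall>x\<in>carrier H. S (T x \<ominus>\<^bsub>H\<^esub> c \<odot>\<^bsub>H\<^esub> x) = x" by blast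
  obtain C where C: "C \<ge> 0" "\<forall>x\<in>carrier H. Hil.nm (S x) \<le> C * Hil.nm x"
    using bounded_op_bdd[OF S(1)] unfolding Hil.bdd_def by blast
  define e where "e = 1 / (2 * (C + 1))"
  have e: "e > 0" "C * e \<le> 1 / 2" using C by (auto simp: e_def field_simps)
  obtain x where x: "x \<in> carrier H" "x \<noteq> \<zero>\<^bsub>H\<^esub>"
    "Hil.nm (T x \<oplus>\<^bsub>H\<^esub> (-1) \<odot>\<^bsub>H\<^esub> (c \<odot>\<^bsub>H\<^esub> x)) \<le> e * Hil.nm x" using ap[OF e(1)] by blast
  have Tx: "T x \<in> carrier H" using T x by auto
  let ?y = "T x \<oplus>\<^bsub>H\<^esub> (-1) \<odot>\<^bsub>H\<^esub> (c \<odot>\<^bsub>H\<^esub> x)"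
  have "Hil.nm x = Hil.nm (S ?y)"
    using bspec[OF S(2) x(1)] minus_eq_smult[of "T x" "c \<odot>\<^bsub>H\<^esub> x"] Tx x by simp
  also have "\<dots> \<le> C * Hil.nm ?y" using C(2) Tx x by simp
  also have "\<dots> \<le> C * (e * Hil.nm x)" using x(3) C(1) by (intro mult_left_mono)
  also have "\<dots> \<le> 1 / 2 * Hil.nm x"
    using mult_right_mono[OF e(2), of "Hil.nm x"] x(1) by (simp add: mult.assoc)
  finally show False using Hil.nm_pos[OF x(1,2)] by simp
qed

theorem omega_stable_of_countable:
  assumes K: "compact K" "countable K"
  shows "omega_stable (Sigma_models K m :: ('u hilb \<times> ('u \<Rightarrow> 'u)) set)"
  unfolding omega_stable_def
proof (intro ballI, clarify)
  fix H :: "'u hilb" and T B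
  assume HT: "(H, T) \<in> Sigma_models K m" and B: "countable B" "B \<subseteq> unit_ball H"
  interpret complex_hilbert_space H using HT by (simp add: Sigma_models_def)
  have normal: "normal_op H T" and contr: "\<forall>x\<in>carrier H. Hil.nm (T x) \<le> Hil.nm x"
    and spec: "op_spectrum H T = K" using HT by (simp_all add: Sigma_models_def hnorm_eq)
  obtain S where nh: "normal_hilbert (carrier H) \<zero>\<^bsub>H\<^esub> (add H) (smult H) (hinner H) T S"
    by (rule normal_op_normal_hilbert[OF normal])
  interpret nor: normal_hilbert "carrier H" "\<zero>\<^bsub>H\<^esub>" "add H" "smult H" "hinner H" T S by (rule nh)
  \<comment> \<open>This inclusion carries the countability of \<open>K\<close> over to the
    approximate spectrum, and it places every eigenvalue of the eigenbasis in
    \<open>K\<close>.\<close>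
  have ap: "nor.apspec \<subseteq> K"
  proof
    fix c assume c: "c \<in> nor.apspec"
    have "c \<in> op_spectrum H T"
      by (rule approximate_eigenvalue_in_spectrum[OF nor.lin_T]) (use c in \<open>simp add: nor.apspec_def\<close>)
    then show "c \<in> K" by (simp add: spec)
  qed
  obtain E where E: "Hil.orthonormal E" "\<And>e. e \<in> E \<Longrightarrow> \<exists>c. T e = c \<odot>\<^bsub>H\<^esub> e"
    "\<forall>v\<in>carrier H. (\<forall>e\<in>E. hinner H v e = 0) \<longrightarrow> v = \<zero>\<^bsub>H\<^esub>"
    by (rule nor.eigenbasis_exists[OF countable_subset[OF ap K(2)]]) (rule that)
  obtain \<kappa> where \<kappa>: "\<And>e. e \<in> E \<Longrightarrow> T e = \<kappa> e \<odot>\<^bsub>H\<^esub> e" using E(2) by metis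
  have EV: "e \<in> carrier H" if "e \<in> E" for e using E(1) that by (auto simp: Hil.orthonormal_def)
  have E1: "hinner H e e' = (if e = e' then 1 else 0)" if "e \<in> E" "e' \<in> E" for e e'
    using E(1) that by (simp add: Hil.orthonormal_def)
  interpret contraction_model H T
    by unfold_locales (use contr nor.lin_T in auto)
  interpret diagonal_model H T E \<kappa> K
  proof
    show "e \<in> carrier H" if "e \<in> E" for e by (rule EV[OF that])
    show "hinner H e e' = (if e = e' then 1 else 0)" if "e \<in> E" "e' \<in> E" for e e' by (rule E1[OF that])
    show "v = \<zero>\<^bsub>H\<^esub>" if "v \<in> carrier H" "\<And>e. e \<in> E \<Longrightarrow> hinner H v e = 0" for v using E(3) that by blast
    show "hinner H (T x) e = \<kappa> e * hinner H x e" if x: "x \<in> carrier H" and e: "e \<in> E" for x e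
    proof -
      have "S e = cnj (\<kappa> e) \<odot>\<^bsub>H\<^esub> e" by (rule nor.eigenvector_adjoint[OF EV[OF e] \<kappa>[OF e]])
      then show ?thesis using nor.adj[OF x EV[OF e]] x EV[OF e] by simp
    qed
    show "\<kappa> e \<in> K" if e: "e \<in> E" for e
    proof (rule subsetD[OF ap])
      have "e \<noteq> \<zero>\<^bsub>H\<^esub>" using E1[OF e e] by auto
      moreover have "Hil.nm (T e \<oplus>\<^bsub>H\<^esub> (-1) \<odot>\<^bsub>H\<^esub> (\<kappa> e \<odot>\<^bsub>H\<^esub> e)) = 0"
        unfolding \<kappa>[OF e] using Hil.mi_eq_zr[of "\<kappa> e \<odot>\<^bsub>H\<^esub> e" "\<kappa> e \<odot>\<^bsub>H\<^esub> e"] EV[OF e] by simp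
      ultimately show "\<kappa> e \<in> nor.apspec"
        unfolding nor.apspec_def using EV[OF e] by (intro CollectI allI impI bexI[of _ e]) simp_all
    qed
  qed (use K in auto)
  show "types_separable H T B" by (rule types_separable_countable[OF B])
qed

section \<open>Approximate eigenvectors separate types\<close>

text \<open>The norms of \<open>x\<close>, \<open>T x\<close>, \<open>(x + T x) / 2\<close> and \<open>(\<i> x + T x) / 2\<close> determine \<open>\<parallel>T x - c x\<parallel>\<close>
  by polarisation.\<close>

definition eigen_fmls :: "nat \<Rightarrow> 'u fml list" where
  "eigen_fmls i = [FNorm (Var i), FNorm (TOp (Var i)), FNorm (TAvg (Var i) (TOp (Var i))),
     FNorm (TAvg (TImag (Var i)) (TOp (Var i)))]"

text \<open>The values of \<open>eigen_fmls\<close> at a unit eigenvector for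
  \<open>c\<close>.\<close>

definition eigen_vals :: "complex \<Rightarrow> real list" where
  "eigen_vals c = [1, cmod c, cmod (1 + c) / 2, cmod (\<i> + c) / 2]"

text \<open>The head of the list is a distance, of which only the excess over \<open>1 / 8\<close>
  counts; the other four entries are compared with \<open>eigen_vals c\<close>. Truncation at 1
  makes it a connective.\<close>

definition eigen_conn :: "complex \<Rightarrow> real list \<Rightarrow> real" where
  "eigen_conn c xs = min 1 (max 0 (xs ! 0 - 1 / 8) + (\<Sum>k<4. \<bar>xs ! Suc k - eigen_vals c ! k\<bar>))"

text \<open>Small exactly when an approximate unit eigenvector for \<open>c\<close> lies within
  little more than \<open>1 / 8\<close> in the halved distance. As a formula in one variable without
  parameters it can be evaluated at every type.\<close>

definition near_eigenvector :: "complex \<Rightarrow> 'u fml" where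
  "near_eigenvector c = FInf 1 (FConn (eigen_conn c) (FDist (Var 0) (Var 1) # eigen_fmls 1))"

lemma lessThan_4: "{..<4 :: nat} = {0, 1, 2, 3}"
  by auto

lemma connective_eigen_conn: "connective 5 (eigen_conn c)"
  unfolding connective_def
proof (intro conjI ballI allI impI)
  fix xs
  show "eigen_conn c xs \<in> {0..1}" by (auto simp: eigen_conn_def intro!: add_nonneg_nonneg sum_nonneg)
next
  fix xs and e :: real assume e: "e > 0"
  show "\<exists>d>0. \<forall>ys\<in>unit_cube 5. (\<forall>i<5. \<bar>ys ! i - xs ! i\<bar> < d) \<longrightarrow> \<bar>eigen_conn c ys - eigen_conn c xs\<bar> < e"
  proof (intro exI[of _ "e / 5"] conjI ballI impI)
    fix ys :: "real list" assume d: "\<forall>i<5. \<bar>ys ! i - xs ! i\<bar> < e / 5"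
    have min: "\<bar>min 1 a - min 1 b\<bar> \<le> \<bar>a - b\<bar>" for a b :: real by (simp add: min_def)
    have max: "\<bar>max 0 a - max 0 b\<bar> \<le> \<bar>a - b\<bar>" for a b :: real by (simp add: max_def)
    have "\<bar>eigen_conn c ys - eigen_conn c xs\<bar> \<le>
        \<bar>(max 0 (ys ! 0 - 1 / 8) - max 0 (xs ! 0 - 1 / 8)) +
         (\<Sum>k<4. \<bar>ys ! Suc k - eigen_vals c ! k\<bar> - \<bar>xs ! Suc k - eigen_vals c ! k\<bar>)\<bar>"
      unfolding eigen_conn_def by (rule order_trans[OF min]) (simp add: sum_subtractf)
    also have "\<dots> \<le> \<bar>max 0 (ys ! 0 - 1 / 8) - max 0 (xs ! 0 - 1 / 8)\<bar> +
         (\<Sum>k<4. \<bar>\<bar>ys ! Suc k - eigen_vals c ! k\<bar> - \<bar>xs ! Suc k - eigen_vals c ! k\<bar>\<bar>)"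
      by (intro order_trans[OF abs_triangle_ineq] add_left_mono sum_abs)
    also have "\<dots> < e / 5 + (\<Sum>k<(4 :: nat). e / 5)"
    proof (rule add_less_le_mono)
      show "\<bar>max 0 (ys ! 0 - 1 / 8) - max 0 (xs ! 0 - 1 / 8)\<bar> < e / 5"
        using max[of "ys ! 0 - 1 / 8" "xs ! 0 - 1 / 8"] d[rule_format, of 0] by simp
      show "(\<Sum>k<4. \<bar>\<bar>ys ! Suc k - eigen_vals c ! k\<bar> - \<bar>xs ! Suc k - eigen_vals c ! k\<bar>\<bar>) \<le> (\<Sum>k<(4 :: nat). e / 5)"
      proof (rule sum_mono)
        fix k :: nat assume "k \<in> {..<4}"
        then have "\<bar>ys ! Suc k - xs ! Suc k\<bar> < e / 5" using d[rule_format, of "Suc k"] by simp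
        then show "\<bar>\<bar>ys ! Suc k - eigen_vals c ! k\<bar> - \<bar>xs ! Suc k - eigen_vals c ! k\<bar>\<bar> \<le> e / 5" by linarith
      qed
    qed
    finally show "\<bar>eigen_conn c ys - eigen_conn c xs\<bar> < e" by simp
  qed (use e in simp)
qed

lemma near_eigenvector_fml: "near_eigenvector c \<in> fmls_over {} 1"
  using connective_eigen_conn[of c] by (auto simp: fmls_over_def near_eigenvector_def eigen_fmls_def eval_nat_numeral)

lemma eigen_fmls_over: "set (eigen_fmls 0) \<subseteq> fmls_over {} 1"
  by (auto simp: fmls_over_def eigen_fmls_def)

section \<open>Approximate eigenvectors seen through formulas\<close>

locale normal_contraction = contraction_model H T +
    nor: normal_hilbert "carrier H" "\<zero>\<^bsub>H\<^esub>" "add H" "smult H" "hinner H" T Ts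
  for H :: "'u hilb" and T Ts
begin

definition norms :: "'u \<Rightarrow> real list" where
  "norms x = [Hil.nm x, Hil.nm (T x), Hil.nm (x \<oplus>\<^bsub>H\<^esub> T x) / 2, Hil.nm (\<i> \<odot>\<^bsub>H\<^esub> x \<oplus>\<^bsub>H\<^esub> T x) / 2]"

lemma T_closed: "x \<in> carrier H \<Longrightarrow> T x \<in> carrier H"
  using Hil.linD[OF lin_op] .

lemma fval_eigen_fmls: "v i \<in> carrier H \<Longrightarrow> map (\<lambda>f. fval H T f v) (eigen_fmls i) = norms (v i)"
  by (simp add: eigen_fmls_def norms_def hnorm_eq Hil.nm_sm T_closed)

lemma norms_ball: assumes "x \<in> B1" "k < 4" shows "norms x ! k \<in> {0..1}"
proof -
  have x: "x \<in> carrier H" "Hil.nm x \<le> 1" "T x \<in> carrier H" "Hil.nm (T x) \<le> 1"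
    using ballD[OF assms(1)] ballD[OF op_ball[OF assms(1)]] by auto
  have "Hil.nm (x \<oplus>\<^bsub>H\<^esub> T x) \<le> 2" using Hil.nm_triangle[OF x(1,3)] x by linarith
  moreover have "Hil.nm (\<i> \<odot>\<^bsub>H\<^esub> x \<oplus>\<^bsub>H\<^esub> T x) \<le> 2"
    using Hil.nm_triangle[of "\<i> \<odot>\<^bsub>H\<^esub> x" "T x"] x by (simp add: Hil.nm_sm)
  moreover have "k \<in> {..<4}" using assms(2) by simp
  ultimately show ?thesis using x unfolding lessThan_4 by (auto simp: norms_def)
qed

text \<open>Up to halving, the entries after the first have the form \<open>|d x + T x|\<close> with
  \<open>d\<close> equal to 0, 1 or \<open>i\<close>; replacing \<open>T x\<close> by
  \<open>c x\<close> changes them by at most \<open>e\<close>.\<close>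

lemma norms_near:
  assumes x: "x \<in> carrier H" "Hil.nm x = 1" and e: "Hil.nm (T x \<boxminus> c \<odot>\<^bsub>H\<^esub> x) \<le> e" and k: "k < 4"
  shows "\<bar>norms x ! k - eigen_vals c ! k\<bar> \<le> e"
proof -
  have *: "\<bar>Hil.nm (d \<odot>\<^bsub>H\<^esub> x \<oplus>\<^bsub>H\<^esub> T x) - cmod (d + c)\<bar> \<le> e" for d
  proof -
    have "(d \<odot>\<^bsub>H\<^esub> x \<oplus>\<^bsub>H\<^esub> T x) \<boxminus> ((d + c) \<odot>\<^bsub>H\<^esub> x) = T x \<boxminus> c \<odot>\<^bsub>H\<^esub> x"
      using x T_closed by (intro Hil.vec_eqI) (auto simp: algebra_simps)
    then show ?thesis
      using Hil.nm_diff_le[of "d \<odot>\<^bsub>H\<^esub> x \<oplus>\<^bsub>H\<^esub> T x" "(d + c) \<odot>\<^bsub>H\<^esub> x"] x T_closed e by (simp add: Hil.nm_sm)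
  qed
  have "0 \<odot>\<^bsub>H\<^esub> x \<oplus>\<^bsub>H\<^esub> T x = T x" "1 \<odot>\<^bsub>H\<^esub> x \<oplus>\<^bsub>H\<^esub> T x = x \<oplus>\<^bsub>H\<^esub> T x"
    by (rule Hil.vec_eqI; use x T_closed in simp)+
  then have "\<bar>Hil.nm (T x) - cmod c\<bar> \<le> e" "\<bar>Hil.nm (x \<oplus>\<^bsub>H\<^esub> T x) - cmod (1 + c)\<bar> \<le> e"
    "\<bar>Hil.nm (\<i> \<odot>\<^bsub>H\<^esub> x \<oplus>\<^bsub>H\<^esub> T x) - cmod (\<i> + c)\<bar> \<le> e" using *[of 0] *[of 1] *[of \<i>] by simp_all
  moreover have "k \<in> {..<4}" using k by simp
  ultimately show ?thesis using x unfolding lessThan_4 by (auto simp: norms_def eigen_vals_def)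
qed

lemma sq_close: fixes v t :: real assumes "\<bar>v - t\<bar> \<le> e" "v \<in> {0..1}" "t \<in> {0..1}" shows "\<bar>v\<^sup>2 - t\<^sup>2\<bar> \<le> 2 * e"
proof -
  have "\<bar>v\<^sup>2 - t\<^sup>2\<bar> = \<bar>v - t\<bar> * (v + t)" using assms by (simp add: power2_eq_square square_diff_square_factored abs_mult)
  also have "\<dots> \<le> e * 2" using assms by (intro mult_mono) auto
  finally show ?thesis by simp
qed

lemma eigen_vals_range: "cmod c \<le> 1 \<Longrightarrow> k < 4 \<Longrightarrow> eigen_vals c ! k \<in> {0..1}"
proof -
  assume c: "cmod c \<le> 1" and "k < 4"
  then have "k \<in> {0, 1, 2, 3}" using lessThan_4 by blast
  then show ?thesis using c norm_triangle_ineq[of 1 c] norm_triangle_ineq[of \<i> c] by (auto simp: eigen_vals_def)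
qed

text \<open>Squaring doubles the error, and undoing the halving of the last two norms multiplies
  their squares by 4. Polarisation recovers \<open>2 Re z\<close> and \<open>2 Im z\<close> up to
  \<open>8 + 2 + 2 = 12\<close> times \<open>e\<close>, and expanding \<open>|T x - c x|^2\<close>
  around its ideal value 0 gives \<open>2 + 12 + 12 + 2 = 28\<close>.\<close>

lemma near_norms:
  assumes x: "x \<in> B1" and c: "cmod c \<le> 1" and e: "\<And>k. k < 4 \<Longrightarrow> \<bar>norms x ! k - eigen_vals c ! k\<bar> \<le> e"
  shows "(Hil.nm (T x \<boxminus> c \<odot>\<^bsub>H\<^esub> x))\<^sup>2 \<le> 28 * e"
proof -
  have xc: "x \<in> carrier H" "T x \<in> carrier H" using ballD[OF x] T_closed by auto
  define A where "A = (Hil.nm x)\<^sup>2"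
  define D where "D = (Hil.nm (T x))\<^sup>2"
  define P where "P = (Hil.nm (x \<oplus>\<^bsub>H\<^esub> T x))\<^sup>2"
  define Q where "Q = (Hil.nm (\<i> \<odot>\<^bsub>H\<^esub> x \<oplus>\<^bsub>H\<^esub> T x))\<^sup>2"
  define z where "z = hinner H (T x) x"
  have xT: "hinner H x (T x) = cnj z" using hinner_commute[OF xc(2,1)] by (simp add: z_def)
  have P: "P = A + 2 * Re z + D" unfolding P_def A_def D_def
    using Hil.nm_sq_ad[OF xc] xT by simp
  have Q: "Q = A + 2 * Im z + D" unfolding Q_def A_def D_def
    using Hil.nm_sq_ad[of "\<i> \<odot>\<^bsub>H\<^esub> x" "T x"] xc xT by (simp add: Hil.nm_sm)
  have N: "(Hil.nm (T x \<boxminus> c \<odot>\<^bsub>H\<^esub> x))\<^sup>2 = D - 2 * (Re c * Re z + Im c * Im z) + (cmod c)\<^sup>2 * A"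
    unfolding A_def D_def
    using Hil.nm_sq_mi[of "T x" "c \<odot>\<^bsub>H\<^esub> x"] xc by (simp add: Hil.nm_sm power_mult_distrib z_def)
  have sq: "\<bar>(norms x ! k)\<^sup>2 - (eigen_vals c ! k)\<^sup>2\<bar> \<le> 2 * e" if "k < 4" for k
    by (rule sq_close[OF e[OF that] norms_ball[OF x that] eigen_vals_range[OF c that]])
  have cc: "(cmod c)\<^sup>2 = (Re c)\<^sup>2 + (Im c)\<^sup>2" by (simp add: cmod_power2)
  have "\<bar>A - 1\<bar> \<le> 2 * e" using sq[of 0] by (simp add: norms_def eigen_vals_def A_def)
  moreover have "\<bar>D - (cmod c)\<^sup>2\<bar> \<le> 2 * e" using sq[of 1] by (simp add: norms_def eigen_vals_def D_def)
  moreover have "\<bar>P - (cmod (1 + c))\<^sup>2\<bar> \<le> 8 * e"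
    using sq[of 2] by (simp add: norms_def eigen_vals_def P_def power_divide abs_le_iff)
  moreover have "(cmod (1 + c))\<^sup>2 = 1 + 2 * Re c + (cmod c)\<^sup>2"
    by (simp add: cmod_power2 power2_sum)
  moreover have "\<bar>Q - (cmod (\<i> + c))\<^sup>2\<bar> \<le> 8 * e"
    using sq[of 3] by (simp add: norms_def eigen_vals_def Q_def power_divide abs_le_iff)
  moreover have "(cmod (\<i> + c))\<^sup>2 = 1 + 2 * Im c + (cmod c)\<^sup>2"
    by (simp add: cmod_power2 power2_sum)
  ultimately have dz: "\<bar>2 * Re z - 2 * Re c\<bar> \<le> 12 * e" "\<bar>2 * Im z - 2 * Im c\<bar> \<le> 12 * e"
    and dA: "\<bar>A - 1\<bar> \<le> 2 * e" and dD: "\<bar>D - (cmod c)\<^sup>2\<bar> \<le> 2 * e"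
    using P Q by linarith+
  have e0: "e \<ge> 0" using dA by linarith
  have "- (Re c * (2 * Re z - 2 * Re c)) \<le> 12 * e"
  proof -
    have "\<bar>Re c * (2 * Re z - 2 * Re c)\<bar> \<le> 1 * (12 * e)"
      unfolding abs_mult using c abs_Re_le_cmod[of c] dz(1) by (intro mult_mono) auto
    then show ?thesis by linarith
  qed
  moreover have "- (Im c * (2 * Im z - 2 * Im c)) \<le> 12 * e"
  proof -
    have "\<bar>Im c * (2 * Im z - 2 * Im c)\<bar> \<le> 1 * (12 * e)"
      unfolding abs_mult using c abs_Im_le_cmod[of c] dz(2) by (intro mult_mono) auto
    then show ?thesis by linarith
  qed
  moreover have "(cmod c)\<^sup>2 * (A - 1) \<le> 2 * e"
  proof -
    have "\<bar>(cmod c)\<^sup>2 * (A - 1)\<bar> \<le> 1 * (2 * e)"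
      unfolding abs_mult using c dA by (intro mult_mono) (auto simp: power_le_one)
    then show ?thesis by linarith
  qed
  moreover have "(Hil.nm (T x \<boxminus> c \<odot>\<^bsub>H\<^esub> x))\<^sup>2 = (D - (cmod c)\<^sup>2) - Re c * (2 * Re z - 2 * Re c)
      - Im c * (2 * Im z - 2 * Im c) + (cmod c)\<^sup>2 * (A - 1)"
    unfolding N cc by (simp add: algebra_simps power2_eq_square)
  ultimately show ?thesis using dD by linarith
qed

text \<open>\<open>(c - d) * ip a b\<close> is the difference of two pairings with residuals, the
  one for \<open>b\<close> being the adjoint residual, so \<open>|ip a b|\<close> is at most
  \<open>2 / 100\<close>. With both norms at least \<open>99 / 100\<close>, \<open>|a - b|^2\<close>
  is at least \<open>1.9602 - 0.04\<close>, well above 1.\<close>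

lemma eigenvectors_far:
  assumes ab: "a \<in> B1" "b \<in> B1" and cd: "c \<noteq> d" and e: "0 < e" "e \<le> 1 / 100" "28 * e \<le> (cmod (c - d) / 100)\<^sup>2"
    and n: "1 - e \<le> Hil.nm a" "1 - e \<le> Hil.nm b"
    and ea: "(Hil.nm (T a \<boxminus> c \<odot>\<^bsub>H\<^esub> a))\<^sup>2 \<le> 28 * e" and eb: "(Hil.nm (T b \<boxminus> d \<odot>\<^bsub>H\<^esub> b))\<^sup>2 \<le> 28 * e"
  shows "Hil.nm (a \<boxminus> b) > 1"
proof -
  have abc: "a \<in> carrier H" "b \<in> carrier H" "Hil.nm a \<le> 1" "Hil.nm b \<le> 1" using ab ballD by auto
  define w where "w = cmod (c - d)"
  have w: "w > 0" using cd by (simp add: w_def)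
  have ra: "Hil.nm (T a \<boxminus> c \<odot>\<^bsub>H\<^esub> a) \<le> w / 100"
    by (rule power2_le_imp_le) (use ea e(3) w in \<open>simp_all add: w_def\<close>)
  have rb: "Hil.nm (T b \<boxminus> d \<odot>\<^bsub>H\<^esub> b) \<le> w / 100"
    by (rule power2_le_imp_le) (use eb e(3) w in \<open>simp_all add: w_def\<close>)
  have rb': "Hil.nm (Ts b \<boxminus> cnj d \<odot>\<^bsub>H\<^esub> b) \<le> w / 100" using nor.nm_T_minus[OF abc(2), of d] rb by simp
  have cl: "T a \<boxminus> c \<odot>\<^bsub>H\<^esub> a \<in> carrier H" "Ts b \<boxminus> cnj d \<odot>\<^bsub>H\<^esub> b \<in> carrier H"
    using abc T_closed Hil.linD[OF nor.lin_Ts] by auto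
  have "(c - d) * hinner H a b = hinner H a (Ts b \<boxminus> cnj d \<odot>\<^bsub>H\<^esub> b) - hinner H (T a \<boxminus> c \<odot>\<^bsub>H\<^esub> a) b"
    using abc T_closed Hil.linD[OF nor.lin_Ts] nor.adj[OF abc(1,2)] by (simp add: algebra_simps)
  then have "w * cmod (hinner H a b) \<le>
      cmod (hinner H a (Ts b \<boxminus> cnj d \<odot>\<^bsub>H\<^esub> b)) + cmod (hinner H (T a \<boxminus> c \<odot>\<^bsub>H\<^esub> a) b)"
    unfolding w_def norm_mult[symmetric] by (metis norm_triangle_ineq4)
  also have "\<dots> \<le> 1 * (w / 100) + (w / 100) * 1"
  proof (rule add_mono)
    show "cmod (hinner H a (Ts b \<boxminus> cnj d \<odot>\<^bsub>H\<^esub> b)) \<le> 1 * (w / 100)"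
      by (rule order_trans[OF Hil.cauchy_schwarz[OF abc(1) cl(2)]])
        (use abc rb' cl in \<open>intro mult_mono; simp\<close>)
    show "cmod (hinner H (T a \<boxminus> c \<odot>\<^bsub>H\<^esub> a) b) \<le> (w / 100) * 1"
      by (rule order_trans[OF Hil.cauchy_schwarz[OF cl(1) abc(2)]])
        (use abc ra cl w in \<open>intro mult_mono; simp\<close>)
  qed
  finally have "w * cmod (hinner H a b) \<le> w * (2 / 100)" by simp
  then have "cmod (hinner H a b) \<le> 2 / 100" using w by simp
  then have "Re (hinner H a b) \<le> 2 / 100" using complex_Re_le_cmod[of "hinner H a b"] by linarith
  moreover have "(99 / 100)\<^sup>2 \<le> (Hil.nm a)\<^sup>2" "(99 / 100)\<^sup>2 \<le> (Hil.nm b)\<^sup>2"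
    using n e(2) by (intro power_mono; simp)+
  ultimately have "1 < (Hil.nm (a \<boxminus> b))\<^sup>2"
    unfolding Hil.nm_sq_mi[OF abc(1,2)] by (simp add: power2_eq_square)
  then show ?thesis using abc power2_less_imp_less[of 1 "Hil.nm (a \<boxminus> b)"] by simp
qed

lemma fval_near_eigenvector:
  assumes v: "range v \<subseteq> B1"
  shows "fval H T (near_eigenvector c) v =
    (INF a\<in>B1. eigen_conn c (Hil.nm (v 0 \<boxminus> a) / 2 # norms a))"
proof -
  have "fval H T (FConn (eigen_conn c) (FDist (Var 0) (Var 1) # eigen_fmls 1)) (v(1 := a)) =
      eigen_conn c (Hil.nm (v 0 \<boxminus> a) / 2 # norms a)" if a: "a \<in> B1" for a
  proof -
    have "v 0 \<in> B1" using v by auto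
    then have "fval H T (FDist (Var 0) (Var 1)) (v(1 := a)) = Hil.nm (v 0 \<boxminus> a) / 2"
      using a by (intro fval_FDist) simp_all
    moreover have "map (\<lambda>f. fval H T f (v(1 := a))) (eigen_fmls 1) = norms a"
      using fval_eigen_fmls[of "v(1 := a)" 1] ballD(1)[OF a] by simp
    ultimately show ?thesis by (simp only: fval.simps list.map)
  qed
  then show ?thesis unfolding near_eigenvector_def fval.simps(5) by (intro INF_cong) auto
qed

text \<open>Unit vectors with arbitrarily small residual exist in the model, an exact eigenvector
  need not; compactness turns the limiting values into a type.\<close>

lemma eigen_type_exists:
  assumes c: "cmod c \<le> 1"
    and ap: "\<And>e. e > 0 \<Longrightarrow> \<exists>x\<in>carrier H. Hil.nm x = 1 \<and> Hil.nm (T x \<boxminus> c \<odot>\<^bsub>H\<^esub> x) \<le> e"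
  shows "\<exists>p\<in>types_over H T {} 1. \<forall>k<4. p (eigen_fmls 0 ! k) = eigen_vals c ! k"
proof -
  define X where "X = {v :: nat \<Rightarrow> 'u. range v \<subseteq> B1}"
  define \<phi> where "\<phi> v f = (if f \<in> fmls_over {} 1 then fval H T f v else 0)" for v f
  define Cst where "Cst = (\<lambda>k. (eigen_fmls 0 ! k :: 'u fml, eigen_vals c ! k)) ` {..<4}"
  have len: "length (eigen_fmls 0 :: 'u fml list) = 4" by (simp add: eigen_fmls_def)
  have in_fmls: "(eigen_fmls 0 ! k :: 'u fml) \<in> fmls_over {} 1" if "k < 4" for k
    by (rule subsetD[OF eigen_fmls_over nth_mem]) (use that len in simp)
  obtain q where q: "\<And>i r. (i, r) \<in> Cst \<Longrightarrow> q i = r"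
    "\<And>F e. finite F \<Longrightarrow> e > 0 \<Longrightarrow> \<exists>x\<in>X. \<forall>i\<in>F. \<bar>\<phi> x i - q i\<bar> < e"
  proof (rule approximate_compactness[of X \<phi> Cst])
    show "\<phi> v f \<in> {-1..1}" if "v \<in> X" for v f
    proof (cases "f \<in> fmls_over {} 1")
      case True
      have "fval H T f v \<in> {0..1}"
        by (rule fval_range) (use that fmls_over_D[OF True] in \<open>auto simp: X_def\<close>)
      then show ?thesis using True by (simp add: \<phi>_def)
    qed (simp add: \<phi>_def)
    fix C and e :: real assume C: "C \<subseteq> Cst" "e > 0"
    then obtain x where x: "x \<in> carrier H" "Hil.nm x = 1" "Hil.nm (T x \<boxminus> c \<odot>\<^bsub>H\<^esub> x) \<le> e / 2"
      using ap[of "e / 2"] by auto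
    have "\<bar>\<phi> (\<lambda>_. x) (eigen_fmls 0 ! k) - eigen_vals c ! k\<bar> < e" if k: "k < 4" for k
    proof -
      have "fval H T (eigen_fmls 0 ! k) (\<lambda>_. x) = norms x ! k"
        using arg_cong[OF fval_eigen_fmls[of "\<lambda>_. x" 0], of "\<lambda>l. l ! k"] x(1) k len by simp
      then show ?thesis using norms_near[OF x k] in_fmls[OF k] C(2) by (simp add: \<phi>_def)
    qed
    then have "\<forall>(i, r)\<in>C. \<bar>\<phi> (\<lambda>_. x) i - r\<bar> < e" using C(1) by (auto simp: Cst_def)
    moreover have "(\<lambda>_. x) \<in> X" using x by (auto simp: X_def ball_iff)
    ultimately show "\<exists>v\<in>X. \<forall>(i, r)\<in>C. \<bar>\<phi> v i - r\<bar> < e" by blast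
  qed (rule that)
  define p where "p = restrict q (fmls_over {} 1)"
  have "p \<in> types_over H T {} 1"
    unfolding types_over_def
  proof (intro CollectI conjI allI impI)
    show "p \<in> extensional (fmls_over {} 1)" by (simp add: p_def)
    fix F :: "'u fml set" and e :: real assume F: "finite F" "F \<subseteq> fmls_over {} 1" "e > 0"
    obtain v where v: "v \<in> X" "\<forall>i\<in>F. \<bar>\<phi> v i - q i\<bar> < e" using q(2)[OF F(1,3)] by blast
    have "\<bar>fval H T f v - p f\<bar> < e" if "f \<in> F" for f using v(2) that F(2) by (auto simp: \<phi>_def p_def)
    then show "\<exists>v. range v \<subseteq> B1 \<and> (\<forall>f\<in>F. \<bar>fval H T f v - p f\<bar> < e)"
      using v(1) by (intro exI[of _ v]) (simp add: X_def)
  qed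
  moreover have "p (eigen_fmls 0 ! k) = eigen_vals c ! k" if "k < 4" for k
    using q(1)[of "eigen_fmls 0 ! k" "eigen_vals c ! k"] in_fmls[OF that] that by (auto simp: p_def Cst_def)
  ultimately show ?thesis by blast
qed

text \<open>An infimum of reals is informative only for a nonempty set. Two vectors of the unit ball
  are at norm distance at most 2, so arbitrary approximations of \<open>p\<close> and of
  \<open>q\<close> can be paired and amalgamated.\<close>

lemma type_dist_lessD:
  assumes p: "p \<in> types_over H T B 1" and q: "q \<in> types_over H T B 1" and B: "B \<subseteq> B1"
    and less: "type_dist H T B p q < s"
  shows "\<exists>r\<in>types_over H T B 2. (\<forall>f\<in>fmls_over B 1. r f = p f \<and> r (fml_rename swap01 f) = q f) \<and>
    r (FDist (Var 0) (Var 1)) < s"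
proof -
  let ?S = "{r (FDist (Var 0) (Var 1)) | r. r \<in> types_over H T B 2 \<and>
      (\<forall>f\<in>fmls_over B 1. r f = p f \<and> r (fml_rename swap01 f) = q f)}"
  have "\<exists>r\<in>types_over H T B 2. (\<forall>f\<in>fmls_over B 1. r f = p f \<and> r (fml_rename swap01 f) = q f) \<and>
      r (FDist (Var 0) (Var 1)) \<le> 2 / 2"
  proof (rule amalgam[OF B])
    fix F1 F2 d assume F: "finite F1" "F1 \<subseteq> fmls_over B 1" "finite F2" "F2 \<subseteq> fmls_over B 1" "(d :: real) > 0"
    obtain x where x: "range x \<subseteq> B1" "\<And>f. f \<in> F1 \<Longrightarrow> \<bar>fval H T f x - p f\<bar> < d"
      by (rule types_overD[OF p F(1,2,5)]) (rule that)
    obtain y where y: "range y \<subseteq> B1" "\<And>f. f \<in> F2 \<Longrightarrow> \<bar>fval H T f y - q f\<bar> < d"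
      by (rule types_overD[OF q F(3,4,5)]) (rule that)
    define v where "v = (\<lambda>i :: nat. if i = 0 then x 0 else y 0)"
    have xy: "x 0 \<in> B1" "y 0 \<in> B1" using x(1) y(1) by auto
    have "range v \<subseteq> B1" using xy by (auto simp: v_def)
    moreover have "Hil.nm (v 0 \<boxminus> v 1) \<le> 2"
      using Hil.nm_triangle_mi[of "x 0" "y 0"] ballD[OF xy(1)] ballD[OF xy(2)] by (simp add: v_def)
    moreover have "\<bar>fval H T f v - p f\<bar> < d" if "f \<in> F1" for f
      using fval_at_0[of f B v x H T] x(2)[OF that] that F(2) by (auto simp: v_def)
    moreover have "\<bar>fval H T f (v \<circ> swap01) - q f\<bar> < d" if "f \<in> F2" for f
    proof -
      have "fval H T f (v \<circ> swap01) = fval H T f y"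
        by (rule fval_at_0[of f B]) (use that F(4) in \<open>auto simp: v_def\<close>)
      then show ?thesis using y(2)[OF that] by simp
    qed
    ultimately show "\<exists>v. range v \<subseteq> B1 \<and> Hil.nm (v 0 \<boxminus> v 1) \<le> 2 \<and> (\<forall>f\<in>F1. \<bar>fval H T f v - p f\<bar> < d) \<and>
        (\<forall>f\<in>F2. \<bar>fval H T f (v \<circ> swap01) - q f\<bar> < d)" by (intro exI[of _ v]) simp
  qed
  then have "?S \<noteq> {}" by blast
  from cInf_lessD[OF this less[unfolded type_dist_def]] show ?thesis by blast
qed

text \<open>In a pair approximating a close amalgam of \<open>p\<close> and \<open>q\<close>, the
  first vector is an approximate eigenvector for \<open>c\<close> within \<open>1 / 8\<close> of the
  second, hence a witness for the infimum evaluated at the second.\<close>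

lemma near_eigen_type:
  assumes p: "p \<in> types_over H T {} 1" "\<forall>k<4. p (eigen_fmls 0 ! k) = eigen_vals c ! k"
    and q: "q \<in> types_over H T {} 1" and less: "type_dist H T {} p q < 1 / 8"
  shows "q (near_eigenvector c) \<le> 0"
proof (rule field_le_epsilon)
  fix e :: real assume e: "e > 0"
  obtain r where r: "r \<in> types_over H T {} 2"
    "\<forall>f\<in>fmls_over {} 1. r f = p f \<and> r (fml_rename swap01 f) = q f" "r (FDist (Var 0) (Var 1)) < 1 / 8"
    using type_dist_lessD[OF p(1) q empty_subsetI less] by blast
  \<comment> \<open>Four of the five shares of \<open>e\<close> cover the deviations of the norms,
    the fifth the error in the value of the formula; the second bound keeps the distance of the pair
    at most \<open>1 / 8\<close>.\<close>
  define d where "d = min (e / 5) (1 / 8 - r (FDist (Var 0) (Var 1)))"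
  have "d \<le> e / 5" unfolding d_def by (rule min.cobounded1)
  then have d: "d > 0" "5 * d \<le> e" using e r(3) by (auto simp: d_def)
  define F :: "'u fml set" where "F = {FDist (Var 0) (Var 1), fml_rename swap01 (near_eigenvector c)} \<union> set (eigen_fmls 0)"
  have "set (eigen_fmls 0) \<subseteq> fmls_over {} 2" using eigen_fmls_over fmls_over_mono[of 1 2 "{}"] by fastforce
  moreover have "FDist (Var 0) (Var 1) \<in> fmls_over {} 2" by (auto simp: fmls_over_def)
  ultimately have F: "finite F" "F \<subseteq> fmls_over {} 2"
    using swap01_fmls_over[OF near_eigenvector_fml] by (auto simp: F_def)
  obtain v where v: "range v \<subseteq> B1" "\<And>f. f \<in> F \<Longrightarrow> \<bar>fval H T f v - r f\<bar> < d"
    by (rule types_overD[OF r(1) F d(1)]) (rule that)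
  have v01: "v 0 \<in> B1" "v 1 \<in> B1" using v(1) by auto
  have k: "\<bar>norms (v 0) ! k - eigen_vals c ! k\<bar> \<le> d" if k: "k < 4" for k
  proof -
    have len: "k < length (eigen_fmls 0 :: 'u fml list)" using k by (simp add: eigen_fmls_def)
    have "norms (v 0) ! k = fval H T (eigen_fmls 0 ! k) v"
      using arg_cong[OF fval_eigen_fmls[of v 0], of "\<lambda>l. l ! k"] ballD(1)[OF v01(1)] len by simp
    moreover have "eigen_fmls 0 ! k \<in> F" using nth_mem[OF len] by (simp add: F_def)
    moreover have "r (eigen_fmls 0 ! k) = eigen_vals c ! k"
      using r(2) p(2) k eigen_fmls_over nth_mem[OF len] by (metis subsetD)
    ultimately show ?thesis using v(2) by fastforce
  qed
  have "Hil.nm (v 0 \<boxminus> v 1) / 2 \<le> 1 / 8"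
  proof -
    have "fval H T (FDist (Var 0) (Var 1)) v = Hil.nm (v 0 \<boxminus> v 1) / 2"
      using v01 by (intro fval_FDist) simp_all
    moreover have "\<bar>fval H T (FDist (Var 0) (Var 1)) v - r (FDist (Var 0) (Var 1))\<bar> < d"
      by (rule v(2)) (simp add: F_def)
    moreover have "d \<le> 1 / 8 - r (FDist (Var 0) (Var 1))" by (simp add: d_def)
    ultimately show ?thesis by linarith
  qed
  then have "Hil.nm (v 1 \<boxminus> v 0) / 2 \<le> 1 / 8"
    using Hil.nm_mi_commute[OF ballD(1)[OF v01(1)] ballD(1)[OF v01(2)]] by simp
  moreover have "(\<Sum>k<4. \<bar>norms (v 0) ! k - eigen_vals c ! k\<bar>) \<le> (\<Sum>k<(4 :: nat). d)"
    by (rule sum_mono) (use k in auto)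
  ultimately have conn: "eigen_conn c (Hil.nm (v 1 \<boxminus> v 0) / 2 # norms (v 0)) \<le> 4 * d"
    by (simp add: eigen_conn_def)
  have rv: "range (v \<circ> swap01) \<subseteq> B1" using v(1) by auto
  have "fval H T (fml_rename swap01 (near_eigenvector c)) v = fval H T (near_eigenvector c) (v \<circ> swap01)"
    by (rule fval_rename[OF inj_swap01])
  also have "\<dots> = (INF a\<in>B1. eigen_conn c (Hil.nm (v 1 \<boxminus> a) / 2 # norms a))"
    unfolding fval_near_eigenvector[OF rv] by simp
  also have "\<dots> \<le> eigen_conn c (Hil.nm (v 1 \<boxminus> v 0) / 2 # norms (v 0))"
    by (rule cINF_lower[OF _ v01(1)])
      (auto simp: eigen_conn_def intro!: bdd_belowI[of _ 0] add_nonneg_nonneg sum_nonneg)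
  finally have "fval H T (fml_rename swap01 (near_eigenvector c)) v \<le> 4 * d" using conn by linarith
  moreover have "\<bar>fval H T (fml_rename swap01 (near_eigenvector c)) v - r (fml_rename swap01 (near_eigenvector c))\<bar> < d"
    by (rule v(2)) (simp add: F_def)
  moreover have "r (fml_rename swap01 (near_eigenvector c)) = q (near_eigenvector c)"
    using r(2) near_eigenvector_fml by blast
  ultimately show "q (near_eigenvector c) \<le> 0 + e" using d(2) by linarith
qed

text \<open>A vector approximating \<open>q\<close> would have near it approximate eigenvectors
  \<open>a\<close> for \<open>c\<close> and \<open>b\<close> for \<open>d\<close>. Halved distances
  of at most \<open>1 / 8 + e\<close> give \<open>|a - b| <= 1 / 2 + 4 e < 1\<close>, while near
  orthogonality forces \<open>|a - b| > 1\<close>.\<close>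

lemma near_eigen_type_unique:
  assumes q: "q \<in> types_over H T {} 1" and cd: "cmod c \<le> 1" "cmod d \<le> 1"
    and qc: "q (near_eigenvector c) \<le> 0" and qd: "q (near_eigenvector d) \<le> 0"
  shows "c = d"
proof (rule ccontr)
  assume ne: "c \<noteq> d"
  define e where "e = min (1 / 100) ((cmod (c - d) / 100)\<^sup>2 / 28)"
  have e: "e > 0" "e \<le> 1 / 100" "28 * e \<le> (cmod (c - d) / 100)\<^sup>2" using ne by (auto simp: e_def)
  have fin: "finite {near_eigenvector c :: 'u fml, near_eigenvector d}"
    and sub: "{near_eigenvector c :: 'u fml, near_eigenvector d} \<subseteq> fmls_over {} 1"
    using near_eigenvector_fml[of c, where 'a = 'u] near_eigenvector_fml[of d, where 'a = 'u] by simp_all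
  obtain v where v: "range v \<subseteq> B1"
    "\<And>f. f \<in> {near_eigenvector c, near_eigenvector d} \<Longrightarrow> \<bar>fval H T f v - q f\<bar> < e"
    by (rule types_overD[OF q fin sub e(1)]) (rule that)
  have v0: "v 0 \<in> B1" using v(1) by auto
  have ex: "\<exists>a\<in>B1. Hil.nm (v 0 \<boxminus> a) / 2 \<le> 1 / 8 + e \<and> 1 - e \<le> Hil.nm a \<and>
      (Hil.nm (T a \<boxminus> x \<odot>\<^bsub>H\<^esub> a))\<^sup>2 \<le> 28 * e"
    if x: "x \<in> {c, d}" for x
  proof -
    have "fval H T (near_eigenvector x) v < e" using v(2)[of "near_eigenvector x"] x qc qd by auto
    then obtain a where a: "a \<in> B1" "eigen_conn x (Hil.nm (v 0 \<boxminus> a) / 2 # norms a) < e"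
    proof -
      assume l: "fval H T (near_eigenvector x) v < e"
      have ne: "(\<lambda>a. eigen_conn x (Hil.nm (v 0 \<boxminus> a) / 2 # norms a)) ` B1 \<noteq> {}" using zero_ball by blast
      show ?thesis using cInf_lessD[OF ne l[unfolded fval_near_eigenvector[OF v(1)]]] that by blast
    qed
    have sum0: "0 \<le> (\<Sum>k<4. \<bar>norms a ! k - eigen_vals x ! k\<bar>)" by (rule sum_nonneg) simp
    have "max 0 (Hil.nm (v 0 \<boxminus> a) / 2 - 1 / 8) + (\<Sum>k<4. \<bar>norms a ! k - eigen_vals x ! k\<bar>) < e"
      using a(2) e(2) by (simp add: eigen_conn_def min_less_iff_disj)
    then have 1: "Hil.nm (v 0 \<boxminus> a) / 2 \<le> 1 / 8 + e" and 2: "(\<Sum>k<4. \<bar>norms a ! k - eigen_vals x ! k\<bar>) \<le> e"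
      using sum0 by linarith+
    have k: "\<bar>norms a ! k - eigen_vals x ! k\<bar> \<le> e" if "k < 4" for k
      using 2 member_le_sum[of k "{..<4}" "\<lambda>k. \<bar>norms a ! k - eigen_vals x ! k\<bar>"] that by simp
    have "1 - e \<le> Hil.nm a" using k[of 0] by (simp add: norms_def eigen_vals_def)
    moreover have "(Hil.nm (T a \<boxminus> x \<odot>\<^bsub>H\<^esub> a))\<^sup>2 \<le> 28 * e"
      by (rule near_norms[OF a(1) _ k]) (use x cd in auto)
    ultimately show ?thesis using a(1) 1 by blast
  qed
  obtain a where a: "a \<in> B1" "Hil.nm (v 0 \<boxminus> a) / 2 \<le> 1 / 8 + e" "1 - e \<le> Hil.nm a"
    "(Hil.nm (T a \<boxminus> c \<odot>\<^bsub>H\<^esub> a))\<^sup>2 \<le> 28 * e" using ex[of c] by blast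
  obtain b where b: "b \<in> B1" "Hil.nm (v 0 \<boxminus> b) / 2 \<le> 1 / 8 + e" "1 - e \<le> Hil.nm b"
    "(Hil.nm (T b \<boxminus> d \<odot>\<^bsub>H\<^esub> b))\<^sup>2 \<le> 28 * e" using ex[of d] by blast
  have "Hil.nm (a \<boxminus> b) \<le> Hil.nm (a \<boxminus> v 0) + Hil.nm (v 0 \<boxminus> b)"
    by (rule Hil.nm_dist_triangle) (use a b v0 ballD in auto)
  also have "Hil.nm (a \<boxminus> v 0) = Hil.nm (v 0 \<boxminus> a)"
    by (rule Hil.nm_mi_commute) (use a v0 ballD in auto)
  finally have "Hil.nm (a \<boxminus> b) \<le> 1" using a(2) b(2) e(2) by linarith
  moreover have "Hil.nm (a \<boxminus> b) > 1" by (rule eigenvectors_far[OF a(1) b(1) ne e a(3) b(3) a(4) b(4)])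
  ultimately show False by linarith
qed

text \<open>Each \<open>c\<close> in \<open>K\<close> is assigned a member of the dense set close to
  its type. The formulas \<open>near_eigenvector\<close> show the assignment to be injective without
  comparing the types of two eigenvectors directly.\<close>

theorem types_not_separable:
  assumes K: "uncountable K" "K \<subseteq> cball 0 1"
    and ap: "\<And>c e. c \<in> K \<Longrightarrow> e > 0 \<Longrightarrow> \<exists>x\<in>carrier H. Hil.nm x = 1 \<and> Hil.nm (T x \<boxminus> c \<odot>\<^bsub>H\<^esub> x) \<le> e"
  shows "\<not> types_separable H T {}"
proof
  assume "types_separable H T {}"
  then obtain D where D: "countable D" "D \<subseteq> types_over H T {} 1"
    "\<forall>p\<in>types_over H T {} 1. \<forall>e>0. \<exists>q\<in>D. type_dist H T {} p q < e"
    unfolding types_separable_def by blast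
  have c1: "cmod c \<le> 1" if "c \<in> K" for c using that K(2) by auto
  have "\<exists>q. q \<in> D \<and> q (near_eigenvector c) \<le> 0" if c: "c \<in> K" for c
  proof -
    obtain p where p: "p \<in> types_over H T {} 1" "\<forall>k<4. p (eigen_fmls 0 ! k) = eigen_vals c ! k"
      using eigen_type_exists[OF c1[OF c] ap[OF c]] by blast
    obtain q where q: "q \<in> D" "type_dist H T {} p q < 1 / 8"
      using D(3) p(1) by (meson zero_less_divide_1_iff zero_less_numeral)
    then show ?thesis using near_eigen_type[OF p _ q(2)] D(2) by blast
  qed
  then obtain Q where Q: "\<And>c. c \<in> K \<Longrightarrow> Q c \<in> D" "\<And>c. c \<in> K \<Longrightarrow> Q c (near_eigenvector c) \<le> 0" by metis
  have "inj_on Q K"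
  proof (rule inj_onI)
    fix c d assume cd: "c \<in> K" "d \<in> K" "Q c = Q d"
    show "c = d"
    proof (rule near_eigen_type_unique[of "Q c"])
      show "Q c (near_eigenvector d) \<le> 0" unfolding cd(3) by (rule Q(2)[OF cd(2)])
    qed (use cd(1,2) Q D(2) c1 in auto)
  qed
  moreover have "Q ` K \<subseteq> D" using Q(1) by blast
  ultimately have "countable K" using countable_image_inj_on countable_subset[OF _ D(1)] by metis
  then show False using K(1) by simp
qed

end

section \<open>Diagonal operators on sequences\<close>

definition square_summable :: "(nat \<Rightarrow> complex) set" where
  "square_summable = {x. summable (\<lambda>n. (cmod (x n))\<^sup>2)}"

definition l2_inner :: "(nat \<Rightarrow> complex) \<Rightarrow> (nat \<Rightarrow> complex) \<Rightarrow> complex" where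
  "l2_inner x y = (\<Sum>n. x n * cnj (y n))"

lemma l2_add: "x \<in> square_summable \<Longrightarrow> y \<in> square_summable \<Longrightarrow> (\<lambda>n. x n + y n) \<in> square_summable"
proof -
  assume "x \<in> square_summable" "y \<in> square_summable"
  then have "summable (\<lambda>n. 2 * (cmod (x n))\<^sup>2 + 2 * (cmod (y n))\<^sup>2)"
    by (intro summable_add summable_mult) (simp_all add: square_summable_def)
  then have "summable (\<lambda>n. (cmod (x n + y n))\<^sup>2)"
  proof (rule summable_comparison_test', simp)
    fix n
    have "(cmod (x n + y n))\<^sup>2 \<le> (cmod (x n) + cmod (y n))\<^sup>2" by (intro power_mono norm_triangle_ineq) auto
    also have "\<dots> \<le> 2 * (cmod (x n))\<^sup>2 + 2 * (cmod (y n))\<^sup>2"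
      using sum_squares_bound[of "cmod (x n)" "cmod (y n)"] by (simp add: power2_sum)
    finally show "(cmod (x n + y n))\<^sup>2 \<le> 2 * (cmod (x n))\<^sup>2 + 2 * (cmod (y n))\<^sup>2" .
  qed
  then show ?thesis by (simp add: square_summable_def)
qed

lemma l2_mult:
  assumes x: "x \<in> square_summable" and g: "\<And>n. cmod (g n) \<le> M" shows "(\<lambda>n. g n * x n) \<in> square_summable"
proof -
  have "summable (\<lambda>n. M\<^sup>2 * (cmod (x n))\<^sup>2)" using x by (intro summable_mult) (simp add: square_summable_def)
  then have "summable (\<lambda>n. (cmod (g n * x n))\<^sup>2)"
    by (rule summable_comparison_test')
      (use g in \<open>auto simp: norm_mult power_mult_distrib intro!: mult_right_mono power_mono\<close>)
  then show ?thesis by (simp add: square_summable_def)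
qed

lemma l2_scale: "x \<in> square_summable \<Longrightarrow> (\<lambda>n. c * x n) \<in> square_summable"
  by (rule l2_mult[where M = "cmod c"]) simp_all

lemma l2_diff: "x \<in> square_summable \<Longrightarrow> y \<in> square_summable \<Longrightarrow> (\<lambda>n. x n - y n) \<in> square_summable"
  using l2_add[of x "\<lambda>n. - 1 * y n"] l2_scale[of y "-1"] by simp

lemma l2_zero: "(\<lambda>n. 0) \<in> square_summable"
  by (simp add: square_summable_def)

lemma l2_inner_summable:
  assumes "x \<in> square_summable" "y \<in> square_summable" shows "summable (\<lambda>n. x n * cnj (y n))"
proof -
  have "summable (\<lambda>n. (cmod (x n))\<^sup>2 + (cmod (y n))\<^sup>2)"
    using assms by (intro summable_add) (simp_all add: square_summable_def)
  then show ?thesis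
  proof (rule summable_comparison_test')
    fix n
    have "2 * (cmod (x n) * cmod (y n)) \<le> (cmod (x n))\<^sup>2 + (cmod (y n))\<^sup>2"
      using sum_squares_bound[of "cmod (x n)" "cmod (y n)"] by simp
    moreover have "0 \<le> cmod (x n) * cmod (y n)" by simp
    ultimately show "norm (x n * cnj (y n)) \<le> (cmod (x n))\<^sup>2 + (cmod (y n))\<^sup>2"
      unfolding norm_mult complex_mod_cnj by linarith
  qed
qed

lemma l2_inner_self:
  assumes "x \<in> square_summable" shows "l2_inner x x = of_real (\<Sum>n. (cmod (x n))\<^sup>2)"
proof -
  have "l2_inner x x = (\<Sum>n. of_real ((cmod (x n))\<^sup>2))"
    unfolding l2_inner_def by (simp only: complex_norm_square)
  also have "\<dots> = of_real (\<Sum>n. (cmod (x n))\<^sup>2)"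
    by (rule suminf_of_real[symmetric]) (use assms in \<open>simp add: square_summable_def\<close>)
  finally show ?thesis .
qed

lemma l2_inner_self_Re: "x \<in> square_summable \<Longrightarrow> Re (l2_inner x x) = (\<Sum>n. (cmod (x n))\<^sup>2)"
  by (simp add: l2_inner_self)

lemma l2_coord_le:
  assumes "x \<in> square_summable" shows "cmod (x n) \<le> sqrt (Re (l2_inner x x))"
proof -
  have "(\<Sum>k\<in>{n}. (cmod (x k))\<^sup>2) \<le> (\<Sum>n. (cmod (x n))\<^sup>2)"
    by (rule sum_le_suminf) (use assms in \<open>simp_all add: square_summable_def\<close>)
  then show ?thesis unfolding l2_inner_self_Re[OF assms] by (simp add: real_le_rsqrt)
qed

text \<open>The limit is taken coordinatewise. The Cauchy bound holds for finite partial sums,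
  passes to the limit there, and then bounds the whole series.\<close>

lemma l2_complete:
  assumes X: "\<And>i. X i \<in> square_summable"
    and C: "\<And>e. e > 0 \<Longrightarrow> \<exists>N. \<forall>i\<ge>N. \<forall>j\<ge>N.
      sqrt (Re (l2_inner (\<lambda>n. X i n - X j n) (\<lambda>n. X i n - X j n))) < e"
  shows "\<exists>l\<in>square_summable. (\<lambda>i. sqrt (Re (l2_inner (\<lambda>n. X i n - l n) (\<lambda>n. X i n - l n)))) \<longlonglongrightarrow> 0"
proof -
  have diff: "(\<lambda>n. X i n - X j n) \<in> square_summable" for i j by (intro l2_diff X)
  have "Cauchy (\<lambda>i. X i n)" for n
  proof (rule metric_CauchyI)
    fix e :: real assume "e > 0"
    then obtain N where N: "\<forall>i\<ge>N. \<forall>j\<ge>N. sqrt (Re (l2_inner (\<lambda>n. X i n - X j n) (\<lambda>n. X i n - X j n))) < e"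
      using C by blast
    have "dist (X i n) (X j n) < e" if "i \<ge> N" "j \<ge> N" for i j
      unfolding dist_norm using l2_coord_le[OF diff, of i n j] N that by (meson le_less_trans)
    then show "\<exists>N. \<forall>i\<ge>N. \<forall>j\<ge>N. dist (X i n) (X j n) < e" by blast
  qed
  then have "\<exists>a. (\<lambda>i. X i n) \<longlonglongrightarrow> a" for n using Cauchy_convergent_iff convergent_def by blast
  then obtain l where l: "\<And>n. (\<lambda>i. X i n) \<longlonglongrightarrow> l n" by metis
  have tail: "(\<lambda>n. X i n - l n) \<in> square_summable \<and> (\<Sum>n. (cmod (X i n - l n))\<^sup>2) \<le> e\<^sup>2"
    if e: "e > 0" and N: "\<forall>i\<ge>N. \<forall>j\<ge>N. sqrt (Re (l2_inner (\<lambda>n. X i n - X j n) (\<lambda>n. X i n - X j n))) < e"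
      and i: "i \<ge> N" for e N i
  proof -
    have part: "(\<Sum>n<k. (cmod (X i n - l n))\<^sup>2) \<le> e\<^sup>2" for k
    proof (rule LIMSEQ_le_const2)
      show "(\<lambda>j. \<Sum>n<k. (cmod (X i n - X j n))\<^sup>2) \<longlonglongrightarrow> (\<Sum>n<k. (cmod (X i n - l n))\<^sup>2)"
        by (intro tendsto_intros l)
      have "(\<Sum>n<k. (cmod (X i n - X j n))\<^sup>2) \<le> e\<^sup>2" if j: "j \<ge> N" for j
      proof -
        have "(\<Sum>n<k. (cmod (X i n - X j n))\<^sup>2) \<le> (\<Sum>n. (cmod (X i n - X j n))\<^sup>2)"
          by (rule sum_le_suminf) (use diff[of i j] in \<open>simp_all add: square_summable_def\<close>)
        also have "\<dots> \<le> e\<^sup>2"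
        proof -
          have "sqrt (\<Sum>n. (cmod (X i n - X j n))\<^sup>2) < e"
            using N i j unfolding l2_inner_self_Re[OF diff] by blast
          then show ?thesis using e by (simp add: real_sqrt_less_iff sqrt_le_D)
        qed
        finally show ?thesis .
      qed
      then show "\<exists>N. \<forall>j\<ge>N. (\<Sum>n<k. (cmod (X i n - X j n))\<^sup>2) \<le> e\<^sup>2" by blast
    qed
    have sm: "summable (\<lambda>n. (cmod (X i n - l n))\<^sup>2)"
      by (rule summableI_nonneg_bounded[OF _ part]) simp
    moreover have "(\<Sum>n. (cmod (X i n - l n))\<^sup>2) \<le> e\<^sup>2" by (rule suminf_le_const[OF sm part])
    ultimately show ?thesis by (simp add: square_summable_def)
  qed
  obtain N1 where "\<forall>i\<ge>N1. \<forall>j\<ge>N1. sqrt (Re (l2_inner (\<lambda>n. X i n - X j n) (\<lambda>n. X i n - X j n))) < 1"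
    using C[of 1] by auto
  then have "(\<lambda>n. X N1 n - l n) \<in> square_summable" using tail[of 1 N1 N1] by simp
  from l2_diff[OF X[of N1] this] have lS: "l \<in> square_summable" by simp
  have dS: "(\<lambda>n. X i n - l n) \<in> square_summable" for i by (intro l2_diff X lS)
  have "(\<lambda>i. sqrt (Re (l2_inner (\<lambda>n. X i n - l n) (\<lambda>n. X i n - l n)))) \<longlonglongrightarrow> 0"
  proof (rule LIMSEQ_I)
    fix e :: real assume e: "e > 0"
    then have e2: "e / 2 > 0" by simp
    then obtain N where N: "\<forall>i\<ge>N. \<forall>j\<ge>N. sqrt (Re (l2_inner (\<lambda>n. X i n - X j n) (\<lambda>n. X i n - X j n))) < e / 2"
      using C by blast
    have "norm (sqrt (Re (l2_inner (\<lambda>n. X i n - l n) (\<lambda>n. X i n - l n))) - 0) < e" if i: "i \<ge> N" for i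
    proof -
      have "sqrt (\<Sum>n. (cmod (X i n - l n))\<^sup>2) \<le> e / 2"
        using tail[OF e2 N i] e by (intro real_le_lsqrt) auto
      moreover have "0 \<le> (\<Sum>n. (cmod (X i n - l n))\<^sup>2)"
        using dS[of i] by (intro suminf_nonneg) (simp_all add: square_summable_def)
      ultimately show ?thesis using e unfolding l2_inner_self_Re[OF dS] by simp
    qed
    then show "\<exists>N. \<forall>i\<ge>N. norm (sqrt (Re (l2_inner (\<lambda>n. X i n - l n) (\<lambda>n. X i n - l n))) - 0) < e" by blast
  qed
  then show ?thesis using lS by blast
qed

text \<open>Dedekind cuts of the real and imaginary parts code a sequence of complex numbers by a subset of
  a countable set.\<close>

lemma complex_sequences_lepoll_reals: "(UNIV :: (nat \<Rightarrow> complex) set) \<lesssim> (UNIV :: real set)"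
proof -
  define cut :: "(nat \<Rightarrow> complex) \<Rightarrow> (nat \<times> bool \<times> rat) set" where
    "cut x = {(n, b, q). real_of_rat q < (if b then Re else Im) (x n)}" for x
  have dense: "a = b" if "\<And>q. real_of_rat q < a \<longleftrightarrow> real_of_rat q < b" for a b :: real
    using that of_rat_dense[of a b] of_rat_dense[of b a] by (metis less_asym linorder_neqE_linordered_idom)
  have "inj cut"
  proof (rule injI)
    fix x y assume eq: "cut x = cut y"
    have "Re (x n) = Re (y n)" "Im (x n) = Im (y n)" for n
    proof -
      have "((n, b, q) \<in> cut x) = ((n, b, q) \<in> cut y)" for b q by (simp add: eq)
      from this[of True] this[of False] show "Re (x n) = Re (y n)" "Im (x n) = Im (y n)"
        by (auto simp: cut_def intro!: dense)
    qed
    then show "x = y" by (simp add: fun_eq_iff complex_eq_iff)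
  qed
  moreover have "inj (image (to_nat :: nat \<times> bool \<times> rat \<Rightarrow> nat))" by (simp add: inj_image_eq_iff inj_def)
  ultimately have "inj (image (to_nat :: nat \<times> bool \<times> rat \<Rightarrow> nat) \<circ> cut)" by (rule inj_compose[rotated])
  then have "(UNIV :: (nat \<Rightarrow> complex) set) \<lesssim> (UNIV :: nat set set)" unfolding lepoll_def by blast
  also have "(UNIV :: nat set set) \<approx> (UNIV :: real set)" by (rule nat_sets_eqpoll_reals)
  finally show ?thesis .
qed

text \<open>Models are required to have their carrier inside \<open>'u\<close>, so the sequence
  space is carried there by the injection \<open>j\<close>, which \<open>i\<close> undoes.\<close>

locale l2_model =
  fixes j :: "(nat \<Rightarrow> complex) \<Rightarrow> 'u" and \<kappa> :: "nat \<Rightarrow> complex"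
  assumes inj_j: "inj j" and \<kappa>_bound: "cmod (\<kappa> n) \<le> 1"
begin

definition i :: "'u \<Rightarrow> nat \<Rightarrow> complex" where "i = inv_into UNIV j"

lemma i_j [simp]: "i (j x) = x"
  using inj_j by (simp add: i_def)

lemma j_eq [simp]: "j x = j y \<longleftrightarrow> x = y"
  using inj_j by (simp add: inj_eq)

definition model :: "'u hilb" where
  "model = \<lparr>carrier = j ` square_summable, mult = undefined, one = undefined, zero = j (\<lambda>_. 0),
     add = (\<lambda>x y. j (\<lambda>n. i x n + i y n)), smult = (\<lambda>c x. j (\<lambda>n. c * i x n)),
     hinner = (\<lambda>x y. l2_inner (i x) (i y))\<rparr>"

definition dop :: "(nat \<Rightarrow> complex) \<Rightarrow> 'u \<Rightarrow> 'u" where "dop g x = j (\<lambda>n. g n * i x n)"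

lemma model_simps [simp]:
  "carrier model = j ` square_summable" "\<zero>\<^bsub>model\<^esub> = j (\<lambda>_. 0)"
  "x \<oplus>\<^bsub>model\<^esub> y = j (\<lambda>n. i x n + i y n)" "c \<odot>\<^bsub>model\<^esub> x = j (\<lambda>n. c * i x n)"
  "hinner model x y = l2_inner (i x) (i y)"
  by (simp_all add: model_def)

lemma l2_\<kappa>: "a \<in> square_summable \<Longrightarrow> (\<lambda>n. \<kappa> n * a n) \<in> square_summable"
  by (rule l2_mult[where M = 1]) (use \<kappa>_bound in auto)

lemma cring_complex: "cring complex_cring"
proof (rule cringI)
  show "abelian_group complex_cring"
  proof (rule abelian_groupI)
    fix x show "\<exists>y\<in>carrier complex_cring. y \<oplus>\<^bsub>complex_cring\<^esub> x = \<zero>\<^bsub>complex_cring\<^esub>"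
      by (rule bexI[of _ "- x"]) (simp_all add: complex_cring_def)
  qed (auto simp: complex_cring_def algebra_simps)
  show "comm_monoid complex_cring"
    by (rule comm_monoidI) (auto simp: complex_cring_def)
qed (auto simp: complex_cring_def algebra_simps)

lemma abelian_group_model: "abelian_group model"
proof (rule abelian_groupI)
  fix x assume "x \<in> carrier model"
  then obtain a where a: "x = j a" "a \<in> square_summable" by auto
  show "\<exists>y\<in>carrier model. y \<oplus>\<^bsub>model\<^esub> x = \<zero>\<^bsub>model\<^esub>"
    by (rule bexI[of _ "j (\<lambda>n. - 1 * a n)"]) (use a l2_scale[of a "-1"] in auto)
qed (auto simp: l2_add l2_zero algebra_simps)

lemma module_model: "module complex_cring model"
proof (rule moduleI)
  show "cring complex_cring" by (rule cring_complex)
  show "abelian_group model" by (rule abelian_group_model)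
qed (auto simp: complex_cring_def l2_scale algebra_simps)

lemma minus_model: "a \<in> square_summable \<Longrightarrow> b \<in> square_summable \<Longrightarrow> j a \<ominus>\<^bsub>model\<^esub> j b = j (\<lambda>n. a n - b n)"
proof -
  assume a: "a \<in> square_summable" and b: "b \<in> square_summable"
  interpret abelian_group model by (rule abelian_group_model)
  have "\<ominus>\<^bsub>model\<^esub> j b = j (\<lambda>n. - 1 * b n)"
    by (rule minus_equality) (use b l2_scale[of b "-1"] in auto)
  then show ?thesis using a b by (simp add: a_minus_def)
qed

lemma hnorm_model: "hnorm model (j a) = sqrt (Re (l2_inner a a))"
  by (simp add: hnorm_def)

lemma hilbert_model: "complex_hilbert_space model"
proof -
  interpret module complex_cring model by (rule module_model)
  show ?thesis
  proof
    fix x y z c assume x: "x \<in> carrier model"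
    then obtain a where a: "x = j a" "a \<in> square_summable" by auto
    show "0 \<le> Re (hinner model x x)"
      using a by (simp add: l2_inner_self_Re suminf_nonneg square_summable_def)
    show "x = \<zero>\<^bsub>model\<^esub>" if "hinner model x x = 0"
    proof -
      have "sqrt (Re (l2_inner a a)) = 0" using that a by simp
      then have "a n = 0" for n using l2_coord_le[OF a(2), of n] by simp
      then show ?thesis using a by (simp add: fun_eq_iff)
    qed
    assume y: "y \<in> carrier model"
    then obtain b where b: "y = j b" "b \<in> square_summable" by auto
    show "hinner model (c \<odot>\<^bsub>model\<^esub> x) y = c * hinner model x y"
      using l2_inner_summable[OF a(2) b(2)] a b by (simp add: l2_inner_def mult.assoc suminf_mult)
    show "hinner model y x = cnj (hinner model x y)"
      using l2_inner_summable[OF a(2) b(2)] a b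
      by (simp add: l2_inner_def bounded_linear.suminf[OF bounded_linear_cnj] mult.commute)
    assume "z \<in> carrier model"
    then obtain d where d: "z = j d" "d \<in> square_summable" by auto
    show "hinner model (x \<oplus>\<^bsub>model\<^esub> y) z = hinner model x z + hinner model y z"
      using suminf_add[OF l2_inner_summable[OF a(2) d(2)] l2_inner_summable[OF b(2) d(2)]] a b d
      by (simp add: l2_inner_def distrib_right)
  next
    fix X :: "nat \<Rightarrow> 'u" assume X: "\<And>n. X n \<in> carrier model"
      and C: "\<And>e. e > 0 \<Longrightarrow> \<exists>N. \<forall>i\<ge>N. \<forall>j\<ge>N. hnorm model (X i \<ominus>\<^bsub>model\<^esub> X j) < e"
    have "\<exists>a. a \<in> square_summable \<and> X n = j a" for n using X[of n] by auto
    then obtain Y :: "nat \<Rightarrow> nat \<Rightarrow> complex" where Y: "\<And>n. Y n \<in> square_summable" "\<And>n. X n = j (Y n)" by metis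
    have "\<exists>l\<in>square_summable. (\<lambda>i. sqrt (Re (l2_inner (\<lambda>n. Y i n - l n) (\<lambda>n. Y i n - l n)))) \<longlonglongrightarrow> 0"
      by (rule l2_complete[OF Y(1)]) (use C in \<open>simp add: Y minus_model hnorm_model\<close>)
    then obtain l where l: "l \<in> square_summable"
      "(\<lambda>i. sqrt (Re (l2_inner (\<lambda>n. Y i n - l n) (\<lambda>n. Y i n - l n)))) \<longlonglongrightarrow> 0" by blast
    then show "\<exists>l\<in>carrier model. (\<lambda>n. hnorm model (X n \<ominus>\<^bsub>model\<^esub> l)) \<longlonglongrightarrow> 0"
      by (intro bexI[of _ "j l"]) (simp_all add: Y minus_model hnorm_model)
  qed
qed

lemma hnorm_dop_le:
  assumes a: "a \<in> square_summable" and g: "\<And>n. cmod (g n) \<le> M"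
  shows "hnorm model (dop g (j a)) \<le> M * hnorm model (j a)"
proof -
  have M: "M \<ge> 0" using g[of 0] norm_ge_zero order_trans by blast
  have ga: "(\<lambda>n. g n * a n) \<in> square_summable" by (rule l2_mult[OF a g])
  have "(\<Sum>n. (cmod (g n * a n))\<^sup>2) \<le> (\<Sum>n. M\<^sup>2 * (cmod (a n))\<^sup>2)"
  proof (rule suminf_le)
    show "(cmod (g n * a n))\<^sup>2 \<le> M\<^sup>2 * (cmod (a n))\<^sup>2" for n
      unfolding norm_mult power_mult_distrib using g[of n] by (intro mult_right_mono power_mono) auto
  qed (use a ga in \<open>auto simp: square_summable_def intro!: summable_mult\<close>)
  also have "\<dots> = M\<^sup>2 * (\<Sum>n. (cmod (a n))\<^sup>2)"
    by (rule suminf_mult) (use a in \<open>simp add: square_summable_def\<close>)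
  finally have "sqrt (\<Sum>n. (cmod (g n * a n))\<^sup>2) \<le> sqrt (M\<^sup>2 * (\<Sum>n. (cmod (a n))\<^sup>2))" by simp
  then show ?thesis using M by (simp add: dop_def hnorm_model l2_inner_self_Re[OF a] l2_inner_self_Re[OF ga] real_sqrt_mult)
qed

lemma bounded_dop: assumes g: "\<And>n. cmod (g n) \<le> M" shows "bounded_op model (dop g)"
  unfolding bounded_op_def
proof (intro conjI)
  show "\<forall>x\<in>carrier model. dop g x \<in> carrier model" using l2_mult[OF _ g] by (auto simp: dop_def)
  show "\<exists>C. \<forall>x\<in>carrier model. hnorm model (dop g x) \<le> C * hnorm model x"
    using hnorm_dop_le[OF _ g] by (intro exI[of _ M]) auto
qed (auto simp: dop_def algebra_simps)

lemma normal_dop: "normal_op model (dop \<kappa>)"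
  unfolding normal_op_def is_adjoint_def
proof (intro conjI exI[of _ "dop (\<lambda>n. cnj (\<kappa> n))"])
  show "bounded_op model (dop \<kappa>)" "bounded_op model (dop (\<lambda>n. cnj (\<kappa> n)))"
    by (rule bounded_dop[where M = 1]; use \<kappa>_bound in simp)+
qed (auto simp: dop_def l2_inner_def algebra_simps)

lemma single_l2: "(\<lambda>n. if n = k then 1 else 0) \<in> square_summable"
proof -
  have "summable (\<lambda>n. (cmod (if n = k then 1 else 0))\<^sup>2)"
    by (rule summable_finite[of "{k}"]) auto
  then show ?thesis by (simp add: square_summable_def)
qed

definition unit_vec :: "nat \<Rightarrow> 'u" where "unit_vec k = j (\<lambda>n. if n = k then 1 else 0)"

lemma inner_unit_vec: "hinner model (j a) (unit_vec k) = a k"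
proof -
  have "(\<lambda>n. a n * cnj (if n = k then 1 else 0)) = (\<lambda>n. if n = k then a k else 0)" by auto
  then have "l2_inner a (\<lambda>n. if n = k then 1 else 0) = (\<Sum>n. if n = k then a k else 0)"
    unfolding l2_inner_def by simp
  also have "\<dots> = (\<Sum>n\<in>{k}. if n = k then a k else 0)" by (rule suminf_finite) auto
  finally show ?thesis by (simp add: unit_vec_def)
qed

lemma unit_vec_inj: "inj unit_vec"
proof (rule injI)
  fix k l assume "unit_vec k = unit_vec l"
  then have "(\<lambda>n. if n = k then 1 else 0 :: complex) = (\<lambda>n. if n = l then 1 else 0)" by (simp add: unit_vec_def)
  from fun_cong[OF this, of k] show "k = l" by (simp split: if_splits)
qed

text \<open>Sequences in \<open>V\<close> vanish outside \<open>N\<close>, so one that is orthogonal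
  to all unit vectors with index in \<open>N\<close> is 0: these unit vectors are a basis.\<close>

lemma basis_unit_vecs:
  assumes V: "V \<subseteq> carrier model" and N: "\<And>k. k \<in> N \<Longrightarrow> unit_vec k \<in> V"
    and supp: "\<And>a n. j a \<in> V \<Longrightarrow> n \<notin> N \<Longrightarrow> a n = 0"
  shows "hilbert_dim model V (if finite N then enat (card N) else \<infinity>)"
proof -
  have "hilbert_basis model V (unit_vec ` N)"
    unfolding hilbert_basis_def
  proof (intro conjI ballI impI)
    show "unit_vec ` N \<subseteq> V" using N by blast
    fix x y assume "x \<in> unit_vec ` N" "y \<in> unit_vec ` N"
    then obtain k l where kl: "x = unit_vec k" "y = unit_vec l" by blast
    have "hinner model x y = (if l = k then 1 else 0)"
      unfolding kl using inner_unit_vec[of "\<lambda>n. if n = k then 1 else 0" l] by (simp only: unit_vec_def)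
    then show "hinner model x y = (if x = y then 1 else 0)" using unit_vec_inj kl by (auto simp: inj_eq)
  next
    fix v assume v: "v \<in> V" "\<forall>x\<in>unit_vec ` N. hinner model v x = 0"
    then obtain a where a: "v = j a" using V by auto
    have "a n = 0" for n
    proof (cases "n \<in> N")
      case True
      then have "hinner model v (unit_vec n) = 0" using v(2) by blast
      then show ?thesis unfolding a inner_unit_vec .
    next
      case False
      then show ?thesis using supp v(1) a by blast
    qed
    then show "v = \<zero>\<^bsub>model\<^esub>" using a by (simp add: fun_eq_iff)
  qed
  moreover have "inj_on unit_vec N" using unit_vec_inj by (rule inj_on_subset) simp
  then have "card (unit_vec ` N) = card N" "finite (unit_vec ` N) = finite N"
    by (simp_all only: card_image finite_image_iff)
  ultimately show ?thesis unfolding hilbert_dim_def by (intro exI[of _ "unit_vec ` N"]) simp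
qed

lemma dim_model: "hilbert_dim model (carrier model) \<infinity>"
  using basis_unit_vecs[of "carrier model" UNIV] single_l2 by (simp add: unit_vec_def)

lemma eigenspace_dop: "eigenspace model (dop \<kappa>) c = {j a | a. a \<in> square_summable \<and> (\<forall>n. (\<kappa> n - c) * a n = 0)}"
proof -
  have "dop \<kappa> (j a) \<ominus>\<^bsub>model\<^esub> c \<odot>\<^bsub>model\<^esub> j a = \<zero>\<^bsub>model\<^esub> \<longleftrightarrow> (\<forall>n. (\<kappa> n - c) * a n = 0)"
    if a: "a \<in> square_summable" for a
  proof -
    have "dop \<kappa> (j a) \<ominus>\<^bsub>model\<^esub> c \<odot>\<^bsub>model\<^esub> j a = j (\<lambda>n. (\<kappa> n - c) * a n)"
      using minus_model[OF l2_\<kappa>[OF a] l2_scale[OF a, of c]] by (simp add: dop_def left_diff_distrib)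
    then show ?thesis by (simp add: fun_eq_iff)
  qed
  then show ?thesis by (auto simp: eigenspace_def)
qed

lemma dim_eigenspace:
  "hilbert_dim model (eigenspace model (dop \<kappa>) c)
    (if finite {n. \<kappa> n = c} then enat (card {n. \<kappa> n = c}) else \<infinity>)"
proof (rule basis_unit_vecs)
  show "eigenspace model (dop \<kappa>) c \<subseteq> carrier model" by (auto simp: eigenspace_def)
  show "unit_vec k \<in> eigenspace model (dop \<kappa>) c" if "k \<in> {n. \<kappa> n = c}" for k
    unfolding eigenspace_dop unit_vec_def using that single_l2[of k] by auto
  show "a n = 0" if "j a \<in> eigenspace model (dop \<kappa>) c" "n \<notin> {n. \<kappa> n = c}" for a n
    using that unfolding eigenspace_dop by auto
qed

lemma approximate_eigenvector:
  assumes "cmod (\<kappa> k - c) \<le> e"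
  shows "unit_vec k \<in> carrier model" "hnorm model (unit_vec k) = 1"
    "hnorm model (dop \<kappa> (unit_vec k) \<oplus>\<^bsub>model\<^esub> (-1) \<odot>\<^bsub>model\<^esub> (c \<odot>\<^bsub>model\<^esub> unit_vec k)) \<le> e"
proof -
  interpret H: complex_hilbert_space model by (rule hilbert_model)
  show u: "unit_vec k \<in> carrier model" using single_l2 by (simp add: unit_vec_def)
  have "hinner model (unit_vec k) (unit_vec k) = 1"
    using inner_unit_vec[of "\<lambda>n. if n = k then 1 else 0" k] by (simp only: unit_vec_def if_True refl)
  then show n1: "hnorm model (unit_vec k) = 1" by (simp add: hnorm_def del: model_simps)
  have "dop \<kappa> (unit_vec k) \<oplus>\<^bsub>model\<^esub> (-1) \<odot>\<^bsub>model\<^esub> (c \<odot>\<^bsub>model\<^esub> unit_vec k) = (\<kappa> k - c) \<odot>\<^bsub>model\<^esub> unit_vec k"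
    by (auto simp: dop_def unit_vec_def fun_eq_iff)
  then show "hnorm model (dop \<kappa> (unit_vec k) \<oplus>\<^bsub>model\<^esub> (-1) \<odot>\<^bsub>model\<^esub> (c \<odot>\<^bsub>model\<^esub> unit_vec k)) \<le> e"
    using H.Hil.nm_sm[OF u, of "\<kappa> k - c"] n1 assms unfolding H.hnorm_eq by simp
qed

text \<open>At points of \<open>K\<close> suitable unit vectors are approximate eigenvectors. A
  point \<open>c\<close> outside the closed set \<open>K\<close> has distance at least some
  \<open>d > 0\<close> from all diagonal entries, so the reciprocals of
  \<open>\<kappa> n - c\<close> are bounded and define the inverse.\<close>

lemma spectrum_dop:
  assumes K: "closed K" "range \<kappa> \<subseteq> K" and dense: "\<And>c e. c \<in> K \<Longrightarrow> e > 0 \<Longrightarrow> \<exists>n. cmod (\<kappa> n - c) \<le> e"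
  shows "op_spectrum model (dop \<kappa>) = K"
proof
  interpret H: complex_hilbert_space model by (rule hilbert_model)
  have bl: "bounded_op model (dop \<kappa>)" by (rule bounded_dop[OF \<kappa>_bound])
  show "K \<subseteq> op_spectrum model (dop \<kappa>)"
  proof
    fix c assume c: "c \<in> K"
    show "c \<in> op_spectrum model (dop \<kappa>)"
    proof (rule H.approximate_eigenvalue_in_spectrum[OF H.bounded_op_lin[OF bl]])
      fix e :: real assume "e > 0"
      then obtain k where k: "cmod (\<kappa> k - c) \<le> e" using dense[OF c] by blast
      note ae = approximate_eigenvector[OF k]
      have "unit_vec k \<noteq> \<zero>\<^bsub>model\<^esub>" using ae(2) H.Hil.nm_zr unfolding H.hnorm_eq by (metis zero_neq_one)
      then show "\<exists>x\<in>carrier model. x \<noteq> \<zero>\<^bsub>model\<^esub> \<and>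
          H.Hil.nm (dop \<kappa> x \<oplus>\<^bsub>model\<^esub> (-1) \<odot>\<^bsub>model\<^esub> (c \<odot>\<^bsub>model\<^esub> x)) \<le> e * H.Hil.nm x"
        using ae unfolding H.hnorm_eq by (intro bexI[of _ "unit_vec k"] conjI) (simp_all only: mult_1_right not_False_eq_True)
    qed
  qed
  show "op_spectrum model (dop \<kappa>) \<subseteq> K"
  proof (rule subsetI, rule ccontr)
    fix c assume c: "c \<in> op_spectrum model (dop \<kappa>)" "c \<notin> K"
    then obtain d where d: "d > 0" "\<And>y. y \<in> K \<Longrightarrow> d \<le> dist c y"
      using separate_point_closed[OF K(1)] by blast
    define g where "g n = inverse (\<kappa> n - c)" for n
    have dn: "d \<le> cmod (\<kappa> n - c)" for n using d(2)[of "\<kappa> n"] K(2) by (auto simp: dist_norm norm_minus_commute)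
    then have ne: "\<kappa> n - c \<noteq> 0" for n using d(1) by (metis norm_zero not_le)
    have gb: "cmod (g n) \<le> inverse d" for n
      unfolding g_def norm_inverse using dn d(1) by (intro le_imp_inverse_le)
    have "bounded_op model (dop g)" by (rule bounded_dop[OF gb])
    moreover have "dop g (dop \<kappa> x \<ominus>\<^bsub>model\<^esub> c \<odot>\<^bsub>model\<^esub> x) = x \<and> dop \<kappa> (dop g x) \<ominus>\<^bsub>model\<^esub> c \<odot>\<^bsub>model\<^esub> dop g x = x"
      if "x \<in> carrier model" for x
    proof -
      obtain a where a: "x = j a" "a \<in> square_summable" using \<open>x \<in> carrier model\<close> by auto
      have ga: "(\<lambda>n. g n * a n) \<in> square_summable" by (rule l2_mult[OF a(2) gb])
      have "(\<kappa> n - c) * g n = 1" for n using ne[of n] by (simp add: g_def)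
      then have "(\<kappa> n - c) * g n * a n = a n" for n by simp
      then have gk: "g n * (\<kappa> n * a n - c * a n) = a n" "\<kappa> n * (g n * a n) - c * (g n * a n) = a n" for n
        by (simp_all only: algebra_simps)
      show ?thesis
        using minus_model[OF l2_\<kappa>[OF a(2)] l2_scale[OF a(2), of c]]
          minus_model[OF l2_\<kappa>[OF ga] l2_scale[OF ga, of c]]
        by (simp add: a dop_def gk)
    qed
    ultimately show False using c(1) unfolding op_spectrum_def by blast
  qed
qed

end

text \<open>Pairs \<open>(c, k)\<close> of a point of a countable dense subset and a copy number are
  enumerated: an isolated point gets \<open>m c\<close> copies, any other point infinitely many.
  Since \<open>m c >= 1\<close>, no point of the dense subset is lost, and isolated points belong to
  every dense subset.\<close>

lemma enumeration_with_multiplicities: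
  fixes K :: "complex set" and m :: "complex \<Rightarrow> enat"
  assumes K: "infinite K" and m: "\<And>c. c isolated_in K \<Longrightarrow> m c \<ge> 1"
  obtains \<kappa> :: "nat \<Rightarrow> complex" where "range \<kappa> \<subseteq> K"
    "\<And>c e. c \<in> K \<Longrightarrow> e > 0 \<Longrightarrow> \<exists>n. cmod (\<kappa> n - c) \<le> e"
    "\<And>c. c isolated_in K \<Longrightarrow> (if finite {n. \<kappa> n = c} then enat (card {n. \<kappa> n = c}) else \<infinity>) = m c"
proof -
  obtain D where D: "countable D" "D \<subseteq> K" "K \<subseteq> closure D" using separable by blast
  have "infinite D"
  proof
    assume f: "finite D"
    then have "K \<subseteq> D" using D(3) finite_imp_closed closure_closed by metis
    then show False using f K finite_subset by blast
  qed
  define I where "I = {(c, k :: nat). c \<in> D \<and> (c isolated_in K \<longrightarrow> enat k < m c)}"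
  have I0: "(c, 0) \<in> I" if c: "c \<in> D" for c
  proof -
    have "enat 0 < m c" if "c isolated_in K"
      by (rule less_le_trans[OF _ m[OF that]]) (simp add: one_enat_def)
    then show ?thesis using c by (simp add: I_def)
  qed
  have "countable I" by (rule countable_subset[of _ "D \<times> UNIV"]) (use D(1) in \<open>auto simp: I_def\<close>)
  moreover have "infinite I"
  proof
    assume "finite I"
    then have "finite (fst ` I)" by simp
    moreover have "D \<subseteq> fst ` I" using I0 by force
    ultimately show False using \<open>infinite D\<close> finite_subset by blast
  qed
  ultimately have bij: "bij_betw (from_nat_into I) UNIV I" by (rule bij_betw_from_nat_into)
  define \<kappa> where "\<kappa> = fst \<circ> from_nat_into I"
  show ?thesis
  proof (rule that)
    have range_I: "range (from_nat_into I) = I" using bij by (simp add: bij_betw_def)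
    have "fst ` I \<subseteq> D" by (auto simp: I_def)
    moreover have "D \<subseteq> fst ` I" using I0 by force
    ultimately have range_\<kappa>: "range \<kappa> = D" unfolding \<kappa>_def image_comp[symmetric] range_I by (rule equalityI)
    then show "range \<kappa> \<subseteq> K" using D(2) by simp
    show "\<exists>n. cmod (\<kappa> n - c) \<le> e" if ce: "c \<in> K" "e > 0" for c e
    proof -
      obtain d where "d \<in> D" "dist d c < e" using D(3) ce closure_approachable by blast
      moreover obtain n where "d = \<kappa> n" using \<open>d \<in> D\<close> range_\<kappa> by blast
      ultimately show ?thesis by (intro exI[of _ n]) (simp add: dist_norm)
    qed
    fix c assume c: "c isolated_in K"
    have cD: "c \<in> D"
    proof -
      obtain U where U: "open U" "U \<inter> K = {c}" using c by (auto simp: isolated_in_def)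
      then have "U \<inter> closure D \<noteq> {}" using D(3) by blast
      then obtain d where d: "d \<in> U" "d \<in> D" using open_Int_closure_eq_empty[OF U(1), of D] by blast
      then have "d \<in> U \<inter> K" using D(2) by blast
      then show ?thesis using U(2) d(2) by simp
    qed
    have "from_nat_into I ` {n. \<kappa> n = c} = range (from_nat_into I) \<inter> fst -` {c}"
      by (auto simp: \<kappa>_def)
    also have "\<dots> = I \<inter> fst -` {c}" by (simp only: range_I)
    also have "\<dots> = {c} \<times> {k. enat k < m c}" using c cD by (auto simp: I_def)
    finally have "bij_betw (from_nat_into I) {n. \<kappa> n = c} ({c} \<times> {k. enat k < m c})"
      by (intro bij_betw_subset[OF bij]) simp_all
    note fibre = bij_betw_same_card[OF this] bij_betw_finite[OF this]
    have "card {n. \<kappa> n = c} = card {k. enat k < m c}" unfolding fibre(1) by (rule card_cartesian_product_singleton)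
    moreover have "finite {n. \<kappa> n = c} \<longleftrightarrow> finite {k. enat k < m c}"
      unfolding fibre(2) by (auto simp: finite_cartesian_product_iff)
    ultimately show "(if finite {n. \<kappa> n = c} then enat (card {n. \<kappa> n = c}) else \<infinity>) = m c"
      by (cases "m c") simp_all
  qed
qed

theorem not_omega_stable_of_uncountable:
  assumes type: "(UNIV :: real set) \<lesssim> (UNIV :: 'u set)"
    and K: "compact K" "K \<subseteq> cball 0 1" "uncountable K" and m: "\<And>c. c isolated_in K \<Longrightarrow> m c \<ge> 1"
  shows "\<not> omega_stable (Sigma_models K m :: ('u hilb \<times> ('u \<Rightarrow> 'u)) set)"
proof -
  \<comment> \<open>The sequences are no more numerous than the reals, so the sequence space can be
    placed inside \<open>'u\<close>.\<close>
  have "(UNIV :: (nat \<Rightarrow> complex) set) \<lesssim> (UNIV :: 'u set)"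
    by (rule lepoll_trans[OF complex_sequences_lepoll_reals type])
  then obtain j :: "(nat \<Rightarrow> complex) \<Rightarrow> 'u" where j: "inj j" by (auto simp: lepoll_def)
  have inf: "infinite K" using K(3) countable_finite by blast
  obtain \<kappa> :: "nat \<Rightarrow> complex" where \<kappa>: "range \<kappa> \<subseteq> K" "\<And>c e. c \<in> K \<Longrightarrow> e > 0 \<Longrightarrow> \<exists>n. cmod (\<kappa> n - c) \<le> e"
    "\<And>c. c isolated_in K \<Longrightarrow> (if finite {n. \<kappa> n = c} then enat (card {n. \<kappa> n = c}) else \<infinity>) = m c"
  proof (rule enumeration_with_multiplicities[of K m])
    show "infinite K" by (rule inf)
    show "1 \<le> m c" if "c isolated_in K" for c by (rule m[OF that])
  qed (rule that)
  have "\<kappa> n \<in> cball 0 1" for n using \<kappa>(1) K(2) by blast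
  then interpret l2: l2_model j \<kappa> by unfold_locales (use j in auto)
  let ?H = l2.model and ?T = "l2.dop \<kappa>"
  have contr: "hnorm ?H (?T x) \<le> hnorm ?H x" if "x \<in> carrier ?H" for x
    using that l2.hnorm_dop_le[OF _ l2.\<kappa>_bound] by auto
  have mem: "(?H, ?T) \<in> Sigma_models K m"
    unfolding Sigma_models_def
  proof (intro CollectI case_prodI conjI allI impI ballI)
    show "op_spectrum ?H ?T = K" by (rule l2.spectrum_dop[OF compact_imp_closed[OF K(1)] \<kappa>(1,2)])
    show "hilbert_dim ?H (eigenspace ?H ?T c) (m c)" if "c isolated_in K" for c
      using l2.dim_eigenspace[of c] unfolding \<kappa>(3)[OF that] .
  qed (use l2.hilbert_model l2.dim_model l2.normal_dop contr in blast)+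
  interpret H: complex_hilbert_space ?H by (rule l2.hilbert_model)
  obtain S where "normal_hilbert (carrier ?H) \<zero>\<^bsub>?H\<^esub> (add ?H) (smult ?H) (hinner ?H) ?T S"
    by (rule H.normal_op_normal_hilbert[OF l2.normal_dop])
  then interpret nor: normal_hilbert "carrier ?H" "\<zero>\<^bsub>?H\<^esub>" "add ?H" "smult ?H" "hinner ?H" ?T S .
  interpret normal_contraction ?H ?T S
    by unfold_locales (use contr nor.lin_T in \<open>simp_all only: H.hnorm_eq\<close>)
  have nsep: "\<not> types_separable ?H ?T {}"
  proof (rule types_not_separable[OF K(3,2)])
    fix c and e :: real assume "c \<in> K" "e > 0"
    then obtain k where k: "cmod (\<kappa> k - c) \<le> e" using \<kappa>(2) by blast
    show "\<exists>x\<in>carrier ?H. H.Hil.nm x = 1 \<and>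
        H.Hil.nm (?T x \<oplus>\<^bsub>?H\<^esub> (-1) \<odot>\<^bsub>?H\<^esub> (c \<odot>\<^bsub>?H\<^esub> x)) \<le> e"
      using l2.approximate_eigenvector[OF k] unfolding H.hnorm_eq by blast
  qed
  show ?thesis
  proof
    assume "omega_stable (Sigma_models K m :: ('u hilb \<times> ('u \<Rightarrow> 'u)) set)"
    from bspec[OF this[unfolded omega_stable_def] mem] nsep show False by simp
  qed
qed

theorem theorem6p7:
  fixes K :: "complex set" and m :: "complex \<Rightarrow> enat"
  assumes "(UNIV :: real set) \<lesssim> (UNIV :: 'u set)"
    and "compact K" and "K \<subseteq> cball 0 1"
    and "\<And>c. c isolated_in K \<Longrightarrow> m c \<ge> 1"
  shows "omega_stable (Sigma_models K m :: ('u hilb \<times> ('u \<Rightarrow> 'u)) set) \<longleftrightarrow> countable K"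
proof
  show "countable K" if "omega_stable (Sigma_models K m :: ('u hilb \<times> ('u \<Rightarrow> 'u)) set)"
  proof (rule ccontr)
    assume "uncountable K"
    from not_omega_stable_of_uncountable[OF assms(1-3) this] assms(4) that show False by blast
  qed
qed (rule omega_stable_of_countable[OF assms(2)])

end
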